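(* Let $A\in\mathbb{Z}^{d\times n}$ have rank $d$ with columns lying in an affine hyperplane of $\mathbb{Q}^d$ not containing the origin, let $\beta\in\mathbb{C}^d$, let $w\in\mathbb{R}^n$ be a generic weight vector, and let $v$ be a fake exponent of $H_A(\beta)$ with respect to $w$. Assume that $\mathcal{S}_w(v)$ contains a top-dimensional standard pair and that $\mathbb{C}[\operatorname{link}_v]$ is Cohen--Macaulay. Then $$H_{w,v}(t)=h_{\operatorname{link}_v}(t).$$ Consequently, $$\sum_{q\geq0}\dim_{\mathbb{C}}(Q_v^{\perp})_q\,t^q=h_{\operatorname{link}_v}(t)\quad\text{and}\quad\operatorname{frank}_w(v)=h_{\operatorname{link}_v}(1).$$ If, in addition, $B$ is a $\mathbb{Z}$-basis of $L=\ker_{\mathbb{Z}}(A)$ and $P=m(s)P_B$, then $$\sum_{q\geq0}\dim_{\mathbb{C}}C_v(q)\,t^q=h_{\operatorname{link}_v}(t),$$ and thus $\max\{q\mid C_v(q)\neq0\}=\deg h_{\operatorname{link}_v}(t)$ and $\dim_{\mathbb{C}}C_v=h_{\operatorname{link}_v}(1)$.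
   Context: Notation: $\mathbb{N}=\{0,1,2,\ldots\}$, $[n]=\{1,\ldots,n\}$, $L=\ker_{\mathbb{Z}}(A)$. The toric ideal is $I_A=\langle\partial^u-\partial^{u'}\mid Au=Au',\ u,u'\in\mathbb{N}^n\rangle\subseteq\mathbb{C}[\partial_1,\ldots,\partial_n]$. $\operatorname{in}_w(I_A)$ is the ideal generated by the $w$-initial forms (sums of terms of maximal $w$-weight) of elements of $I_A$; "$w$ generic" means in particular that $\operatorname{in}_w(I_A)$ is a monomial ideal. Let $D=\mathbb{C}\langle x_1,\ldots,x_n,\partial_1,\ldots,\partial_n\rangle$ be the Weyl algebra and $\vartheta_j=x_j\partial_j$. $H_A(\beta)$ is the left ideal of $D$ generated by $I_A$ and the Euler operators $\sum_j a_{ij}\vartheta_j-\beta_i$. The fake indicial ideal is $(D\cdot\operatorname{in}_w(I_A)\cap\mathbb{C}[\vartheta])+\langle A\vartheta-\beta\rangle\subseteq\mathbb{C}[\vartheta]$; a zero $v\in\mathbb{C}^n$ of it is called a fake exponent of $H_A(\beta)$ with respect to $w$. $\operatorname{nsupp}(z)=\{j\in[n]\mid z_j\in\mathbb{Z}_{<0}\}$ for $z\in\mathbb{C}^n$. For $u\in L$ put $I_u=\operatorname{nsupp}(v+u)$, so $I_0=\operatorname{nsupp}(v)$; put $V=[n]\setminus I_0$. A standard pair of a monomial ideal $M\subseteq\mathbb{C}[\partial]$ is a pair $(a,\sigma)$, $a\in\mathbb{N}^n$, $\sigma\subseteq[n]$, such that (i) $a_i=0$ for $i\in\sigma$; (ii)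 $\partial^a\prod_{j\in\sigma}\partial_j^{b_j}\notin M$ for all $b_j\in\mathbb{N}$; (iii) for every $\ell\notin\sigma$ there are $b_j\in\mathbb{N}$ ($j\in\sigma\cup\{\ell\}$) with $\partial^a\prod_{j\in\sigma\cup\{\ell\}}\partial_j^{b_j}\in M$. $\mathcal{S}(M)$ is the set of standard pairs. A standard pair of $\operatorname{in}_w(I_A)$ is top-dimensional if $|\sigma|=d$. Put $\mathcal{S}_w(v)=\{(a,\sigma)\in\mathcal{S}(\operatorname{in}_w(I_A))\mid v_j=a_j\text{ for every }j\notin\sigma\}$. (Known criterion: $v$ is a fake exponent iff $Av=\beta$ and $\mathcal{S}_w(v)\neq\emptyset$.) $\Delta_w(v)=\{\tau\subseteq[n]\mid\tau\subseteq\sigma\text{ for some }(a,\sigma)\in\mathcal{S}_w(v)\}$, and $\operatorname{link}_v=\{\tau\in\Delta_w(v)\mid\tau\cap I_0=\emptyset,\ \tau\cup I_0\in\Delta_w(v)\}$, regarded as a simplicial complex on the vertex set $V$ (some elements of $V$ may be nonfaces). For a simplicial complex $\Delta$ on $V$, $I_\Delta=\langle\prod_{i\in\tau}x_i\mid\tau\subseteq V,\ \tau\notin\Delta\rangle$ and $\mathbb{C}[\Delta]=\mathbb{C}[x_i\mid i\in V]/I_\Delta$. If $\dim\Delta=r-1$, the $h$-polynomial $h_\Delta(t)$ is defined by $\operatorname{Hilb}(\mathbb{C}[\Delta],t)=h_\Delta(t)/(1-t)^r$; equivalently $h_\Delta(t)=\sum_{j=-1}^{r-1}f_j(\Delta)t^{j+1}(1-t)^{r-1-j}$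 with $f_j(\Delta)$ the number of $j$-dimensional faces, $f_{-1}=1$. Let $\{\partial^{g_+^{(i)}}-\partial^{g_-^{(i)}}\mid i=1,\ldots,m\}$ be the reduced Gröbner basis of $I_A$ with respect to $w$, with $\partial^{g_+^{(i)}}\in\operatorname{in}_w(I_A)$; put $g^{(i)}=g_+^{(i)}-g_-^{(i)}$ and $G^{(i)}=I_{-g^{(i)}}\setminus I_0$. Let $T=\mathbb{C}[\theta_1,\ldots,\theta_n]$, $\langle A\theta\rangle=\langle\sum_j a_{ij}\theta_j\mid i=1,\ldots,d\rangle$, $M_\theta(v)=\langle\prod_{j\in G^{(i)}}\theta_j\mid i=1,\ldots,m\rangle$, $Q_v=\langle A\theta\rangle+M_\theta(v)\subseteq T$. $Q_v^\perp=\{f\in\mathbb{C}[z_1,\ldots,z_n]\mid\phi(\partial_z)\bullet f=0\text{ for all }\phi\in Q_v\}$, $(Q_v^\perp)_q$ is its degree-$q$ part, and $\operatorname{frank}_w(v)=\dim_{\mathbb{C}}Q_v^\perp$. Write $k=|I_0|$, $I_0=\{i_1,\ldots,i_k\}$. By row reduction, $\langle A\theta\rangle$ has generators $\theta_{i_p}-L_p(\theta_V)$ ($1\le p\le k$), $\ell_q(\theta_V)$ ($1\le q\le d-k$), with $L_p,\ell_q$ linear forms in the variables $\theta_j$, $j\in V$. Via $\theta_j\mapsto x_j$ regard $\ell_q\in\mathbb{C}[\operatorname{link}_v]$, and define $H_{w,v}(t)=\operatorname{Hilb}\bigl(\mathbb{C}[\operatorname{link}_v]/(\ell_1,\ldots,\ell_{d-|I_0|}),t\bigr)$;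 it is a polynomial independent of the choice of the $L_p,\ell_q$. Frobenius data. $C(w)=\sum_{i=1}^m\mathbb{N}g^{(i)}$. For a $\mathbb{Z}$-basis $B=\{b^{(1)},\ldots,b^{(h)}\}$ of $L$ ($h=n-d$), put $(Bs)_j=\sum_{k=1}^h b^{(k)}_js_k\in\mathbb{C}[s]=\mathbb{C}[s_1,\ldots,s_h]$ and $(Bs)^F=\prod_{j\in F}(Bs)_j$ for $F\subseteq[n]$. Let $$\operatorname{NS}_w(v)=\{I_u\mid u\in L,\ u'\in C(w)\text{ for every }u'\in L\text{ with }I_{u'}=I_u\},$$ let $\operatorname{NS}_w^c(v)=\{I_u\mid u\in L\}\setminus\operatorname{NS}_w(v)$, and $K=\bigcap_{I\in\operatorname{NS}_w(v)}I$. Define $$P=\langle(Bs)^{(I\cup J)\setminus K}\mid I\in\operatorname{NS}_w(v),\ J\in\operatorname{NS}_w^c(v)\rangle,\quad m(s)=(Bs)^{I_0\setminus K},\quad P_B=\langle(Bs)^{G^{(i)}}\mid i=1,\ldots,m\rangle$$ (ideals, resp. an element, of $\mathbb{C}[s]$). Series solutions. A series solution with exponent $v$ in the direction $w$ is a solution of $H_A(\beta)$ of the form $\phi=x^v\sum_{u\in L}g_u(\log x)x^u$ with $g_0\neq0$, where the $g_u\in\mathbb{C}[\log x_1,\ldots,\log x_n]$ have uniformly bounded degree and $\{u\mid g_u\neq0\}$ lies in a pointed rational cone on which $w\cdot u>0$ for $u\neq0$ (the usual convention for series in the direction $w$). $C_v$ is the vector space consisting of $0$ and all leading coefficients $g_0$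 of such solutions, and $C_v(q)=C_v\cap\mathbb{C}[\log x_1,\ldots,\log x_n]_q$. *)

theory Defs
  imports
    "HOL-Algebra.QuotRing"
    "HOL-Algebra.Ring_Divisibility"
    "HOL-Analysis.Analysis"
    "HOL-Library.Poly_Mapping"
    "HOL-Library.Extended_Nat"
    "HOL-Computational_Algebra.Polynomial_FPS"
begin

section \<open>Polynomials\<close>

type_synonym 'v cpoly = "('v \<Rightarrow>\<^sub>0 nat) \<Rightarrow>\<^sub>0 complex"

definition pconst :: "complex \<Rightarrow> 'v cpoly" where
  "pconst c = Poly_Mapping.single 0 c"

definition pmon :: "('v \<Rightarrow>\<^sub>0 nat) \<Rightarrow> 'v cpoly" where
  "pmon m = Poly_Mapping.single m 1"

definition pvar :: "'v \<Rightarrow> 'v cpoly" where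
  "pvar j = pmon (Poly_Mapping.single j 1)"

definition peval :: "('v \<Rightarrow> complex) \<Rightarrow> 'v cpoly \<Rightarrow> complex" where
  "peval z p = (\<Sum>m\<in>Poly_Mapping.keys p.
     Poly_Mapping.lookup p m *
     (\<Prod>j\<in>Poly_Mapping.keys m. z j ^ Poly_Mapping.lookup m j))"

definition mdeg :: "('v \<Rightarrow>\<^sub>0 nat) \<Rightarrow> nat" where
  "mdeg m = (\<Sum>j\<in>Poly_Mapping.keys m. Poly_Mapping.lookup m j)"

definition homog :: "nat \<Rightarrow> 'v cpoly \<Rightarrow> bool" where
  "homog q p \<longleftrightarrow> (\<forall>m\<in>Poly_Mapping.keys p. mdeg m = q)"

text \<open>The subring of polynomials that involve only the variables in \<open>V\<close>.\<close>

definition poly_ring :: "'v set \<Rightarrow> 'v cpoly ring" where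
  "poly_ring V =
     \<lparr>carrier = {p. \<forall>m\<in>Poly_Mapping.keys p. Poly_Mapping.keys m \<subseteq> V},
      mult = (*), one = 1, zero = 0, add = (+)\<rparr>"

definition cscale :: "complex \<Rightarrow> 'v cpoly \<Rightarrow> 'v cpoly" where
  "cscale c p = pconst c * p"

interpretation cpoly: vector_space cscale
  by unfold_locales
    (simp_all add: cscale_def pconst_def distrib_left distrib_right single_add
      mult.assoc[symmetric] mult_single)

definition fin_dim :: "'v cpoly set \<Rightarrow> bool" where
  "fin_dim S \<longleftrightarrow> (\<exists>E. finite E \<and> S \<subseteq> cpoly.span E)"

definition monomial_ideal :: "'v cpoly set \<Rightarrow> bool" where
  "monomial_ideal M \<longleftrightarrow> (\<exists>E. M = Idl\<^bsub>poly_ring UNIV\<^esub> (pmon ` E))"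

text \<open>\<open>pdiff \<phi> f\<close> is the polynomial \<open>\<phi>(\<partial>) \<bullet> f\<close>. The inner product vanishes unless the
  exponent of the operator is bounded by the exponent of the monomial it is applied to.\<close>

definition pdiff :: "'v cpoly \<Rightarrow> 'v cpoly \<Rightarrow> 'v cpoly" where
  "pdiff \<phi> f = (\<Sum>m\<in>Poly_Mapping.keys \<phi>. \<Sum>k\<in>Poly_Mapping.keys f.
     Poly_Mapping.single (k - m)
       (Poly_Mapping.lookup \<phi> m * Poly_Mapping.lookup f k *
        (\<Prod>j\<in>Poly_Mapping.keys m. \<Prod>i<Poly_Mapping.lookup m j.
           of_nat (Poly_Mapping.lookup k j) - of_nat i)))"


section \<open>Vectors\<close>

definition exp_vec :: "('n::finite \<Rightarrow>\<^sub>0 nat) \<Rightarrow> int ^ 'n" where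
  "exp_vec u = (\<chi> j. int (Poly_Mapping.lookup u j))"

definition cvec :: "int ^ 'n::finite \<Rightarrow> complex ^ 'n" where
  "cvec u = (\<chi> j. of_int (u $ j))"

definition rvec :: "int ^ 'n::finite \<Rightarrow> real ^ 'n" where
  "rvec u = (\<chi> j. of_int (u $ j))"

definition int_kernel :: "int ^ 'n::finite ^ 'd::finite \<Rightarrow> (int ^ 'n) set" where
  "int_kernel A = {u. A *v u = 0}"

definition is_Z_basis :: "nat \<Rightarrow> (nat \<Rightarrow> int ^ 'n::finite) \<Rightarrow> (int ^ 'n) set \<Rightarrow> bool" where
  "is_Z_basis h B L \<longleftrightarrow>
     L = {\<Sum>k<h. c k *s B k | c :: nat \<Rightarrow> int. True} \<and>
     (\<forall>c :: nat \<Rightarrow> int. (\<Sum>k<h. c k *s B k) = 0 \<longrightarrow> (\<forall>k<h. c k = 0))"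

definition columns_in_affine_hyperplane :: "int ^ 'n::finite ^ 'd::finite \<Rightarrow> bool" where
  "columns_in_affine_hyperplane A \<longleftrightarrow>
     (\<exists>(c :: rat ^ 'd) (b :: rat). c \<noteq> 0 \<and> b \<noteq> 0 \<and>
        (\<forall>j. (\<Sum>i\<in>UNIV. c $ i * of_int (A $ i $ j)) = b))"


section \<open>Toric ideals, initial ideals and Groebner bases\<close>

definition toric_ideal :: "int ^ 'n::finite ^ 'd::finite \<Rightarrow> 'n cpoly set" where
  "toric_ideal A = Idl\<^bsub>poly_ring UNIV\<^esub>
     {pmon u - pmon u' | u u'. A *v exp_vec u = A *v exp_vec u'}"

definition weight :: "real ^ 'n::finite \<Rightarrow> ('n \<Rightarrow>\<^sub>0 nat) \<Rightarrow> real" where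
  "weight w m = w \<bullet> rvec (exp_vec m)"

definition init_form :: "real ^ 'n::finite \<Rightarrow> 'n cpoly \<Rightarrow> 'n cpoly" where
  "init_form w f =
     (\<Sum>m\<in>{m \<in> Poly_Mapping.keys f. \<forall>m'\<in>Poly_Mapping.keys f. weight w m' \<le> weight w m}.
        Poly_Mapping.single m (Poly_Mapping.lookup f m))"

definition init_ideal :: "real ^ 'n::finite \<Rightarrow> 'n cpoly set \<Rightarrow> 'n cpoly set" where
  "init_ideal w I = Idl\<^bsub>poly_ring UNIV\<^esub> (init_form w ` I)"

definition reduced_groebner_basis ::
    "real ^ 'n::finite \<Rightarrow> 'n cpoly set \<Rightarrow> 'n cpoly set \<Rightarrow> bool" where
  "reduced_groebner_basis w I G \<longleftrightarrow>
     finite G \<and> G \<subseteq> I \<and>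
     Idl\<^bsub>poly_ring UNIV\<^esub> (init_form w ` G) = init_ideal w I \<and>
     (\<forall>g\<in>G. \<exists>m. init_form w g = pmon m \<and>
        pmon m \<notin> Idl\<^bsub>poly_ring UNIV\<^esub> (init_form w ` (G - {g})) \<and>
        (\<forall>m'\<in>Poly_Mapping.keys g - {m}. pmon m' \<notin> init_ideal w I))"

definition generic_weight :: "int ^ 'n::finite ^ 'd::finite \<Rightarrow> real ^ 'n \<Rightarrow> bool" where
  "generic_weight A w \<longleftrightarrow> monomial_ideal (init_ideal w (toric_ideal A))"


section \<open>The Weyl algebra\<close>

text \<open>An operator is stored by its coefficients in the basis \<open>x\<^sup>a \<partial>\<^sup>b\<close>, indexed by the pairs
  \<open>(a, b)\<close>. The product is \<open>weyl_mult\<close>, not the commutative product \<open>(*)\<close> that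
  \<^typ>\<open>'a \<Rightarrow>\<^sub>0 'b\<close> carries; it comes from the Leibniz rule
  \<open>\<partial>\<^sup>b x\<^sup>c = (\<Sum>k. (\<Prod>j. k\<^sub>j! binom(b\<^sub>j, k\<^sub>j) binom(c\<^sub>j, k\<^sub>j)) x\<^bsup>c-k\<^esup> \<partial>\<^bsup>b-k\<^esup>)\<close>.\<close>

type_synonym 'n weyl = "(('n \<Rightarrow>\<^sub>0 nat) \<times> ('n \<Rightarrow>\<^sub>0 nat)) \<Rightarrow>\<^sub>0 complex"

definition weyl_mult_mon ::
    "('n::finite \<Rightarrow>\<^sub>0 nat) \<times> ('n \<Rightarrow>\<^sub>0 nat) \<Rightarrow> ('n \<Rightarrow>\<^sub>0 nat) \<times> ('n \<Rightarrow>\<^sub>0 nat) \<Rightarrow> 'n weyl" where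
  "weyl_mult_mon = (\<lambda>(a, b) (c, e).
     (\<Sum>k\<in>{k. \<forall>j. Poly_Mapping.lookup k j \<le> Poly_Mapping.lookup b j \<and>
                   Poly_Mapping.lookup k j \<le> Poly_Mapping.lookup c j}.
        Poly_Mapping.single (a + (c - k), (b - k) + e)
          (\<Prod>j\<in>UNIV. fact (Poly_Mapping.lookup k j) *
             of_nat (Poly_Mapping.lookup b j choose Poly_Mapping.lookup k j) *
             of_nat (Poly_Mapping.lookup c j choose Poly_Mapping.lookup k j))))"

definition weyl_scale :: "complex \<Rightarrow> 'n weyl \<Rightarrow> 'n weyl" where
  "weyl_scale c P = Poly_Mapping.map ((*) c) P"

definition weyl_mult :: "'n::finite weyl \<Rightarrow> 'n weyl \<Rightarrow> 'n weyl" where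
  "weyl_mult P Q = (\<Sum>s\<in>Poly_Mapping.keys P. \<Sum>t\<in>Poly_Mapping.keys Q.
     weyl_scale (Poly_Mapping.lookup P s * Poly_Mapping.lookup Q t) (weyl_mult_mon s t))"

inductive_set weyl_left_ideal :: "'n::finite weyl set \<Rightarrow> 'n weyl set" for S where
  zero: "0 \<in> weyl_left_ideal S"
| mult: "Q \<in> S \<Longrightarrow> weyl_mult P Q \<in> weyl_left_ideal S"
| add: "P \<in> weyl_left_ideal S \<Longrightarrow> Q \<in> weyl_left_ideal S \<Longrightarrow> P + Q \<in> weyl_left_ideal S"

definition weyl_const :: "complex \<Rightarrow> 'n weyl" where
  "weyl_const c = Poly_Mapping.single (0, 0) c"

definition weyl_theta :: "'n \<Rightarrow> 'n weyl" where
  "weyl_theta j = Poly_Mapping.single (Poly_Mapping.single j 1, Poly_Mapping.single j 1) 1"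

text \<open>The inclusion of \<open>\<complex>[\<partial>]\<close> in the Weyl algebra.\<close>

definition weyl_of_partial :: "'n cpoly \<Rightarrow> 'n weyl" where
  "weyl_of_partial f =
     (\<Sum>b\<in>Poly_Mapping.keys f. Poly_Mapping.single (0, b) (Poly_Mapping.lookup f b))"

text \<open>The graph of the algebra homomorphism \<open>\<complex>[\<vartheta>] \<rightarrow> D\<close> that sends the variable \<open>j\<close> to
  \<open>\<vartheta>\<^sub>j = x\<^sub>j \<partial>\<^sub>j\<close>.\<close>

inductive theta_graph :: "'n::finite cpoly \<Rightarrow> 'n weyl \<Rightarrow> bool" where
  const: "theta_graph (pconst c) (weyl_const c)"
| var: "theta_graph (pvar j) (weyl_theta j)"
| add: "theta_graph p P \<Longrightarrow> theta_graph q Q \<Longrightarrow> theta_graph (p + q) (P + Q)"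
| mult: "theta_graph p P \<Longrightarrow> theta_graph q Q \<Longrightarrow> theta_graph (p * q) (weyl_mult P Q)"

definition row_form :: "int ^ 'n::finite ^ 'd::finite \<Rightarrow> 'd \<Rightarrow> 'n cpoly" where
  "row_form A i = (\<Sum>j\<in>UNIV. pconst (of_int (A $ i $ j)) * pvar j)"

definition euler_op :: "int ^ 'n::finite ^ 'd::finite \<Rightarrow> complex ^ 'd \<Rightarrow> 'd \<Rightarrow> 'n weyl" where
  "euler_op A \<beta> i =
     (\<Sum>j\<in>UNIV. weyl_scale (of_int (A $ i $ j)) (weyl_theta j)) - weyl_const (\<beta> $ i)"

definition hypergeometric_ideal ::
    "int ^ 'n::finite ^ 'd::finite \<Rightarrow> complex ^ 'd \<Rightarrow> 'n weyl set" where
  "hypergeometric_ideal A \<beta> =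
     weyl_left_ideal (weyl_of_partial ` toric_ideal A \<union> range (euler_op A \<beta>))"

definition fake_indicial_ideal ::
    "int ^ 'n::finite ^ 'd::finite \<Rightarrow> complex ^ 'd \<Rightarrow> real ^ 'n \<Rightarrow> 'n cpoly set" where
  "fake_indicial_ideal A \<beta> w = Idl\<^bsub>poly_ring UNIV\<^esub>
     ({p. \<exists>P\<in>weyl_left_ideal (weyl_of_partial ` init_ideal w (toric_ideal A)). theta_graph p P} \<union>
      {row_form A i - pconst (\<beta> $ i) | i. True})"

definition fake_exponent ::
    "int ^ 'n::finite ^ 'd::finite \<Rightarrow> complex ^ 'd \<Rightarrow> real ^ 'n \<Rightarrow> complex ^ 'n \<Rightarrow> bool" where
  "fake_exponent A \<beta> w v \<longleftrightarrow> (\<forall>p\<in>fake_indicial_ideal A \<beta> w. peval (($) v) p = 0)"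


section \<open>Standard pairs and the link\<close>

definition nsupp :: "complex ^ 'n::finite \<Rightarrow> 'n set" where
  "nsupp z = {j. \<exists>k::int. k < 0 \<and> z $ j = of_int k}"

definition nsupp_shift :: "complex ^ 'n::finite \<Rightarrow> int ^ 'n \<Rightarrow> 'n set" where
  "nsupp_shift v u = nsupp (v + cvec u)"

definition standard_pairs :: "'n cpoly set \<Rightarrow> (('n \<Rightarrow>\<^sub>0 nat) \<times> 'n set) set" where
  "standard_pairs M = {(a, \<sigma>).
     (\<forall>i\<in>\<sigma>. Poly_Mapping.lookup a i = 0) \<and>
     (\<forall>b. Poly_Mapping.keys b \<subseteq> \<sigma> \<longrightarrow> pmon (a + b) \<notin> M) \<and>
     (\<forall>l. l \<notin> \<sigma> \<longrightarrow> (\<exists>b. Poly_Mapping.keys b \<subseteq> insert l \<sigma> \<and> pmon (a + b) \<in> M))}"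

definition std_pairs_at ::
    "int ^ 'n::finite ^ 'd::finite \<Rightarrow> real ^ 'n \<Rightarrow> complex ^ 'n \<Rightarrow> (('n \<Rightarrow>\<^sub>0 nat) \<times> 'n set) set" where
  "std_pairs_at A w v = {(a, \<sigma>) \<in> standard_pairs (init_ideal w (toric_ideal A)).
     \<forall>j. j \<notin> \<sigma> \<longrightarrow> v $ j = of_nat (Poly_Mapping.lookup a j)}"

definition Delta_complex ::
    "int ^ 'n::finite ^ 'd::finite \<Rightarrow> real ^ 'n \<Rightarrow> complex ^ 'n \<Rightarrow> 'n set set" where
  "Delta_complex A w v = {\<tau>. \<exists>(a, \<sigma>)\<in>std_pairs_at A w v. \<tau> \<subseteq> \<sigma>}"

definition link_complex ::
    "int ^ 'n::finite ^ 'd::finite \<Rightarrow> real ^ 'n \<Rightarrow> complex ^ 'n \<Rightarrow> 'n set set" where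
  "link_complex A w v =
     {\<tau> \<in> Delta_complex A w v. \<tau> \<inter> nsupp v = {} \<and> \<tau> \<union> nsupp v \<in> Delta_complex A w v}"


section \<open>Stanley-Reisner rings, Hilbert series and the Cohen-Macaulay property\<close>

definition sr_ideal :: "'v set \<Rightarrow> 'v set set \<Rightarrow> 'v cpoly set" where
  "sr_ideal V \<Delta> = Idl\<^bsub>poly_ring V\<^esub> {\<Prod>i\<in>\<tau>. pvar i | \<tau>. \<tau> \<subseteq> V \<and> \<tau> \<notin> \<Delta>}"

definition sr_ring :: "'v set \<Rightarrow> 'v set set \<Rightarrow> 'v cpoly set ring" where
  "sr_ring V \<Delta> = poly_ring V Quot (sr_ideal V \<Delta>)"

definition graded_part :: "'v cpoly set \<Rightarrow> nat \<Rightarrow> 'v cpoly set" where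
  "graded_part S q = {p \<in> S. homog q p}"

text \<open>The Hilbert series of \<open>\<complex>[x\<^sub>i | i \<in> V] / J\<close> for a finite set \<open>V\<close> and a homogeneous ideal \<open>J\<close>:
  the degree-\<open>q\<close> part is the quotient of the two finite-dimensional spaces below.\<close>

definition hilbert_series :: "'v set \<Rightarrow> 'v cpoly set \<Rightarrow> int fps" where
  "hilbert_series V J = Abs_fps (\<lambda>q.
     int (cpoly.dim (graded_part (carrier (poly_ring V)) q)) - int (cpoly.dim (graded_part J q)))"

definition h_poly :: "'v set \<Rightarrow> 'v set set \<Rightarrow> int poly" where
  "h_poly V \<Delta> = (THE p. fps_of_poly p =
     hilbert_series V (sr_ideal V \<Delta>) * (1 - fps_X) ^ Max (card ` \<Delta>))"

definition regular_sequence :: "('a, 'b) ring_scheme \<Rightarrow> 'a list \<Rightarrow> bool" where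
  "regular_sequence R xs \<longleftrightarrow>
     set xs \<subseteq> carrier R \<and> Idl\<^bsub>R\<^esub> (set xs) \<noteq> carrier R \<and>
     (\<forall>i<length xs. \<forall>y\<in>carrier R.
        (xs ! i) \<otimes>\<^bsub>R\<^esub> y \<in> Idl\<^bsub>R\<^esub> (set (take i xs)) \<longrightarrow> y \<in> Idl\<^bsub>R\<^esub> (set (take i xs)))"

definition ideal_depth :: "('a, 'b) ring_scheme \<Rightarrow> 'a set \<Rightarrow> enat" where
  "ideal_depth R I = Sup {enat (length xs) | xs. regular_sequence R xs \<and> set xs \<subseteq> I}"

definition prime_height :: "('a, 'b) ring_scheme \<Rightarrow> 'a set \<Rightarrow> enat" where
  "prime_height R Q = Sup {enat k | k. \<exists>C :: nat \<Rightarrow> 'a set.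
     (\<forall>i\<le>k. primeideal (C i) R) \<and> (\<forall>i<k. C i \<subset> C (Suc i)) \<and> C k = Q}"

definition cohen_macaulay :: "('a, 'b) ring_scheme \<Rightarrow> bool" where
  "cohen_macaulay R \<longleftrightarrow> cring R \<and> noetherian_ring R \<and>
     (\<forall>M. maximalideal M R \<longrightarrow> ideal_depth R M = prime_height R M)"


section \<open>The ideal \<open>Q\<^sub>v\<close> and the Hilbert series \<open>H\<^sub>w\<^sub>,\<^sub>v\<close>\<close>

text \<open>From here on, \<open>g i\<close> for \<open>i < m\<close> are the vectors \<open>g\<^sub>+ - g\<^sub>-\<close> of a reduced Groebner basis.\<close>

definition G_set :: "complex ^ 'n::finite \<Rightarrow> int ^ 'n \<Rightarrow> 'n set" where
  "G_set v u = nsupp_shift v (- u) - nsupp v"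

definition Q_ideal ::
    "int ^ 'n::finite ^ 'd::finite \<Rightarrow> complex ^ 'n \<Rightarrow> nat \<Rightarrow> (nat \<Rightarrow> int ^ 'n) \<Rightarrow> 'n cpoly set" where
  "Q_ideal A v m g = Idl\<^bsub>poly_ring UNIV\<^esub>
     (range (row_form A) \<union> {\<Prod>j\<in>G_set v (g i). pvar j | i. i < m})"

definition Q_perp ::
    "int ^ 'n::finite ^ 'd::finite \<Rightarrow> complex ^ 'n \<Rightarrow> nat \<Rightarrow> (nat \<Rightarrow> int ^ 'n) \<Rightarrow> 'n cpoly set" where
  "Q_perp A v m g = {f. \<forall>\<phi>\<in>Q_ideal A v m g. pdiff \<phi> f = 0}"

definition frank ::
    "int ^ 'n::finite ^ 'd::finite \<Rightarrow> complex ^ 'n \<Rightarrow> nat \<Rightarrow> (nat \<Rightarrow> int ^ 'n) \<Rightarrow> nat" where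
  "frank A v m g = cpoly.dim (Q_perp A v m g)"

text \<open>\<open>\<theta>\<^sub>p - L p\<close> (\<open>p \<in> I\<^sub>0\<close>) and \<open>ell q\<close> (\<open>q < d - |I\<^sub>0|\<close>) generate \<open>\<langle>A\<theta>\<rangle>\<close>, where all \<open>L p\<close> and \<open>ell q\<close> are
  linear forms in the variables outside \<open>I\<^sub>0 = nsupp v\<close>.\<close>

definition row_reduction ::
    "int ^ 'n::finite ^ 'd::finite \<Rightarrow> complex ^ 'n \<Rightarrow> ('n \<Rightarrow> 'n cpoly) \<Rightarrow> (nat \<Rightarrow> 'n cpoly) \<Rightarrow> bool" where
  "row_reduction A v L ell \<longleftrightarrow>
     (\<forall>p\<in>nsupp v. L p \<in> graded_part (carrier (poly_ring (- nsupp v))) 1) \<and>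
     (\<forall>q < CARD('d) - card (nsupp v). ell q \<in> graded_part (carrier (poly_ring (- nsupp v))) 1) \<and>
     Idl\<^bsub>poly_ring UNIV\<^esub>
       ((\<lambda>p. pvar p - L p) ` nsupp v \<union> ell ` {..<CARD('d) - card (nsupp v)}) =
     Idl\<^bsub>poly_ring UNIV\<^esub> (range (row_form A))"

text \<open>\<open>\<complex>[link\<^sub>v] / (ell)\<close> is presented as the quotient of \<open>\<complex>[x\<^sub>i | i \<in> V]\<close> by the ideal generated by the
  Stanley-Reisner ideal and the \<open>ell q\<close>.\<close>

definition H_series ::
    "int ^ 'n::finite ^ 'd::finite \<Rightarrow> real ^ 'n \<Rightarrow> complex ^ 'n \<Rightarrow> (nat \<Rightarrow> 'n cpoly) \<Rightarrow> int fps" where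
  "H_series A w v ell = hilbert_series (- nsupp v) (Idl\<^bsub>poly_ring (- nsupp v)\<^esub>
     (sr_ideal (- nsupp v) (link_complex A w v) \<union> ell ` {..<CARD('d) - card (nsupp v)}))"


section \<open>Frobenius data\<close>

definition C_monoid :: "nat \<Rightarrow> (nat \<Rightarrow> int ^ 'n::finite) \<Rightarrow> (int ^ 'n) set" where
  "C_monoid m g = {\<Sum>i<m. int (c i) *s g i | c :: nat \<Rightarrow> nat. True}"

definition NS ::
    "int ^ 'n::finite ^ 'd::finite \<Rightarrow> complex ^ 'n \<Rightarrow> nat \<Rightarrow> (nat \<Rightarrow> int ^ 'n) \<Rightarrow> 'n set set" where
  "NS A v m g = {nsupp_shift v u | u. u \<in> int_kernel A \<and>
     (\<forall>u'\<in>int_kernel A. nsupp_shift v u' = nsupp_shift v u \<longrightarrow> u' \<in> C_monoid m g)}"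

definition NS_compl ::
    "int ^ 'n::finite ^ 'd::finite \<Rightarrow> complex ^ 'n \<Rightarrow> nat \<Rightarrow> (nat \<Rightarrow> int ^ 'n) \<Rightarrow> 'n set set" where
  "NS_compl A v m g = nsupp_shift v ` int_kernel A - NS A v m g"

definition K_set ::
    "int ^ 'n::finite ^ 'd::finite \<Rightarrow> complex ^ 'n \<Rightarrow> nat \<Rightarrow> (nat \<Rightarrow> int ^ 'n) \<Rightarrow> 'n set" where
  "K_set A v m g = \<Inter> (NS A v m g)"

definition Bs_prod :: "nat \<Rightarrow> (nat \<Rightarrow> int ^ 'n::finite) \<Rightarrow> 'n set \<Rightarrow> nat cpoly" where
  "Bs_prod h B F = (\<Prod>j\<in>F. \<Sum>k<h. pconst (of_int (B k $ j)) * pvar k)"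

definition P_ideal ::
    "int ^ 'n::finite ^ 'd::finite \<Rightarrow> complex ^ 'n \<Rightarrow> nat \<Rightarrow> (nat \<Rightarrow> int ^ 'n) \<Rightarrow>
     nat \<Rightarrow> (nat \<Rightarrow> int ^ 'n) \<Rightarrow> nat cpoly set" where
  "P_ideal A v m g h B = Idl\<^bsub>poly_ring {..<h}\<^esub>
     {Bs_prod h B ((I \<union> J) - K_set A v m g) | I J. I \<in> NS A v m g \<and> J \<in> NS_compl A v m g}"

definition m_elem ::
    "int ^ 'n::finite ^ 'd::finite \<Rightarrow> complex ^ 'n \<Rightarrow> nat \<Rightarrow> (nat \<Rightarrow> int ^ 'n) \<Rightarrow>
     nat \<Rightarrow> (nat \<Rightarrow> int ^ 'n) \<Rightarrow> nat cpoly" where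
  "m_elem A v m g h B = Bs_prod h B (nsupp v - K_set A v m g)"

definition PB_ideal ::
    "complex ^ 'n::finite \<Rightarrow> nat \<Rightarrow> (nat \<Rightarrow> int ^ 'n) \<Rightarrow>
     nat \<Rightarrow> (nat \<Rightarrow> int ^ 'n) \<Rightarrow> nat cpoly set" where
  "PB_ideal v m g h B = Idl\<^bsub>poly_ring {..<h}\<^esub> {Bs_prod h B (G_set v (g i)) | i. i < m}"


section \<open>Series solutions\<close>

text \<open>A function \<open>F\<close> on \<open>\<int>\<^sup>n\<close> stands for the formal series \<open>x\<^sup>v (\<Sum>u. F u (log x) x\<^sup>u)\<close>. Since
  \<open>\<partial>\<^sub>j (x\<^sup>s g(log x)) = x\<^bsup>s-e\<^sub>j\<^esup> ((s\<^sub>j + \<partial>/\<partial>log x\<^sub>j) g)(log x)\<close>, the coefficient of \<open>x\<^bsup>v+u\<^esup>\<close> in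
  \<open>x\<^sup>a \<partial>\<^sup>b F\<close> is \<open>(\<Prod>j. \<Prod>k=1..b\<^sub>j. v\<^sub>j + u\<^sub>j - a\<^sub>j + k + \<partial>/\<partial>log x\<^sub>j) F (u - a + b)\<close>.\<close>

definition weyl_act ::
    "complex ^ 'n::finite \<Rightarrow> 'n weyl \<Rightarrow> (int ^ 'n \<Rightarrow> 'n cpoly) \<Rightarrow> (int ^ 'n \<Rightarrow> 'n cpoly)" where
  "weyl_act v P F = (\<lambda>u. \<Sum>(a, b)\<in>Poly_Mapping.keys P.
     cscale (Poly_Mapping.lookup P (a, b))
       (pdiff
         (\<Prod>j\<in>UNIV. \<Prod>k\<in>{1..Poly_Mapping.lookup b j}.
            pconst (v $ j + of_int (u $ j - int (Poly_Mapping.lookup a j) + int k)) + pvar j)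
         (F (u - exp_vec a + exp_vec b))))"

definition rational_cone :: "(int ^ 'n::finite) set \<Rightarrow> (real ^ 'n) set" where
  "rational_cone R = {\<Sum>r\<in>R. c r *\<^sub>R rvec r | c. \<forall>r\<in>R. 0 \<le> c r}"

definition series_solution ::
    "int ^ 'n::finite ^ 'd::finite \<Rightarrow> complex ^ 'd \<Rightarrow> real ^ 'n \<Rightarrow> complex ^ 'n \<Rightarrow>
     (int ^ 'n \<Rightarrow> 'n cpoly) \<Rightarrow> bool" where
  "series_solution A \<beta> w v F \<longleftrightarrow>
     (\<forall>u. F u \<noteq> 0 \<longrightarrow> u \<in> int_kernel A) \<and>
     F 0 \<noteq> 0 \<and>
     (\<exists>N. \<forall>u. \<forall>m\<in>Poly_Mapping.keys (F u). mdeg m \<le> N) \<and>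
     (\<exists>R. finite R \<and>
        (\<forall>x. x \<in> rational_cone R \<and> - x \<in> rational_cone R \<longrightarrow> x = 0) \<and>
        (\<forall>x\<in>rational_cone R. x \<noteq> 0 \<longrightarrow> w \<bullet> x > 0) \<and>
        (\<forall>u. F u \<noteq> 0 \<longrightarrow> rvec u \<in> rational_cone R)) \<and>
     (\<forall>P\<in>hypergeometric_ideal A \<beta>. weyl_act v P F = (\<lambda>u. 0))"

definition leading_coeffs ::
    "int ^ 'n::finite ^ 'd::finite \<Rightarrow> complex ^ 'd \<Rightarrow> real ^ 'n \<Rightarrow> complex ^ 'n \<Rightarrow> 'n cpoly set" where
  "leading_coeffs A \<beta> w v = insert 0 {F 0 | F. series_solution A \<beta> w v F}"

end

theory Submission
  imports Defs
begin

text \<open>Write \<open>V\<close> for the complement of \<open>nsupp v\<close>. Eliminating the variables of \<open>nsupp v\<close> by row reduction identifies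
  the polynomial ring modulo \<open>Q_ideal\<close> with the Stanley-Reisner ring of the link modulo the \<open>d - |nsupp v|\<close> linear
  forms \<open>ell\<close>: a set \<open>\<tau> \<subseteq> V\<close> is a face of the link if and only if it contains no \<open>G_set v (g i)\<close>. The columns of
  \<open>A\<close> indexed by a standard pair are linearly independent, so modulo the Stanley-Reisner ideal and \<open>ell\<close> every
  monomial can be rewritten with strictly larger support until it dies; the quotient is Artinian and the \<open>ell\<close> are
  a system of parameters. By the Cohen-Macaulay hypothesis they form a regular sequence (proved with the Koszul
  complex and graded Nakayama), which gives the \<open>h\<close>-polynomial. Macaulay duality turns the Hilbert
  function of the quotient into that of \<open>Q_perp\<close>.

  The coefficient of a series solution at \<open>- g i\<close> vanishes because \<open>w \<bullet> g i > 0\<close>, so the toric equations at this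
  exponent show that leading coefficients lie in \<open>Q_perp\<close>. Conversely let \<open>f \<in> Q_perp\<close>. Each \<open>\<partial>\<^sub>j\<close> with \<open>j\<close> in the
  support of some lattice vector is surjective on the common kernel of the row forms, so \<open>f\<close> is the image of some \<open>q\<close>
  under the product of \<open>\<partial>\<^sub>j\<close>, \<open>j \<in> nsupp v - K\<close>. The identity \<open>P = m(s) P\<^sub>B\<close> makes \<open>q\<close> vanish under all products over
  \<open>(I \<union> J) - K\<close>, and hence the Frobenius coefficients obtained by applying Gamma-quotients in \<open>\<partial>\<close> to \<open>q\<close> solve the
  system with leading coefficient \<open>f\<close>.\<close>

text \<open>The obstacle is that the Cohen-Macaulay hypothesis speaks of depth at maximal ideals of
  a quotient ring. It yields some regular sequence \<open>y\<close> of the right length in the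
  irrelevant ideal, in general neither homogeneous nor related to \<open>ell\<close>. The transfer
  to \<open>ell\<close> uses one fact on the Koszul homology of \<open>ell\<close>: if an element is
  regular and one of its powers lies in the ideal of the \<open>ell\<close>, then vanishing in
  degree \<open>i + 1\<close> modulo this element gives vanishing in degree \<open>i\<close>. With
  all of \<open>y\<close> adjoined the degree in question exceeds the length of the complex;
  removing the elements one by one ends in degree 1, where the grading takes over. The length comes
  from the top-dimensional standard pair: its face of the link has \<open>d - |nsupp v|\<close>
  vertices, as many as there are forms \<open>ell\<close>, and no face has more because
  \<open>d + 1\<close> columns are dependent.

  Gamma quotients occur only as truncated power series, since derivatives are nilpotent on
  polynomials of bounded degree.\<close>

abbreviation lookup where "lookup \<equiv> Poly_Mapping.lookup"
abbreviation keys where "keys \<equiv> Poly_Mapping.keys"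
abbreviation single where "single \<equiv> Poly_Mapping.single"

section \<open>Coefficients and supports of polynomial mappings\<close>

lemma poly_sum_single: "p = (\<Sum>m\<in>keys p. single m (lookup p m))"
proof (rule poly_mapping_eqI)
  fix k
  show "lookup p k = lookup (\<Sum>m\<in>keys p. single m (lookup p m)) k"
    by (simp add: lookup_sum lookup_single when_def in_keys_iff sum.delta)
qed

lemma cpoly_induct [case_names zero single add]:
  assumes "P 0" "\<And>m c. P (single m c)" "\<And>p q. P p \<Longrightarrow> P q \<Longrightarrow> P (p + q)"
  shows "P (p :: 'v cpoly)"
proof -
  have "P (\<Sum>m\<in>X. single m (lookup p m))" if "finite X" for X
    using that by (induction X rule: finite_induct) (auto intro: assms)
  then show ?thesis
    using poly_sum_single[of p] by (metis finite_keys)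
qed

lemma keys_subset_add: "keys (p + q) \<subseteq> keys p \<union> keys q"
  by (rule Poly_Mapping.keys_add)

lemma keys_add_nat: "keys (a + b :: 'v \<Rightarrow>\<^sub>0 nat) = keys a \<union> keys b"
  by (auto simp: in_keys_iff lookup_add)

lemma keys_mult_mem:
  assumes "m \<in> keys (p * q)"
  obtains a b where "a \<in> keys p" "b \<in> keys q" "m = a + b"
  using keys_mult[of p q] assms by blast

text \<open>Exponents cancel, so the complementary exponent \<open>b\<close> is unique and
  \<open>THE\<close> picks it; an exponent not of the form \<open>a + b\<close> cannot occur in the
  product.\<close>

lemma lookup_single_mult:
  "lookup (single a c * p) k = (if \<exists>b. k = a + b then c * lookup p (THE b. k = a + b) else 0)"
  for a :: "'v \<Rightarrow>\<^sub>0 nat" and p :: "'v cpoly"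
proof (induction p rule: cpoly_induct)
  case (single m d)
  show ?case
    by (auto simp: mult_single lookup_single when_def)
next
  case (add p q)
  then show ?case by (simp add: distrib_left lookup_add)
qed auto

lemma lookup_single_mult_add [simp]:
  "lookup (single a c * p) (a + b) = c * lookup p b" for a :: "'v \<Rightarrow>\<^sub>0 nat" and p :: "'v cpoly"
  by (simp add: lookup_single_mult)

lemma pconst_0 [simp]: "pconst 0 = 0" and pconst_1 [simp]: "pconst 1 = 1"
  and pconst_add: "pconst (a + b) = pconst a + pconst b"
  and pconst_mult: "pconst (a * b) = pconst a * pconst b"
  and pconst_uminus: "pconst (- a) = - pconst a"
  and pconst_diff: "pconst (a - b) = pconst a - pconst b"
  by (simp_all add: pconst_def single_add mult_single single_uminus single_diff)

lemma pmon_0 [simp]: "pmon 0 = 1"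
  by (simp add: pmon_def)

lemma pmon_add: "pmon (a + b) = pmon a * pmon b"
  by (simp add: pmon_def mult_single)

lemma single_eq_pconst_pmon: "single m c = pconst c * pmon m"
  by (simp add: pconst_def pmon_def mult_single)

lemma keys_pmon [simp]: "keys (pmon m) = {m}"
  by (simp add: pmon_def)

lemma keys_pvar [simp]: "keys (pvar j) = {single j 1}"
  by (simp add: pvar_def)

lemma keys_pconst: "keys (pconst c) \<subseteq> {0}"
  by (simp add: pconst_def)

lemma lookup_cscale [simp]: "lookup (cscale c p) m = c * lookup p m"
  using lookup_single_mult_add[of 0 c p m] by (simp add: cscale_def pconst_def)

lemma cscale_mult_left: "cscale c p * q = cscale c (p * q)"
  and cscale_mult_right: "p * cscale c q = cscale c (p * q)"
  by (simp_all add: cscale_def mult_ac)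

lemma pmon_prod_single: "pmon (\<Sum>i\<in>X. f i) = (\<Prod>i\<in>X. pmon (f i))"
  by (induction X rule: infinite_finite_induct) (auto simp: pmon_add)

lemma prod_pvar: "(\<Prod>i\<in>X. pvar i) = pmon (\<Sum>i\<in>X. single i 1)"
  by (simp add: pvar_def pmon_prod_single)

lemma lookup_indicator: "finite X \<Longrightarrow> lookup (\<Sum>i\<in>X. single i (1::nat)) j = (if j \<in> X then 1 else 0)"
  by (simp add: lookup_sum lookup_single when_def)

lemma keys_indicator: "finite X \<Longrightarrow> keys (\<Sum>i\<in>X. single i (1::nat)) = X"
  using lookup_indicator[of X] by (auto simp: in_keys_iff split: if_splits)

section \<open>Ideals of the polynomial rings\<close>

lemma carrier_poly_ring: "carrier (poly_ring V) = {p. \<forall>m\<in>keys p. keys m \<subseteq> V}"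
  and poly_ring_simps [simp]: "mult (poly_ring V) = (*)" "one (poly_ring V) = 1"
    "zero (poly_ring V) = 0" "add (poly_ring V) = (+)"
  by (simp_all add: poly_ring_def)

abbreviation Polys :: "'v set \<Rightarrow> 'v cpoly set" where
  "Polys V \<equiv> carrier (poly_ring V)"

lemma Polys_UNIV [simp]: "p \<in> Polys UNIV"
  by (simp add: carrier_poly_ring)

lemma Polys_0 [simp]: "0 \<in> Polys V" and Polys_1 [simp]: "1 \<in> Polys V"
  by (auto simp: carrier_poly_ring)

lemma Polys_add: "p \<in> Polys V \<Longrightarrow> q \<in> Polys V \<Longrightarrow> p + q \<in> Polys V"
  using keys_subset_add[of p q] by (auto simp: carrier_poly_ring)

lemma Polys_mult: "p \<in> Polys V \<Longrightarrow> q \<in> Polys V \<Longrightarrow> p * q \<in> Polys V"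
  by (fastforce simp: carrier_poly_ring keys_add_nat elim!: keys_mult_mem)

lemma Polys_uminus: "p \<in> Polys V \<Longrightarrow> - p \<in> Polys V"
  by (simp add: carrier_poly_ring)

lemma Polys_diff: "p \<in> Polys V \<Longrightarrow> q \<in> Polys V \<Longrightarrow> p - q \<in> Polys V"
  using Polys_add[of p V "- q"] Polys_uminus[of q V] by simp

lemma Polys_pconst [simp]: "pconst c \<in> Polys V"
  using keys_pconst[of c] by (auto simp: carrier_poly_ring)

lemma Polys_pvar [simp]: "pvar j \<in> Polys V \<longleftrightarrow> j \<in> V"
  by (auto simp: carrier_poly_ring)

lemma Polys_pmon [simp]: "pmon m \<in> Polys V \<longleftrightarrow> keys m \<subseteq> V"
  by (auto simp: carrier_poly_ring)

lemma Polys_single: "keys m \<subseteq> V \<Longrightarrow> single m c \<in> Polys V"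
  by (auto simp: carrier_poly_ring)

lemma Polys_sum: "(\<And>x. x \<in> X \<Longrightarrow> f x \<in> Polys V) \<Longrightarrow> sum f X \<in> Polys V"
  by (induction X rule: infinite_finite_induct) (auto intro: Polys_add)

lemma Polys_prod: "(\<And>x. x \<in> X \<Longrightarrow> f x \<in> Polys V) \<Longrightarrow> prod f X \<in> Polys V"
  by (induction X rule: infinite_finite_induct) (auto intro: Polys_mult)

lemma Polys_power: "p \<in> Polys V \<Longrightarrow> p ^ k \<in> Polys V"
  by (induction k) (auto intro: Polys_mult)

lemmas Polys_intros = Polys_add Polys_mult Polys_uminus Polys_diff Polys_sum Polys_prod Polys_power

lemma poly_ring_cring: "cring (poly_ring V)"
proof (rule cringI)
  show "abelian_group (poly_ring V)"
  proof (rule abelian_groupI)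
    fix x assume x: "x \<in> Polys V"
    have "- x \<in> Polys V" using x by (rule Polys_uminus)
    then show "\<exists>y\<in>Polys V. y \<oplus>\<^bsub>poly_ring V\<^esub> x = \<zero>\<^bsub>poly_ring V\<^esub>"
      by (intro bexI[of _ "- x"]) simp_all
  qed (simp_all add: Polys_add add_ac)
  show "comm_monoid (poly_ring V)"
    by (rule comm_monoidI) (simp_all add: Polys_mult mult_ac)
qed (simp_all add: distrib_right)

interpretation poly_ring: cring "poly_ring V" for V
  by (rule poly_ring_cring)

lemma a_inv_poly_ring: "p \<in> Polys V \<Longrightarrow> a_inv (poly_ring V) p = - p"
  by (rule poly_ring.minus_equality) (auto simp: Polys_uminus)

text \<open>Closure under negatives comes from multiplication by \<open>- 1\<close>; this recovers
  the additive subgroup condition.\<close>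

lemma poly_ideal_iff:
  "ideal J (poly_ring V) \<longleftrightarrow> J \<subseteq> Polys V \<and> 0 \<in> J \<and> (\<forall>a\<in>J. \<forall>b\<in>J. a + b \<in> J) \<and>
     (\<forall>c\<in>Polys V. \<forall>a\<in>J. c * a \<in> J)" (is "?L \<longleftrightarrow> ?R")
proof
  assume ?L
  then interpret ideal J "poly_ring V" .
  show ?R
    using a_subset zero_closed a_closed I_l_closed by simp
next
  assume R: ?R
  show ?L
  proof (rule idealI)
    show "ring (poly_ring V)" by (rule poly_ring.ring_axioms)
    show "subgroup J (add_monoid (poly_ring V))"
    proof (rule poly_ring.add.subgroupI)
      show "a_inv (poly_ring V) a \<in> J" if "a \<in> J" for a
      proof -
        have "(- 1) * a \<in> J" using R that Polys_uminus[OF Polys_1] by blast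
        then show ?thesis using a_inv_poly_ring that R by (metis mult_minus1 subset_iff)
      qed
    qed (use R in auto)
    show "a \<otimes>\<^bsub>poly_ring V\<^esub> x \<in> J" if "a \<in> J" "x \<in> Polys V" for a x
      using R that by (metis poly_ring_simps(1) mult.commute)
  qed (use R in auto)
qed

lemma Polys_ideal: "ideal (Polys V) (poly_ring V)"
  by (rule poly_ring.oneideal)

context
  fixes V :: "'v set" and J :: "'v cpoly set"
  assumes J: "ideal J (poly_ring V)"
begin

lemma ideal_sub: "p \<in> J \<Longrightarrow> p \<in> Polys V"
  and ideal_0: "0 \<in> J"
  and ideal_add: "p \<in> J \<Longrightarrow> q \<in> J \<Longrightarrow> p + q \<in> J"
  and ideal_mult: "c \<in> Polys V \<Longrightarrow> p \<in> J \<Longrightarrow> c * p \<in> J"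
  using J by (auto simp: poly_ideal_iff)

lemma ideal_mult_right: "c \<in> Polys V \<Longrightarrow> p \<in> J \<Longrightarrow> p * c \<in> J"
  using ideal_mult by (simp add: mult.commute)

lemma ideal_uminus: "p \<in> J \<Longrightarrow> - p \<in> J"
  using ideal_mult[of "- 1" p] Polys_uminus[OF Polys_1, of V] by simp

lemma ideal_diff: "p \<in> J \<Longrightarrow> q \<in> J \<Longrightarrow> p - q \<in> J"
  using ideal_add[of p "- q"] ideal_uminus[of q] by simp

lemma ideal_sum: "(\<And>x. x \<in> X \<Longrightarrow> f x \<in> J) \<Longrightarrow> sum f X \<in> J"
  by (induction X rule: infinite_finite_induct) (auto intro: ideal_add ideal_0)

lemma ideal_cscale: "p \<in> J \<Longrightarrow> cscale c p \<in> J"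
  by (simp add: cscale_def ideal_mult)

lemma ideal_subspace: "cpoly.subspace J"
  by (rule cpoly.subspaceI) (auto intro: ideal_0 ideal_add ideal_cscale)

end

lemmas Polys_subspace = ideal_subspace[OF Polys_ideal]

lemma Idl_ideal: "S \<subseteq> Polys V \<Longrightarrow> ideal (Idl\<^bsub>poly_ring V\<^esub> S) (poly_ring V)"
  by (rule poly_ring.genideal_ideal)

lemma Idl_gen: "S \<subseteq> Polys V \<Longrightarrow> s \<in> S \<Longrightarrow> s \<in> Idl\<^bsub>poly_ring V\<^esub> S"
  using poly_ring.genideal_self by blast

lemma Idl_least: "ideal J (poly_ring V) \<Longrightarrow> S \<subseteq> J \<Longrightarrow> Idl\<^bsub>poly_ring V\<^esub> S \<subseteq> J"
  by (rule poly_ring.genideal_minimal)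

lemma Idl_mono: "S \<subseteq> S' \<Longrightarrow> S' \<subseteq> Polys V \<Longrightarrow> Idl\<^bsub>poly_ring V\<^esub> S \<subseteq> Idl\<^bsub>poly_ring V\<^esub> S'"
  by (rule Idl_least) (auto intro: Idl_ideal Idl_gen)

text \<open>\<open>Idl\<close> is an intersection of ideals. The finite sums of multiples of
  generators form an ideal \<open>J\<close> containing \<open>S\<close>, hence containing the
  generated ideal; the predicate is then carried along the partial sums of such a
  representation.\<close>

lemma Idl_induct [consumes 2, case_names zero mult add]:
  assumes "p \<in> Idl\<^bsub>poly_ring V\<^esub> S" "S \<subseteq> Polys V" "P 0"
    and mult: "\<And>c s. c \<in> Polys V \<Longrightarrow> s \<in> S \<Longrightarrow> P (c * s)"
    and add: "\<And>p q. p \<in> Polys V \<Longrightarrow> q \<in> Polys V \<Longrightarrow> P p \<Longrightarrow> P q \<Longrightarrow> P (p + q)"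
  shows "P p"
proof -
  define J where "J = {p. \<exists>(N::nat) c s. (\<forall>i<N. c i \<in> Polys V \<and> s i \<in> S) \<and> p = (\<Sum>i<N. c i * s i)}"
  have "ideal J (poly_ring V)"
    unfolding poly_ideal_iff
  proof (intro conjI ballI subsetI)
    show "x \<in> Polys V" if "x \<in> J" for x
      using that \<open>S \<subseteq> Polys V\<close> by (auto simp: J_def intro!: Polys_sum Polys_mult)
    show "0 \<in> J" by (auto simp: J_def intro!: exI[of _ 0])
  next
    fix a b assume "a \<in> J" "b \<in> J"
    then obtain N c s N' c' s' where
      "\<forall>i<N. c i \<in> Polys V \<and> s i \<in> S" "a = (\<Sum>i<(N::nat). c i * s i)"
      "\<forall>i<N'. c' i \<in> Polys V \<and> s' i \<in> S" "b = (\<Sum>i<(N'::nat). c' i * s' i)"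
      unfolding J_def by blast
    \<comment> \<open>Adding two representations concatenates them: the second one is shifted by
      \<open>N\<close>.\<close>
    moreover have "(\<Sum>i<N+N'. (if i < N then c i else c' (i - N)) * (if i < N then s i else s' (i - N)))
      = (\<Sum>i<N. c i * s i) + (\<Sum>i<N'. c' i * s' i)"
      by (induction N') (simp_all add: add.assoc)
    ultimately show "a + b \<in> J"
      unfolding J_def by (intro CollectI exI[of _ "N+N'"]
        exI[of _ "\<lambda>i. if i < N then c i else c' (i - N)"]
        exI[of _ "\<lambda>i. if i < N then s i else s' (i - N)"]) auto
  next
    fix d a assume "d \<in> Polys V" "a \<in> J"
    then obtain N c s where "\<forall>i<N. c i \<in> Polys V \<and> s i \<in> S" "a = (\<Sum>i<(N::nat). c i * s i)"
      unfolding J_def by blast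
    with \<open>d \<in> Polys V\<close> show "d * a \<in> J"
      unfolding J_def by (intro CollectI exI[of _ N] exI[of _ "\<lambda>i. d * c i"] exI[of _ s])
        (auto simp: sum_distrib_left mult.assoc intro: Polys_mult)
  qed
  moreover have "S \<subseteq> J"
  proof
    fix x assume "x \<in> S"
    then show "x \<in> J"
      unfolding J_def by (intro CollectI exI[of _ 1] exI[of _ "\<lambda>_. 1"] exI[of _ "\<lambda>_. x"]) auto
  qed
  ultimately have "p \<in> J" using Idl_least assms(1) by blast
  then obtain N c s where *: "\<forall>i<N. c i \<in> Polys V \<and> s i \<in> S" "p = (\<Sum>i<(N::nat). c i * s i)"
    unfolding J_def by blast
  have "P (\<Sum>i<k. c i * s i)" if "k \<le> N" for k
    using that
  proof (induction k)
    case (Suc k)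
    have "(\<Sum>i<k. c i * s i) \<in> Polys V" "c k * s k \<in> Polys V"
      using * Suc.prems \<open>S \<subseteq> Polys V\<close> by (auto intro!: Polys_sum Polys_mult)
    then show ?case using Suc * by (auto intro!: add mult)
  qed (simp add: \<open>P 0\<close>)
  then show ?thesis using * by blast
qed

text \<open>This splits off the cofactor of one new generator, as needed when passing from
  \<open>J\<close> to \<open>J\<close> plus \<open>y\<close> in the Koszul step and in the Hilbert
  series.\<close>

lemma Idl_insert:
  assumes J: "ideal J (poly_ring V)" and y: "y \<in> Polys V"
  shows "Idl\<^bsub>poly_ring V\<^esub> (insert y J) = {a + c * y | a c. a \<in> J \<and> c \<in> Polys V}" (is "?L = ?R")
proof
  have sub: "insert y J \<subseteq> Polys V" using ideal_sub[OF J] y by auto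
  show "?L \<subseteq> ?R"
  proof (rule Idl_least)
    show "ideal ?R (poly_ring V)"
      unfolding poly_ideal_iff
    proof (intro conjI ballI subsetI)
      show "x \<in> Polys V" if "x \<in> ?R" for x
        using that y by (auto intro!: Polys_add Polys_mult intro: ideal_sub[OF J])
      have "0 = 0 + 0 * y" by simp
      then show "0 \<in> ?R" using ideal_0[OF J] Polys_0 by blast
    next
      fix a b assume "a \<in> ?R" "b \<in> ?R"
      then obtain a' c b' d where "a = a' + c * y" "b = b' + d * y" "a' \<in> J" "b' \<in> J" "c \<in> Polys V" "d \<in> Polys V"
        by blast
      moreover from this have "a + b = (a' + b') + (c + d) * y" by (simp add: algebra_simps)
      ultimately show "a + b \<in> ?R" using ideal_add[OF J] Polys_add by blast
    next
      fix e a assume "e \<in> Polys V" "a \<in> ?R"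
      then obtain a' c where "a = a' + c * y" "a' \<in> J" "c \<in> Polys V" by blast
      moreover from this have "e * a = e * a' + (e * c) * y" by (simp add: algebra_simps)
      ultimately show "e * a \<in> ?R" using \<open>e \<in> Polys V\<close> ideal_mult[OF J] Polys_mult by blast
    qed
    show "insert y J \<subseteq> ?R"
    proof
      fix x assume "x \<in> insert y J"
      moreover have "y = 0 + 1 * y" "x = x + 0 * y" by simp_all
      ultimately show "x \<in> ?R" using ideal_0[OF J] Polys_0 Polys_1 by blast
    qed
  qed
  show "?R \<subseteq> ?L"
    using Idl_gen[OF sub] ideal_add[OF Idl_ideal[OF sub]] ideal_mult[OF Idl_ideal[OF sub]] by blast
qed

text \<open>Terms do not interact: multiplication keeps every exponent above some generator, and
  each term above a generator is a multiple of it. The cofactor stays in \<open>V\<close> because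
  its support lies in that of the term.\<close>

lemma monomial_ideal_char:
  assumes "E \<subseteq> {m. keys m \<subseteq> V}"
  shows "Idl\<^bsub>poly_ring V\<^esub> (pmon ` E) = {p \<in> Polys V. \<forall>m\<in>keys p. \<exists>e\<in>E. \<exists>b. m = e + b}" (is "?L = ?R")
proof
  have sub: "pmon ` E \<subseteq> Polys V" using assms by auto
  show "?L \<subseteq> ?R"
  proof (rule Idl_least)
    show "ideal ?R (poly_ring V)"
      unfolding poly_ideal_iff
    proof (intro conjI ballI subsetI)
      fix a b assume "a \<in> ?R" "b \<in> ?R"
      then show "a + b \<in> ?R" using keys_subset_add[of a b] by (auto intro: Polys_add)
    next
      fix c a assume c: "c \<in> Polys V" and a: "a \<in> ?R"
      have "\<exists>e\<in>E. \<exists>b. m = e + b" if "m \<in> keys (c * a)" for m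
        using that
      proof (rule keys_mult_mem)
        fix x y assume "y \<in> keys a" "m = x + y"
        moreover obtain e b where "e \<in> E" "y = e + b" using a \<open>y \<in> keys a\<close> by blast
        ultimately have "m = e + (x + b)" by (simp add: ac_simps)
        with \<open>e \<in> E\<close> show ?thesis by blast
      qed
      then show "c * a \<in> ?R" using c a by (auto intro: Polys_mult)
    qed auto
    show "pmon ` E \<subseteq> ?R" using assms by (auto intro!: exI[of _ 0])
  qed
  show "?R \<subseteq> ?L"
  proof
    fix p assume p: "p \<in> ?R"
    have "single m (lookup p m) \<in> ?L" if m: "m \<in> keys p" for m
    proof -
      obtain e b where e: "e \<in> E" "m = e + b" using p m by blast
      have "keys m \<subseteq> V" using p m by (auto simp: carrier_poly_ring)
      then have "single b (lookup p m) \<in> Polys V"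
        using e by (intro Polys_single) (auto simp: keys_add_nat)
      moreover have "single m (lookup p m) = single b (lookup p m) * pmon e"
        by (simp add: pmon_def mult_single e add.commute)
      ultimately show ?thesis
        using ideal_mult[OF Idl_ideal[OF sub]] Idl_gen[OF sub] e by auto
    qed
    then show "p \<in> ?L"
      by (subst poly_sum_single) (auto intro!: ideal_sum[OF Idl_ideal[OF sub]])
  qed
qed

section \<open>Grading\<close>

lemma mdeg_superset: "finite X \<Longrightarrow> keys m \<subseteq> X \<Longrightarrow> mdeg m = (\<Sum>j\<in>X. lookup m j)"
  unfolding mdeg_def by (rule sum.mono_neutral_left) (auto simp: in_keys_iff)

lemma mdeg_0 [simp]: "mdeg 0 = 0"
  by (simp add: mdeg_def)

lemma mdeg_add: "mdeg (a + b) = mdeg a + mdeg b"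
  using mdeg_superset[of "keys a \<union> keys b" a] mdeg_superset[of "keys a \<union> keys b" b]
    mdeg_superset[of "keys a \<union> keys b" "a + b"]
  by (simp add: keys_add_nat lookup_add sum.distrib)

lemma mdeg_single [simp]: "mdeg (single j k) = k"
  by (cases "k = 0") (auto simp: mdeg_def)

lemma mdeg_eq_0_iff: "mdeg m = 0 \<longleftrightarrow> m = 0"
  unfolding mdeg_def by (metis (no_types, lifting) finite_keys in_keys_iff keys_eq_empty equals0I sum.empty sum_eq_0_iff)

lemma homog_0 [simp]: "homog q 0"
  by (simp add: homog_def)

lemma homog_add: "homog q p \<Longrightarrow> homog q p' \<Longrightarrow> homog q (p + p')"
  using keys_subset_add[of p p'] by (auto simp: homog_def)

lemma homog_uminus: "homog q p \<Longrightarrow> homog q (- p)"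
  by (simp add: homog_def)

lemma homog_diff: "homog q p \<Longrightarrow> homog q p' \<Longrightarrow> homog q (p - p')"
  using homog_add[of q p "- p'"] homog_uminus by auto

lemma homog_sum: "(\<And>x. x \<in> X \<Longrightarrow> homog q (f x)) \<Longrightarrow> homog q (sum f X)"
  by (induction X rule: infinite_finite_induct) (auto intro: homog_add)

lemma homog_mult: "homog a p \<Longrightarrow> homog b q \<Longrightarrow> homog (a + b) (p * q)"
  by (auto simp: homog_def mdeg_add elim!: keys_mult_mem)

lemma homog_pconst [simp]: "homog 0 (pconst c)"
  using keys_pconst[of c] by (auto simp: homog_def)

lemma homog_1 [simp]: "homog 0 1"
  by (simp add: homog_def)

lemma homog_pvar [simp]: "homog 1 (pvar j)"
  by (simp add: homog_def)

lemma homog_cscale: "homog q p \<Longrightarrow> homog q (cscale c p)"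
  using homog_mult[of 0 "pconst c" q p] by (simp add: cscale_def)

lemma homog_single: "homog (mdeg m) (single m c)"
  by (auto simp: homog_def)

lemma homog_prod: "finite X \<Longrightarrow> (\<And>x. x \<in> X \<Longrightarrow> homog (d x) (f x)) \<Longrightarrow> homog (sum d X) (prod f X)"
  by (induction X rule: finite_induct) (auto intro: homog_mult)

lemma homog_power: "homog d f \<Longrightarrow> homog (k * d) (f ^ k)"
  by (induction k) (auto intro: homog_mult)

definition hcomp :: "nat \<Rightarrow> 'v cpoly \<Rightarrow> 'v cpoly" where
  "hcomp q p = (\<Sum>m\<in>{m \<in> keys p. mdeg m = q}. single m (lookup p m))"

lemma lookup_hcomp: "lookup (hcomp q p) m = (if mdeg m = q then lookup p m else 0)"
proof -
  have "finite {m \<in> keys p. mdeg m = q}" by simp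
  then show ?thesis
    by (auto simp: hcomp_def lookup_sum lookup_single when_def in_keys_iff)
qed

lemma hcomp_add: "hcomp q (p + p') = hcomp q p + hcomp q p'"
  by (rule poly_mapping_eqI) (simp add: lookup_hcomp lookup_add)

lemma hcomp_0 [simp]: "hcomp q 0 = 0"
  by (rule poly_mapping_eqI) (simp add: lookup_hcomp)

lemma hcomp_uminus: "hcomp q (- p) = - hcomp q p"
  by (rule poly_mapping_eqI) (simp add: lookup_hcomp)

lemma hcomp_diff: "hcomp q (p - p') = hcomp q p - hcomp q p'"
  by (rule poly_mapping_eqI) (simp add: lookup_hcomp lookup_minus)

lemma hcomp_sum: "hcomp q (sum f X) = (\<Sum>x\<in>X. hcomp q (f x))"
  by (induction X rule: infinite_finite_induct) (auto simp: hcomp_add)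

lemma homog_hcomp: "homog q (hcomp q p)"
  by (auto simp: homog_def in_keys_iff lookup_hcomp split: if_splits)

lemma hcomp_homog: "homog e p \<Longrightarrow> hcomp q p = (if q = e then p else 0)"
  by (rule poly_mapping_eqI) (auto simp: lookup_hcomp homog_def in_keys_iff)

text \<open>A homogeneous factor shifts every degree by \<open>e\<close>. Below degree
  \<open>e\<close> the difference \<open>q - e\<close> is truncated, but there the product has no
  component at all.\<close>

lemma hcomp_mult_homog:
  assumes "homog e b"
  shows "hcomp q (a * b) = (if e \<le> q then hcomp (q - e) a * b else 0)"
proof (induction a rule: cpoly_induct)
  case (single m c)
  have *: "homog (mdeg m + e) (single m c * b)"
    by (intro homog_mult homog_single assms)
  show ?case
    by (auto simp: hcomp_homog[OF *] hcomp_homog[OF homog_single])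
qed (auto simp: distrib_right hcomp_add)

lemma sum_hcomp:
  assumes "\<And>m. m \<in> keys p \<Longrightarrow> mdeg m \<le> N"
  shows "(\<Sum>q\<le>N. hcomp q p) = p"
  using assms by (intro poly_mapping_eqI) (auto simp: lookup_sum lookup_hcomp in_keys_iff)

lemma keys_mdeg_bound: "\<exists>N. \<forall>m\<in>keys p. mdeg m \<le> N"
  using finite_keys[of p] by (meson finite_imageI finite_nat_set_iff_bounded_le imageI)

lemma Polys_hcomp: "p \<in> Polys V \<Longrightarrow> hcomp q p \<in> Polys V"
  by (auto simp: carrier_poly_ring in_keys_iff lookup_hcomp split: if_splits)

text \<open>The condition for a homogeneous ideal, stated for sets so that it also covers the
  subspace \<open>Q_perp\<close>.\<close>

definition homog_closed :: "'v cpoly set \<Rightarrow> bool" where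
  "homog_closed J \<longleftrightarrow> (\<forall>p\<in>J. \<forall>q. hcomp q p \<in> J)"

lemma homog_closed_Idl:
  assumes "S \<subseteq> Polys V" and h: "\<And>s. s \<in> S \<Longrightarrow> \<exists>e. homog e s"
  shows "homog_closed (Idl\<^bsub>poly_ring V\<^esub> S)"
  unfolding homog_closed_def
proof (intro ballI allI)
  fix p q assume "p \<in> Idl\<^bsub>poly_ring V\<^esub> S"
  then show "hcomp q p \<in> Idl\<^bsub>poly_ring V\<^esub> S"
    using assms(1)
  proof (induction rule: Idl_induct)
    case (mult c s)
    then obtain e where e: "homog e s" using h by blast
    show ?case
      using mult ideal_0[OF Idl_ideal[OF assms(1)]]
      by (auto simp: hcomp_mult_homog[OF e] intro!: ideal_mult[OF Idl_ideal[OF assms(1)]]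
          intro: Idl_gen[OF assms(1)] Polys_hcomp)
  qed (auto simp: hcomp_add intro: ideal_add[OF Idl_ideal[OF assms(1)]] ideal_0[OF Idl_ideal[OF assms(1)]])
qed

text \<open>Members of \<open>J\<close> need not be homogeneous, so \<open>J\<close> is replaced by
  its homogeneous members; they generate it because every component of a member lies in
  \<open>J\<close> again.\<close>

lemma homog_closed_Idl_Un:
  assumes J: "ideal J (poly_ring V)" "homog_closed J" and S: "S \<subseteq> Polys V" "\<And>s. s \<in> S \<Longrightarrow> \<exists>e. homog e s"
  shows "homog_closed (Idl\<^bsub>poly_ring V\<^esub> (J \<union> S))"
proof -
  let ?H = "{p \<in> J. \<exists>e. homog e p}"
  have sub: "?H \<union> S \<subseteq> Polys V" using ideal_sub[OF J(1)] S by auto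
  have sub2: "J \<union> S \<subseteq> Polys V" using ideal_sub[OF J(1)] S by auto
  have "J \<subseteq> Idl\<^bsub>poly_ring V\<^esub> (?H \<union> S)"
  proof
    fix p assume p: "p \<in> J"
    obtain N where N: "\<forall>m\<in>keys p. mdeg m \<le> N" using keys_mdeg_bound by blast
    have "hcomp q p \<in> Idl\<^bsub>poly_ring V\<^esub> (?H \<union> S)" for q
      using J p homog_hcomp[of q p] by (intro Idl_gen[OF sub]) (auto simp: homog_closed_def)
    then have "(\<Sum>q\<le>N. hcomp q p) \<in> Idl\<^bsub>poly_ring V\<^esub> (?H \<union> S)"
      by (intro ideal_sum[OF Idl_ideal[OF sub]])
    then show "p \<in> Idl\<^bsub>poly_ring V\<^esub> (?H \<union> S)" using sum_hcomp[of p N] N by simp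
  qed
  then have "Idl\<^bsub>poly_ring V\<^esub> (J \<union> S) = Idl\<^bsub>poly_ring V\<^esub> (?H \<union> S)"
    using Idl_gen[OF sub] by (intro antisym Idl_least Idl_ideal sub Idl_mono sub2) auto
  then show ?thesis using homog_closed_Idl[OF sub] S by auto
qed

section \<open>Substitution\<close>

text \<open>The target may have other variables: in one place the substitution eliminates the
  variables of \<open>nsupp v\<close>, in another it carries polynomials in the parameters
  \<open>s\<close> back to the variables theta.\<close>

definition psubst :: "('v \<Rightarrow> 'u cpoly) \<Rightarrow> 'v cpoly \<Rightarrow> 'u cpoly" where
  "psubst \<sigma> p = (\<Sum>m\<in>keys p. pconst (lookup p m) * (\<Prod>j\<in>keys m. \<sigma> j ^ lookup m j))"

lemma prod_power_superset:
  "finite X \<Longrightarrow> keys m \<subseteq> X \<Longrightarrow> (\<Prod>j\<in>keys m. \<sigma> j ^ lookup m j) = (\<Prod>j\<in>X. \<sigma> j ^ lookup m j)"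
  for \<sigma> :: "_ \<Rightarrow> 'a::comm_semiring_1"
  by (rule prod.mono_neutral_left) (auto simp: in_keys_iff)

lemma prod_power_add:
  "(\<Prod>j\<in>keys (a + b). \<sigma> j ^ lookup (a + b) j) =
   (\<Prod>j\<in>keys a. \<sigma> j ^ lookup a j) * (\<Prod>j\<in>keys b. \<sigma> j ^ lookup b j)"
  for \<sigma> :: "_ \<Rightarrow> 'a::comm_semiring_1"
  using prod_power_superset[of "keys a \<union> keys b" a \<sigma>] prod_power_superset[of "keys a \<union> keys b" b \<sigma>]
  by (simp add: keys_add_nat lookup_add power_add prod.distrib)

lemma psubst_0 [simp]: "psubst \<sigma> 0 = 0"
  by (simp add: psubst_def)

lemma psubst_add: "psubst \<sigma> (p + q) = psubst \<sigma> p + psubst \<sigma> q"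
  unfolding psubst_def by (rule setsum_keys_plus_distrib) (auto simp: pconst_add distrib_right)

lemma psubst_single: "psubst \<sigma> (single m c) = pconst c * (\<Prod>j\<in>keys m. \<sigma> j ^ lookup m j)"
  by (cases "c = 0") (auto simp: psubst_def)

lemma psubst_pconst [simp]: "psubst \<sigma> (pconst c) = pconst c"
  using psubst_single[of \<sigma> 0 c] by (simp add: pconst_def)

lemma psubst_1 [simp]: "psubst \<sigma> 1 = 1"
  using psubst_pconst[of \<sigma> 1] by simp

lemma psubst_pvar [simp]: "psubst \<sigma> (pvar j) = \<sigma> j"
  by (simp add: pvar_def pmon_def psubst_single)

lemma psubst_mult: "psubst \<sigma> (p * q) = psubst \<sigma> p * psubst \<sigma> q"
proof (induction p rule: cpoly_induct)
  case (single m c)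
  show ?case
    by (induction q rule: cpoly_induct)
      (simp_all add: mult_single psubst_single prod_power_add pconst_mult mult_ac, simp add: algebra_simps psubst_add)
qed (auto simp: distrib_right psubst_add)

lemma psubst_uminus: "psubst \<sigma> (- p) = - psubst \<sigma> p"
  using psubst_add[of \<sigma> p "- p"] by (simp add: eq_neg_iff_add_eq_0 add.commute)

lemma psubst_diff: "psubst \<sigma> (p - q) = psubst \<sigma> p - psubst \<sigma> q"
  using psubst_add[of \<sigma> p "- q"] by (simp add: psubst_uminus)

lemma psubst_sum: "psubst \<sigma> (sum f X) = (\<Sum>x\<in>X. psubst \<sigma> (f x))"
  by (induction X rule: infinite_finite_induct) (auto simp: psubst_add)

lemma psubst_prod: "psubst \<sigma> (prod f X) = (\<Prod>x\<in>X. psubst \<sigma> (f x))"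
  by (induction X rule: infinite_finite_induct) (auto simp: psubst_mult)

lemma psubst_cscale: "psubst \<sigma> (cscale c p) = cscale c (psubst \<sigma> p)"
  by (simp add: cscale_def psubst_mult)

lemma psubst_id_on:
  assumes "p \<in> Polys V" "\<And>j. j \<in> V \<Longrightarrow> \<sigma> j = pvar j"
  shows "psubst \<sigma> p = p"
proof -
  have *: "(\<Prod>j\<in>X. pvar j ^ f j) = pmon (\<Sum>j\<in>X. single j (f j))" for X :: "'v set" and f
  proof -
    have "pvar j ^ k = pmon (single j k)" for j :: 'v and k
      by (induction k) (auto simp: pvar_def pmon_add[symmetric] single_add[symmetric] add.commute)
    then show ?thesis by (simp add: pmon_prod_single)
  qed
  have "(\<Prod>j\<in>keys m. \<sigma> j ^ lookup m j) = pmon m" if "m \<in> keys p" for m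
  proof -
    have "(\<Prod>j\<in>keys m. \<sigma> j ^ lookup m j) = (\<Prod>j\<in>keys m. pvar j ^ lookup m j)"
      using assms that by (intro prod.cong arg_cong[where f = "\<lambda>x. x ^ _"]) (auto simp: carrier_poly_ring)
    also have "\<dots> = pmon m"
      unfolding * by (rule arg_cong[where f = pmon], rule poly_mapping_eqI)
        (simp add: lookup_sum lookup_single when_def in_keys_iff sum.delta)
    finally show ?thesis .
  qed
  then have "psubst \<sigma> p = (\<Sum>m\<in>keys p. single m (lookup p m))"
    unfolding psubst_def by (intro sum.cong) (auto simp: single_eq_pconst_pmon)
  then show ?thesis using poly_sum_single[of p] by simp
qed

lemma psubst_in_Polys:
  assumes "\<And>j. \<sigma> j \<in> Polys V"
  shows "psubst \<sigma> p \<in> Polys V"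
  unfolding psubst_def by (intro Polys_intros Polys_pconst assms)

lemma homog_psubst:
  assumes "\<And>j. homog 1 (\<sigma> j)" "homog q p"
  shows "homog q (psubst \<sigma> p)"
  unfolding psubst_def
proof (rule homog_sum)
  fix m assume m: "m \<in> keys p"
  have "homog (0 + (\<Sum>j\<in>keys m. lookup m j * 1)) (pconst (lookup p m) * (\<Prod>j\<in>keys m. \<sigma> j ^ lookup m j))"
    by (intro homog_mult homog_pconst homog_prod homog_power assms) auto
  then show "homog q (pconst (lookup p m) * (\<Prod>j\<in>keys m. \<sigma> j ^ lookup m j))"
    using assms(2) m by (simp add: homog_def mdeg_def)
qed

section \<open>Dimension counts\<close>

text \<open>Rank-nullity for the map from \<open>U\<close> to the ambient space modulo
  \<open>Y\<close>, without forming the quotient. A basis \<open>B'\<close> of the preimage of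
  \<open>Y\<close> is extended to a basis \<open>B\<close> of \<open>U\<close>; the images of
  \<open>B - B'\<close> are independent modulo \<open>Y\<close>.\<close>

lemma (in vector_space) dim_preimage_sum:
  assumes f: "Vector_Spaces.linear scale scale f" and U: "subspace U" and Y: "subspace Y"
    and finU: "finite E" "U \<subseteq> span E" and finY: "finite E'" "Y \<subseteq> span E'"
  shows "dim {y + f u | y u. y \<in> Y \<and> u \<in> U} + dim {u \<in> U. f u \<in> Y} = dim Y + dim U"
proof -
  interpret f: Vector_Spaces.linear scale scale f by fact
  define U' where "U' = {u \<in> U. f u \<in> Y}"
  have U': "subspace U'" unfolding U'_def
    using U Y by (auto simp: subspace_def f.add f.scale)
  obtain B' where B': "B' \<subseteq> U'" "independent B'" "U' \<subseteq> span B'" "card B' = dim U'"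
    using basis_exists by blast
  then have "B' \<subseteq> U" by (auto simp: U'_def)
  then obtain B where B: "B' \<subseteq> B" "B \<subseteq> U" "independent B" "U \<subseteq> span B"
    using maximal_independent_subset_extend[of B' U] B' by blast
  obtain D where D: "D \<subseteq> Y" "independent D" "Y \<subseteq> span D" "card D = dim Y"
    using basis_exists by blast
  have finB: "finite B" and finD: "finite D"
    using independent_span_bound[of E B] independent_span_bound[of E' D] B D finU finY by auto
  have spB': "span B' = U'" and spD: "span D = Y" and spB: "span B = U"
    using span_minimal[OF B'(1) U'] span_minimal[OF D(1) Y] span_minimal[OF B(2) U] B' D B by auto
  \<comment> \<open>The cardinality belongs to the induction: it records that \<open>f\<close> is
    injective on \<open>C\<close> and that no image falls into \<open>D\<close>.\<close>
  have key: "independent (D \<union> f ` C) \<and> card (D \<union> f ` C) = card D + card C"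
    if "finite C" "C \<subseteq> B - B'" for C
    using that
  proof (induction C rule: finite_induct)
    case (insert c C)
    have "f c \<notin> span (D \<union> f ` C)"
    proof
      assume "f c \<in> span (D \<union> f ` C)"
      then obtain y z where yz: "f c = y + z" "y \<in> span D" "z \<in> span (f ` C)"
        unfolding span_Un by blast
      then obtain x where x: "x \<in> span C" "z = f x" using f.span_image by blast
      have "c - x \<in> U'"
      proof -
        have "C \<subseteq> U" using insert.prems B by auto
        then have "x \<in> U" using x span_minimal[OF _ U] by blast
        moreover have "c \<in> U" using insert.prems B by auto
        ultimately show ?thesis using yz x spD U by (simp add: U'_def f.diff subspace_diff)
      qed
      then have "c - x \<in> span (B - {c})"
        using spB' span_mono[of B' "B - {c}"] B(1) insert.prems by auto
      moreover have "x \<in> span (B - {c})"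
        using x span_mono[of C "B - {c}"] insert by auto
      ultimately have "c \<in> span (B - {c})" using span_add[of "c - x" "B - {c}" x] by simp
      then show False using B(3) insert.prems by (auto simp: dependent_def)
    qed
    moreover from this have "f c \<notin> D \<union> f ` C" using span_superset[of "D \<union> f ` C"] by auto
    ultimately show ?case
      using insert finD by (auto simp: independent_insertI)
  qed (use D in auto)
  have "dim {y + f u | y u. y \<in> Y \<and> u \<in> U} = card (D \<union> f ` (B - B'))"
  proof (rule dim_unique)
    show "D \<union> f ` (B - B') \<subseteq> {y + f u | y u. y \<in> Y \<and> u \<in> U}"
    proof
      fix x assume "x \<in> D \<union> f ` (B - B')"
      then consider "x \<in> D" | b where "x = f b" "b \<in> B" by blast
      then show "x \<in> {y + f u | y u. y \<in> Y \<and> u \<in> U}"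
      proof cases
        case 1
        then have "x = x + f 0" "x \<in> Y" using D by (auto simp: f.zero)
        then show ?thesis using subspace_0[OF U] by blast
      next
        case 2
        then have "x = 0 + f b" "b \<in> U" using B by auto
        then show ?thesis using subspace_0[OF Y] by blast
      qed
    qed
    show "{y + f u | y u. y \<in> Y \<and> u \<in> U} \<subseteq> span (D \<union> f ` (B - B'))"
    proof clarify
      fix y u assume y: "y \<in> Y" and u: "u \<in> U"
      have yy: "y \<in> span (D \<union> f ` (B - B'))"
        using y spD span_mono[of D "D \<union> f ` (B - B')"] by blast
      have "u \<in> span (B' \<union> (B - B'))" using u spB B(1) by (simp add: Un_absorb1)
      then obtain a c where ac: "u = a + c" "a \<in> span B'" "c \<in> span (B - B')"
        unfolding span_Un by blast
      have "f a \<in> span (D \<union> f ` (B - B'))"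
        using ac spB' spD span_mono[of D "D \<union> f ` (B - B')"] by (auto simp: U'_def)
      moreover have "f c \<in> span (D \<union> f ` (B - B'))"
        using ac f.span_image[of "B - B'"] span_mono[of "f ` (B - B')" "D \<union> f ` (B - B')"] by blast
      ultimately show "y + f u \<in> span (D \<union> f ` (B - B'))"
        using yy ac by (simp add: f.add span_add)
    qed
  qed (use key[of "B - B'"] finB in auto)
  also have "\<dots> = card D + card (B - B')" using key[of "B - B'"] finB by auto
  also have "card (B - B') = card B - card B'" using B(1) finB by (meson card_Diff_subset finite_subset)
  finally show ?thesis
    using B' D card_mono[OF finB B(1)] basis_card_eq_dim[of B U] B by (simp add: U'_def[symmetric])
qed

lemma (in vector_space) dim_image_kernel:
  assumes f: "Vector_Spaces.linear scale scale f" and U: "subspace U" and finU: "finite E" "U \<subseteq> span E"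
  shows "dim (f ` U) + dim {u \<in> U. f u = 0} = dim U"
proof -
  have "{y + f u | y u. y \<in> {0} \<and> u \<in> U} = f ` U" by auto
  moreover have "dim {0} = 0"
    using dim_le_card[of "{0}" "{}"] by simp
  ultimately show ?thesis
    using dim_preimage_sum[OF f U subspace_single_0 finU, of "{}"] by simp
qed

text \<open>The projections \<open>c q\<close> replace a direct sum. The subspaces whose components
  vanish from \<open>k\<close> on form a filtration, and \<open>c k\<close> maps stage
  \<open>k + 1\<close> onto degree \<open>k\<close> with kernel stage \<open>k\<close>.\<close>

lemma (in vector_space) dim_graded:
  assumes S: "subspace S" and c: "\<And>q::nat. Vector_Spaces.linear scale scale (c q)"
    and proj: "\<And>q p. p \<in> S \<Longrightarrow> c q p \<in> S" "\<And>q r p. c q (c r p) = (if q = r then c r p else 0)"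
    and sum: "\<And>p. p \<in> S \<Longrightarrow> p = (\<Sum>q\<le>N. c q p)"
    and fin: "finite E" "S \<subseteq> span E"
  shows "dim S = (\<Sum>q\<le>N. dim (c q ` S))"
proof -
  have c0: "c q 0 = 0" and cadd: "c q (x + y) = c q x + c q y" and cscale: "c q (scale r x) = scale r (c q x)"
    for q x y r
    using c[of q] by (auto simp: Vector_Spaces.linear_iff) (metis add_cancel_left_left)
  have "dim {p \<in> S. \<forall>q\<ge>k. q \<le> N \<longrightarrow> c q p = 0} = (\<Sum>q<k. dim (c q ` S))" if "k \<le> Suc N" for k
    using that
  proof (induction k)
    case 0
    have "{p \<in> S. \<forall>q\<ge>0. q \<le> N \<longrightarrow> c q p = 0} = {0}"
    proof (intro equalityI subsetI)
      fix p assume p: "p \<in> {p \<in> S. \<forall>q\<ge>0. q \<le> N \<longrightarrow> c q p = 0}"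
      then have "p = (\<Sum>q\<le>N. c q p)" using sum by blast
      also have "\<dots> = 0" using p by simp
      finally show "p \<in> {0}" by simp
    qed (auto simp: c0 subspace_0[OF S])
    then show ?case using dim_le_card[of "{0}" "{}"] by simp
  next
    case (Suc k)
    let ?S = "\<lambda>k. {p \<in> S. \<forall>q\<ge>k. q \<le> N \<longrightarrow> c q p = 0}"
    have sub: "subspace (?S k)" for k
      using S by (auto simp: subspace_def c0 cadd cscale)
    have im: "c k ` ?S (Suc k) = c k ` S"
    proof
      show "c k ` S \<subseteq> c k ` ?S (Suc k)"
      proof
        fix x assume "x \<in> c k ` S"
        then obtain p where "p \<in> S" "x = c k p" by blast
        then have "c k p \<in> ?S (Suc k)" "x = c k (c k p)" using proj by auto
        then show "x \<in> c k ` ?S (Suc k)" by blast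
      qed
    qed auto
    have eq: "(\<forall>q\<ge>k. q \<le> N \<longrightarrow> P q) \<longleftrightarrow> (\<forall>q\<ge>Suc k. q \<le> N \<longrightarrow> P q) \<and> P k" for P
      using Suc.prems by (metis Suc_leD Suc_le_mono le_antisym le_refl not_less_eq_eq)
    have "{p \<in> ?S (Suc k). c k p = 0} = ?S k"
      by (rule Set.set_eqI) (simp only: mem_Collect_eq eq conj_assoc)
    then show ?case
      using im dim_image_kernel[OF c[of k] sub[of "Suc k"] fin(1)] fin(2) Suc by fastforce
  qed
  from this[of "Suc N"] show ?thesis by (simp add: lessThan_Suc_atMost)
qed

lemma linear_cscaleI:
  "(\<And>p q. f (p + q) = f p + f q) \<Longrightarrow> (\<And>c p. f (cscale c p) = cscale c (f p)) \<Longrightarrow>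
   Vector_Spaces.linear cscale cscale (f :: 'v cpoly \<Rightarrow> 'u cpoly)"
  by (simp add: Vector_Spaces.linear_iff cpoly.vector_space_axioms)

lemma hcomp_cscale: "hcomp q (cscale c p) = cscale c (hcomp q p)"
  by (rule poly_mapping_eqI) (simp add: lookup_hcomp)

lemma linear_hcomp: "Vector_Spaces.linear cscale cscale (hcomp q)"
  by (rule linear_cscaleI) (auto simp: hcomp_add hcomp_cscale)

lemma finite_monoms: "finite V \<Longrightarrow> finite {m :: 'v \<Rightarrow>\<^sub>0 nat. keys m \<subseteq> V \<and> mdeg m = q}"
proof -
  assume V: "finite V"
  let ?M = "{m :: 'v \<Rightarrow>\<^sub>0 nat. keys m \<subseteq> V \<and> mdeg m = q}"
  have "lookup ` ?M \<subseteq> {f. \<forall>x. (x \<in> V \<longrightarrow> f x \<in> {..q}) \<and> (x \<notin> V \<longrightarrow> f x = 0)}"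
  proof clarify
    fix m :: "'v \<Rightarrow>\<^sub>0 nat" and x assume m: "keys m \<subseteq> V" "q = mdeg m"
    have "lookup m x \<le> (\<Sum>j\<in>keys m. lookup m j)" if "x \<in> keys m"
      using that by (intro member_le_sum) auto
    then show "(x \<in> V \<longrightarrow> lookup m x \<in> {..mdeg m}) \<and> (x \<notin> V \<longrightarrow> lookup m x = 0)"
      using m by (cases "x \<in> keys m") (auto simp: mdeg_def in_keys_iff)
  qed
  moreover have "finite {f. \<forall>x. (x \<in> V \<longrightarrow> f x \<in> {..q}) \<and> (x \<notin> V \<longrightarrow> f x = (0::nat))}"
    by (rule finite_set_of_finite_funs[OF V]) simp
  ultimately have "finite (lookup ` ?M)" by (rule finite_subset)
  then show ?thesis
    by (rule finite_imageD) (rule inj_onI, simp only: poly_mapping_eq_iff)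
qed

lemma graded_part_subspace: "cpoly.subspace S \<Longrightarrow> cpoly.subspace (graded_part S q)"
  unfolding cpoly.subspace_def by (auto simp: graded_part_def homog_add homog_cscale)

lemma graded_part_span:
  assumes "S \<subseteq> Polys V"
  shows "graded_part S q \<subseteq> cpoly.span (pmon ` {m. keys m \<subseteq> V \<and> mdeg m = q})"
proof
  fix p assume p: "p \<in> graded_part S q"
  have "(\<Sum>m\<in>keys p. cscale (lookup p m) (pmon m)) \<in> cpoly.span (pmon ` {m. keys m \<subseteq> V \<and> mdeg m = q})"
    using p assms by (intro cpoly.span_sum cpoly.span_scale cpoly.span_base)
      (auto simp: graded_part_def homog_def carrier_poly_ring)
  then show "p \<in> cpoly.span (pmon ` {m. keys m \<subseteq> V \<and> mdeg m = q})"
    using poly_sum_single[of p] by (simp add: cscale_def single_eq_pconst_pmon)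
qed

lemma graded_part_fin:
  fixes V :: "'n::finite set"
  shows "\<exists>E. finite E \<and> graded_part (Polys V) q \<subseteq> cpoly.span E"
  using graded_part_span[of "Polys V" V q] finite_monoms[of V q]
  by (intro exI[of _ "pmon ` {m. keys m \<subseteq> V \<and> mdeg m = q}"]) simp

lemma graded_part_mono: "S \<subseteq> S' \<Longrightarrow> graded_part S q \<subseteq> graded_part S' q"
  by (auto simp: graded_part_def)

lemma hcomp_image_graded:
  "(\<And>p q. p \<in> S \<Longrightarrow> hcomp q p \<in> S) \<Longrightarrow> hcomp q ` S = graded_part S q"
proof (intro equalityI subsetI)
  assume *: "\<And>p q. p \<in> S \<Longrightarrow> hcomp q p \<in> S"
  show "x \<in> graded_part S q" if "x \<in> hcomp q ` S" for x
    using that * homog_hcomp by (auto simp: graded_part_def)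
  show "x \<in> hcomp q ` S" if "x \<in> graded_part S q" for x
    using that hcomp_homog[of q x q] by (auto simp: graded_part_def image_iff intro!: bexI[of _ x])
qed

lemma hcomp_hcomp: "hcomp q (hcomp r p) = (if q = r then hcomp r p else 0)"
  by (rule hcomp_homog[OF homog_hcomp])

text \<open>The value of \<open>dim\<close> is informative only for finite dimensional spaces, so
  finiteness is proved along with the count; both rest on the absence of components above degree
  \<open>N\<close>.\<close>

lemma dim_eq_sum_graded:
  fixes S :: "'n::finite cpoly set"
  assumes S: "cpoly.subspace S" "homog_closed S" and N: "\<And>q. q > N \<Longrightarrow> graded_part S q \<subseteq> {0}"
  shows "fin_dim S" and "cpoly.dim S = (\<Sum>q\<le>N. cpoly.dim (graded_part S q))"
proof -
  have hc: "\<And>p q. p \<in> S \<Longrightarrow> hcomp q p \<in> S" using S(2) by (auto simp: homog_closed_def)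
  have sum: "p = (\<Sum>q\<le>N. hcomp q p)" if p: "p \<in> S" for p
  proof (rule sum_hcomp[symmetric], rule ccontr)
    fix m assume m: "m \<in> keys p" "\<not> mdeg m \<le> N"
    have "hcomp (mdeg m) p \<in> graded_part S (mdeg m)"
      using hc[OF p] homog_hcomp by (simp add: graded_part_def)
    with N[of "mdeg m"] m have "hcomp (mdeg m) p = 0" by auto
    then have "lookup (hcomp (mdeg m) p) m = 0" by simp
    then show False using m by (simp add: lookup_hcomp in_keys_iff)
  qed
  define E where "E = (\<Union>q\<le>N. pmon ` {m :: 'n \<Rightarrow>\<^sub>0 nat. keys m \<subseteq> UNIV \<and> mdeg m = q})"
  have E: "finite E" unfolding E_def using finite_monoms[of "UNIV :: 'n set"] by auto
  have SE: "S \<subseteq> cpoly.span E"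
  proof
    fix p assume p: "p \<in> S"
    have "hcomp q p \<in> cpoly.span E" if "q \<le> N" for q
    proof -
      have "hcomp q p \<in> graded_part (Polys UNIV) q" using homog_hcomp by (simp add: graded_part_def)
      then have "hcomp q p \<in> cpoly.span (pmon ` {m. keys m \<subseteq> UNIV \<and> mdeg m = q})"
        using graded_part_span by blast
      then show ?thesis using that
        by (rule_tac subsetD[OF cpoly.span_mono]) (auto simp: E_def)
    qed
    then have "(\<Sum>q\<le>N. hcomp q p) \<in> cpoly.span E" by (auto intro: cpoly.span_sum)
    with sum[OF p] show "p \<in> cpoly.span E" by simp
  qed
  show "fin_dim S" using E SE by (auto simp: fin_dim_def)
  show "cpoly.dim S = (\<Sum>q\<le>N. cpoly.dim (graded_part S q))"
    using cpoly.dim_graded[OF S(1) linear_hcomp hc hcomp_hcomp sum E SE]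
    by (simp add: hcomp_image_graded[OF hc])
qed

section \<open>Polynomial differential operators\<close>

definition mfact :: "('n::finite \<Rightarrow>\<^sub>0 nat) \<Rightarrow> complex" where
  "mfact m = (\<Prod>j\<in>UNIV. fact (lookup m j))"

lemma mfact_nonzero [simp]: "mfact m \<noteq> 0"
  by (simp add: mfact_def)

lemma falling_prod: "(\<Prod>i<a. of_nat (b + a) - of_nat i) = (fact (b + a) / fact b :: complex)"
proof (induction a)
  case (Suc a)
  have "(\<Prod>i<Suc a. of_nat (b + Suc a) - of_nat i) =
    (of_nat (b + Suc a) - of_nat 0) * (\<Prod>i<a. of_nat (b + Suc a) - of_nat (Suc i) :: complex)"
    by (rule prod.lessThan_Suc_shift)
  also have "(\<Prod>i<a. of_nat (b + Suc a) - of_nat (Suc i)) = (\<Prod>i<a. of_nat (b + a) - of_nat i :: complex)"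
    by (rule prod.cong) auto
  finally show ?case using Suc by simp
qed simp

lemma falling_prod_monomial:
  fixes k m :: "'n::finite \<Rightarrow>\<^sub>0 nat"
  shows "(\<Prod>j\<in>keys m. \<Prod>i<lookup m j. of_nat (lookup (k + m) j) - of_nat i) = mfact (k + m) / mfact k"
proof -
  have "(\<Prod>j\<in>keys m. \<Prod>i<lookup m j. of_nat (lookup (k + m) j) - of_nat i) =
    (\<Prod>j\<in>UNIV. \<Prod>i<lookup m j. of_nat (lookup (k + m) j) - of_nat i :: complex)"
    by (rule prod.mono_neutral_left) (auto simp: in_keys_iff)
  also have "\<dots> = (\<Prod>j\<in>UNIV. fact (lookup (k + m) j) / fact (lookup k j))"
    by (rule prod.cong[OF refl]) (simp only: lookup_add falling_prod)
  finally show ?thesis by (simp add: mfact_def prod_dividef)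
qed

text \<open>Only the exponent \<open>k + m\<close> of \<open>f\<close> can be differentiated down to
  \<open>k\<close>, and it brings the factor \<open>(k + m)! / k!\<close> in multi-index
  notation.\<close>

lemma lookup_pdiff:
  fixes f :: "'n::finite cpoly"
  shows "lookup (pdiff \<phi> f) k = (\<Sum>m\<in>keys \<phi>. lookup \<phi> m * lookup f (k + m) * (mfact (k + m) / mfact k))"
proof -
  let ?ff = "\<lambda>l m. \<Prod>j\<in>keys m. \<Prod>i<lookup m j. of_nat (lookup l j) - of_nat i :: complex"
  have *: "(lookup (single (l - m) (lookup \<phi> m * lookup f l * ?ff l m)) k) =
     (if l = k + m then lookup \<phi> m * lookup f (k + m) * (mfact (k + m) / mfact k) else 0)" for l m
  proof (cases "\<forall>j. lookup m j \<le> lookup l j")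
    case True
    then have "l - m = k \<longleftrightarrow> l = k + m"
      by (auto simp: poly_mapping_eq_iff fun_eq_iff lookup_add lookup_minus)
        (metis le_add_diff_inverse2)
    then show ?thesis by (auto simp: lookup_single when_def falling_prod_monomial)
  next
    case False
    \<comment> \<open>Here \<open>l - m\<close> is truncated and says nothing; the term vanishes
      because the falling factorial at \<open>j\<close> contains the factor with
      \<open>i = lookup l j\<close>.\<close>
    then obtain j where j: "lookup l j < lookup m j" by (auto simp: not_le)
    then have "j \<in> keys m" by (auto simp: in_keys_iff)
    with j have "?ff l m = 0" by (intro prod_zero) (auto intro!: bexI[of _ j])
    moreover have "l \<noteq> k + m" using j by (auto simp: lookup_add)
    ultimately show ?thesis by (simp only: single_zero mult_zero_right lookup_zero if_False)
  qed
  have "lookup (pdiff \<phi> f) k = (\<Sum>m\<in>keys \<phi>. \<Sum>l\<in>keys f.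
     (if l = k + m then lookup \<phi> m * lookup f (k + m) * (mfact (k + m) / mfact k) else 0))"
    unfolding pdiff_def lookup_sum * ..
  also have "\<dots> = (\<Sum>m\<in>keys \<phi>. lookup \<phi> m * lookup f (k + m) * (mfact (k + m) / mfact k))"
    by (rule sum.cong[OF refl]) (auto simp: in_keys_iff sum.delta)
  finally show ?thesis .
qed

lemma pdiff_add_left: "pdiff (\<phi> + \<psi>) f = pdiff \<phi> f + pdiff \<psi> f" for f :: "'n::finite cpoly"
  by (rule poly_mapping_eqI, unfold lookup_pdiff lookup_add[of "pdiff _ _"])
    (rule setsum_keys_plus_distrib, auto simp: algebra_simps)

lemma pdiff_add_right: "pdiff \<phi> (f + g) = pdiff \<phi> f + pdiff \<phi> g" for f :: "'n::finite cpoly"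
  by (rule poly_mapping_eqI) (simp add: lookup_pdiff lookup_add sum.distrib distrib_left distrib_right add_divide_distrib)

lemma pdiff_0_left [simp]: "pdiff 0 f = 0"
  by (simp add: pdiff_def)

lemma pdiff_0_right [simp]: "pdiff \<phi> 0 = 0"
  by (simp add: pdiff_def)

lemma lookup_pdiff_single:
  "lookup (pdiff (single m c) f) k = c * lookup f (k + m) * (mfact (k + m) / mfact k)"
  for f :: "'n::finite cpoly"
  by (cases "c = 0") (auto simp: lookup_pdiff)

text \<open>On monomials the factorial quotients telescope. Polynomials thus form a module over the
  commutative ring of constant-coefficient operators, where all later operator identities are
  computed.\<close>

lemma pdiff_mult: "pdiff (\<phi> * \<psi>) f = pdiff \<phi> (pdiff \<psi> f)" for f :: "'n::finite cpoly"
proof (induction \<phi> rule: cpoly_induct)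
  case (single m c)
  show ?case
  proof (induction \<psi> rule: cpoly_induct)
    case (single m' c')
    show ?case
      by (rule poly_mapping_eqI) (simp add: mult_single lookup_pdiff_single add.assoc)
  qed (auto simp: distrib_left pdiff_add_left pdiff_add_right)
qed (auto simp: distrib_right pdiff_add_left)

lemma pdiff_commute: "pdiff \<phi> (pdiff \<psi> f) = pdiff \<psi> (pdiff \<phi> f)" for f :: "'n::finite cpoly"
  by (metis pdiff_mult mult.commute)

lemma pdiff_pconst: "pdiff (pconst c) f = cscale c f" for f :: "'n::finite cpoly"
  by (rule poly_mapping_eqI) (simp add: pconst_def lookup_pdiff_single)

lemma pdiff_1 [simp]: "pdiff 1 f = f" for f :: "'n::finite cpoly"
  using pdiff_pconst[of 1 f] by (simp add: cpoly.scale_one)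

lemma pdiff_uminus_left: "pdiff (- \<phi>) f = - pdiff \<phi> f" for f :: "'n::finite cpoly"
  by (rule sym) (simp only: neg_eq_iff_add_eq_0 pdiff_add_left[symmetric] right_minus pdiff_0_left)

lemma pdiff_uminus_right: "pdiff \<phi> (- f) = - pdiff \<phi> f" for f :: "'n::finite cpoly"
  by (rule sym) (simp only: neg_eq_iff_add_eq_0 pdiff_add_right[symmetric] right_minus pdiff_0_right)

lemma pdiff_diff_left: "pdiff (\<phi> - \<psi>) f = pdiff \<phi> f - pdiff \<psi> f" for f :: "'n::finite cpoly"
  using pdiff_add_left[of \<phi> "- \<psi>" f] by (simp add: pdiff_uminus_left)

lemma pdiff_diff_right: "pdiff \<phi> (f - g) = pdiff \<phi> f - pdiff \<phi> g" for f :: "'n::finite cpoly"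
  using pdiff_add_right[of \<phi> f "- g"] by (simp add: pdiff_uminus_right)

lemma pdiff_sum_left: "pdiff (sum h X) f = (\<Sum>x\<in>X. pdiff (h x) f)" for f :: "'n::finite cpoly"
  by (induction X rule: infinite_finite_induct) (auto simp: pdiff_add_left)

lemma pdiff_sum_right: "pdiff \<phi> (sum h X) = (\<Sum>x\<in>X. pdiff \<phi> (h x))" for h :: "_ \<Rightarrow> 'n::finite cpoly"
  by (induction X rule: infinite_finite_induct) (auto simp: pdiff_add_right)

lemma pdiff_cscale_left: "pdiff (cscale c \<phi>) f = cscale c (pdiff \<phi> f)" for f :: "'n::finite cpoly"
  by (simp add: cscale_def pdiff_mult pdiff_pconst[unfolded cscale_def])

lemma pdiff_cscale_right: "pdiff \<phi> (cscale c f) = cscale c (pdiff \<phi> f)" for f :: "'n::finite cpoly"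
  by (metis pdiff_pconst pdiff_commute)

lemma keys_pdiff_bound:
  fixes f :: "'n::finite cpoly"
  assumes "\<forall>m\<in>keys f. mdeg m \<le> N"
  shows "\<forall>m\<in>keys (pdiff \<phi> f). mdeg m \<le> N"
proof
  fix k assume "k \<in> keys (pdiff \<phi> f)"
  then have "(\<Sum>m\<in>keys \<phi>. lookup \<phi> m * lookup f (k + m) * (mfact (k + m) / mfact k)) \<noteq> 0"
    by (simp add: in_keys_iff lookup_pdiff)
  then obtain m where "lookup f (k + m) \<noteq> 0"
    by (metis (no_types, lifting) mult_eq_0_iff sum.neutral)
  then have "mdeg (k + m) \<le> N" using assms by (simp add: in_keys_iff)
  then show "mdeg k \<le> N" by (simp add: mdeg_add)
qed

text \<open>Each derivative lowers the degree, so \<open>Suc N\<close> of them kill degree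
  \<open>N\<close>. This local nilpotency later inverts operators with nonzero constant
  term.\<close>

lemma pdiff_power_eq_0:
  fixes f :: "'n::finite cpoly"
  assumes "\<forall>m\<in>keys f. mdeg m \<le> N"
  shows "pdiff (pvar j ^ Suc N) f = 0"
proof (rule poly_mapping_eqI)
  have "pvar j ^ k = single (single j k) 1" for k
    by (induction k) (auto simp: pvar_def pmon_def mult_single single_add[symmetric] add.commute)
  moreover have "lookup f (k + single j (Suc N)) = 0" for k
  proof (rule ccontr)
    assume "lookup f (k + single j (Suc N)) \<noteq> 0"
    then have "mdeg (k + single j (Suc N)) \<le> N" using assms by (simp add: in_keys_iff)
    then show False by (simp add: mdeg_add)
  qed
  ultimately show "lookup (pdiff (pvar j ^ Suc N) f) k = lookup 0 k" for k
    by (simp only: lookup_pdiff_single) simp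
qed

section \<open>Duality between an ideal and its solution space\<close>

text \<open>The apolarity pairing; on monomials it is diagonal with entries
  \<open>mfact\<close>.\<close>

definition apair :: "'n::finite cpoly \<Rightarrow> 'n cpoly \<Rightarrow> complex" where
  "apair \<phi> f = lookup (pdiff \<phi> f) 0"

interpretation cfun: vector_space_pair cscale "(*) :: complex \<Rightarrow> complex \<Rightarrow> complex"
  by unfold_locales (auto simp: algebra_simps)

lemma apair_add_left: "apair (\<phi> + \<psi>) f = apair \<phi> f + apair \<psi> f"
  and apair_add_right: "apair \<phi> (f + g) = apair \<phi> f + apair \<phi> g"
  and apair_diff_right: "apair \<phi> (f - g) = apair \<phi> f - apair \<phi> g"
  and apair_cscale_left: "apair (cscale c \<phi>) f = c * apair \<phi> f"
  and apair_cscale_right: "apair \<phi> (cscale c f) = c * apair \<phi> f"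
  and apair_0 [simp]: "apair 0 f = 0" "apair \<phi> 0 = 0"
  by (simp_all add: apair_def pdiff_add_left pdiff_add_right lookup_add pdiff_diff_right lookup_minus
      pdiff_cscale_left pdiff_cscale_right)

lemma apair_sum_left: "apair (sum h X) f = (\<Sum>x\<in>X. apair (h x) f)"
  by (induction X rule: infinite_finite_induct) (auto simp: apair_add_left)

lemma apair_sum_right: "apair \<phi> (sum h X) = (\<Sum>x\<in>X. apair \<phi> (h x))"
  by (induction X rule: infinite_finite_induct) (auto simp: apair_add_right)

lemma apair_pmon: "apair (pmon m) f = lookup f m * mfact m"
  by (simp add: apair_def pmon_def lookup_pdiff_single mfact_def)

text \<open>Pairing with all monomial multiples of \<phi> recovers every coefficient of
  \<open>pdiff \<phi> f\<close>, so the solution space of an ideal is its annihilator under the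
  pairing.\<close>

lemma lookup_pdiff_apair: "lookup (pdiff \<phi> f) k * mfact k = apair (pmon k * \<phi>) f"
  by (simp add: pdiff_mult apair_def) (simp add: pmon_def lookup_pdiff_single mfact_def)

text \<open>The pairing is perfect in each degree. A basis \<open>B'\<close> of \<open>W\<close> is
  extended to a basis \<open>B\<close> of the whole degree, \<open>D\<close> is the dual basis under
  the pairing, and the annihilator of \<open>W\<close> has the basis \<open>D b\<close> for
  \<open>b\<close> outside \<open>B'\<close>.\<close>

lemma dim_annihilator:
  fixes W :: "'n::finite cpoly set"
  assumes W: "cpoly.subspace W" "W \<subseteq> graded_part (Polys UNIV) q"
  shows "cpoly.dim {f \<in> graded_part (Polys UNIV) q. \<forall>\<phi>\<in>W. apair \<phi> f = 0} + cpoly.dim W =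
    cpoly.dim (graded_part (Polys (UNIV :: 'n set)) q)"
proof -
  define T where "T = graded_part (Polys (UNIV :: 'n set)) q"
  define X where "X = {m :: 'n \<Rightarrow>\<^sub>0 nat. mdeg m = q}"
  have finX: "finite X" using finite_monoms[of "UNIV :: 'n set" q] by (simp add: X_def)
  have T: "cpoly.subspace T" unfolding T_def by (intro graded_part_subspace Polys_subspace)
  have T_exp: "\<phi> = (\<Sum>m\<in>X. cscale (lookup \<phi> m) (pmon m))" if "\<phi> \<in> T" for \<phi>
  proof -
    have "(\<Sum>m\<in>keys \<phi>. cscale (lookup \<phi> m) (pmon m)) = (\<Sum>m\<in>X. cscale (lookup \<phi> m) (pmon m))"
      using that finX by (intro sum.mono_neutral_left) (auto simp: T_def graded_part_def homog_def X_def in_keys_iff)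
    then show ?thesis using poly_sum_single[of \<phi>] by (simp add: cscale_def single_eq_pconst_pmon)
  qed
  obtain E where E: "finite E" "T \<subseteq> cpoly.span E"
    unfolding T_def using graded_part_fin[of "UNIV :: 'n set" q] by blast
  obtain B' where B': "B' \<subseteq> W" "cpoly.independent B'" "W \<subseteq> cpoly.span B'" "card B' = cpoly.dim W"
    using cpoly.basis_exists by blast
  then have "B' \<subseteq> T" using W by (auto simp: T_def)
  then obtain B where B: "B' \<subseteq> B" "B \<subseteq> T" "cpoly.independent B" "T \<subseteq> cpoly.span B"
    using cpoly.maximal_independent_subset_extend[of B' T] B' by blast
  have finB: "finite B" using cpoly.independent_span_bound[of E B] B E by auto
  have "\<forall>b\<in>B. \<exists>l. Vector_Spaces.linear cscale (*) l \<and> (\<forall>x\<in>B. l x = (if x = b then 1 else 0))"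
    by (intro ballI cfun.linear_independent_extend[OF B(3)])
  then obtain l where l: "\<And>b. b \<in> B \<Longrightarrow> Vector_Spaces.linear cscale (*) (l b)"
    "\<And>b x. b \<in> B \<Longrightarrow> x \<in> B \<Longrightarrow> l b x = (if x = b then 1 else 0 :: complex)"
    by metis
  \<comment> \<open>The coordinate functional \<open>l b\<close> is represented by a polynomial;
    dividing by \<open>mfact\<close> undoes the weights of the pairing.\<close>
  define D where "D b = (\<Sum>m\<in>X. single m (l b (pmon m) / mfact m))" for b
  have DT: "D b \<in> T" for b
    unfolding D_def T_def graded_part_def by (auto intro!: homog_sum simp: X_def intro: homog_single)
  have lD: "lookup (D b) m = l b (pmon m) / mfact m" if "m \<in> X" for b m
    using that finX by (auto simp: D_def lookup_sum lookup_single when_def)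
  have pD: "apair \<phi> (D b) = l b \<phi>" if "\<phi> \<in> T" "b \<in> B" for \<phi> b
  proof -
    interpret lb: Vector_Spaces.linear cscale "(*)" "l b" using l that by blast
    have "apair \<phi> (D b) = (\<Sum>m\<in>X. lookup \<phi> m * l b (pmon m))"
      by (subst T_exp[OF that(1)]) (simp add: apair_sum_left apair_cscale_left apair_pmon lD)
    also have "\<dots> = l b \<phi>"
      by (subst (2) T_exp[OF that(1)]) (simp add: lb.sum lb.scale)
    finally show ?thesis .
  qed
  have pDB: "apair b' (D b) = (if b' = b then 1 else 0)" if "b \<in> B" "b' \<in> B" for b b'
    using that pD l B by auto
  have injD: "inj_on D B"
    by (rule inj_onI) (metis pDB zero_neq_one)
  have exp: "f = (\<Sum>b\<in>B. cscale (apair b f) (D b))" if f: "f \<in> T" for f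
  proof -
    define g where "g = f - (\<Sum>b\<in>B. cscale (apair b f) (D b))"
    have gT: "g \<in> T" unfolding g_def
      using f DT by (intro cpoly.subspace_diff[OF T] cpoly.subspace_sum[OF T] cpoly.subspace_scale[OF T])
    have "apair b g = 0" if "b \<in> B" for b
      using that finB by (simp add: g_def apair_diff_right apair_sum_right apair_cscale_right pDB if_distrib sum.delta cong: if_cong)
    moreover have "cpoly.subspace {\<phi>. apair \<phi> g = 0}"
      by (auto simp: cpoly.subspace_def apair_add_left apair_cscale_left)
    ultimately have "cpoly.span B \<subseteq> {\<phi>. apair \<phi> g = 0}"
      by (intro cpoly.span_minimal) auto
    then have *: "apair \<phi> g = 0" if "\<phi> \<in> T" for \<phi> using that B by auto
    have "g = 0"
    proof (rule poly_mapping_eqI)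
      fix m
      show "lookup g m = lookup 0 m"
      proof (cases "mdeg m = q")
        case True
        then have "pmon m \<in> T" by (simp add: T_def graded_part_def homog_def)
        then have "apair (pmon m) g = 0" by (rule *)
        then show ?thesis by (simp add: apair_pmon)
      next
        case False
        then show ?thesis using gT by (auto simp: T_def graded_part_def homog_def in_keys_iff)
      qed
    qed
    then show ?thesis by (simp add: g_def)
  qed
  have ind: "cpoly.independent (D ` (B - B'))"
  proof (rule cpoly.independent_if_scalars_zero)
    fix c x assume s: "(\<Sum>x\<in>D ` (B - B'). cscale (c x) x) = 0" and x: "x \<in> D ` (B - B')"
    then obtain b where b: "b \<in> B - B'" "x = D b" by blast
    have "inj_on D (B - B')" using injD by (rule inj_on_subset) auto
    then have "(\<Sum>y\<in>B - B'. cscale (c (D y)) (D y)) = 0" using s by (simp add: sum.reindex)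
    then have "apair b (\<Sum>y\<in>B - B'. cscale (c (D y)) (D y)) = 0" by simp
    moreover have "apair b (\<Sum>y\<in>B - B'. cscale (c (D y)) (D y)) = (\<Sum>y\<in>B - B'. if y = b then c (D y) else 0)"
      unfolding apair_sum_right apair_cscale_right using b by (intro sum.cong) (auto simp: pDB)
    ultimately show "c x = 0" using b finB by (simp add: sum.delta)
  qed (use finB in auto)
  have "cpoly.dim {f \<in> T. \<forall>\<phi>\<in>W. apair \<phi> f = 0} = card (D ` (B - B'))"
  proof (rule cpoly.dim_unique[OF _ _ ind refl])
    show "D ` (B - B') \<subseteq> {f \<in> T. \<forall>\<phi>\<in>W. apair \<phi> f = 0}"
    proof clarify
      fix b assume b: "b \<in> B" "b \<notin> B'"
      have "cpoly.subspace {\<phi>. apair \<phi> (D b) = 0}"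
        by (auto simp: cpoly.subspace_def apair_add_left apair_cscale_left)
      moreover have "B' \<subseteq> {\<phi>. apair \<phi> (D b) = 0}" using b B pDB by auto
      ultimately have "W \<subseteq> {\<phi>. apair \<phi> (D b) = 0}" using B'(3) cpoly.span_minimal by blast
      then show "D b \<in> T \<and> (\<forall>\<phi>\<in>W. apair \<phi> (D b) = 0)" using DT by blast
    qed
    show "{f \<in> T. \<forall>\<phi>\<in>W. apair \<phi> f = 0} \<subseteq> cpoly.span (D ` (B - B'))"
    proof clarify
      fix f assume f: "f \<in> T" "\<forall>\<phi>\<in>W. apair \<phi> f = 0"
      have "f = (\<Sum>b\<in>B. cscale (apair b f) (D b))" by (rule exp[OF f(1)])
      also have "\<dots> = (\<Sum>b\<in>B - B'. cscale (apair b f) (D b))"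
        using finB f(2) B'(1) by (intro sum.mono_neutral_right) auto
      finally show "f \<in> cpoly.span (D ` (B - B'))"
        by (elim ssubst) (intro cpoly.span_sum cpoly.span_scale cpoly.span_base imageI)
    qed
  qed
  also have "\<dots> = card (B - B')" using card_image[OF inj_on_subset[OF injD, of "B - B'"]] by auto
  also have "\<dots> = card B - card B'" using B(1) finB by (meson card_Diff_subset finite_subset)
  finally show ?thesis
    using B' card_mono[OF finB B(1)] cpoly.basis_card_eq_dim[of B T] B by (simp add: T_def)
qed

section \<open>Koszul complexes\<close>

text \<open>The sign of moving \<open>j\<close> past the smaller elements of \<open>U\<close> in an
  exterior product.\<close>

definition ksgn :: "nat \<Rightarrow> nat set \<Rightarrow> 'a::comm_ring_1" where
  "ksgn j U = (- 1) ^ card {i \<in> U. i < j}"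

text \<open>A chain is a function on index sets, its value at \<open>U\<close> being the coefficient
  of the basis element of \<open>U\<close>. The Koszul differential lowers the degree, so its value
  at \<open>U\<close> collects the values at sets with one more element.\<close>

definition kdiff :: "nat \<Rightarrow> (nat \<Rightarrow> 'a::comm_ring_1) \<Rightarrow> (nat set \<Rightarrow> 'a) \<Rightarrow> nat set \<Rightarrow> 'a" where
  "kdiff r l f U = (\<Sum>j\<in>{..<r} - U. ksgn j U * l j * f (insert j U))"

text \<open>Exterior multiplication by the basis element of index \<open>j\<close>.\<close>

definition kext :: "nat \<Rightarrow> (nat set \<Rightarrow> 'a::comm_ring_1) \<Rightarrow> nat set \<Rightarrow> 'a" where
  "kext j f U = (if j \<in> U then ksgn j U * f (U - {j}) else 0)"

lemma ksgn_square [simp]: "ksgn j U * ksgn j U = 1"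
  by (simp add: ksgn_def power_mult_distrib[symmetric])

lemma ksgn_insert:
  assumes "finite U" "k \<notin> U"
  shows "ksgn j (insert k U) = (if k < j then - ksgn j U else ksgn j U)"
proof (cases "k < j")
  case True
  then have "{i \<in> insert k U. i < j} = insert k {i \<in> U. i < j}" by auto
  then show ?thesis using assms True by (simp add: ksgn_def)
next
  case False
  then have "{i \<in> insert k U. i < j} = {i \<in> U. i < j}" by auto
  then show ?thesis using False by (simp add: ksgn_def)
qed

lemma ksgn_insert_self: "ksgn j (insert j U) = ksgn j U"
  unfolding ksgn_def by (rule arg_cong[where f = "\<lambda>X. (- 1) ^ card X"]) auto

lemma kdiff_diff: "kdiff r l (\<lambda>U. f U - g U) U = kdiff r l f U - kdiff r l g U"
  by (simp add: kdiff_def right_diff_distrib sum_subtractf)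

lemma kdiff_scale: "kdiff r l (\<lambda>U. c * f U) U = c * kdiff r l f U"
  by (simp add: kdiff_def sum_distrib_left mult_ac)

lemma kdiff_sum: "kdiff r l (\<lambda>U. \<Sum>x\<in>X. f x U) U = (\<Sum>x\<in>X. kdiff r l (f x) U)"
  unfolding kdiff_def sum_distrib_left by (rule sum.swap)

lemma self_eq_uminus_cpoly: "(S :: 'v cpoly) = - S \<Longrightarrow> S = 0"
proof (rule poly_mapping_eqI)
  fix k assume "S = - S"
  then have "lookup S k = - lookup S k" by (metis lookup_uminus)
  then show "lookup S k = lookup 0 k" by simp
qed

text \<open>Adding \<open>j\<close> and then \<open>k\<close> has the opposite sign of adding
  \<open>k\<close> and then \<open>j\<close>, so the double sum equals its own negative.\<close>

lemma kdiff_kdiff: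
  fixes f :: "nat set \<Rightarrow> 'v cpoly"
  assumes U: "finite U"
  shows "kdiff r l (kdiff r l f) U = 0"
proof -
  define X where "X = {..<r} - U"
  define t where "t j k = (if j = k then 0 else ksgn j U * l j * (ksgn k (insert j U) * l k * f (insert k (insert j U))))" for j k
  have eq: "kdiff r l (kdiff r l f) U = (\<Sum>j\<in>X. \<Sum>k\<in>X. t j k)"
  proof -
    have "(\<Sum>k\<in>{..<r} - insert j U. ksgn j U * l j * (ksgn k (insert j U) * l k * f (insert k (insert j U)))) =
      (\<Sum>k\<in>X. t j k)" if "j \<in> X" for j
      using that by (intro sum.mono_neutral_cong_left) (auto simp: X_def t_def)
    then show ?thesis unfolding kdiff_def sum_distrib_left X_def[symmetric] by (rule sum.cong[OF refl])
  qed
  have anti: "t j k = - t k j" if "j \<in> X" "k \<in> X" for j k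
    using that U by (cases j k rule: linorder_cases) (auto simp: t_def X_def ksgn_insert insert_commute mult_ac)
  have "(\<Sum>j\<in>X. \<Sum>k\<in>X. t j k) = (\<Sum>k\<in>X. \<Sum>j\<in>X. t j k)" by (rule sum.swap)
  also have "\<dots> = (\<Sum>k\<in>X. \<Sum>j\<in>X. - t k j)"
    by (intro sum.cong refl anti)
  finally have "(\<Sum>j\<in>X. \<Sum>k\<in>X. t j k) = - (\<Sum>j\<in>X. \<Sum>k\<in>X. t j k)" by (simp add: sum_negf)
  then show ?thesis using eq self_eq_uminus_cpoly by metis
qed

text \<open>Multiplication by \<open>l j\<close> is null-homotopic; hence the ideal generated by the \<open>l j\<close> annihilates
  Koszul homology.\<close>

lemma kext_homotopy:
  assumes j: "j < r" and U: "U \<subseteq> {..<r}"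
  shows "kdiff r l (kext j f) U + kext j (kdiff r l f) U = l j * f U"
proof (cases "j \<in> U")
  case False
  have finU: "finite U" using U finite_subset by blast
  have "kdiff r l (kext j f) U = (\<Sum>k\<in>{..<r} - U. if k = j then l j * f U else 0)"
    unfolding kdiff_def
  proof (rule sum.cong[OF refl])
    fix k assume "k \<in> {..<r} - U"
    have "ksgn j U * l j * (ksgn j U * f U) = (ksgn j U * ksgn j U) * (l j * f U)" by (simp add: mult_ac)
    then show "ksgn k U * l k * kext j f (insert k U) = (if k = j then l j * f U else 0)"
      using False by (auto simp: kext_def ksgn_insert_self)
  qed
  then show ?thesis using False j by (simp add: kext_def)
next
  case True
  define W where "W = U - {j}"
  have finW: "finite W" using U finite_subset by (auto simp: W_def)
  have UW: "U = insert j W" "j \<notin> W" using True by (auto simp: W_def)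
  have "kdiff r l (kext j f) U = (\<Sum>k\<in>{..<r} - U. - (ksgn j W * (ksgn k W * l k * f (insert k W))))"
    unfolding kdiff_def
  proof (rule sum.cong[OF refl])
    fix k assume k: "k \<in> {..<r} - U"
    then have "k \<noteq> j" "k \<notin> W" using UW by auto
    then have "insert k U - {j} = insert k W" using UW by auto
    \<comment> \<open>Inserting \<open>k\<close> and removing \<open>j\<close> anticommute in sign;
      this is the cancellation behind the homotopy.\<close>
    moreover have "ksgn k U * ksgn j (insert k U) = - (ksgn k W * ksgn j W :: 'a)"
      unfolding UW(1) using \<open>k \<noteq> j\<close> \<open>k \<notin> W\<close> UW(2) finW
      by (cases k j rule: linorder_cases) (auto simp: ksgn_insert ksgn_insert_self insert_commute[of k j])
    ultimately show "ksgn k U * l k * kext j f (insert k U) = - (ksgn j W * (ksgn k W * l k * f (insert k W)))"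
      using True by (simp add: kext_def) (metis (no_types, lifting) mult.assoc mult.commute mult_minus_left)
  qed
  moreover have "kext j (kdiff r l f) U =
    (\<Sum>k\<in>{..<r} - U. ksgn j W * (ksgn k W * l k * f (insert k W))) + l j * f U"
  proof -
    have "{..<r} - W = insert j ({..<r} - U)" using UW j by auto
    then have "kdiff r l f W = (\<Sum>k\<in>insert j ({..<r} - U). ksgn k W * l k * f (insert k W))"
      by (simp only: kdiff_def)
    also have "\<dots> = ksgn j W * l j * f (insert j W) + (\<Sum>k\<in>{..<r} - U. ksgn k W * l k * f (insert k W))"
      using True by (subst sum.insert) auto
    finally have "kdiff r l f W = ksgn j W * l j * f U + (\<Sum>k\<in>{..<r} - U. ksgn k W * l k * f (insert k W))"
      by (simp only: UW(1)[symmetric])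
    moreover have "ksgn j U = (ksgn j W :: 'a)" by (simp add: UW(1) ksgn_insert_self)
    moreover have "ksgn j W * (ksgn j W * l j * f U) = (ksgn j W * ksgn j W) * (l j * f U)" by (simp add: mult_ac)
    ultimately show ?thesis
      using True by (simp add: kext_def W_def[symmetric] distrib_left sum_distrib_left)
  qed
  ultimately show ?thesis by (simp add: sum_negf)
qed

lemma ksgn_Polys: "ksgn j U \<in> Polys V"
  unfolding ksgn_def by (intro Polys_power Polys_uminus Polys_1)

lemma kdiff_Polys: "(\<And>j. j < r \<Longrightarrow> l j \<in> Polys V) \<Longrightarrow> (\<And>U. f U \<in> Polys V) \<Longrightarrow> kdiff r l f U \<in> Polys V"
  unfolding kdiff_def by (intro Polys_sum Polys_mult ksgn_Polys) auto

lemma kext_Polys: "(\<And>U. f U \<in> Polys V) \<Longrightarrow> kext j f U \<in> Polys V"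
  unfolding kext_def by (auto intro: Polys_mult ksgn_Polys)

text \<open>Vanishing of Koszul homology over the quotient by \<open>J\<close>, kept on
  representatives: cycles and boundaries are tested modulo \<open>J\<close>. The degree of a chain
  is the size of its index sets; for \<open>i = 0\<close> every chain is a cycle.\<close>

definition kexact :: "'v set \<Rightarrow> nat \<Rightarrow> (nat \<Rightarrow> 'v cpoly) \<Rightarrow> 'v cpoly set \<Rightarrow> nat \<Rightarrow> bool" where
  "kexact V r l J i \<longleftrightarrow> (\<forall>f. (\<forall>U. f U \<in> Polys V) \<and>
     (\<forall>U\<subseteq>{..<r}. Suc (card U) = i \<longrightarrow> kdiff r l f U \<in> J) \<longrightarrow>
     (\<exists>g. (\<forall>U. g U \<in> Polys V) \<and> (\<forall>U\<subseteq>{..<r}. card U = i \<longrightarrow> f U - kdiff r l g U \<in> J)))"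

lemma kdiff_mem:
  assumes J: "ideal J (poly_ring V)" and l: "\<And>j. j < r \<Longrightarrow> l j \<in> Polys V"
    and h: "\<And>W. W \<subseteq> {..<r} \<Longrightarrow> card W = Suc (card U) \<Longrightarrow> h W \<in> J" and U: "U \<subseteq> {..<r}"
  shows "kdiff r l h U \<in> J"
proof -
  have "finite U" using U finite_subset by blast
  then show ?thesis unfolding kdiff_def
    using U by (intro ideal_sum[OF J] ideal_mult[OF J] Polys_mult ksgn_Polys l h) auto
qed

lemma Idl_Un_repr:
  fixes r :: nat
  assumes J: "ideal J (poly_ring V)" and l: "\<And>j. j < r \<Longrightarrow> l j \<in> Polys V"
  shows "Idl\<^bsub>poly_ring V\<^esub> (J \<union> l ` {..<r}) = {a + (\<Sum>j<r. c j * l j) | a c. a \<in> J \<and> (\<forall>j. c j \<in> Polys V)}"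
    (is "?L = ?R")
proof
  have sub: "J \<union> l ` {..<r} \<subseteq> Polys V" using ideal_sub[OF J] l by auto
  show "?L \<subseteq> ?R"
  proof (rule Idl_least)
    show "ideal ?R (poly_ring V)"
      unfolding poly_ideal_iff
    proof (intro conjI ballI subsetI)
      show "x \<in> Polys V" if "x \<in> ?R" for x
        using that l ideal_sub[OF J] by (auto intro!: Polys_add Polys_mult Polys_sum)
      show "0 \<in> ?R" using ideal_0[OF J] by (intro CollectI exI[of _ 0] exI[of _ "\<lambda>_. 0"]) auto
    next
      fix a b assume "a \<in> ?R" "b \<in> ?R"
      then obtain a' c b' d where "a = a' + (\<Sum>j<r. c j * l j)" "b = b' + (\<Sum>j<r. d j * l j)"
        "a' \<in> J" "b' \<in> J" "\<forall>j. c j \<in> Polys V" "\<forall>j. d j \<in> Polys V"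
        by blast
      moreover from this have "a + b = (a' + b') + (\<Sum>j<r. (c j + d j) * l j)"
        by (simp add: algebra_simps sum.distrib)
      ultimately show "a + b \<in> ?R"
        by (intro CollectI exI[of _ "a' + b'"] exI[of _ "\<lambda>j. c j + d j"]) (auto intro: ideal_add[OF J] Polys_add)
    next
      fix e a assume "e \<in> Polys V" "a \<in> ?R"
      then obtain a' c where "a = a' + (\<Sum>j<r. c j * l j)" "a' \<in> J" "\<forall>j. c j \<in> Polys V" by blast
      moreover from this have "e * a = e * a' + (\<Sum>j<r. (e * c j) * l j)"
        by (simp add: algebra_simps sum_distrib_left)
      ultimately show "e * a \<in> ?R"
        using \<open>e \<in> Polys V\<close>
        by (intro CollectI exI[of _ "e * a'"] exI[of _ "\<lambda>j. e * c j"]) (auto intro: ideal_mult[OF J] Polys_mult)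
    qed
    show "J \<union> l ` {..<r} \<subseteq> ?R"
    proof
      fix x assume "x \<in> J \<union> l ` {..<r}"
      then consider "x \<in> J" | i where "i < r" "x = l i" by auto
      then show "x \<in> ?R"
      proof cases
        case 1
        then show ?thesis by (intro CollectI exI[of _ x] exI[of _ "\<lambda>_. 0"]) auto
      next
        case 2
        then have "x = 0 + (\<Sum>j<r. (if j = i then 1 else 0) * l j)" by (simp add: if_distrib[of "\<lambda>x. x * _"] cong: if_cong)
        then show ?thesis using ideal_0[OF J]
          by (intro CollectI exI[of _ 0] exI[of _ "\<lambda>j. if j = i then 1 else 0"]) auto
      qed
    qed
  qed
  show "?R \<subseteq> ?L"
    using Idl_gen[OF sub] by (auto intro!: ideal_add[OF Idl_ideal[OF sub]] ideal_sum[OF Idl_ideal[OF sub]]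
      ideal_mult[OF Idl_ideal[OF sub]])
qed

lemma Idl_Un_Suc:
  assumes J: "ideal J (poly_ring V)" and l: "\<And>j. j < Suc r \<Longrightarrow> l j \<in> Polys V"
  shows "Idl\<^bsub>poly_ring V\<^esub> (J \<union> l ` {..<Suc r}) =
    Idl\<^bsub>poly_ring V\<^esub> (insert (l r) (Idl\<^bsub>poly_ring V\<^esub> (J \<union> l ` {..<r})))"
proof -
  have s1: "J \<union> l ` {..<r} \<subseteq> Polys V" and s2: "J \<union> l ` {..<Suc r} \<subseteq> Polys V"
    using ideal_sub[OF J] l by auto
  have s3: "insert (l r) (Idl\<^bsub>poly_ring V\<^esub> (J \<union> l ` {..<r})) \<subseteq> Polys V"
    using ideal_sub[OF Idl_ideal[OF s1]] l by auto
  show ?thesis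
  proof (rule antisym)
    show "Idl\<^bsub>poly_ring V\<^esub> (J \<union> l ` {..<Suc r}) \<subseteq> Idl\<^bsub>poly_ring V\<^esub> (insert (l r) (Idl\<^bsub>poly_ring V\<^esub> (J \<union> l ` {..<r})))"
      using Idl_gen[OF s1] by (intro Idl_least Idl_ideal[OF s3] subsetI Idl_gen[OF s3]) (auto simp: less_Suc_eq)
    have "l r \<in> Idl\<^bsub>poly_ring V\<^esub> (J \<union> l ` {..<Suc r})" by (rule Idl_gen[OF s2]) auto
    moreover have "Idl\<^bsub>poly_ring V\<^esub> (J \<union> l ` {..<r}) \<subseteq> Idl\<^bsub>poly_ring V\<^esub> (J \<union> l ` {..<Suc r})"
      by (rule Idl_mono[OF _ s2]) auto
    ultimately show "Idl\<^bsub>poly_ring V\<^esub> (insert (l r) (Idl\<^bsub>poly_ring V\<^esub> (J \<union> l ` {..<r}))) \<subseteq> Idl\<^bsub>poly_ring V\<^esub> (J \<union> l ` {..<Suc r})"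
      by (intro Idl_least Idl_ideal[OF s2]) auto
  qed
qed

text \<open>Multiplication by the regular element \<open>y\<close> gives a short exact sequence of
  Koszul complexes. In its long exact sequence, vanishing in degree \<open>i + 1\<close> modulo
  \<open>y\<close> makes \<open>y\<close> injective on the homology in degree \<open>i\<close>; but
  a power of \<open>y\<close> annihilates this homology, so it is zero. Both facts are carried out
  on chains.\<close>

lemma kexact_step:
  assumes J: "ideal J (poly_ring V)" and l: "\<And>j. j < r \<Longrightarrow> l j \<in> Polys V"
    and y: "y \<in> Polys V" and reg: "\<And>p. p \<in> Polys V \<Longrightarrow> y * p \<in> J \<Longrightarrow> p \<in> J"
    and nil: "y ^ N \<in> Idl\<^bsub>poly_ring V\<^esub> (J \<union> l ` {..<r})"
    and ex: "kexact V r l (Idl\<^bsub>poly_ring V\<^esub> (insert y J)) (Suc i)"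
  shows "kexact V r l J i"
  unfolding kexact_def
proof (intro allI impI)
  fix f :: "nat set \<Rightarrow> 'a cpoly"
  assume f: "(\<forall>U. f U \<in> Polys V) \<and> (\<forall>U\<subseteq>{..<r}. Suc (card U) = i \<longrightarrow> kdiff r l f U \<in> J)"
  define bd where "bd f \<longleftrightarrow> (\<exists>g. (\<forall>U. g U \<in> Polys V) \<and> (\<forall>U\<subseteq>{..<r}. card U = i \<longrightarrow> f U - kdiff r l g U \<in> J))"
    for f :: "nat set \<Rightarrow> 'a cpoly"
  \<comment> \<open>Injectivity of \<open>y\<close>: if \<open>y * f\<close> is the boundary of
    \<open>g\<close>, then \<open>g\<close> is a cycle modulo \<open>y\<close>, hence a boundary
    plus \<open>k * y\<close>, and \<open>k\<close> bounds \<open>f\<close> after cancelling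
    \<open>y\<close>.\<close>
  have cancel: "bd f" if f: "\<And>U. f U \<in> Polys V" and b: "bd (\<lambda>U. y * f U)" for f
  proof -
    obtain g where g: "\<And>U. g U \<in> Polys V" "\<And>U. U \<subseteq> {..<r} \<Longrightarrow> card U = i \<Longrightarrow> y * f U - kdiff r l g U \<in> J"
      using b unfolding bd_def by blast
    have "\<forall>U\<subseteq>{..<r}. Suc (card U) = Suc i \<longrightarrow> kdiff r l g U \<in> Idl\<^bsub>poly_ring V\<^esub> (insert y J)"
    proof (intro allI impI)
      fix U assume U: "U \<subseteq> {..<r}" "Suc (card U) = Suc i"
      have "kdiff r l g U = - (y * f U - kdiff r l g U) + f U * y" by (simp add: mult.commute)
      then show "kdiff r l g U \<in> Idl\<^bsub>poly_ring V\<^esub> (insert y J)"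
        unfolding Idl_insert[OF J y] using ideal_uminus[OF J g(2)] U f by blast
    qed
    then have "\<exists>h. (\<forall>U. h U \<in> Polys V) \<and> (\<forall>U\<subseteq>{..<r}. card U = Suc i \<longrightarrow>
        g U - kdiff r l h U \<in> Idl\<^bsub>poly_ring V\<^esub> (insert y J))"
      by (intro ex[unfolded kexact_def, rule_format]) (use g(1) in auto)
    then obtain h where h: "\<And>U. h U \<in> Polys V"
      "\<And>U. U \<subseteq> {..<r} \<Longrightarrow> card U = Suc i \<Longrightarrow> g U - kdiff r l h U \<in> Idl\<^bsub>poly_ring V\<^esub> (insert y J)"
      by auto
    have "\<forall>U. \<exists>k. k \<in> Polys V \<and> (U \<subseteq> {..<r} \<longrightarrow> card U = Suc i \<longrightarrow> g U - kdiff r l h U - k * y \<in> J)"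
    proof
      fix U
      show "\<exists>k. k \<in> Polys V \<and> (U \<subseteq> {..<r} \<longrightarrow> card U = Suc i \<longrightarrow> g U - kdiff r l h U - k * y \<in> J)"
      proof (cases "U \<subseteq> {..<r} \<and> card U = Suc i")
        case True
        then obtain a k where "a \<in> J" "k \<in> Polys V" "g U - kdiff r l h U = a + k * y"
          using h(2) unfolding Idl_insert[OF J y] by blast
        then show ?thesis by (intro exI[of _ k]) auto
      qed (use Polys_0 in blast)
    qed
    then obtain k where k: "\<And>U. k U \<in> Polys V"
      "\<And>U. U \<subseteq> {..<r} \<Longrightarrow> card U = Suc i \<Longrightarrow> g U - kdiff r l h U - k U * y \<in> J" by metis
    have "f U - kdiff r l k U \<in> J" if U: "U \<subseteq> {..<r}" "card U = i" for U
    proof (rule reg)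
      show "f U - kdiff r l k U \<in> Polys V" using f k(1) l by (intro Polys_diff kdiff_Polys) auto
      have "kdiff r l (\<lambda>U. g U - kdiff r l h U - k U * y) U \<in> J"
        using k(2) U by (intro kdiff_mem[OF J l]) auto
      moreover have "kdiff r l (\<lambda>U. g U - kdiff r l h U - k U * y) U = kdiff r l g U - y * kdiff r l k U"
      proof -
        have "finite U" using U finite_subset by blast
        then show ?thesis by (simp add: kdiff_diff kdiff_kdiff mult.commute[of _ y] kdiff_scale)
      qed
      ultimately have "kdiff r l g U - y * kdiff r l k U \<in> J" by simp
      then have "(y * f U - kdiff r l g U) + (kdiff r l g U - y * kdiff r l k U) \<in> J"
        by (rule ideal_add[OF J g(2)[OF U]])
      then show "y * (f U - kdiff r l k U) \<in> J" by (simp add: right_diff_distrib)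
    qed
    then show ?thesis unfolding bd_def using k(1) by blast
  qed
  \<comment> \<open>Modulo \<open>J\<close> the power \<open>y ^ N\<close> is a combination of the
    \<open>l j\<close>, so the null-homotopies of the \<open>l j\<close> combine to an explicit
    bounding chain.\<close>
  have "bd (\<lambda>U. y ^ N * f U)"
  proof -
    obtain a c where ac: "a \<in> J" "\<And>j. c j \<in> Polys V" "y ^ N = a + (\<Sum>j<r. c j * l j)"
      using nil Idl_Un_repr[OF J, of r l] l by blast
    define g where "g U = (\<Sum>j<r. c j * kext j f U)" for U
    have "y ^ N * f U - kdiff r l g U \<in> J" if U: "U \<subseteq> {..<r}" "card U = i" for U
    proof -
      have "(\<Sum>j<r. c j * l j) * f U = (\<Sum>j<r. c j * (l j * f U))" by (simp add: sum_distrib_right mult.assoc)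
      also have "\<dots> = (\<Sum>j<r. c j * (kdiff r l (kext j f) U + kext j (kdiff r l f) U))"
        using U by (intro sum.cong refl) (simp add: kext_homotopy)
      also have "\<dots> = kdiff r l g U + (\<Sum>j<r. c j * kext j (kdiff r l f) U)"
        by (simp add: g_def[abs_def] kdiff_sum kdiff_scale distrib_left sum.distrib)
      finally have "y ^ N * f U - kdiff r l g U = f U * a + (\<Sum>j<r. c j * kext j (kdiff r l f) U)"
        by (simp add: ac(3) algebra_simps)
      moreover have "kext j (kdiff r l f) U \<in> J" if "j < r" for j
      proof (cases "j \<in> U")
        case True
        have "finite U" using U finite_subset by blast
        then have "Suc (card (U - {j})) = i" using True U by (metis card_Suc_Diff1)
        moreover have "U - {j} \<subseteq> {..<r}" using U by auto
        ultimately have "kdiff r l f (U - {j}) \<in> J" using f by blast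
        then show ?thesis using True by (simp add: kext_def ideal_mult[OF J ksgn_Polys])
      qed (simp add: kext_def ideal_0[OF J])
      ultimately show ?thesis
        using f ac by (auto intro!: ideal_add[OF J] ideal_mult[OF J] ideal_sum[OF J])
    qed
    moreover have "g U \<in> Polys V" for U
      unfolding g_def using ac f by (intro Polys_sum Polys_mult kext_Polys) auto
    ultimately show ?thesis unfolding bd_def by blast
  qed
  then have "bd f"
  proof (induction N)
    case (Suc N)
    have "bd (\<lambda>U. y ^ N * f U)"
    proof (rule cancel)
      show "y ^ N * f U \<in> Polys V" for U using f y by (intro Polys_mult Polys_power) auto
      show "bd (\<lambda>U. y * (y ^ N * f U))" using Suc.prems by (simp add: mult.assoc)
    qed
    then show ?case by (rule Suc.IH)
  qed simp
  then show "\<exists>g. (\<forall>U. g U \<in> Polys V) \<and> (\<forall>U\<subseteq>{..<r}. card U = i \<longrightarrow> f U - kdiff r l g U \<in> J)"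
    unfolding bd_def .
qed

text \<open>With all of \<open>y\<close> adjoined the degree \<open>i + s\<close> exceeds
  \<open>r\<close> and no index set has that size; \<open>kexact_step\<close> then removes one
  element at a time. Nilpotency is assumed over \<open>J 0\<close> and persists because the ideals
  grow.\<close>

lemma kexact_regular_sequence:
  assumes J: "\<And>k. k \<le> s \<Longrightarrow> ideal (J k) (poly_ring V)" and l: "\<And>j. j < r \<Longrightarrow> l j \<in> Polys V"
    and y: "\<And>k. k < s \<Longrightarrow> y k \<in> Polys V"
    and JS: "\<And>k. k < s \<Longrightarrow> J (Suc k) = Idl\<^bsub>poly_ring V\<^esub> (insert (y k) (J k))"
    and reg: "\<And>k p. k < s \<Longrightarrow> p \<in> Polys V \<Longrightarrow> y k * p \<in> J k \<Longrightarrow> p \<in> J k"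
    and nil: "\<And>k. k < s \<Longrightarrow> \<exists>N. y k ^ N \<in> Idl\<^bsub>poly_ring V\<^esub> (J 0 \<union> l ` {..<r})"
    and i: "i + s > r"
  shows "kexact V r l (J 0) i"
proof -
  have mono: "J 0 \<subseteq> J k" if "k \<le> s" for k
    using that
  proof (induction k)
    case (Suc k)
    have "J k \<subseteq> J (Suc k)"
      using JS[of k] Idl_gen[of "insert (y k) (J k)" V] ideal_sub[OF J[of k]] y[of k] Suc.prems by auto
    then show ?case using Suc by auto
  qed simp
  have "kexact V r l (J k) i" if "k \<le> s" "i + (s - k) > r" for k i
    using that
  proof (induction "s - k" arbitrary: k i)
    case 0
    have "card U \<noteq> i" if "U \<subseteq> {..<r}" for U
      using card_mono[OF _ that] 0 by auto
    then show ?case unfolding kexact_def using Polys_0 by blast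
  next
    case (Suc d)
    then have k: "k < s" by auto
    have "kexact V r l (J (Suc k)) (Suc i)" using Suc by (intro Suc.hyps) auto
    moreover obtain N where "y k ^ N \<in> Idl\<^bsub>poly_ring V\<^esub> (J 0 \<union> l ` {..<r})" using nil k by blast
    then have "y k ^ N \<in> Idl\<^bsub>poly_ring V\<^esub> (J k \<union> l ` {..<r})"
      using Idl_mono[of "J 0 \<union> l ` {..<r}" "J k \<union> l ` {..<r}" V] mono[of k] k ideal_sub[OF J[of k]] l by auto
    ultimately show ?case
      using k JS[OF k] by (intro kexact_step[OF J l y reg]) auto
  qed
  from this[of 0 i] i show ?thesis by simp
qed

section \<open>Regular sequences of linear forms and Hilbert series\<close>

text \<open>Degree 1 in coordinates: a homogeneous syzygy modulo \<open>J\<close> comes from an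
  antisymmetric matrix with entries one degree lower. For \<open>e = 0\<close> the degree
  \<open>e - 1\<close> would be truncated to 0, so the matrix is required to vanish.\<close>

definition koszul1 :: "'v set \<Rightarrow> nat \<Rightarrow> (nat \<Rightarrow> 'v cpoly) \<Rightarrow> 'v cpoly set \<Rightarrow> bool" where
  "koszul1 V r l J \<longleftrightarrow> (\<forall>e p. (\<forall>j<r. p j \<in> Polys V \<and> homog e (p j)) \<and> (\<Sum>j<r. p j * l j) \<in> J \<longrightarrow>
     (\<exists>q. (\<forall>j k. q j k = - q k j) \<and>
          (\<forall>j k. q j k \<in> Polys V \<and> (if e = 0 then q j k = 0 else homog (e - 1) (q j k))) \<and>
          (\<forall>j<r. p j - (\<Sum>k<r. q j k * l k) \<in> J)))"

text \<open>A syzygy is a 1-cycle. The chain \<open>g\<close> that bounds it need not be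
  homogeneous, but its component of degree \<open>e - 1\<close> serves as well because
  \<open>J\<close> is homogeneous.\<close>

lemma kexact_koszul1:
  assumes J: "ideal J (poly_ring V)" "homog_closed J" and l: "\<And>j. j < r \<Longrightarrow> l j \<in> Polys V \<and> homog 1 (l j)"
    and ex: "kexact V r l J 1"
  shows "koszul1 V r l J"
  unfolding koszul1_def
proof (intro allI impI)
  fix e p assume p: "(\<forall>j<r. p j \<in> Polys V \<and> homog e (p j)) \<and> (\<Sum>j<r. p j * l j) \<in> J"
  define f where "f U = (if \<exists>j<r. U = {j} then p (the_elem U) else 0)" for U
  have f1: "f {j} = p j" if "j < r" for j using that by (auto simp: f_def)
  have "f U \<in> Polys V" for U using p by (auto simp: f_def)
  moreover have "\<forall>U\<subseteq>{..<r}. Suc (card U) = 1 \<longrightarrow> kdiff r l f U \<in> J"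
  proof (intro allI impI)
    fix U assume "U \<subseteq> {..<r}" "Suc (card U) = 1"
    then have "U = {}" using finite_subset[of U "{..<r}"] by auto
    then have "kdiff r l f U = (\<Sum>j<r. p j * l j)"
      by (simp add: kdiff_def ksgn_def) (rule sum.cong, auto simp: f1 mult.commute)
    then show "kdiff r l f U \<in> J" using p by simp
  qed
  ultimately have "\<exists>g. (\<forall>U. g U \<in> Polys V) \<and> (\<forall>U\<subseteq>{..<r}. card U = 1 \<longrightarrow> f U - kdiff r l g U \<in> J)"
    by (intro ex[unfolded kexact_def, rule_format]) auto
  then obtain g where g: "\<And>U. g U \<in> Polys V" "\<And>U. U \<subseteq> {..<r} \<Longrightarrow> card U = 1 \<Longrightarrow> f U - kdiff r l g U \<in> J"
    by auto
  define hc where "hc x = (if e = 0 then 0 else hcomp (e - 1) x)" for x :: "'a cpoly"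
  have hc_l: "hcomp e (x * l k) = hc x * l k" if "k < r" for x k
    using hcomp_mult_homog[of 1 "l k" e x] l that by (auto simp: hc_def)
  \<comment> \<open>A 2-chain lives on unordered pairs; the signs of the differential turn it into
    an antisymmetric matrix.\<close>
  define q where "q j k = (if j < k then - hc (g {j, k}) else if k < j then hc (g {j, k}) else 0)" for j k :: nat
  have "p j - (\<Sum>k<r. q j k * l k) \<in> J" if j: "j < r" for j
  proof -
    have "kdiff r l g {j} = (\<Sum>k<r. (if j < k then - g {j, k} else if k < j then g {j, k} else 0) * l k)"
    proof -
      have "kdiff r l g {j} = (\<Sum>k\<in>{..<r} - {j}. (if j < k then - g {j, k} else if k < j then g {j, k} else 0) * l k)"
        unfolding kdiff_def
      proof (rule sum.cong[OF refl])
        fix k assume k: "k \<in> {..<r} - {j}"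
        have "{i. i = j \<and> i < k} = (if j < k then {j} else {})" by auto
        then show "ksgn k {j} * l k * g {k, j} = (if j < k then - g {j, k} else if k < j then g {j, k} else 0) * l k"
          using k by (auto simp: ksgn_def insert_commute[of k j] mult.commute)
      qed
      also have "\<dots> = (\<Sum>k<r. (if j < k then - g {j, k} else if k < j then g {j, k} else 0) * l k)"
        by (rule sum.mono_neutral_left) auto
      finally show ?thesis .
    qed
    then have "hcomp e (kdiff r l g {j}) = (\<Sum>k<r. q j k * l k)"
      by (simp add: hcomp_sum) (rule sum.cong, auto simp: hc_l q_def hc_def hcomp_uminus)
    moreover have "hcomp e (p j) = p j" using p j hcomp_homog[of e "p j" e] by simp
    moreover have "hcomp e (f {j} - kdiff r l g {j}) \<in> J"
      using J(2) g(2)[of "{j}"] j by (auto simp: homog_closed_def)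
    ultimately show ?thesis using f1 j by (simp add: hcomp_diff)
  qed
  moreover have "q j k = - q k j" for j k by (auto simp: q_def insert_commute)
  moreover have "q j k \<in> Polys V \<and> (if e = 0 then q j k = 0 else homog (e - 1) (q j k))" for j k
    by (auto simp: q_def hc_def intro!: Polys_uminus Polys_hcomp g(1) homog_uminus homog_hcomp)
  ultimately show "\<exists>q. (\<forall>j k. q j k = - q k j) \<and>
      (\<forall>j k. q j k \<in> Polys V \<and> (if e = 0 then q j k = 0 else homog (e - 1) (q j k))) \<and>
      (\<forall>j<r. p j - (\<Sum>k<r. q j k * l k) \<in> J)"
    by blast
qed

text \<open>Graded Nakayama: induction on the degree of the syzygy.\<close>

lemma koszul1_Suc:
  assumes J: "ideal J (poly_ring V)" and l: "\<And>j. j < Suc r \<Longrightarrow> l j \<in> Polys V \<and> homog 1 (l j)"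
    and k1: "koszul1 V (Suc r) l J"
  shows "koszul1 V r l J"
proof -
  have "\<exists>q. (\<forall>j k. q j k = - q k j) \<and>
          (\<forall>j k. q j k \<in> Polys V \<and> (if e = 0 then q j k = 0 else homog (e - 1) (q j k))) \<and>
          (\<forall>j<r. p j - (\<Sum>k<r. q j k * l k) \<in> J)"
    if "\<forall>j<r. p j \<in> Polys V \<and> homog e (p j)" "(\<Sum>j<r. p j * l j) \<in> J" for e p
    using that
  proof (induction e arbitrary: p)
    case (0 p)
    define p' where "p' j = (if j < r then p j else 0)" for j
    have "(\<Sum>j<Suc r. p' j * l j) = (\<Sum>j<r. p j * l j)" by (simp add: p'_def)
    moreover have "\<forall>j<Suc r. p' j \<in> Polys V \<and> homog 0 (p' j)" using 0 by (auto simp: p'_def)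
    ultimately have "\<exists>q. (\<forall>j k. q j k = - q k j) \<and>
          (\<forall>j k. q j k \<in> Polys V \<and> (if (0::nat) = 0 then q j k = 0 else homog (0 - 1) (q j k))) \<and>
          (\<forall>j<Suc r. p' j - (\<Sum>k<Suc r. q j k * l k) \<in> J)"
      using 0(2) by (intro k1[unfolded koszul1_def, rule_format]) simp
    then obtain q where q: "\<forall>j k. q j k \<in> Polys V \<and> (if (0::nat) = 0 then q j k = 0 else homog (0 - 1) (q j k))"
      and q': "\<forall>j<Suc r. p' j - (\<Sum>k<Suc r. q j k * l k) \<in> J"
      by blast
    have "q j k = 0" for j k using q by simp
    then have "p j \<in> J" if "j < r" for j using q'[rule_format, of j] that by (simp add: p'_def)
    then show ?case by (intro exI[of _ "\<lambda>_ _. 0"]) auto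
  next
    case (Suc e p)
    define p' where "p' j = (if j < r then p j else 0)" for j
    have "(\<Sum>j<Suc r. p' j * l j) = (\<Sum>j<r. p j * l j)" by (simp add: p'_def)
    moreover have "\<forall>j<Suc r. p' j \<in> Polys V \<and> homog (Suc e) (p' j)" using Suc.prems by (auto simp: p'_def)
    ultimately have "\<exists>q. (\<forall>j k. q j k = - q k j) \<and>
          (\<forall>j k. q j k \<in> Polys V \<and> (if Suc e = 0 then q j k = 0 else homog (Suc e - 1) (q j k))) \<and>
          (\<forall>j<Suc r. p' j - (\<Sum>k<Suc r. q j k * l k) \<in> J)"
      using k1[unfolded koszul1_def, rule_format, of p' "Suc e"] Suc.prems(2) by simp
    then obtain q where q0: "\<forall>j k. q j k \<in> Polys V \<and> (if Suc e = 0 then q j k = 0 else homog (Suc e - 1) (q j k))"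
      and q1: "\<And>j k. q j k = - q k j"
      and q4: "\<And>j. j < Suc r \<Longrightarrow> p' j - (\<Sum>k<Suc r. q j k * l k) \<in> J"
      by blast
    have q2: "q j k \<in> Polys V" and q3: "homog e (q j k)" for j k using q0 by auto
    note q = q1 q2 q3 q4
    \<comment> \<open>Row \<open>r\<close> says that the last column of \<open>q\<close> is a syzygy
      of the first \<open>r\<close> forms, of degree \<open>e\<close> instead of
      \<open>Suc e\<close>. Rewriting this column by induction absorbs the terms with
      \<open>l r\<close> into \<open>q''\<close>.\<close>
    have "q r r = 0" using q(1)[of r r] by (rule self_eq_uminus_cpoly)
    then have "- (\<Sum>k<r. q r k * l k) \<in> J" using q(4)[of r] by (simp add: p'_def)
    then have syz: "(\<Sum>k<r. q k r * l k) \<in> J"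
      by (subst q(1)) (simp add: sum_negf)
    have "\<exists>q'. (\<forall>j k. q' j k = - q' k j) \<and>
          (\<forall>j k. q' j k \<in> Polys V \<and> (if e = 0 then q' j k = 0 else homog (e - 1) (q' j k))) \<and>
          (\<forall>j<r. q j r - (\<Sum>k<r. q' j k * l k) \<in> J)"
      by (rule Suc.IH) (simp_all add: q2 q3 syz)
    then obtain q' where q': "\<And>j k. q' j k = - q' k j" "\<And>j k. q' j k \<in> Polys V"
      "\<And>j k. if e = 0 then q' j k = 0 else homog (e - 1) (q' j k)"
      "\<And>j. j < r \<Longrightarrow> q j r - (\<Sum>k<r. q' j k * l k) \<in> J"
      by blast
    define q'' where "q'' j k = q j k + q' j k * l r" for j k
    have A: "p j - (\<Sum>k<r. q'' j k * l k) \<in> J" if j: "j < r" for j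
    proof -
      have "p j - (\<Sum>k<r. q'' j k * l k) =
        (p j - (\<Sum>k<r. q j k * l k) - q j r * l r) + l r * (q j r - (\<Sum>k<r. q' j k * l k))"
        by (simp add: q''_def algebra_simps sum.distrib sum_distrib_left)
      moreover have "p j - (\<Sum>k<r. q j k * l k) - q j r * l r \<in> J"
        using q(4)[of j] j by (simp add: p'_def algebra_simps)
      moreover have "l r * (q j r - (\<Sum>k<r. q' j k * l k)) \<in> J"
        using q'(4)[OF j] l[of r] by (intro ideal_mult[OF J]) auto
      ultimately show ?thesis by (simp only: ideal_add[OF J])
    qed
    have B: "q'' j k = - q'' k j" for j k
      unfolding q''_def by (subst q(1), subst q'(1)) simp
    have C: "q'' j k \<in> Polys V" for j k
      unfolding q''_def using q(2) q'(2) l[of r] by (intro Polys_add Polys_mult) auto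
    have D: "homog e (q'' j k)" for j k
    proof (cases "e = 0")
      case True
      then show ?thesis using q'(3)[of j k] q(3) by (simp add: q''_def)
    next
      case False
      then have "homog ((e - 1) + 1) (q' j k * l r)" using q'(3)[of j k] l[of r] by (intro homog_mult) auto
      then show ?thesis unfolding q''_def using q(3) False by (intro homog_add) auto
    qed
    show ?case
      by (rule exI[of _ q''], intro conjI allI impI, rule B, rule C, simp add: D, rule A)
  qed
  then show ?thesis unfolding koszul1_def by blast
qed

text \<open>The hypothesis on \<open>p * l r\<close> is a syzygy with last coefficient
  \<open>p\<close>. Antisymmetry gives \<open>q r r = 0\<close>, so \<open>p\<close> is congruent to
  a combination of the earlier forms.\<close>

lemma koszul1_regular:
  assumes J: "ideal J (poly_ring V)" "homog_closed J" and l: "\<And>j. j < Suc r \<Longrightarrow> l j \<in> Polys V \<and> homog 1 (l j)"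
    and k1: "koszul1 V (Suc r) l J"
    and p: "p \<in> Polys V" "homog e p" "p * l r \<in> Idl\<^bsub>poly_ring V\<^esub> (J \<union> l ` {..<r})"
  shows "p \<in> Idl\<^bsub>poly_ring V\<^esub> (J \<union> l ` {..<r})"
proof -
  have repr: "Idl\<^bsub>poly_ring V\<^esub> (J \<union> l ` {..<r}) = {a + (\<Sum>j<r. c j * l j) | a c. a \<in> J \<and> (\<forall>j. c j \<in> Polys V)}"
    using l by (intro Idl_Un_repr[OF J(1)]) auto
  obtain a c where ac: "a \<in> J" "\<And>j. c j \<in> Polys V" "p * l r = a + (\<Sum>j<r. c j * l j)"
    using p(3) unfolding repr by blast
  have "homog (e + 1) (p * l r)" using p l[of r] by (intro homog_mult) auto
  then have "p * l r = hcomp (e + 1) (p * l r)" using hcomp_homog[of "e + 1" "p * l r" "e + 1"] by simp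
  also have "\<dots> = hcomp (e + 1) a + (\<Sum>j<r. hcomp e (c j) * l j)"
    unfolding ac(3) hcomp_add hcomp_sum
    using l by (intro arg_cong2[where f = "(+)"] refl sum.cong) (auto simp: hcomp_mult_homog[of 1])
  finally have eq: "p * l r = hcomp (e + 1) a + (\<Sum>j<r. hcomp e (c j) * l j)" .
  define p' where "p' j = (if j < r then - hcomp e (c j) else p)" for j
  have "(\<Sum>j<Suc r. p' j * l j) = hcomp (e + 1) a"
    using eq by (simp add: p'_def sum_negf)
  also have "\<dots> \<in> J" using J(2) ac(1) by (simp add: homog_closed_def)
  finally have "(\<Sum>j<Suc r. p' j * l j) \<in> J" .
  moreover have "\<forall>j<Suc r. p' j \<in> Polys V \<and> homog e (p' j)"
    using p ac(2) by (auto simp: p'_def intro!: Polys_uminus Polys_hcomp homog_uminus homog_hcomp)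
  ultimately have "\<exists>q. (\<forall>j k. q j k = - q k j) \<and>
          (\<forall>j k. q j k \<in> Polys V \<and> (if e = 0 then q j k = 0 else homog (e - 1) (q j k))) \<and>
          (\<forall>j<Suc r. p' j - (\<Sum>k<Suc r. q j k * l k) \<in> J)"
    using k1[unfolded koszul1_def, rule_format, of p' e] by blast
  then obtain q where q: "\<And>j k. q j k = - q k j" "\<And>j k. q j k \<in> Polys V"
    "\<And>j. j < Suc r \<Longrightarrow> p' j - (\<Sum>k<Suc r. q j k * l k) \<in> J" by blast
  have "q r r = 0" using q(1)[of r r] by (rule self_eq_uminus_cpoly)
  then have "p - (\<Sum>k<r. q r k * l k) \<in> J" using q(3)[of r] by (simp add: p'_def)
  moreover have "p = (p - (\<Sum>k<r. q r k * l k)) + (\<Sum>k<r. q r k * l k)" by simp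
  ultimately show ?thesis unfolding repr using q(2) by blast
qed

text \<open>Multiplication by \<open>l\<close> maps degree \<open>q\<close> to degree
  \<open>q + 1\<close>, and by regularity the preimage of \<open>J\<close> is \<open>J\<close>;
  comparing dimensions gives the factor \<open>1 - X\<close>. Degree 0 is separate since no multiple
  of \<open>l\<close> reaches it.\<close>

lemma hilbert_series_insert:
  fixes V :: "'n::finite set"
  assumes J: "ideal J (poly_ring V)" "homog_closed J" and l: "l \<in> Polys V" "homog 1 l"
    and reg: "\<And>e p. p \<in> Polys V \<Longrightarrow> homog e p \<Longrightarrow> p * l \<in> J \<Longrightarrow> p \<in> J"
  shows "hilbert_series V (Idl\<^bsub>poly_ring V\<^esub> (insert l J)) = hilbert_series V J * (1 - fps_X)"
proof -
  define S where "S q = cpoly.dim (graded_part (Polys V) q)" for q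
  define I where "I = Idl\<^bsub>poly_ring V\<^esub> (insert l J)"
  have I_eq: "I = {a + c * l | a c. a \<in> J \<and> c \<in> Polys V}" unfolding I_def by (rule Idl_insert[OF J(1) l(1)])
  have J0: "graded_part I 0 = graded_part J 0"
  proof
    show "graded_part I 0 \<subseteq> graded_part J 0"
    proof
      fix p assume p: "p \<in> graded_part I 0"
      then obtain a c where ac: "a \<in> J" "c \<in> Polys V" "p = a + c * l" by (auto simp: graded_part_def I_eq)
      have "p = hcomp 0 p" using p hcomp_homog[of 0 p 0] by (simp add: graded_part_def)
      also have "\<dots> = hcomp 0 a" using hcomp_mult_homog[OF l(2), of 0 c] by (simp add: ac(3) hcomp_add)
      finally show "p \<in> graded_part J 0" using p J(2) ac(1) by (auto simp: graded_part_def homog_closed_def)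
    qed
    have "J \<subseteq> I" unfolding I_eq using Polys_0[of V] by force
    then show "graded_part J 0 \<subseteq> graded_part I 0" by (rule graded_part_mono)
  qed
  have step: "cpoly.dim (graded_part I (Suc q)) + cpoly.dim (graded_part J q) = cpoly.dim (graded_part J (Suc q)) + S q" for q
  proof -
    let ?f = "\<lambda>p. p * l"
    have lin: "Vector_Spaces.linear cscale cscale ?f"
      by (rule linear_cscaleI) (auto simp: distrib_right cscale_mult_left)
    obtain E where E: "finite E" "graded_part (Polys V) q \<subseteq> cpoly.span E" using graded_part_fin by blast
    obtain E' where E': "finite E'" "graded_part (Polys V) (Suc q) \<subseteq> cpoly.span E'" using graded_part_fin by blast
    have E'': "graded_part J (Suc q) \<subseteq> cpoly.span E'"
      using E' graded_part_mono[of J "Polys V" "Suc q"] ideal_sub[OF J(1)] by blast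
    have "{y + ?f u | y u. y \<in> graded_part J (Suc q) \<and> u \<in> graded_part (Polys V) q} = graded_part I (Suc q)"
    proof (intro equalityI subsetI)
      fix x assume "x \<in> {y + ?f u | y u. y \<in> graded_part J (Suc q) \<and> u \<in> graded_part (Polys V) q}"
      then obtain y u where x: "x = y + u * l" "y \<in> J" "homog (Suc q) y" "u \<in> Polys V" "homog q u"
        by (auto simp: graded_part_def)
      then have "homog (Suc q) x" using homog_mult[OF \<open>homog q u\<close> l(2)] by (auto intro: homog_add)
      then show "x \<in> graded_part I (Suc q)" using x unfolding graded_part_def I_eq by blast
    next
      fix x assume x: "x \<in> graded_part I (Suc q)"
      then obtain a c where ac: "a \<in> J" "c \<in> Polys V" "x = a + c * l" by (auto simp: graded_part_def I_eq)
      have "x = hcomp (Suc q) x" using x hcomp_homog[of "Suc q" x "Suc q"] by (simp add: graded_part_def)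
      also have "\<dots> = hcomp (Suc q) a + hcomp q c * l"
        using hcomp_mult_homog[OF l(2), of "Suc q" c] by (simp add: ac(3) hcomp_add)
      finally have "x = hcomp (Suc q) a + hcomp q c * l" .
      moreover have "hcomp (Suc q) a \<in> graded_part J (Suc q)"
        using J(2) ac(1) homog_hcomp by (auto simp: graded_part_def homog_closed_def)
      moreover have "hcomp q c \<in> graded_part (Polys V) q"
        using Polys_hcomp[OF ac(2)] homog_hcomp by (auto simp: graded_part_def)
      ultimately show "x \<in> {y + ?f u | y u. y \<in> graded_part J (Suc q) \<and> u \<in> graded_part (Polys V) q}" by blast
    qed
    moreover have "{u \<in> graded_part (Polys V) q. ?f u \<in> graded_part J (Suc q)} = graded_part J q"
    proof (intro equalityI subsetI)
      fix u assume "u \<in> {u \<in> graded_part (Polys V) q. ?f u \<in> graded_part J (Suc q)}"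
      then show "u \<in> graded_part J q" using reg[of u q] by (auto simp: graded_part_def)
    next
      fix u assume u: "u \<in> graded_part J q"
      then have "u * l \<in> J" using ideal_mult_right[OF J(1) l(1)] by (auto simp: graded_part_def)
      then show "u \<in> {u \<in> graded_part (Polys V) q. ?f u \<in> graded_part J (Suc q)}"
        using u homog_mult[of q u 1 l] l ideal_sub[OF J(1)] by (auto simp: graded_part_def)
    qed
    ultimately show ?thesis
      using cpoly.dim_preimage_sum[OF lin graded_part_subspace[OF Polys_subspace]
        graded_part_subspace[OF ideal_subspace[OF J(1)]] E E'(1) E'']
      by (simp add: S_def)
  qed
  show ?thesis
  proof (rule fps_ext)
    fix q
    show "fps_nth (hilbert_series V (Idl\<^bsub>poly_ring V\<^esub> (insert l J))) q = fps_nth (hilbert_series V J * (1 - fps_X)) q"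
    proof (cases q)
      case 0
      then show ?thesis using J0 by (simp add: hilbert_series_def I_def[symmetric] right_diff_distrib)
    next
      case (Suc q')
      have "fps_nth (hilbert_series V J * (1 - fps_X)) (Suc q') =
        fps_nth (hilbert_series V J) (Suc q') - fps_nth (hilbert_series V J) q'"
        by (simp add: right_diff_distrib)
      then show ?thesis using step[of q'] Suc by (simp add: hilbert_series_def I_def[symmetric] S_def)
    qed
  qed
qed

text \<open>Since \<open>koszul1\<close> passes to shorter initial segments, each form is regular
  modulo its predecessors and contributes one factor.\<close>

lemma hilbert_series_koszul:
  fixes V :: "'n::finite set"
  assumes J: "ideal J (poly_ring V)" "homog_closed J" and l: "\<And>j. j < r \<Longrightarrow> l j \<in> Polys V \<and> homog 1 (l j)"
    and k1: "koszul1 V r l J"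
  shows "hilbert_series V (Idl\<^bsub>poly_ring V\<^esub> (J \<union> l ` {..<r})) = hilbert_series V J * (1 - fps_X) ^ r"
  using l k1
proof (induction r)
  case 0
  have "Idl\<^bsub>poly_ring V\<^esub> J = J"
    using Idl_least[OF J(1)] Idl_gen[of J V] ideal_sub[OF J(1)] by blast
  then show ?case by simp
next
  case (Suc r)
  have l': "\<And>j. j < r \<Longrightarrow> l j \<in> Polys V \<and> homog 1 (l j)" using Suc.prems by auto
  have sub: "J \<union> l ` {..<r} \<subseteq> Polys V" using ideal_sub[OF J(1)] l' by auto
  have IH: "hilbert_series V (Idl\<^bsub>poly_ring V\<^esub> (J \<union> l ` {..<r})) = hilbert_series V J * (1 - fps_X) ^ r"
    using Suc.IH[OF l'] koszul1_Suc[OF J(1) Suc.prems] by blast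
  have hcl: "homog_closed (Idl\<^bsub>poly_ring V\<^esub> (J \<union> l ` {..<r}))"
    using l' by (intro homog_closed_Idl_Un[OF J]) auto
  have "hilbert_series V (Idl\<^bsub>poly_ring V\<^esub> (insert (l r) (Idl\<^bsub>poly_ring V\<^esub> (J \<union> l ` {..<r})))) =
    hilbert_series V (Idl\<^bsub>poly_ring V\<^esub> (J \<union> l ` {..<r})) * (1 - fps_X)"
  proof (rule hilbert_series_insert[OF Idl_ideal[OF sub] hcl])
    fix e p assume p: "p \<in> Polys V" "homog e p" "p * l r \<in> Idl\<^bsub>poly_ring V\<^esub> (J \<union> l ` {..<r})"
    show "p \<in> Idl\<^bsub>poly_ring V\<^esub> (J \<union> l ` {..<r})"
      by (rule koszul1_regular[OF J _ Suc.prems(2) p]) (rule Suc.prems(1))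
  qed (use Suc.prems(1)[of r] in auto)
  moreover have "Idl\<^bsub>poly_ring V\<^esub> (J \<union> l ` {..<Suc r}) =
    Idl\<^bsub>poly_ring V\<^esub> (insert (l r) (Idl\<^bsub>poly_ring V\<^esub> (J \<union> l ` {..<r})))"
    using Suc.prems(1) by (intro Idl_Un_Suc[OF J(1)]) auto
  ultimately show ?case using IH by (simp add: mult.assoc mult.commute)
qed

section \<open>Stanley-Reisner rings\<close>

text \<open>A monomial is a multiple of the squarefree monomial of its own support, so membership
  depends on supports alone.\<close>

lemma sr_ideal_char:
  fixes V :: "'n::finite set"
  assumes down: "\<forall>\<tau>\<in>\<Delta>. \<forall>\<tau>'\<subseteq>\<tau>. \<tau>' \<in> \<Delta>"
  shows "sr_ideal V \<Delta> = {p \<in> Polys V. \<forall>m\<in>keys p. keys m \<notin> \<Delta>}"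
proof -
  define E where "E = {(\<Sum>i\<in>\<tau>. single i (1::nat)) | \<tau>. \<tau> \<subseteq> V \<and> \<tau> \<notin> \<Delta>}"
  have gens: "{\<Prod>i\<in>\<tau>. pvar i | \<tau>. \<tau> \<subseteq> V \<and> \<tau> \<notin> \<Delta>} = pmon ` E"
    unfolding E_def prod_pvar by blast
  have E: "E \<subseteq> {m. keys m \<subseteq> V}" 
  proof
    fix m assume "m \<in> E"
    then obtain \<tau> where "\<tau> \<subseteq> V" "m = (\<Sum>i\<in>\<tau>. single i 1)" unfolding E_def by blast
    then show "m \<in> {m. keys m \<subseteq> V}" using keys_indicator[OF finite[of \<tau>]] by (simp only: mem_Collect_eq)
  qed
  have "sr_ideal V \<Delta> = {p \<in> Polys V. \<forall>m\<in>keys p. \<exists>e\<in>E. \<exists>b. m = e + b}"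
    unfolding sr_ideal_def gens by (rule monomial_ideal_char[OF E])
  also have "\<dots> = {p \<in> Polys V. \<forall>m\<in>keys p. keys m \<notin> \<Delta>}"
  proof -
    have "(\<exists>e\<in>E. \<exists>b. m = e + b) \<longleftrightarrow> keys m \<notin> \<Delta>" if m: "keys m \<subseteq> V" for m
    proof
      assume "\<exists>e\<in>E. \<exists>b. m = e + b"
      then obtain \<tau> b where "\<tau> \<notin> \<Delta>" "m = (\<Sum>i\<in>\<tau>. single i 1) + b" unfolding E_def by blast
      then have "\<tau> \<subseteq> keys m" using keys_indicator[OF finite[of \<tau>]] by (simp only: keys_add_nat) blast
      then show "keys m \<notin> \<Delta>" using down \<open>\<tau> \<notin> \<Delta>\<close> by blast
    next
      assume n: "keys m \<notin> \<Delta>"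
      have "m = (\<Sum>i\<in>keys m. single i 1) + (m - (\<Sum>i\<in>keys m. single i 1))"
      proof (rule poly_mapping_eqI)
        fix j
        have "lookup m j = (if j \<in> keys m then 1 else 0) + (lookup m j - (if j \<in> keys m then 1 else 0))"
          by (auto simp: in_keys_iff)
        then show "lookup m j = lookup ((\<Sum>i\<in>keys m. single i 1) + (m - (\<Sum>i\<in>keys m. single i 1))) j"
          using lookup_indicator[OF finite_keys[of m], of j] by (simp only: lookup_add lookup_minus)
      qed
      then show "\<exists>e\<in>E. \<exists>b. m = e + b" using n m unfolding E_def by blast
    qed
    then show ?thesis by (auto simp: carrier_poly_ring)
  qed
  finally show ?thesis .
qed

lemma sr_ideal_gens: "{\<Prod>i\<in>\<tau>. pvar i | \<tau>. \<tau> \<subseteq> V \<and> \<tau> \<notin> \<Delta>} \<subseteq> Polys V"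
  by (auto intro!: Polys_prod)

lemma sr_ideal_ideal: "ideal (sr_ideal V \<Delta>) (poly_ring V)"
  unfolding sr_ideal_def by (rule Idl_ideal[OF sr_ideal_gens])

lemma homog_prod_pvar: "homog (card X) (\<Prod>i\<in>X. pvar (i :: 'n::finite))"
  using homog_prod[of X "\<lambda>_. 1" pvar, OF _ homog_pvar] by simp

lemma sr_ideal_homog_closed: "homog_closed (sr_ideal (V :: 'n::finite set) \<Delta>)"
  unfolding sr_ideal_def using homog_prod_pvar by (intro homog_closed_Idl[OF sr_ideal_gens]) blast

text \<open>For \<open>F\<close> inside \<open>V\<close> this is the prime generated by the
  variables of \<open>V - F\<close>, the kernel of setting them to zero; for empty \<open>F\<close>
  it is the irrelevant ideal.\<close>

definition face_prime :: "'v set \<Rightarrow> 'v set \<Rightarrow> 'v cpoly set" where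
  "face_prime V F = {p \<in> Polys V. \<forall>m\<in>keys p. \<not> keys m \<subseteq> F}"

lemma face_prime_ideal: "ideal (face_prime V F) (poly_ring V)"
  unfolding poly_ideal_iff
proof (intro conjI ballI subsetI)
  fix a b assume "a \<in> face_prime V F" "b \<in> face_prime V F"
  then show "a + b \<in> face_prime V F"
    using keys_subset_add[of a b] by (auto simp: face_prime_def intro: Polys_add)
next
  fix c a assume c: "c \<in> Polys V" and a: "a \<in> face_prime V F"
  have "\<not> keys m \<subseteq> F" if "m \<in> keys (c * a)" for m
    using that
  proof (rule keys_mult_mem)
    fix x y assume "y \<in> keys a" "m = x + y"
    then show ?thesis using a by (auto simp: face_prime_def keys_add_nat)
  qed
  then show "c * a \<in> face_prime V F" using c a by (auto simp: face_prime_def intro: Polys_mult)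
qed (auto simp: face_prime_def)

text \<open>A stand-in for a monomial order on finitely many exponents: exponents become
  coefficients of univariate polynomials, evaluated at a point that is no root of any of the
  differences.\<close>

lemma exists_separating_weight:
  fixes X :: "('n::finite \<Rightarrow>\<^sub>0 nat) set"
  assumes "finite X"
  obtains \<omega> :: "('n \<Rightarrow>\<^sub>0 nat) \<Rightarrow> real" where "\<And>a b. \<omega> (a + b) = \<omega> a + \<omega> b" "inj_on \<omega> X"
proof -
  obtain idx :: "'n \<Rightarrow> nat" where idx: "inj idx"
    using finite_imp_inj_to_nat_seg[of "UNIV :: 'n set"] by auto
  define P where "P m = (\<Sum>j\<in>UNIV. Polynomial.monom (real (lookup m j)) (idx j))" for m :: "'n \<Rightarrow>\<^sub>0 nat"
  have coeff: "coeff (P m) (idx j) = real (lookup m j)" for m j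
    using idx by (simp add: P_def coeff_sum inj_eq)
  have inj: "P m = P m' \<Longrightarrow> m = m'" for m m'
    using coeff by (metis of_nat_eq_iff poly_mapping_eqI)
  have "finite (\<Union>(m, m')\<in>{(m, m'). m \<in> X \<and> m' \<in> X \<and> m \<noteq> m'}. {t. poly (P m - P m') t = 0})"
  proof (rule finite_UN_I)
    show "finite {(m, m'). m \<in> X \<and> m' \<in> X \<and> m \<noteq> m'}"
      by (rule finite_subset[of _ "X \<times> X"]) (use assms in auto)
    fix mm assume "mm \<in> {(m, m'). m \<in> X \<and> m' \<in> X \<and> m \<noteq> m'}"
    then show "finite (case mm of (m, m') \<Rightarrow> {t. poly (P m - P m') t = 0})"
      using inj by (auto intro!: poly_roots_finite simp del: poly_diff)
  qed
  then obtain t where t: "t \<notin> (\<Union>(m, m')\<in>{(m, m'). m \<in> X \<and> m' \<in> X \<and> m \<noteq> m'}. {t. poly (P m - P m') t = 0})"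
    using ex_new_if_finite[OF infinite_UNIV_char_0] by blast
  show ?thesis
  proof
    show "poly (P (a + b)) t = poly (P a) t + poly (P b) t" for a b
      by (simp add: P_def lookup_add add_monom[symmetric] sum.distrib)
    show "inj_on (\<lambda>m. poly (P m) t) X"
      using t by (force intro!: inj_onI)
  qed
qed

lemma times_sum_keys:
  "p * q = (\<Sum>a\<in>keys p. \<Sum>b\<in>keys q. single (a + b) (lookup p a * lookup q b))" for p q :: "'v cpoly"
proof -
  have "p * q = (\<Sum>a\<in>keys p. single a (lookup p a)) * (\<Sum>b\<in>keys q. single b (lookup q b))"
    by (simp only: poly_sum_single[symmetric])
  then show ?thesis by (simp add: sum_product mult_single)
qed

text \<open>Among the terms supported in \<open>F\<close>, the product of the heaviest terms of
  \<open>p\<close> and \<open>q\<close> cannot cancel: additivity and injectivity of the weight make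
  its decomposition unique.\<close>

lemma face_prime_prime:
  fixes p q :: "'n::finite cpoly"
  assumes p: "p \<in> Polys V" and q: "q \<in> Polys V" and pq: "p * q \<in> face_prime V F"
  shows "p \<in> face_prime V F \<or> q \<in> face_prime V F"
proof (rule ccontr)
  assume n: "\<not> (p \<in> face_prime V F \<or> q \<in> face_prime V F)"
  define X where "X r = {m \<in> keys r. keys m \<subseteq> F}" for r :: "'n cpoly"
  have X: "X p \<noteq> {}" "X q \<noteq> {}" "finite (X p)" "finite (X q)"
    using n p q by (auto simp: X_def face_prime_def)
  then have "finite (X p \<union> X q)" by simp
  then obtain \<omega> where \<omega>: "\<And>a b. \<omega> (a + b) = \<omega> a + (\<omega> b :: real)" "inj_on \<omega> (X p \<union> X q)"
    using exists_separating_weight by metis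
  have "Max (\<omega> ` X p) \<in> \<omega> ` X p" using X by (intro Max_in) auto
  then obtain m1 where "m1 \<in> X p" "\<omega> m1 = Max (\<omega> ` X p)" by auto
  then have m1: "m1 \<in> X p" "\<And>a. a \<in> X p \<Longrightarrow> \<omega> a \<le> \<omega> m1" using X by auto
  have "Max (\<omega> ` X q) \<in> \<omega> ` X q" using X by (intro Max_in) auto
  then obtain m2 where "m2 \<in> X q" "\<omega> m2 = Max (\<omega> ` X q)" by auto
  then have m2: "m2 \<in> X q" "\<And>a. a \<in> X q \<Longrightarrow> \<omega> a \<le> \<omega> m2" using X by auto
  \<comment> \<open>The supports of \<open>a\<close> and \<open>b\<close> lie in that of
    \<open>m1 + m2\<close>, so only terms supported in \<open>F\<close> can contribute to this
    exponent.\<close>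
  have uniq: "a = m1 \<and> b = m2" if "a \<in> keys p" "b \<in> keys q" "a + b = m1 + m2" for a b
  proof -
    have "keys a \<union> keys b = keys m1 \<union> keys m2" using that(3) by (simp only: keys_add_nat[symmetric])
    then have "keys a \<union> keys b \<subseteq> F" using m1(1) m2(1) by (simp add: X_def)
    then have ab: "a \<in> X p" "b \<in> X q" using that by (auto simp: X_def)
    have "\<omega> a + \<omega> b = \<omega> m1 + \<omega> m2" using \<omega>(1) that(3) by metis
    then have "\<omega> a = \<omega> m1" using m1(2)[OF ab(1)] m2(2)[OF ab(2)] by linarith
    then have "a = m1" using \<omega>(2) ab m1 by (auto dest: inj_onD)
    then show ?thesis using that(3) by simp
  qed
  have "lookup (p * q) (m1 + m2) = (\<Sum>a\<in>keys p. \<Sum>b\<in>keys q. if a = m1 \<and> b = m2 then lookup p a * lookup q b else 0)"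
    unfolding times_sum_keys lookup_sum
    using uniq by (intro sum.cong refl) (auto simp: lookup_single when_def)
  also have "\<dots> = (\<Sum>a\<in>keys p. if a = m1 then lookup p m1 * lookup q m2 else 0)"
    using m2(1) by (intro sum.cong refl) (auto simp: X_def)
  also have "\<dots> = lookup p m1 * lookup q m2" using m1(1) by (simp add: X_def)
  also have "\<dots> \<noteq> 0" using m1(1) m2(1) by (simp add: X_def in_keys_iff)
  finally have "m1 + m2 \<in> keys (p * q)" by (simp add: in_keys_iff)
  moreover have "keys (m1 + m2) \<subseteq> F" using m1(1) m2(1) by (simp add: X_def keys_add_nat)
  ultimately show False using pq by (simp add: face_prime_def)
qed

section \<open>Ideals of a quotient ring through their representatives\<close>

context
  fixes V :: "'v set" and I :: "'v cpoly set" and \<pi> :: "'v cpoly \<Rightarrow> 'v cpoly set"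
  assumes I: "ideal I (poly_ring V)"
  defines "\<pi> \<equiv> (+>\<^bsub>poly_ring V\<^esub>) I"
begin

lemma proj_hom: "ring_hom_ring (poly_ring V) (poly_ring V Quot I) \<pi>"
  unfolding \<pi>_def by (rule ideal.rcos_ring_hom_ring[OF I])

lemma carrier_Quot: "carrier (poly_ring V Quot I) = \<pi> ` Polys V"
  unfolding FactRing_def \<pi>_def by (auto simp: A_RCOSETS_def')

lemma proj_mult: "p \<in> Polys V \<Longrightarrow> q \<in> Polys V \<Longrightarrow> \<pi> p \<otimes>\<^bsub>poly_ring V Quot I\<^esub> \<pi> q = \<pi> (p * q)"
  using ring_hom_mult[OF ring_hom_ring.homh[OF proj_hom], of p q] by simp

lemma proj_mem_iff:
  assumes J: "ideal J (poly_ring V)" "I \<subseteq> J" and p: "p \<in> Polys V"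
  shows "\<pi> p \<in> \<pi> ` J \<longleftrightarrow> p \<in> J"
proof
  assume "\<pi> p \<in> \<pi> ` J"
  then obtain q where q: "q \<in> J" "\<pi> p = \<pi> q" by blast
  then have "p \<ominus>\<^bsub>poly_ring V\<^esub> q \<in> I"
    using poly_ring.quotient_eq_iff_same_a_r_cos[OF I p, of q] ideal_sub[OF J(1)] by (simp add: \<pi>_def)
  then have "p - q \<in> I" using a_inv_poly_ring[of q V] ideal_sub[OF J(1)] q by (simp add: a_minus_def)
  then have "(p - q) + q \<in> J" using J q by (intro ideal_add[OF J(1)]) auto
  then show "p \<in> J" by simp
qed blast

lemma proj_ideal: "ideal J (poly_ring V) \<Longrightarrow> ideal (\<pi> ` J) (poly_ring V Quot I)"
  unfolding \<pi>_def by (rule poly_ring.ring_ideal_imp_quot_ideal[OF I])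

text \<open>Both inclusions are minimality: the right side is an ideal of the quotient, and the
  preimage of the left side is an ideal upstairs that contains \<open>I\<close> and
  \<open>X\<close>.\<close>

lemma proj_Idl:
  assumes X: "X \<subseteq> Polys V"
  shows "Idl\<^bsub>poly_ring V Quot I\<^esub> (\<pi> ` X) = \<pi> ` (Idl\<^bsub>poly_ring V\<^esub> (I \<union> X))"
proof
  interpret Q: ring "poly_ring V Quot I" by (rule ideal.quotient_is_ring[OF I])
  have sub: "I \<union> X \<subseteq> Polys V" using ideal_sub[OF I] X by auto
  show "Idl\<^bsub>poly_ring V Quot I\<^esub> (\<pi> ` X) \<subseteq> \<pi> ` (Idl\<^bsub>poly_ring V\<^esub> (I \<union> X))"
    by (rule Q.genideal_minimal[OF proj_ideal[OF Idl_ideal[OF sub]]]) (use Idl_gen[OF sub] in auto)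
  have piX: "\<pi> ` X \<subseteq> carrier (poly_ring V Quot I)" using X by (auto simp: carrier_Quot)
  have id: "ideal (Idl\<^bsub>poly_ring V Quot I\<^esub> (\<pi> ` X)) (poly_ring V Quot I)" by (rule Q.genideal_ideal[OF piX])
  have "Idl\<^bsub>poly_ring V\<^esub> (I \<union> X) \<subseteq> {p \<in> Polys V. \<pi> p \<in> Idl\<^bsub>poly_ring V Quot I\<^esub> (\<pi> ` X)}"
  proof (rule Idl_least)
    show "ideal {p \<in> Polys V. \<pi> p \<in> Idl\<^bsub>poly_ring V Quot I\<^esub> (\<pi> ` X)} (poly_ring V)"
      by (rule ring_hom_ring.ideal_vimage[OF proj_hom id])
    have "\<pi> p \<in> Idl\<^bsub>poly_ring V Quot I\<^esub> (\<pi> ` X)" if "p \<in> I" for p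
    proof -
      have "\<pi> p = I" unfolding \<pi>_def using that ideal.Icarr[OF I] 
        by (metis I ideal_def additive_subgroup.a_subgroup a_r_coset_def poly_ring.add.coset_join2 partial_object.select_convs(1))
      also have "I = \<zero>\<^bsub>poly_ring V Quot I\<^esub>" by (simp add: FactRing_def)
      finally show ?thesis using additive_subgroup.zero_closed[OF ideal.axioms(1)[OF id]] by simp
    qed
    then show "I \<union> X \<subseteq> {p \<in> Polys V. \<pi> p \<in> Idl\<^bsub>poly_ring V Quot I\<^esub> (\<pi> ` X)}"
      using sub Q.genideal_self[OF piX] by auto
  qed
  then show "\<pi> ` (Idl\<^bsub>poly_ring V\<^esub> (I \<union> X)) \<subseteq> Idl\<^bsub>poly_ring V Quot I\<^esub> (\<pi> ` X)" by auto
qed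

end

text \<open>A flag of faces below \<open>F\<close> gives a chain of \<open>r + 1\<close> primes
  ending in the irrelevant ideal \<open>M\<close>, whose height is therefore at least
  \<open>r\<close>. The hypothesis turns height into depth, hence into a regular sequence in
  \<open>M\<close>, which is cut to length \<open>r\<close> and lifted to polynomials.\<close>

lemma cohen_macaulay_regular_sequence:
  fixes V :: "'n::finite set"
  assumes CM: "cohen_macaulay (sr_ring V \<Delta>)"
    and down: "\<forall>\<tau>\<in>\<Delta>. \<forall>\<tau>'\<subseteq>\<tau>. \<tau>' \<in> \<Delta>"
    and F: "F \<in> \<Delta>" "F \<subseteq> V" "card F = r"
  obtains y where "\<And>k. k < r \<Longrightarrow> y k \<in> face_prime V {}"
    "\<And>k p. k < r \<Longrightarrow> p \<in> Polys V \<Longrightarrow> y k * p \<in> Idl\<^bsub>poly_ring V\<^esub> (sr_ideal V \<Delta> \<union> y ` {..<k}) \<Longrightarrow>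
       p \<in> Idl\<^bsub>poly_ring V\<^esub> (sr_ideal V \<Delta> \<union> y ` {..<k})"
proof -
  define I where "I = sr_ideal V \<Delta>"
  define \<pi> where "\<pi> = (+>\<^bsub>poly_ring V\<^esub>) I"
  define R where "R = sr_ring V \<Delta>"
  have R: "R = poly_ring V Quot I" by (simp add: R_def sr_ring_def I_def)
  have I: "ideal I (poly_ring V)" unfolding I_def by (rule sr_ideal_ideal)
  have cR: "cring R" using CM by (simp add: R_def cohen_macaulay_def)
  note pm = proj_mem_iff[OF I, folded \<pi>_def] and carr = carrier_Quot[OF I, folded \<pi>_def R]
    and pmult = proj_mult[OF I, folded \<pi>_def R] and pIdl = proj_Idl[OF I, folded \<pi>_def R]
    and pid = proj_ideal[OF I, folded \<pi>_def R]
  have I_sub: "I \<subseteq> face_prime V G" if "G \<in> \<Delta>" for G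
    using that down by (auto simp: I_def sr_ideal_char[OF down] face_prime_def)
  have one_notin: "1 \<notin> face_prime V G" for G by (auto simp: face_prime_def)
  have notcarr: "carrier R \<noteq> \<pi> ` face_prime V G" if G: "G \<in> \<Delta>" for G
  proof -
    have "\<pi> 1 \<notin> \<pi> ` face_prime V G"
      using pm[OF face_prime_ideal I_sub[OF G] Polys_1] one_notin by simp
    moreover have "\<pi> 1 \<in> carrier R" unfolding carr by (rule imageI[OF Polys_1])
    ultimately show ?thesis by auto
  qed
  have prime: "primeideal (\<pi> ` face_prime V G) R" if G: "G \<in> \<Delta>" for G
  proof (rule primeidealI[OF pid[OF face_prime_ideal] cR])
    show "carrier R \<noteq> \<pi> ` face_prime V G" by (rule notcarr[OF G])
    fix a b assume "a \<in> carrier R" "b \<in> carrier R" and ab: "a \<otimes>\<^bsub>R\<^esub> b \<in> \<pi> ` face_prime V G"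
    then obtain p q where pq: "p \<in> Polys V" "q \<in> Polys V" "a = \<pi> p" "b = \<pi> q" unfolding carr by blast
    then have "\<pi> (p * q) \<in> \<pi> ` face_prime V G" using ab pmult by simp
    then have "p * q \<in> face_prime V G"
      using pm[OF face_prime_ideal I_sub[OF G] Polys_mult[OF pq(1,2)]] by simp
    then show "a \<in> \<pi> ` face_prime V G \<or> b \<in> \<pi> ` face_prime V G"
      using face_prime_prime[OF pq(1,2)] pq(3,4) by auto
  qed
  define M where "M = \<pi> ` face_prime V {}"
  have empty: "{} \<in> \<Delta>" using down F(1) by blast
  \<comment> \<open>A polynomial outside the irrelevant ideal differs from a nonzero constant by a
    member of it, so any larger ideal contains 1.\<close>
  have max: "maximalideal M R"
    unfolding M_def
  proof (rule maximalidealI[OF pid[OF face_prime_ideal]])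
    show "carrier R \<noteq> \<pi> ` face_prime V {}" by (rule notcarr[OF empty])
    fix J assume J: "ideal J R" "\<pi> ` face_prime V {} \<subseteq> J" "J \<subseteq> carrier R"
    define J' where "J' = {p \<in> Polys V. \<pi> p \<in> J}"
    have J': "ideal J' (poly_ring V)"
      unfolding J'_def using ring_hom_ring.ideal_vimage[OF proj_hom[OF I]] J(1) R \<pi>_def by auto
    show "J = \<pi> ` face_prime V {} \<or> J = carrier R"
    proof (cases "J' \<subseteq> face_prime V {}")
      case True
      have "x \<in> \<pi> ` face_prime V {}" if "x \<in> J" for x
      proof -
        obtain p where "p \<in> Polys V" "x = \<pi> p" using J(3) \<open>x \<in> J\<close> carr by auto
        then show ?thesis using True \<open>x \<in> J\<close> by (auto simp: J'_def)
      qed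
      then have "J \<subseteq> \<pi> ` face_prime V {}" by blast
      then show ?thesis using J by auto
    next
      case False
      then obtain p where p: "p \<in> J'" "p \<notin> face_prime V {}" by blast
      define c where "c = lookup p 0"
      have "0 \<in> keys p" using p by (auto simp: J'_def face_prime_def)
      then have c: "c \<noteq> 0" by (simp add: c_def in_keys_iff)
      have pV: "p \<in> Polys V" using p by (simp add: J'_def)
      have "lookup (p - pconst c) 0 = 0" by (simp add: lookup_minus c_def pconst_def)
      then have "m \<noteq> 0" if "m \<in> keys (p - pconst c)" for m using that by (auto simp: in_keys_iff)
      then have "p - pconst c \<in> face_prime V {}"
        using pV by (auto simp: face_prime_def intro: Polys_diff)
      then have "p - pconst c \<in> J'" using J(2) by (auto simp: J'_def face_prime_def)
      then have "pconst c \<in> J'" using ideal_diff[OF J' p(1), of "p - pconst c"] by simp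
      then have "pconst (inverse c) * pconst c \<in> J'" by (rule ideal_mult[OF J' Polys_pconst])
      then have "1 \<in> J'" using c by (simp add: pconst_mult[symmetric])
      then have "Polys V \<subseteq> J'" using ideal_mult[OF J', of _ 1] by auto
      then have "carrier R \<subseteq> J" by (auto simp: carr J'_def)
      then show ?thesis using J(3) by auto
    qed
  qed
  have height: "enat r \<le> prime_height R M"
  proof -
    obtain f where "bij_betw f {0..<r} F"
      using ex_bij_betw_nat_finite[OF finite[of F]] F(3) by auto
    then have f: "F = f ` {0..<r}" "inj_on f {0..<r}" by (auto simp: bij_betw_def)
    \<comment> \<open>\<open>G i\<close> drops the first \<open>i\<close> vertices of
      \<open>F\<close>. Fewer vertices give a larger prime, and \<open>pvar (f i)\<close> witnesses
      strictness.\<close>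
    define G where "G i = f ` {i..<r}" for i
    have GF: "G i \<subseteq> F" for i using f by (auto simp: G_def)
    have GD: "G i \<in> \<Delta>" for i using GF down F by blast
    define C where "C i = \<pi> ` face_prime V (G i)" for i
    have "C i \<subset> C (Suc i)" if i: "i < r" for i
    proof
      have "G (Suc i) \<subseteq> G i" by (auto simp: G_def)
      then have "face_prime V (G i) \<subseteq> face_prime V (G (Suc i))" by (auto simp: face_prime_def)
      then show "C i \<subseteq> C (Suc i)" unfolding C_def by blast
      have "f i \<notin> G (Suc i)" using f(2) i by (auto simp: G_def dest: inj_onD)
      moreover have "f i \<in> V" "f i \<in> G i" using f i F by (auto simp: G_def)
      ultimately have "pvar (f i) \<in> face_prime V (G (Suc i))" "pvar (f i) \<notin> face_prime V (G i)"
        by (auto simp: face_prime_def)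
      moreover have "pvar (f i) \<in> Polys V" using \<open>f i \<in> V\<close> by simp
      ultimately have "\<pi> (pvar (f i)) \<in> C (Suc i)" "\<pi> (pvar (f i)) \<notin> C i"
        using pm[OF face_prime_ideal I_sub[OF GD]] by (simp_all add: C_def)
      then show "C i \<noteq> C (Suc i)" by auto
    qed
    moreover have "C r = M" by (simp add: C_def M_def G_def)
    ultimately have "enat r \<in> {enat k | k. \<exists>C :: nat \<Rightarrow> _. (\<forall>i\<le>k. primeideal (C i) R) \<and> (\<forall>i<k. C i \<subset> C (Suc i)) \<and> C k = M}"
      using prime[OF GD] by (intro CollectI exI[of _ r] conjI refl exI[of _ C]) (auto simp: C_def)
    then show ?thesis unfolding prime_height_def by (rule Sup_upper)
  qed
  then have depth: "enat r \<le> ideal_depth R M" using CM max by (simp add: cohen_macaulay_def R_def)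
  have "\<exists>xs. regular_sequence R xs \<and> set xs \<subseteq> M \<and> r \<le> length xs"
  proof (rule ccontr)
    assume n: "\<not> ?thesis"
    have "[] \<in> {xs. length xs < r}"
    proof (rule ccontr)
      assume "[] \<notin> {xs. length xs < r}"
      then have "r = 0" by simp
      have "regular_sequence R []"
      proof -
        interpret R: cring R by (rule cR)
        have "Idl\<^bsub>R\<^esub> {} \<subseteq> M" by (rule R.genideal_minimal) (use max in \<open>auto simp: maximalideal_def\<close>)
        moreover have "M \<noteq> carrier R" using max by (metis maximalideal.I_notcarr)
        moreover have "M \<subseteq> carrier R" using pid[OF face_prime_ideal] unfolding M_def
          by (metis ideal.Icarr subsetI)
        ultimately show ?thesis unfolding regular_sequence_def by auto
      qed
      then have "regular_sequence R [] \<and> set [] \<subseteq> M \<and> r \<le> length []" using \<open>r = 0\<close> by simp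
      then show False using n by (metis (no_types))
    qed
    then have r: "r > 0" by simp
    have "ideal_depth R M \<le> enat (r - 1)"
      unfolding ideal_depth_def
    proof (rule Sup_least, clarify)
      fix xs assume "regular_sequence R xs" "set xs \<subseteq> M"
      then have "length xs < r" using n by (meson not_le)
      then show "enat (length xs) \<le> enat (r - 1)" by simp
    qed
    with depth have "enat r \<le> enat (r - 1)" by (rule order_trans)
    then show False using r by simp
  qed
  then obtain xs where xs: "regular_sequence R xs" "set xs \<subseteq> M" "r \<le> length xs" by blast
  have "\<forall>k<r. \<exists>y. y \<in> face_prime V {} \<and> xs ! k = \<pi> y"
  proof (intro allI impI)
    fix k assume "k < r"
    then have "xs ! k \<in> M" using xs(2,3) nth_mem[of k xs] by auto
    then show "\<exists>y. y \<in> face_prime V {} \<and> xs ! k = \<pi> y" unfolding M_def by auto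
  qed
  then obtain y where y: "\<And>k. k < r \<Longrightarrow> y k \<in> face_prime V {}" "\<And>k. k < r \<Longrightarrow> xs ! k = \<pi> (y k)" by metis
  have yV: "y k \<in> Polys V" if "k < r" for k using y(1)[OF that] by (simp add: face_prime_def)
  show ?thesis
  proof (rule that[of y])
    fix k p assume k: "k < r" and p: "p \<in> Polys V"
      and yp: "y k * p \<in> Idl\<^bsub>poly_ring V\<^esub> (sr_ideal V \<Delta> \<union> y ` {..<k})"
    have sub: "I \<union> y ` {..<k} \<subseteq> Polys V" using ideal_sub[OF I] yV k by auto
    have "set (take k xs) = \<pi> ` y ` {..<k}"
    proof -
      have "set (take k xs) = (!) xs ` {0..<k}" using nth_image[of k xs] k xs(3) by simp
      also have "\<dots> = (\<lambda>i. \<pi> (y i)) ` {..<k}" using y(2) k by (intro image_cong) auto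
      finally show ?thesis by (simp add: image_image)
    qed
    then have idl: "Idl\<^bsub>R\<^esub> (set (take k xs)) = \<pi> ` (Idl\<^bsub>poly_ring V\<^esub> (I \<union> y ` {..<k}))"
      using pIdl[of "y ` {..<k}"] sub by auto
    have pm': "\<pi> p \<in> Idl\<^bsub>R\<^esub> (set (take k xs)) \<longleftrightarrow> p \<in> Idl\<^bsub>poly_ring V\<^esub> (I \<union> y ` {..<k})" if "p \<in> Polys V" for p
      unfolding idl by (rule pm[OF Idl_ideal[OF sub] _ that]) (use Idl_gen[OF sub] in auto)
    have "xs ! k \<otimes>\<^bsub>R\<^esub> \<pi> p = \<pi> (y k * p)" using y(2)[OF k] pmult[OF yV[OF k] p] by simp
    moreover have "\<pi> (y k * p) \<in> Idl\<^bsub>R\<^esub> (set (take k xs))"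
      using pm'[OF Polys_mult[OF yV[OF k] p]] yp by (simp add: I_def)
    ultimately have "\<pi> p \<in> Idl\<^bsub>R\<^esub> (set (take k xs))"
      using xs(1,3) k p unfolding regular_sequence_def by (auto simp: carr)
    then show "p \<in> Idl\<^bsub>poly_ring V\<^esub> (sr_ideal V \<Delta> \<union> y ` {..<k})"
      using pm'[OF p] by (simp add: I_def)
  qed (rule y(1))
qed

text \<open>A power of each \<open>y\<close> lies in the ideal of the linear forms, so the Koszul complex of the linear
  forms sees the whole depth of the ring.\<close>

lemma hilbert_series_cohen_macaulay:
  fixes V :: "'n::finite set"
  assumes CM: "cohen_macaulay (sr_ring V \<Delta>)"
    and down: "\<forall>\<tau>\<in>\<Delta>. \<forall>\<tau>'\<subseteq>\<tau>. \<tau>' \<in> \<Delta>"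
    and F: "F \<in> \<Delta>" "F \<subseteq> V" "card F = r"
    and l: "\<And>j. j < r \<Longrightarrow> l j \<in> Polys V \<and> homog 1 (l j)"
    and nil: "\<And>m. keys m \<subseteq> V \<Longrightarrow> mdeg m > N \<Longrightarrow> pmon m \<in> Idl\<^bsub>poly_ring V\<^esub> (sr_ideal V \<Delta> \<union> l ` {..<r})"
  shows "hilbert_series V (Idl\<^bsub>poly_ring V\<^esub> (sr_ideal V \<Delta> \<union> l ` {..<r})) =
    hilbert_series V (sr_ideal V \<Delta>) * (1 - fps_X) ^ r"
proof -
  define I where "I = sr_ideal V \<Delta>"
  have I: "ideal I (poly_ring V)" unfolding I_def by (rule sr_ideal_ideal)
  obtain y where y: "\<And>k. k < r \<Longrightarrow> y k \<in> face_prime V {}"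
    "\<And>k p. k < r \<Longrightarrow> p \<in> Polys V \<Longrightarrow> y k * p \<in> Idl\<^bsub>poly_ring V\<^esub> (sr_ideal V \<Delta> \<union> y ` {..<k}) \<Longrightarrow>
       p \<in> Idl\<^bsub>poly_ring V\<^esub> (sr_ideal V \<Delta> \<union> y ` {..<k})"
    using cohen_macaulay_regular_sequence[OF CM down F] by blast
  have yV: "y k \<in> Polys V" if "k < r" for k using y(1)[OF that] by (simp add: face_prime_def)
  have subl: "I \<union> l ` {..<r} \<subseteq> Polys V" using ideal_sub[OF I] l by auto
  \<comment> \<open>Exponents in the irrelevant ideal are nonzero, so a \<open>k\<close>-th power
    has order at least \<open>k\<close>; hence \<open>y k ^ Suc N\<close> consists of monomials
    covered by \<open>nil\<close>.\<close>
  have low: "mdeg m \<ge> k" if p: "p \<in> face_prime V {}" and m: "m \<in> keys (p ^ k)" for p k m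
    using m
  proof (induction k arbitrary: m)
    case (Suc k)
    have "m \<in> keys (p * p ^ k)" using Suc.prems by simp
    then show ?case
    proof (rule keys_mult_mem)
      fix a b assume ab: "a \<in> keys p" "b \<in> keys (p ^ k)" "m = a + b"
      have "a \<noteq> 0" using ab(1) p by (auto simp: face_prime_def)
      then have "mdeg a \<noteq> 0" using mdeg_eq_0_iff by blast
      then show ?thesis using Suc.IH[OF ab(2)] ab(3) by (simp add: mdeg_add)
    qed
  qed simp
  have "kexact V r l (Idl\<^bsub>poly_ring V\<^esub> (I \<union> y ` {..<0})) 1"
  \<comment> \<open>The target is degree 1: with \<open>s = r\<close> the condition
    \<open>1 + r > r\<close> holds with nothing to spare.\<close>
  proof (rule kexact_regular_sequence[where s = r and J = "\<lambda>k. Idl\<^bsub>poly_ring V\<^esub> (I \<union> y ` {..<k})" and y = y])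
    show "ideal (Idl\<^bsub>poly_ring V\<^esub> (I \<union> y ` {..<k})) (poly_ring V)" if "k \<le> r" for k
      using ideal_sub[OF I] yV that by (intro Idl_ideal) auto
    show "Idl\<^bsub>poly_ring V\<^esub> (I \<union> y ` {..<Suc k}) = Idl\<^bsub>poly_ring V\<^esub> (insert (y k) (Idl\<^bsub>poly_ring V\<^esub> (I \<union> y ` {..<k})))"
      if "k < r" for k
      using yV that by (intro Idl_Un_Suc[OF I]) auto
    show "\<exists>N. y k ^ N \<in> Idl\<^bsub>poly_ring V\<^esub> (Idl\<^bsub>poly_ring V\<^esub> (I \<union> y ` {..<0}) \<union> l ` {..<r})" if k: "k < r" for k
    proof -
      have s: "Idl\<^bsub>poly_ring V\<^esub> (I \<union> y ` {..<0}) \<union> l ` {..<r} \<subseteq> Polys V"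
        using ideal_sub[OF Idl_ideal[of "I \<union> y ` {..<0}"]] ideal_sub[OF I] l by auto
      have s0: "I \<union> y ` {..<0} \<subseteq> Polys V" using ideal_sub[OF I] by auto
      have mono: "Idl\<^bsub>poly_ring V\<^esub> (I \<union> l ` {..<r}) \<subseteq> Idl\<^bsub>poly_ring V\<^esub> (Idl\<^bsub>poly_ring V\<^esub> (I \<union> y ` {..<0}) \<union> l ` {..<r})"
        using Idl_gen[OF s0] by (intro Idl_mono[OF _ s]) auto
      have "single m (lookup (y k ^ Suc N) m) \<in> Idl\<^bsub>poly_ring V\<^esub> (I \<union> l ` {..<r})" if m: "m \<in> keys (y k ^ Suc N)" for m
      proof -
        have "keys m \<subseteq> V" using Polys_power[OF yV[OF k], of "Suc N"] m by (auto simp: carrier_poly_ring simp del: power_Suc)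
        moreover have "mdeg m > N" using low[OF y(1)[OF k] m] by simp
        ultimately show ?thesis
          unfolding single_eq_pconst_pmon I_def
          by (intro ideal_mult[OF Idl_ideal[OF subl[unfolded I_def]] Polys_pconst] nil)
      qed
      then have "(\<Sum>m\<in>keys (y k ^ Suc N). single m (lookup (y k ^ Suc N) m)) \<in> Idl\<^bsub>poly_ring V\<^esub> (I \<union> l ` {..<r})"
        by (intro ideal_sum[OF Idl_ideal[OF subl]])
      then have "y k ^ Suc N \<in> Idl\<^bsub>poly_ring V\<^esub> (I \<union> l ` {..<r})"
        by (simp only: poly_sum_single[symmetric])
      then show ?thesis using mono by blast
    qed
  qed (use l yV y(2) in \<open>auto simp: I_def\<close>)
  moreover have "Idl\<^bsub>poly_ring V\<^esub> (I \<union> y ` {..<0}) = I"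
    using Idl_least[OF I, of I] Idl_gen[of I V] ideal_sub[OF I] by auto
  ultimately have "kexact V r l I 1" by simp
  then have "koszul1 V r l I"
    using l sr_ideal_homog_closed unfolding I_def by (intro kexact_koszul1 sr_ideal_ideal) auto
  then show ?thesis
    using l sr_ideal_homog_closed unfolding I_def by (intro hilbert_series_koszul sr_ideal_ideal) auto
qed

section \<open>Integer kernels\<close>

lemma int_kernel_iff: "u \<in> int_kernel A \<longleftrightarrow> (\<forall>k. (\<Sum>j\<in>UNIV. A $ k $ j * u $ j) = 0)"
  by (simp add: int_kernel_def matrix_vector_mult_def vec_eq_iff)

lemma common_denominator:
  fixes c :: "'a \<Rightarrow> rat"
  assumes "finite X"
  shows "\<exists>N::int. N > 0 \<and> (\<forall>j\<in>X. \<exists>z. of_int N * c j = of_int z)"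
  using assms
proof (induction X rule: finite_induct)
  case empty
  show ?case by (intro exI[of _ 1]) simp
next
  case (insert x X)
  then obtain N where N: "N > 0" "\<forall>j\<in>X. \<exists>z. of_int N * c j = of_int z" by blast
  obtain a b where ab: "quotient_of (c x) = (a, b)" by fastforce
  then have b: "b > 0" "c x = of_int a / of_int b"
    using quotient_of_denom_pos quotient_of_div by blast+
  have "\<exists>z. of_int (b * N) * c j = of_int z" if jX: "j \<in> insert x X" for j
  proof (cases "j = x")
    case True
    then have "of_int (b * N) * c j = of_int (N * a)" using b by simp
    then show ?thesis by blast
  next
    case False
    then obtain z where "of_int N * c j = of_int z" using N(2) jX False by auto
    then have "of_int (b * N) * c j = of_int (b * z)" by (simp add: mult.assoc)
    then show ?thesis by blast
  qed
  then show ?case using N b by (intro exI[of _ "b * N"]) simp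
qed

lemma rational_kernel_integral:
  fixes A :: "int ^ 'n::finite ^ 'd::finite" and c :: "'n \<Rightarrow> rat"
  assumes c: "\<And>k. (\<Sum>j\<in>UNIV. of_int (A $ k $ j) * c j) = 0"
  shows "\<exists>N u. N > 0 \<and> u \<in> int_kernel A \<and> (\<forall>j. of_int (u $ j) = of_int N * c j)"
proof -
  obtain N where N: "N > 0" "\<forall>j\<in>UNIV. \<exists>z. of_int N * c j = of_int z"
    using common_denominator[of "UNIV :: 'n set" c] by auto
  obtain z where z: "\<And>j. of_int N * c j = of_int (z j)" using bchoice[OF N(2)] by auto
  have "(\<Sum>j\<in>UNIV. A $ k $ j * z j) = 0" for k
  proof -
    have "of_int (\<Sum>j\<in>UNIV. A $ k $ j * z j) = (\<Sum>j\<in>UNIV. of_int N * (of_int (A $ k $ j) * c j))"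
      by (simp add: z[symmetric] mult_ac)
    also have "\<dots> = 0" by (simp add: sum_distrib_left[symmetric] c)
    finally show ?thesis by (simp only: of_int_eq_0_iff)
  qed
  then have "(\<chi> j. z j) \<in> int_kernel A" by (simp add: int_kernel_iff)
  then show ?thesis using N z by (intro exI[of _ N] exI[of _ "\<chi> j. z j"]) simp
qed

section \<open>Linear independence of columns\<close>

definition rcol :: "int ^ 'n::finite ^ 'd::finite \<Rightarrow> 'n \<Rightarrow> rat ^ 'd" where
  "rcol A j = (\<chi> k. of_int (A $ k $ j))"

text \<open>Independence over the rationals, stated with integer kernel vectors because these split
  into pairs of exponents of toric binomials.\<close>

definition col_indep :: "int ^ 'n::finite ^ 'd::finite \<Rightarrow> 'n set \<Rightarrow> bool" where
  "col_indep A \<sigma> \<longleftrightarrow> (\<forall>u\<in>int_kernel A. (\<forall>j. j \<notin> \<sigma> \<longrightarrow> u $ j = 0) \<longrightarrow> u = 0)"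

lemma col_indep_mono: "col_indep A \<sigma> \<Longrightarrow> \<tau> \<subseteq> \<sigma> \<Longrightarrow> col_indep A \<tau>"
  by (auto simp: col_indep_def)

text \<open>Clearing denominators turns a rational relation into an integer kernel vector supported
  in \<sigma>.\<close>

lemma col_indep_rational:
  fixes A :: "int ^ 'n::finite ^ 'd::finite"
  assumes \<sigma>: "col_indep A \<sigma>" and c: "(\<Sum>j\<in>\<sigma>. c j *s rcol A j) = 0" and j: "j \<in> \<sigma>"
  shows "c j = 0"
proof -
  define c' where "c' j = (if j \<in> \<sigma> then c j else 0)" for j
  have "(\<Sum>j\<in>UNIV. of_int (A $ k $ j) * c' j) = 0" for k
  proof -
    have "(\<Sum>j\<in>UNIV. of_int (A $ k $ j) * c' j) = (\<Sum>j\<in>\<sigma>. of_int (A $ k $ j) * c j)"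
      by (rule sum.mono_neutral_cong_right) (auto simp: c'_def)
    also have "\<dots> = (\<Sum>j\<in>\<sigma>. c j *s rcol A j) $ k" by (simp add: rcol_def mult.commute)
    finally show ?thesis using c by simp
  qed
  then obtain N u where u: "N > 0" "u \<in> int_kernel A" "\<And>j. of_int (u $ j) = of_int N * c' j"
    using rational_kernel_integral[of A c'] by auto
  have "u $ j = 0" if "j \<notin> \<sigma>" for j
  proof -
    have "of_int (u $ j) = (0 :: rat)" using u(3)[of j] that by (simp add: c'_def)
    then show ?thesis by simp
  qed
  then have "u = 0" using \<sigma> u(2) by (auto simp: col_indep_def)
  then have "of_int N * c' j = 0" using u(3)[of j] by simp
  then show ?thesis using u(1) j by (simp add: c'_def)
qed

lemma col_indep_inj:
  assumes \<sigma>: "col_indep A \<sigma>" shows "inj_on (rcol A) \<sigma>"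
proof (rule inj_onI, rule ccontr)
  fix x y assume xy: "x \<in> \<sigma>" "y \<in> \<sigma>" "rcol A x = rcol A y" "x \<noteq> y"
  define c :: "_ \<Rightarrow> rat" where "c j = (if j = x then 1 else if j = y then - 1 else 0)" for j
  have "(\<Sum>j\<in>\<sigma>. c j *s rcol A j) = (\<Sum>j\<in>{x, y}. c j *s rcol A j)"
    using xy by (intro sum.mono_neutral_right) (auto simp: c_def)
  also have "\<dots> = 0" using xy by (simp add: c_def)
  finally have "c x = 0" by (rule col_indep_rational[OF \<sigma> _ xy(1)])
  then show False by (simp add: c_def)
qed

lemma col_indep_independent:
  assumes \<sigma>: "col_indep A \<sigma>" shows "vec.independent (rcol A ` \<sigma>)"
proof (rule vec.independent_if_scalars_zero)
  fix f x assume f: "(\<Sum>x\<in>rcol A ` \<sigma>. f x *s x) = 0" and "x \<in> rcol A ` \<sigma>"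
  then obtain j where j: "j \<in> \<sigma>" "x = rcol A j" by blast
  have "(\<Sum>j\<in>\<sigma>. f (rcol A j) *s rcol A j) = 0"
    using f by (simp add: sum.reindex[OF col_indep_inj[OF \<sigma>]])
  then show "f x = 0" using col_indep_rational[OF \<sigma> _ j(1), of "\<lambda>j. f (rcol A j)"] j(2) by simp
qed simp

text \<open>A linear functional can take prescribed values on independent columns. Its coefficients
  combine the rows of \<open>A\<close> into a form that isolates the variable \<open>i\<close>
  within \<sigma>, the elimination step of every row reduction below.\<close>

lemma row_combination:
  fixes A :: "int ^ 'n::finite ^ 'd::finite"
  assumes \<sigma>: "col_indep A \<sigma>" and i: "i \<in> \<sigma>"
  obtains r :: "'d \<Rightarrow> complex" where
    "\<And>j. j \<in> \<sigma> \<Longrightarrow> (\<Sum>k\<in>UNIV. r k * of_int (A $ k $ j)) = (if j = i then 1 else 0)"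
proof -
  \<comment> \<open>The functional is read off from one coordinate of a linear map, and any
    coordinate serves.\<close>
  define k0 :: 'd where "k0 = undefined"
  obtain f where f: "Vector_Spaces.linear (*s) (*s) f"
    "\<forall>x\<in>rcol A ` \<sigma>. f x = (if x = rcol A i then axis k0 1 else (0 :: rat ^ 'd))"
    using vec.linear_independent_extend[OF col_indep_independent[OF \<sigma>],
      of "\<lambda>x. if x = rcol A i then axis k0 1 else (0 :: rat ^ 'd)"] by blast
  define r :: "'d \<Rightarrow> complex" where "r k = of_rat (matrix f $ k0 $ k)" for k
  have "(\<Sum>k\<in>UNIV. r k * of_int (A $ k $ j)) = (if j = i then 1 else (0::complex))" if j: "j \<in> \<sigma>" for j
  proof -
    have "(\<Sum>k\<in>UNIV. r k * of_int (A $ k $ j)) = of_rat (\<Sum>k\<in>UNIV. matrix f $ k0 $ k * of_int (A $ k $ j))"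
      by (simp add: r_def of_rat_sum of_rat_mult)
    also have "(\<Sum>k\<in>UNIV. matrix f $ k0 $ k * of_int (A $ k $ j)) = (matrix f *v rcol A j) $ k0"
      by (simp add: matrix_vector_mult_def rcol_def)
    also have "\<dots> = f (rcol A j) $ k0" by (simp add: matrix_works[OF f(1)])
    also have "\<dots> = (if j = i then 1 else 0)"
      using f(2) j i col_indep_inj[OF \<sigma>] by (auto simp: axis_def dest: inj_onD)
    finally show ?thesis by simp
  qed
  then show ?thesis by (rule that)
qed

lemma dependent_columns:
  fixes A :: "int ^ 'n::finite ^ 'd::finite"
  assumes "card T > CARD('d)"
  shows "\<not> col_indep A T"
proof
  assume T: "col_indep A T"
  have "card (rcol A ` T) = card T" by (rule card_image[OF col_indep_inj[OF T]])
  moreover have "card (rcol A ` T) \<le> vec.dim (rcol A ` T)"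
    using vec.independent_bound_general[OF col_indep_independent[OF T]] by simp
  moreover have "vec.dim (rcol A ` T) \<le> CARD('d)"
    using vec.dim_subset_UNIV[of "rcol A ` T"] by (simp add: vec.dimension_def card_cart_basis)
  ultimately show False using assms by simp
qed

text \<open>Adding \<open>j\<close> exceeds \<open>d\<close> columns and forces a relation; it
  involves \<open>j\<close> since \<sigma> alone is independent.\<close>

lemma circuit_through:
  fixes A :: "int ^ 'n::finite ^ 'd::finite"
  assumes \<sigma>: "col_indep A \<sigma>" "card \<sigma> = CARD('d)" and j: "j \<notin> \<sigma>"
  obtains u where "u \<in> int_kernel A" "u $ j \<noteq> 0" "\<And>i. i \<notin> insert j \<sigma> \<Longrightarrow> u $ i = 0"
proof -
  have "card (insert j \<sigma>) > CARD('d)" using \<sigma> j by simp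
  then obtain u where u: "u \<in> int_kernel A" "\<forall>i. i \<notin> insert j \<sigma> \<longrightarrow> u $ i = 0" "u \<noteq> 0"
    using dependent_columns[of "insert j \<sigma>" A] unfolding col_indep_def by blast
  have "u $ j \<noteq> 0"
  proof
    assume "u $ j = 0"
    then have "\<forall>i. i \<notin> \<sigma> \<longrightarrow> u $ i = 0" using u(2) by auto
    then show False using \<sigma>(1) u unfolding col_indep_def by blast
  qed
  then show ?thesis using that u by blast
qed

section \<open>Toric ideals\<close>

definition mk_exp :: "('n::finite \<Rightarrow> nat) \<Rightarrow> ('n \<Rightarrow>\<^sub>0 nat)" where
  "mk_exp f = Abs_poly_mapping f"

lemma lookup_mk_exp [simp]: "lookup (mk_exp f) j = f j"
  by (simp add: mk_exp_def)

lemma exp_vec_nth [simp]: "exp_vec a $ j = int (lookup a j)"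
  by (simp add: exp_vec_def)

lemma exp_vec_add: "exp_vec (a + b) = exp_vec a + exp_vec b"
  by (simp add: vec_eq_iff lookup_add)

lemma exp_vec_diff_kernel: "exp_vec a - exp_vec b \<in> int_kernel A \<longleftrightarrow> A *v exp_vec a = A *v exp_vec b"
  by (simp add: int_kernel_def matrix_vector_mult_diff_distrib)

lemma weight_add: "weight w (a + b) = weight w a + weight w b"
proof -
  have "rvec (exp_vec (a + b)) = rvec (exp_vec a) + rvec (exp_vec b)"
    by (simp add: rvec_def vec_eq_iff lookup_add)
  then show ?thesis by (simp add: weight_def inner_add_right)
qed

lemma exp_ge_iff: "(\<exists>b. e = a + b) \<longleftrightarrow> (\<forall>j. lookup a j \<le> lookup e j)" for a e :: "'n::finite \<Rightarrow>\<^sub>0 nat"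
proof
  assume "\<forall>j. lookup a j \<le> lookup e j"
  then have "e = a + (e - a)" by (intro poly_mapping_eqI) (simp add: lookup_add lookup_minus)
  then show "\<exists>b. e = a + b" by blast
qed (auto simp: lookup_add)

lemma toric_gens_sub: "{pmon u - pmon u' | u u'. A *v exp_vec u = A *v exp_vec u'} \<subseteq> Polys UNIV"
  by auto

lemma toric_ideal_binomial: "A *v exp_vec a = A *v exp_vec b \<Longrightarrow> pmon a - pmon b \<in> toric_ideal A"
  unfolding toric_ideal_def by (rule Idl_gen[OF toric_gens_sub]) blast

text \<open>A monomial multiple of such a binomial is again one, so the binomials span the ideal as
  a vector space and linear conditions on it need checking on binomials only.\<close>

lemma toric_ideal_span:
  assumes "p \<in> toric_ideal A"
  shows "p \<in> cpoly.span {pmon a - pmon b | a b. A *v exp_vec a = A *v exp_vec b}" (is "_ \<in> cpoly.span ?S")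
  using assms[unfolded toric_ideal_def] toric_gens_sub
proof (induction rule: Idl_induct)
  case (mult c s)
  then obtain a b where s: "s = pmon a - pmon b" "A *v exp_vec a = A *v exp_vec b" by blast
  have "c * (pmon a - pmon b) \<in> cpoly.span ?S"
  proof (induction c rule: cpoly_induct)
    case (single k x)
    have "single k x * (pmon a - pmon b) = cscale x (pmon (k + a) - pmon (k + b))"
      by (simp add: single_eq_pconst_pmon cscale_def pmon_add right_diff_distrib mult_ac)
    moreover have "pmon (k + a) - pmon (k + b) \<in> ?S"
    proof (rule CollectI, rule exI[of _ "k + a"], rule exI[of _ "k + b"], rule conjI[OF refl])
      show "A *v exp_vec (k + a) = A *v exp_vec (k + b)"
        using s(2) by (simp add: exp_vec_add matrix_vector_right_distrib)
    qed
    ultimately show ?case by (simp add: cpoly.span_scale cpoly.span_base)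
  qed (auto simp: distrib_right cpoly.span_add cpoly.span_zero)
  then show ?case by (simp add: s)
qed (auto intro: cpoly.span_zero cpoly.span_add)

text \<open>The sum \<open>fs\<close> of the coefficients over one fibre of \<open>A\<close> is
  linear and vanishes on all generating binomials, hence on the ideal; it separates exponents of
  different fibres.\<close>

lemma toric_binomial_iff:
  assumes "pmon a - pmon b \<in> toric_ideal A"
  shows "A *v exp_vec a = A *v exp_vec b"
proof (rule ccontr)
  assume n: "A *v exp_vec a \<noteq> A *v exp_vec b"
  define fs where "fs p = (\<Sum>m\<in>keys p. if A *v exp_vec m = A *v exp_vec a then lookup p m else 0)" for p :: "'a cpoly"
  have fs_add: "fs (p + q) = fs p + fs q" for p q
    unfolding fs_def by (rule setsum_keys_plus_distrib) auto
  have fs_single: "fs (single m c) = (if A *v exp_vec m = A *v exp_vec a then c else 0)" for m c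
    by (cases "c = 0") (auto simp: fs_def)
  have fs_0: "fs 0 = 0" by (simp add: fs_def)
  have fs_scale: "fs (cscale c p) = c * fs p" for c p
    by (induction p rule: cpoly_induct)
      (auto simp: fs_add fs_single fs_0 distrib_left cpoly.scale_right_distrib cscale_def pconst_def mult_single)
  have fs_diff: "fs (pmon x - pmon y) = fs (pmon x) - fs (pmon y)" for x y
    using fs_add[of "pmon x - pmon y" "pmon y"] by simp
  have "cpoly.subspace {p. fs p = 0}"
    by (auto simp: cpoly.subspace_def fs_add fs_scale fs_0)
  moreover have "{pmon a - pmon b | a b. A *v exp_vec a = A *v exp_vec b} \<subseteq> {p. fs p = 0}"
    by (auto simp: fs_diff) (simp add: pmon_def fs_single)
  ultimately have "fs (pmon a - pmon b) = 0"
    using toric_ideal_span[OF assms] cpoly.span_minimal by blast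
  then show False using n unfolding fs_diff by (simp add: pmon_def fs_single)
qed

section \<open>Initial forms and the reduced Groebner basis\<close>

lemma lookup_init_form:
  "lookup (init_form w f) m = (if m \<in> keys f \<and> (\<forall>m'\<in>keys f. weight w m' \<le> weight w m) then lookup f m else 0)"
proof -
  have "finite {m \<in> keys f. \<forall>m'\<in>keys f. weight w m' \<le> weight w m}" by simp
  then show ?thesis
    unfolding init_form_def lookup_sum by (simp add: lookup_single when_def sum.delta)
qed

lemma init_gens_sub: "init_form w ` I \<subseteq> Polys UNIV" by auto

lemma init_ideal_ideal: "ideal (init_ideal w I) (poly_ring UNIV)"
  unfolding init_ideal_def by (rule Idl_ideal[OF init_gens_sub])

lemma lookup_binomial:
  assumes "a \<noteq> b"
  shows "lookup (pmon a - pmon b) m = (if m = a then 1 else if m = b then - 1 else 0)"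
    and "keys (pmon a - pmon b) = {a, b}"
proof -
  show *: "lookup (pmon a - pmon b) m = (if m = a then 1 else if m = b then - 1 else 0)" for m
    using assms by (auto simp: lookup_minus pmon_def lookup_single when_def)
  show "keys (pmon a - pmon b) = {a, b}"
    by (auto simp: in_keys_iff * split: if_splits)
qed

locale toric_groebner =
  fixes A :: "int ^ 'n::finite ^ 'd::finite" and w :: "real ^ 'n" and m :: nat
    and gp gm :: "nat \<Rightarrow> ('n \<Rightarrow>\<^sub>0 nat)" and g :: "nat \<Rightarrow> int ^ 'n"
  assumes hyper: "columns_in_affine_hyperplane A"
    and generic: "generic_weight A w"
    and gb: "reduced_groebner_basis w (toric_ideal A) {pmon (gp i) - pmon (gm i) | i. i < m}"
    and gp_init: "\<forall>i<m. pmon (gp i) \<in> init_ideal w (toric_ideal A)"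
    and g_def: "\<forall>i<m. g i = exp_vec (gp i) - exp_vec (gm i)"
begin

abbreviation "M \<equiv> init_ideal w (toric_ideal A)"

lemma M_monomial: "p \<in> M \<Longrightarrow> a \<in> keys p \<Longrightarrow> pmon a \<in> M"
proof -
  assume p: "p \<in> M" "a \<in> keys p"
  obtain E where "M = Idl\<^bsub>poly_ring UNIV\<^esub> (pmon ` E)"
    using generic unfolding generic_weight_def monomial_ideal_def by blast
  then have M: "M = {p \<in> Polys UNIV. \<forall>m\<in>keys p. \<exists>e\<in>E. \<exists>b. m = e + b}"
    using monomial_ideal_char[of E UNIV] by simp
  then show "pmon a \<in> M" using p by auto
qed

lemma M_mult: "pmon a \<in> M \<Longrightarrow> pmon (a + b) \<in> M"
  using ideal_mult[OF init_ideal_ideal, of "pmon b" "pmon a"] by (simp add: pmon_add mult.commute)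

text \<open>If the weights differ, the initial form is \<open>pmon a\<close>. If they agree, it is
  the whole binomial, and the monomial ideal \<open>M\<close> contains each of its terms.\<close>

lemma binomial_leading:
  assumes "A *v exp_vec a = A *v exp_vec b" "a \<noteq> b" "weight w a \<ge> weight w b"
  shows "pmon a \<in> M"
proof -
  have "init_form w (pmon a - pmon b) \<in> M"
    unfolding init_ideal_def using toric_ideal_binomial[OF assms(1)] by (intro Idl_gen[OF init_gens_sub]) blast
  moreover have "a \<in> keys (init_form w (pmon a - pmon b))"
    using assms by (simp add: in_keys_iff lookup_init_form lookup_binomial)
  ultimately show ?thesis by (rule M_monomial)
qed

text \<open>The initial form of a basis element is a monomial with coefficient 1, so it is
  \<open>gp i\<close>, as \<open>gm i\<close> has coefficient \<open>- 1\<close>. Since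
  \<open>gm i\<close> does not occur in it, its weight is strictly smaller.\<close>

lemma
  assumes i: "i < m"
  shows gp_neq_gm: "gp i \<noteq> gm i" and weight_gp: "weight w (gm i) < weight w (gp i)"
    and init_gp: "init_form w (pmon (gp i) - pmon (gm i)) = pmon (gp i)"
    and gp_minimal: "pmon (gp i) \<notin> Idl\<^bsub>poly_ring UNIV\<^esub> (init_form w `
       ({pmon (gp i) - pmon (gm i) | i. i < m} - {pmon (gp i) - pmon (gm i)}))"
    and gp_gm_kernel: "A *v exp_vec (gp i) = A *v exp_vec (gm i)"
proof -
  let ?G = "{pmon (gp i) - pmon (gm i) | i. i < m}"
  let ?g = "pmon (gp i) - pmon (gm i)"
  have gG: "?g \<in> ?G" using i by blast
  then obtain k where k: "init_form w ?g = pmon k"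
    "pmon k \<notin> Idl\<^bsub>poly_ring UNIV\<^esub> (init_form w ` (?G - {?g}))"
    using gb unfolding reduced_groebner_basis_def by blast
  have lk: "lookup (init_form w ?g) k = 1" by (simp only: k(1)) (simp add: pmon_def)
  show neq: "gp i \<noteq> gm i"
  proof
    assume "gp i = gm i"
    then show False using lk by (simp add: lookup_init_form)
  qed
  have "k = gp i"
    using lk by (auto simp: lookup_init_form lookup_binomial[OF neq] split: if_splits)
  with k show "init_form w ?g = pmon (gp i)" "pmon (gp i) \<notin> Idl\<^bsub>poly_ring UNIV\<^esub> (init_form w ` (?G - {?g}))"
    by auto
  then have "lookup (init_form w ?g) (gm i) = 0" using neq by (simp add: pmon_def lookup_single when_def)
  then show "weight w (gm i) < weight w (gp i)"
    using neq by (auto simp: lookup_init_form lookup_binomial[OF neq] split: if_splits)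
  have "?g \<in> toric_ideal A" using gb gG unfolding reduced_groebner_basis_def by blast
  then show "A *v exp_vec (gp i) = A *v exp_vec (gm i)" by (rule toric_binomial_iff)
qed

lemma M_iff: "pmon e \<in> M \<longleftrightarrow> (\<exists>i<m. \<forall>j. lookup (gp i) j \<le> lookup e j)"
proof -
  have "init_form w ` {pmon (gp i) - pmon (gm i) | i. i < m} = (\<lambda>i. init_form w (pmon (gp i) - pmon (gm i))) ` {..<m}"
    by auto
  also have "\<dots> = (\<lambda>i. pmon (gp i)) ` {..<m}" by (intro image_cong refl) (simp add: init_gp)
  also have "\<dots> = pmon ` gp ` {..<m}" by (simp add: image_image)
  finally have "M = Idl\<^bsub>poly_ring UNIV\<^esub> (pmon ` gp ` {..<m})"
    using gb unfolding reduced_groebner_basis_def by metis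
  then have "M = {p \<in> Polys UNIV. \<forall>m'\<in>keys p. \<exists>e\<in>gp ` {..<m}. \<exists>b. m' = e + b}"
    using monomial_ideal_char[of "gp ` {..<m}" UNIV] by simp
  then have "pmon e \<in> M \<longleftrightarrow> (\<exists>i<m. \<exists>b. e = gp i + b)" by auto
  then show ?thesis by (simp only: exp_ge_iff)
qed

text \<open>If a variable divided both monomials, the binomial divided by it would still be toric.
  Then \<open>gp i\<close> without this variable would lie in \<open>M\<close> and be divisible by
  another \<open>gp k\<close>, against the minimality of the basis.\<close>

lemma gp_gm_disjoint:
  assumes i: "i < m"
  shows "lookup (gp i) j = 0 \<or> lookup (gm i) j = 0"
proof (rule ccontr)
  assume n: "\<not> ?thesis"
  define e where "e = single j (1::nat)"
  define a where "a = gp i - e"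
  define b where "b = gm i - e"
  have ae: "gp i = a + e" and be: "gm i = b + e"
    using n by (auto intro!: poly_mapping_eqI simp: a_def b_def e_def lookup_add lookup_minus lookup_single when_def)
  have "A *v exp_vec a = A *v exp_vec b"
    using gp_gm_kernel[OF i] unfolding ae be exp_vec_add matrix_vector_right_distrib by simp
  moreover have "a \<noteq> b" using gp_neq_gm[OF i] ae be by auto
  moreover have "weight w b \<le> weight w a" using weight_gp[OF i] unfolding ae be weight_add by simp
  ultimately have "pmon a \<in> M" by (rule binomial_leading)
  then obtain k where k: "k < m" "\<forall>l. lookup (gp k) l \<le> lookup a l" unfolding M_iff by blast
  then obtain c where c: "a = gp k + c" using exp_ge_iff[of a "gp k"] by blast
  have gik: "gp i = gp k + (c + e)" using ae c by (simp add: add.assoc)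
  have "lookup (gp i) j \<noteq> lookup (gp k) j"
    unfolding gik by (simp add: lookup_add e_def)
  then have neq: "gp i \<noteq> gp k" by auto
  let ?G = "{pmon (gp i) - pmon (gm i) | i. i < m}"
  have "pmon (gp k) - pmon (gm k) \<noteq> pmon (gp i) - pmon (gm i)"
  proof
    assume "pmon (gp k) - pmon (gm k) = pmon (gp i) - pmon (gm i)"
    then have "pmon (gp k) = pmon (gp i)" using init_gp[OF k(1)] init_gp[OF i] by simp
    then have "keys (pmon (gp k)) = keys (pmon (gp i))" by simp
    then show False using neq by simp
  qed
  then have "pmon (gp k) - pmon (gm k) \<in> ?G - {pmon (gp i) - pmon (gm i)}" using k(1) by auto
  then have "init_form w (pmon (gp k) - pmon (gm k)) \<in> Idl\<^bsub>poly_ring UNIV\<^esub> (init_form w ` (?G - {pmon (gp i) - pmon (gm i)}))"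
    by (intro Idl_gen[OF init_gens_sub] imageI)
  then have "pmon (c + e) * pmon (gp k) \<in> Idl\<^bsub>poly_ring UNIV\<^esub> (init_form w ` (?G - {pmon (gp i) - pmon (gm i)}))"
    unfolding init_gp[OF k(1)] by (intro ideal_mult[OF Idl_ideal[OF init_gens_sub]]) auto
  then show False using gp_minimal[OF i] gik by (simp add: pmon_add mult_ac)
qed

text \<open>The hyperplane condition makes the degree a function of \<open>A *v exp_vec e\<close>,
  so a fibre lies in a single degree. Finiteness lets the reduction below terminate.\<close>

lemma finite_fiber: "finite {e. A *v exp_vec e = b}"
proof -
  obtain c :: "rat ^ 'd" and \<delta> :: rat where c: "\<delta> \<noteq> 0" "\<And>j. (\<Sum>i\<in>UNIV. c $ i * of_int (A $ i $ j)) = \<delta>"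
    using hyper unfolding columns_in_affine_hyperplane_def by blast
  define D where "D = (\<Sum>i\<in>UNIV. c $ i * of_int (b $ i)) / \<delta>"
  have D: "of_nat (mdeg e) = D" if "A *v exp_vec e = b" for e
  proof -
    have "(\<Sum>i\<in>UNIV. c $ i * of_int (b $ i)) = (\<Sum>i\<in>UNIV. c $ i * (\<Sum>j\<in>UNIV. of_int (A $ i $ j) * of_nat (lookup e j)))"
      by (simp add: that[symmetric] matrix_vector_mult_def)
    also have "\<dots> = (\<Sum>i\<in>UNIV. \<Sum>j\<in>UNIV. c $ i * of_int (A $ i $ j) * of_nat (lookup e j))"
      by (simp add: sum_distrib_left mult.assoc)
    also have "\<dots> = (\<Sum>j\<in>UNIV. \<Sum>i\<in>UNIV. c $ i * of_int (A $ i $ j) * of_nat (lookup e j))"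
      by (rule sum.swap)
    also have "\<dots> = (\<Sum>j\<in>UNIV. \<delta> * of_nat (lookup e j))"
      by (simp add: sum_distrib_right[symmetric] c(2))
    also have "\<dots> = \<delta> * of_nat (mdeg e)"
      using mdeg_superset[of UNIV e] by (simp add: sum_distrib_left)
    finally show ?thesis using c(1) by (simp add: D_def)
  qed
  show ?thesis
  proof (cases "\<exists>e. A *v exp_vec e = b")
    case True
    then obtain e0 where "A *v exp_vec e0 = b" by blast
    then have "mdeg e = mdeg e0" if "A *v exp_vec e = b" for e
      using D[OF that] D by (metis of_nat_eq_iff)
    then have "{e. A *v exp_vec e = b} \<subseteq> {e. keys e \<subseteq> UNIV \<and> mdeg e = mdeg e0}" by auto
    then show ?thesis by (rule finite_subset) (rule finite_monoms, simp)
  qed simp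
qed

lemma C_monoid_0: "0 \<in> C_monoid m g"
  unfolding C_monoid_def by (intro CollectI exI[of _ "\<lambda>_. 0"]) simp

lemma C_monoid_add_g:
  assumes "u \<in> C_monoid m g" "i < m" shows "u + g i \<in> C_monoid m g"
proof -
  obtain c where c: "u = (\<Sum>i<m. int (c i) *s g i)" using assms(1) unfolding C_monoid_def by blast
  have "u + g i = (\<Sum>k<m. int (if k = i then c k + 1 else c k) *s g k)"
  proof -
    have "(\<Sum>k<m. int (if k = i then c k + 1 else c k) *s g k) = (\<Sum>k<m. int (c k) *s g k + (if k = i then g k else 0))"
      by (intro sum.cong refl) (simp add: vec_eq_iff algebra_simps)
    also have "\<dots> = u + g i" using assms(2) by (simp add: sum.distrib c)
    finally show ?thesis by simp
  qed
  then show ?thesis unfolding C_monoid_def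
    by (intro CollectI exI[of _ "\<lambda>k. if k = i then c k + 1 else c k"]) simp
qed

text \<open>Division replaces \<open>gp i\<close> by \<open>gm i\<close>, each time subtracting
  \<open>g i\<close> and lowering the weight. It can stop only at \<open>e0\<close>: any other
  \<open>e\<close> in the fibre is at least as heavy as \<open>e0\<close>, since otherwise
  \<open>e0\<close> would be in \<open>M\<close>, and therefore \<open>e\<close> itself is in
  \<open>M\<close>.\<close>

lemma reduction_to_standard:
  assumes "A *v exp_vec e = A *v exp_vec e0" "pmon e0 \<notin> M"
  shows "exp_vec e - exp_vec e0 \<in> C_monoid m g"
  using assms(1)
proof (induction "card {e'. A *v exp_vec e' = A *v exp_vec e0 \<and> weight w e' < weight w e}" arbitrary: e rule: less_induct)
  case less
  show ?case
  proof (cases "e = e0")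
    case True
    then show ?thesis using C_monoid_0 by simp
  next
    case False
    have "weight w e \<ge> weight w e0"
      using binomial_leading[of e0 e] less.prems False assms(2) by (metis linear)
    then have "pmon e \<in> M" using binomial_leading[of e e0] less.prems False by blast
    then obtain i where i: "i < m" "\<forall>j. lookup (gp i) j \<le> lookup e j" unfolding M_iff by blast
    then obtain b where b: "e = gp i + b" using exp_ge_iff[of e "gp i"] by blast
    define e' where "e' = gm i + b"
    have Ae': "A *v exp_vec e' = A *v exp_vec e0"
      using less.prems gp_gm_kernel[OF i(1)] by (simp add: b e'_def exp_vec_add matrix_vector_right_distrib)
    have we': "weight w e' < weight w e" using weight_gp[OF i(1)] by (simp add: b e'_def weight_add)
    have "exp_vec e' - exp_vec e0 \<in> C_monoid m g"
    proof (rule less.hyps[OF _ Ae'])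
      have "finite {e'. A *v exp_vec e' = A *v exp_vec e0 \<and> weight w e' < weight w e}"
        by (rule finite_subset[OF _ finite_fiber[of "A *v exp_vec e0"]]) auto
      moreover have "{x. A *v exp_vec x = A *v exp_vec e0 \<and> weight w x < weight w e'} \<subset>
        {e'. A *v exp_vec e' = A *v exp_vec e0 \<and> weight w e' < weight w e}"
        using we' Ae' by (auto intro!: psubsetI)
      ultimately show "card {x. A *v exp_vec x = A *v exp_vec e0 \<and> weight w x < weight w e'} <
        card {e'. A *v exp_vec e' = A *v exp_vec e0 \<and> weight w e' < weight w e}"
        by (rule psubset_card_mono)
    qed
    then have "exp_vec e' - exp_vec e0 + g i \<in> C_monoid m g" by (rule C_monoid_add_g[OF _ i(1)])
    moreover have "exp_vec e' - exp_vec e0 + g i = exp_vec e - exp_vec e0"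
      using g_def i(1) by (simp add: b e'_def exp_vec_add)
    ultimately show ?thesis by simp
  qed
qed

text \<open>A nonzero kernel vector supported in \<sigma> splits into two exponents supported in
  \<sigma> with the same image under \<open>A\<close>. One of them lies in \<open>M\<close>, which a
  standard pair excludes.\<close>

lemma standard_pair_col_indep:
  assumes sp: "(a, \<sigma>) \<in> standard_pairs M"
  shows "col_indep A \<sigma>"
  unfolding col_indep_def
proof (intro ballI impI, rule ccontr)
  fix u assume u: "u \<in> int_kernel A" "\<forall>j. j \<notin> \<sigma> \<longrightarrow> u $ j = 0" "u \<noteq> 0"
  define p where "p = mk_exp (\<lambda>j. nat (u $ j))"
  define q where "q = mk_exp (\<lambda>j. nat (- (u $ j)))"
  have upq: "u = exp_vec p - exp_vec q" by (simp add: vec_eq_iff p_def q_def)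
  have keys: "keys p \<subseteq> \<sigma>" "keys q \<subseteq> \<sigma>" using u(2) by (auto simp: in_keys_iff p_def q_def)
  have "A *v exp_vec p = A *v exp_vec q" using u(1) unfolding upq exp_vec_diff_kernel .
  moreover have "p \<noteq> q" using u(3) upq by auto
  ultimately have "pmon p \<in> M \<or> pmon q \<in> M"
    using binomial_leading[of p q] binomial_leading[of q p] by (metis linorder_le_cases)
  then obtain b where "keys b \<subseteq> \<sigma>" "pmon b \<in> M" using keys by blast
  then have "pmon (a + b) \<in> M" using M_mult[of b a] by (simp add: add.commute)
  then show False using sp \<open>keys b \<subseteq> \<sigma>\<close> by (simp add: standard_pairs_def)
qed

end

section \<open>The link\<close>

text \<open>Only these coordinates can newly enter the negative support after an integer
  shift.\<close>

definition nat_part :: "complex ^ 'n::finite \<Rightarrow> 'n set" where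
  "nat_part v = {j. \<exists>k::nat. v $ j = of_nat k}"

definition nat_val :: "complex ^ 'n::finite \<Rightarrow> 'n \<Rightarrow> nat" where
  "nat_val v j = (THE k. v $ j = of_nat k)"

lemma nat_val: "j \<in> nat_part v \<Longrightarrow> v $ j = of_nat (nat_val v j)"
  unfolding nat_part_def nat_val_def by (auto intro: the1I2)

lemma nat_val_eq: "v $ j = of_nat k \<Longrightarrow> nat_val v j = k"
  unfolding nat_val_def by (rule the_equality) auto

lemma nat_part_nsupp: "j \<in> nat_part v \<Longrightarrow> j \<notin> nsupp v"
proof
  assume "j \<in> nat_part v" "j \<in> nsupp v"
  then obtain k :: nat and z :: int where "v $ j = of_nat k" "z < 0" "v $ j = of_int z"
    unfolding nat_part_def nsupp_def by blast
  then have "of_int (int k) = (of_int z :: complex)" by simp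
  then show False using \<open>z < 0\<close> by (simp only: of_int_eq_iff)
qed

lemma nat_part_if_int: "v $ j = of_int z \<Longrightarrow> j \<notin> nsupp v \<Longrightarrow> j \<in> nat_part v \<and> z = int (nat_val v j)"
proof -
  assume z: "v $ j = of_int z" and n: "j \<notin> nsupp v"
  then have "z \<ge> 0" unfolding nsupp_def by force
  then have "v $ j = of_nat (nat z)" using z by simp
  moreover from this have "nat_val v j = nat z" by (rule nat_val_eq)
  ultimately show ?thesis using \<open>z \<ge> 0\<close> unfolding nat_part_def by (intro conjI CollectI exI[of _ "nat z"]) simp_all
qed

context toric_groebner
begin

text \<open>Where \<open>gp i\<close> is positive, \<open>gm i\<close> vanishes, so subtracting
  \<open>g i\<close> means subtracting \<open>gp i\<close> there; elsewhere no coordinate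
  decreases.\<close>

lemma G_set_eq:
  assumes i: "i < m"
  shows "G_set v (g i) = {j \<in> nat_part v. nat_val v j < lookup (gp i) j}"
proof (intro equalityI subsetI)
  have gi: "g i $ j = int (lookup (gp i) j) - int (lookup (gm i) j)" for j using g_def i by simp
  fix j
  {
    assume "j \<in> G_set v (g i)"
    then obtain k where k: "k < 0" "v $ j - of_int (g i $ j) = of_int k" and n: "j \<notin> nsupp v"
      by (auto simp: G_set_def nsupp_shift_def nsupp_def cvec_def)
    then have "v $ j = of_int (k + g i $ j)" by (simp add: algebra_simps)
    then have "j \<in> nat_part v" "k + g i $ j = int (nat_val v j)" using nat_part_if_int[OF _ n] by blast+
    then show "j \<in> {j \<in> nat_part v. nat_val v j < lookup (gp i) j}" using k(1) gi[of j] by auto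
  next
    assume j: "j \<in> {j \<in> nat_part v. nat_val v j < lookup (gp i) j}"
    then have "lookup (gm i) j = 0" using gp_gm_disjoint[OF i, of j] by auto
    then have "int (nat_val v j) - g i $ j < 0" using j gi[of j] by auto
    moreover have "v $ j - of_int (g i $ j) = of_int (int (nat_val v j) - g i $ j)" using nat_val[of j v] j by simp
    ultimately have "j \<in> nsupp_shift v (- g i)"
      unfolding nsupp_shift_def nsupp_def cvec_def by (intro CollectI exI[of _ "int (nat_val v j) - g i $ j"]) simp
    then show "j \<in> G_set v (g i)" using j nat_part_nsupp[of j v] by (simp add: G_set_def)
  }
qed

lemma std_pairs_at_nat: "(a, \<sigma>) \<in> std_pairs_at A w v \<Longrightarrow> j \<notin> \<sigma> \<Longrightarrow> j \<in> nat_part v \<and> nat_val v j = lookup a j"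
  using nat_val_eq[of v j] unfolding std_pairs_at_def nat_part_def by auto

lemma std_pairs_at_nsupp: "(a, \<sigma>) \<in> std_pairs_at A w v \<Longrightarrow> nsupp v \<subseteq> \<sigma>"
  using std_pairs_at_nat[of a \<sigma> v] nat_part_nsupp[of _ v] by blast

lemma std_pairs_at_col_indep: "(a, \<sigma>) \<in> std_pairs_at A w v \<Longrightarrow> col_indep A \<sigma>"
  using standard_pair_col_indep unfolding std_pairs_at_def by blast

lemma link_alt: "\<tau> \<in> link_complex A w v \<longleftrightarrow>
    \<tau> \<inter> nsupp v = {} \<and> (\<exists>a \<sigma>. (a, \<sigma>) \<in> std_pairs_at A w v \<and> \<tau> \<union> nsupp v \<subseteq> \<sigma>)"
  unfolding link_complex_def Delta_complex_def by blast

lemma link_down: "\<forall>\<tau>\<in>link_complex A w v. \<forall>\<tau>'\<subseteq>\<tau>. \<tau>' \<in> link_complex A w v"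
proof (intro ballI allI impI)
  fix \<tau> \<tau>' assume "\<tau> \<in> link_complex A w v" "\<tau>' \<subseteq> \<tau>"
  then show "\<tau>' \<in> link_complex A w v" unfolding link_alt by blast
qed

lemma link_sub: "\<tau> \<in> link_complex A w v \<Longrightarrow> \<tau> \<subseteq> - nsupp v"
  unfolding link_alt by blast

lemma link_col_indep: "\<tau> \<in> link_complex A w v \<Longrightarrow> col_indep A (\<tau> \<union> nsupp v)"
  unfolding link_alt using std_pairs_at_col_indep col_indep_mono by blast

text \<open>Off \<sigma> a standard pair at \<open>v\<close> agrees with \<open>v\<close>, so
  \<open>gp i\<close> divides some monomial over the pair exactly when \<open>G_set v (g i)\<close>
  lies in \<sigma>. Conversely, a maximal \<sigma> above \<tau> containing no such set, with
  \<open>a\<close> read off from \<open>v\<close>, is a standard pair: maximality is its third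
  condition.\<close>

lemma link_iff:
  assumes \<tau>: "\<tau> \<inter> nsupp v = {}"
  shows "\<tau> \<in> link_complex A w v \<longleftrightarrow> (\<forall>i<m. \<not> G_set v (g i) \<subseteq> \<tau>)"
proof
  assume "\<tau> \<in> link_complex A w v"
  then obtain a \<sigma> where s: "(a, \<sigma>) \<in> std_pairs_at A w v" "\<tau> \<union> nsupp v \<subseteq> \<sigma>" unfolding link_alt by blast
  show "\<forall>i<m. \<not> G_set v (g i) \<subseteq> \<tau>"
  proof (intro allI impI notI)
    fix i assume i: "i < m" "G_set v (g i) \<subseteq> \<tau>"
    define b where "b = mk_exp (\<lambda>j. if j \<in> \<sigma> then lookup (gp i) j else 0)"
    have "lookup (gp i) j \<le> lookup (a + b) j" for j
    proof (cases "j \<in> \<sigma>")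
      case True
      then show ?thesis by (simp add: lookup_add b_def)
    next
      case False
      then have "j \<in> nat_part v" "nat_val v j = lookup a j" "j \<notin> G_set v (g i)"
        using std_pairs_at_nat[OF s(1)] s(2) i(2) by auto
      then show ?thesis unfolding G_set_eq[OF i(1)] by (simp add: lookup_add)
    qed
    then have "pmon (a + b) \<in> M" unfolding M_iff using i(1) by blast
    moreover have "keys b \<subseteq> \<sigma>" by (auto simp: b_def in_keys_iff split: if_splits)
    ultimately show False using s(1) by (auto simp: std_pairs_at_def standard_pairs_def)
  qed
next
  assume nG: "\<forall>i<m. \<not> G_set v (g i) \<subseteq> \<tau>"
  \<comment> \<open>Coordinates of \<open>v\<close> that are not natural numbers must lie in
    \<sigma>, since outside it \<open>v\<close> has to equal the exponent \<open>a\<close>. They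
    belong to no \<open>G_set v (g i)\<close>, so adding them is harmless.\<close>
  define S where "S = {\<sigma>. \<tau> \<union> - nat_part v \<subseteq> \<sigma> \<and> (\<forall>i<m. \<not> G_set v (g i) \<subseteq> \<sigma>)}"
  have "\<tau> \<union> - nat_part v \<in> S"
    unfolding S_def using nG G_set_eq by fastforce
  moreover have "finite S" by simp
  ultimately obtain \<sigma> where \<sigma>: "\<sigma> \<in> S" "\<And>\<sigma>'. \<sigma>' \<in> S \<Longrightarrow> \<sigma> \<subseteq> \<sigma>' \<Longrightarrow> \<sigma>' = \<sigma>"
    using finite_has_maximal2[of S "\<tau> \<union> - nat_part v"] by metis
  define a where "a = mk_exp (\<lambda>j. if j \<in> \<sigma> then 0 else nat_val v j)"
  have nat: "j \<in> nat_part v" if "j \<notin> \<sigma>" for j using \<sigma>(1) that unfolding S_def by blast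
  have "(a, \<sigma>) \<in> standard_pairs M"
    unfolding standard_pairs_def
  proof (intro CollectI case_prodI conjI ballI allI impI)
    show "lookup a i = 0" if "i \<in> \<sigma>" for i using that by (simp add: a_def)
    show "pmon (a + b) \<notin> M" if b: "keys b \<subseteq> \<sigma>" for b
    proof
      assume "pmon (a + b) \<in> M"
      then obtain i where i: "i < m" "\<And>j. lookup (gp i) j \<le> lookup (a + b) j" unfolding M_iff by blast
      have "G_set v (g i) \<subseteq> \<sigma>"
      proof (rule ccontr)
        assume "\<not> G_set v (g i) \<subseteq> \<sigma>"
        then obtain j where j: "j \<in> G_set v (g i)" "j \<notin> \<sigma>" by blast
        have "lookup b j = 0" using b j(2) by (auto simp: in_keys_iff)
        then have "lookup (gp i) j \<le> nat_val v j" using i(2)[of j] j(2) by (simp add: lookup_add a_def)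
        then show False using j(1) unfolding G_set_eq[OF i(1)] by simp
      qed
      then show False using \<sigma>(1) i(1) unfolding S_def by blast
    qed
    show "\<exists>b. keys b \<subseteq> insert l \<sigma> \<and> pmon (a + b) \<in> M" if l: "l \<notin> \<sigma>" for l
    proof -
      have "insert l \<sigma> \<notin> S" using \<sigma>(2)[of "insert l \<sigma>"] l by blast
      then obtain i where i: "i < m" "G_set v (g i) \<subseteq> insert l \<sigma>" using \<sigma>(1) unfolding S_def by blast
      define b where "b = mk_exp (\<lambda>j. if j \<in> insert l \<sigma> then lookup (gp i) j else 0)"
      have "lookup (gp i) j \<le> lookup (a + b) j" for j
      proof (cases "j \<in> insert l \<sigma>")
        case True
        then show ?thesis by (auto simp: lookup_add b_def)
      next
        case False
        then have "j \<in> nat_part v" "j \<notin> G_set v (g i)" using nat i(2) by auto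
        then show ?thesis using False unfolding G_set_eq[OF i(1)] by (simp add: lookup_add a_def)
      qed
      then have "pmon (a + b) \<in> M" unfolding M_iff using i(1) by blast
      moreover have "keys b \<subseteq> insert l \<sigma>" by (auto simp: b_def in_keys_iff split: if_splits)
      ultimately show ?thesis by blast
    qed
  qed
  moreover have "v $ j = of_nat (lookup a j)" if "j \<notin> \<sigma>" for j
    using nat_val[OF nat[OF that]] that by (simp add: a_def)
  ultimately have "(a, \<sigma>) \<in> std_pairs_at A w v" unfolding std_pairs_at_def by simp
  moreover have "\<tau> \<union> nsupp v \<subseteq> \<sigma>" using \<sigma>(1) nat_part_nsupp[of _ v] unfolding S_def by blast
  ultimately show "\<tau> \<in> link_complex A w v" unfolding link_alt using \<tau> by blast
qed

text \<open>Raising \<open>a\<close> far enough along \<sigma> leaves room to add \<open>u\<close>;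
  off \<sigma> the sum stays nonnegative because the negative support is unchanged. The result lies
  in the fibre of a standard monomial, so \<open>u\<close> is a sum of reduction steps.\<close>

lemma same_nsupp_C_monoid:
  assumes sp: "(a, \<sigma>) \<in> std_pairs_at A w v" and u: "u \<in> int_kernel A" "nsupp_shift v u = nsupp v"
  shows "u \<in> C_monoid m g"
proof -
  define b where "b = mk_exp (\<lambda>j. if j \<in> \<sigma> then nat \<bar>u $ j\<bar> else 0)"
  define e where "e = mk_exp (\<lambda>j. nat (int (lookup (a + b) j) + u $ j))"
  have nonneg: "int (lookup (a + b) j) + u $ j \<ge> 0" for j
  proof (cases "j \<in> \<sigma>")
    case True
    then show ?thesis by (simp add: lookup_add b_def)
  next
    case False
    have j: "j \<in> nat_part v" "nat_val v j = lookup a j" using std_pairs_at_nat[OF sp False] by auto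
    then have "j \<notin> nsupp (v + cvec u)" using nat_part_nsupp u(2) unfolding nsupp_shift_def by blast
    moreover have "(v + cvec u) $ j = of_int (int (lookup a j) + u $ j)"
      using nat_val[OF j(1)] j(2) by (simp add: cvec_def)
    ultimately have "\<not> int (lookup a j) + u $ j < 0" unfolding nsupp_def by blast
    then show ?thesis using False by (simp add: lookup_add b_def)
  qed
  have eu: "exp_vec e - exp_vec (a + b) = u"
    using nonneg by (simp add: vec_eq_iff e_def)
  then have "A *v exp_vec e = A *v exp_vec (a + b)" using u(1) exp_vec_diff_kernel by metis
  moreover have "keys b \<subseteq> \<sigma>" by (auto simp: b_def in_keys_iff split: if_splits)
  then have "pmon (a + b) \<notin> M" using sp by (auto simp: std_pairs_at_def standard_pairs_def)
  ultimately show ?thesis using reduction_to_standard eu by metis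
qed

end

section \<open>Linear forms and row reduction\<close>

definition lincoef :: "'v cpoly \<Rightarrow> 'v \<Rightarrow> complex" where
  "lincoef p j = lookup p (single j 1)"

lemma single_one_inj: "single i (1::nat) = single j 1 \<longleftrightarrow> i = j"
proof
  assume "single i (1::nat) = single j 1"
  then have "keys (single i (1::nat)) = keys (single j (1::nat))" by (simp only:)
  then show "i = j" by simp
qed simp

lemma lincoef_pvar [simp]: "lincoef (pvar i) j = (if i = j then 1 else 0)"
  unfolding lincoef_def pvar_def pmon_def lookup_single single_one_inj by (simp add: when_def)

lemma lincoef_0 [simp]: "lincoef 0 j = 0"
  and lincoef_add: "lincoef (p + q) j = lincoef p j + lincoef q j"
  and lincoef_diff: "lincoef (p - q) j = lincoef p j - lincoef q j"
  and lincoef_cscale: "lincoef (cscale c p) j = c * lincoef p j"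
  by (simp_all add: lincoef_def lookup_add lookup_minus)

lemma lincoef_sum: "lincoef (sum f X) j = (\<Sum>x\<in>X. lincoef (f x) j)"
  by (induction X rule: infinite_finite_induct) (auto simp: lincoef_add)

lemma lincoef_Polys: "p \<in> Polys V \<Longrightarrow> j \<notin> V \<Longrightarrow> lincoef p j = 0"
proof (rule ccontr)
  assume "p \<in> Polys V" "j \<notin> V" "lincoef p j \<noteq> 0"
  then have "single j 1 \<in> keys p" by (simp add: lincoef_def in_keys_iff)
  then have "keys (single j (1::nat)) \<subseteq> V" using \<open>p \<in> Polys V\<close> unfolding carrier_poly_ring by blast
  then show False using \<open>j \<notin> V\<close> by simp
qed

lemma mdeg_1_single:
  assumes "mdeg a = 1"
  obtains j where "a = single j 1"
proof -
  have "a \<noteq> 0" using assms by auto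
  then obtain j where j: "j \<in> keys a" by (metis keys_eq_empty equals0I)
  define b where "b = a - single j 1"
  have ab: "a = single j 1 + b"
    using j by (intro poly_mapping_eqI) (auto simp: b_def lookup_add lookup_minus lookup_single when_def in_keys_iff)
  then have "mdeg a = 1 + mdeg b" using mdeg_add[of "single j 1" b] by simp
  then have "b = 0" using assms mdeg_eq_0_iff[of b] by simp
  then show ?thesis using that ab by simp
qed

lemma linear_form_expand:
  fixes p :: "'n::finite cpoly"
  assumes "homog 1 p"
  shows "p = (\<Sum>j\<in>UNIV. cscale (lincoef p j) (pvar j))"
proof (rule poly_mapping_eqI)
  fix a
  show "lookup p a = lookup (\<Sum>j\<in>UNIV. cscale (lincoef p j) (pvar j)) a"
  proof (cases "mdeg a = 1")
    case True
    then obtain j where a: "a = single j 1" by (rule mdeg_1_single)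
    have "lincoef p j = lincoef (\<Sum>j\<in>UNIV. cscale (lincoef p j) (pvar j)) j"
      by (simp add: lincoef_sum lincoef_cscale if_distrib sum.delta cong: if_cong)
    then show ?thesis by (simp add: a lincoef_def)
  next
    case False
    have "homog 1 (\<Sum>j\<in>UNIV. cscale (lincoef p j) (pvar j))"
      by (intro homog_sum homog_cscale homog_pvar)
    then have "a \<notin> keys p" "a \<notin> keys (\<Sum>j\<in>UNIV. cscale (lincoef p j) (pvar j))"
      using assms False unfolding homog_def by blast+
    then show ?thesis by (simp add: in_keys_iff)
  qed
qed

lemma linear_form_Polys:
  fixes p :: "'n::finite cpoly"
  assumes "homog 1 p" "\<And>j. j \<notin> V \<Longrightarrow> lincoef p j = 0"
  shows "p \<in> Polys V"
proof -
  have "cscale (lincoef p j) (pvar j) \<in> Polys V" for j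
    using assms(2)[of j] by (cases "j \<in> V") (auto simp: cscale_def intro!: Polys_mult)
  then show ?thesis by (subst linear_form_expand[OF assms(1)]) (intro Polys_sum)
qed

text \<open>In degree 1 only the constant terms of the cofactors count.\<close>

lemma Idl_degree_1:
  assumes S: "S \<subseteq> Polys V" "\<And>s. s \<in> S \<Longrightarrow> homog 1 s" and p: "p \<in> Idl\<^bsub>poly_ring V\<^esub> S" "homog 1 p"
  shows "p \<in> cpoly.span S"
proof -
  have "hcomp 1 p \<in> cpoly.span S"
    using p(1) S(1)
  proof (induction rule: Idl_induct)
    case (mult c s)
    have "hcomp 0 c = pconst (lookup c 0)"
      by (rule poly_mapping_eqI) (auto simp: lookup_hcomp pconst_def lookup_single when_def mdeg_eq_0_iff)
    then have "hcomp 1 (c * s) = cscale (lookup c 0) s"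
      using hcomp_mult_homog[OF S(2)[OF mult(2)], of 1 c] by (simp add: cscale_def)
    then show ?case using mult by (simp add: cpoly.span_scale cpoly.span_base)
  qed (auto simp: hcomp_add cpoly.span_zero cpoly.span_add)
  then show ?thesis using hcomp_homog[OF p(2), of 1] by simp
qed

lemma span_sub_ideal: "ideal J (poly_ring V) \<Longrightarrow> S \<subseteq> J \<Longrightarrow> cpoly.span S \<subseteq> J"
  by (rule cpoly.span_minimal[OF _ ideal_subspace])

lemma row_form_homog: "homog 1 (row_form A k)"
  unfolding row_form_def cscale_def[symmetric] by (intro homog_sum homog_cscale homog_pvar)

lemma lincoef_row_form: "lincoef (row_form A k) j = of_int (A $ k $ j)"
  unfolding row_form_def cscale_def[symmetric]
  by (simp add: lincoef_sum lincoef_cscale if_distrib sum.delta cong: if_cong)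

definition rowcomb :: "int ^ 'n::finite ^ 'd::finite \<Rightarrow> ('d \<Rightarrow> complex) \<Rightarrow> 'n cpoly" where
  "rowcomb A r = (\<Sum>k\<in>UNIV. cscale (r k) (row_form A k))"

lemma rowcomb_span: "rowcomb A r \<in> cpoly.span (range (row_form A))"
  unfolding rowcomb_def by (intro cpoly.span_sum cpoly.span_scale cpoly.span_base) auto

lemma rowcomb_homog: "homog 1 (rowcomb A r)"
  unfolding rowcomb_def by (intro homog_sum homog_cscale row_form_homog)

lemma lincoef_rowcomb: "lincoef (rowcomb A r) j = (\<Sum>k\<in>UNIV. r k * of_int (A $ k $ j))"
  unfolding rowcomb_def by (simp add: lincoef_sum lincoef_cscale lincoef_row_form)

lemma rows_sub: "range (row_form A) \<subseteq> Polys UNIV" by auto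

lemma homog1_subspace: "cpoly.subspace {p. homog 1 p}"
  by (auto simp: cpoly.subspace_def homog_add homog_cscale)

lemma row_span_homog: "p \<in> cpoly.span (range (row_form A)) \<Longrightarrow> homog 1 p"
proof -
  assume "p \<in> cpoly.span (range (row_form A))"
  moreover have "range (row_form A) \<subseteq> {p. homog 1 p}" by (intro image_subsetI CollectI row_form_homog)
  ultimately show "homog 1 p" using cpoly.span_minimal[OF _ homog1_subspace] by blast
qed

text \<open>The forms of the row space without variables of \<open>nsupp v\<close> are the kernel
  \<open>N\<close> of the projection \<open>f\<close> to these coordinates. Independence makes
  \<open>f\<close> surjective onto them, so rank-nullity bounds the dimension of \<open>N\<close> by
  \<open>d - |nsupp v|\<close>, and a basis of \<open>N\<close> fits into
  \<open>ell\<close>.\<close>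

lemma row_reduction_exists:
  fixes A :: "int ^ 'n::finite ^ 'd::finite"
  assumes I0: "col_indep A (nsupp v)"
  shows "\<exists>L ell. row_reduction A v L ell"
proof -
  define I where "I = nsupp v"
  define U where "U = cpoly.span (range (row_form A))"
  define N where "N = {x \<in> U. \<forall>p\<in>I. lincoef x p = 0}"
  have "\<exists>r. \<forall>j\<in>I. lincoef (rowcomb A r) j = (if j = p then 1 else 0)" if p: "p \<in> I" for p
    using row_combination[OF I0[folded I_def] p] unfolding lincoef_rowcomb by metis
  then obtain r where r: "\<And>p j. p \<in> I \<Longrightarrow> j \<in> I \<Longrightarrow> lincoef (rowcomb A (r p)) j = (if j = p then 1 else 0)"
    by metis
  define L where "L p = pvar p - rowcomb A (r p)" for p
  define f where "f x = (\<Sum>p\<in>I. cscale (lincoef x p) (pvar p))" for x :: "'n cpoly"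
  have lin: "Vector_Spaces.linear cscale cscale f"
    by (rule linear_cscaleI) (auto simp: f_def lincoef_add lincoef_cscale cpoly.scale_left_distrib
      sum.distrib cpoly.scale_sum_right)
  have U: "cpoly.subspace U" unfolding U_def by (rule cpoly.subspace_span)
  have f_coef: "lincoef (f x) j = (if j \<in> I then lincoef x j else 0)" for x j
    by (simp add: f_def lincoef_sum lincoef_cscale if_distrib sum.delta cong: if_cong)
  have ker: "{u \<in> U. f u = 0} = N"
  proof -
    have "f u = 0 \<longleftrightarrow> (\<forall>p\<in>I. lincoef u p = 0)" for u
    proof
      assume "f u = 0"
      then show "\<forall>p\<in>I. lincoef u p = 0" using f_coef[of u] by (metis lincoef_0)
    qed (simp add: f_def)
    then show ?thesis by (simp add: N_def)
  qed
  have indep: "cpoly.independent (pvar ` I)"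
  proof (rule cpoly.independent_if_scalars_zero)
    fix c x assume c: "(\<Sum>x\<in>pvar ` I. cscale (c x) x) = 0" and "x \<in> pvar ` I"
    then obtain j where j: "j \<in> I" "x = pvar j" by blast
    have "inj_on (pvar :: 'n \<Rightarrow> _) I"
    proof (rule inj_onI)
      fix a b :: 'n assume "pvar a = pvar b"
      then have "lincoef (pvar a) a = lincoef (pvar b) a" by simp
      then show "a = b" by (simp split: if_splits)
    qed
    then have "(\<Sum>i\<in>I. cscale (c (pvar i)) (pvar i)) = 0" using c by (simp add: sum.reindex)
    then have "lincoef (\<Sum>i\<in>I. cscale (c (pvar i)) (pvar i)) j = 0" by simp
    then show "c x = 0" using j by (simp add: lincoef_sum lincoef_cscale if_distrib sum.delta cong: if_cong)
  qed simp
  have "card (pvar ` I) \<le> cpoly.dim (f ` U)"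
  proof -
    have "f (rowcomb A (r p)) = pvar p" if p: "p \<in> I" for p
    proof -
      have "f (rowcomb A (r p)) = (\<Sum>j\<in>I. if j = p then pvar j else 0)"
        unfolding f_def using r[OF p] by (intro sum.cong refl) (auto simp: cpoly.scale_one)
      then show ?thesis using p by simp
    qed
    then have "pvar ` I \<subseteq> f ` U" using rowcomb_span U_def by (metis (no_types, lifting) image_eqI image_subsetI)
    moreover have "f ` U \<subseteq> cpoly.span (pvar ` I)"
      by (auto simp: f_def intro!: cpoly.span_sum cpoly.span_scale intro: cpoly.span_base)
    ultimately show ?thesis using cpoly.basis_card_eq_dim[OF _ _ indep] by simp
  qed
  moreover have "card (pvar ` I) = card I"
    by (rule card_image) (metis (no_types, lifting) inj_onI lincoef_pvar zero_neq_one)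
  moreover have "cpoly.dim (f ` U) + cpoly.dim N = cpoly.dim U"
    using cpoly.dim_image_kernel[OF lin U, of "range (row_form A)"] ker by (simp add: U_def)
  moreover have "cpoly.dim U \<le> CARD('d)"
    using cpoly.dim_le_card[of U "range (row_form A)"] card_image_le[of "UNIV :: 'd set" "row_form A"]
    by (simp add: U_def)
  ultimately have dimN: "cpoly.dim N \<le> CARD('d) - card I" by simp
  obtain B where B: "B \<subseteq> N" "cpoly.independent B" "N \<subseteq> cpoly.span B" "card B = cpoly.dim N"
    using cpoly.basis_exists by blast
  have finB: "finite B"
    using cpoly.independent_span_bound[of "range (row_form A)" B] B by (auto simp: N_def U_def)
  obtain h where h: "bij_betw h {0..<card B} B" using ex_bij_betw_nat_finite[OF finB] by blast
  \<comment> \<open>Only an upper bound for the dimension of \<open>N\<close> is at hand, so the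
    basis is padded with 0 to the prescribed length.\<close>
  define ell where "ell q = (if q < card B then h q else 0)" for q
  let ?q = "CARD('d) - card I"
  have ellN: "ell q \<in> N" for q
  proof (cases "q < card B")
    case True
    then have "h q \<in> B" using h by (auto simp: bij_betw_def)
    then show ?thesis using True B(1) by (auto simp: ell_def)
  next
    case False
    then show ?thesis using cpoly.span_zero by (simp add: ell_def N_def U_def)
  qed
  have Bell: "B \<subseteq> ell ` {..<?q}"
  proof
    fix b assume "b \<in> B"
    then have "b \<in> h ` {0..<card B}" using h by (simp add: bij_betw_def)
    then obtain q where "q < card B" "b = h q" by auto
    then have "b = ell q" "q < ?q" using B(4) dimN by (auto simp: ell_def)
    then show "b \<in> ell ` {..<?q}" by auto
  qed
  have N_ok: "x \<in> graded_part (Polys (- I)) 1" if "x \<in> N" for x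
  proof -
    have "x \<in> cpoly.span (range (row_form A))" using that by (simp add: N_def U_def)
    then have "homog 1 x" by (rule row_span_homog)
    then show ?thesis using that linear_form_Polys[of x "- I"] by (auto simp: graded_part_def N_def)
  qed
  have L_ok: "L p \<in> graded_part (Polys (- I)) 1" if "p \<in> I" for p
  proof -
    have h1: "homog 1 (L p)" unfolding L_def by (intro homog_diff homog_pvar rowcomb_homog)
    have "lincoef (L p) j = 0" if "j \<notin> - I" for j
      using r[OF \<open>p \<in> I\<close>, of j] that by (auto simp: L_def lincoef_diff)
    then have "L p \<in> Polys (- I)" by (rule linear_form_Polys[OF h1])
    then show ?thesis using h1 by (simp add: graded_part_def)
  qed
  let ?G = "(\<lambda>p. pvar p - L p) ` I \<union> ell ` {..<?q}"
  have Gsub: "?G \<subseteq> Polys UNIV" by auto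
  have "Idl\<^bsub>poly_ring UNIV\<^esub> ?G = Idl\<^bsub>poly_ring UNIV\<^esub> (range (row_form A))"
  proof (rule antisym)
    have UI: "U \<subseteq> Idl\<^bsub>poly_ring UNIV\<^esub> (range (row_form A))"
      unfolding U_def using Idl_gen[OF rows_sub] by (intro span_sub_ideal[OF Idl_ideal[OF rows_sub]]) auto
    have "pvar p - L p \<in> U" for p by (simp add: L_def U_def rowcomb_span)
    moreover have "ell q \<in> U" for q using ellN by (simp add: N_def)
    ultimately have "?G \<subseteq> U" by auto
    then show "Idl\<^bsub>poly_ring UNIV\<^esub> ?G \<subseteq> Idl\<^bsub>poly_ring UNIV\<^esub> (range (row_form A))"
      using UI by (intro Idl_least[OF Idl_ideal[OF rows_sub]]) auto
    show "Idl\<^bsub>poly_ring UNIV\<^esub> (range (row_form A)) \<subseteq> Idl\<^bsub>poly_ring UNIV\<^esub> ?G"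
    proof (rule Idl_least[OF Idl_ideal[OF Gsub]], clarify)
      fix k
      let ?x = "row_form A k"
      define y where "y = ?x - (\<Sum>p\<in>I. cscale (lincoef ?x p) (pvar p - L p))"
      have "?x \<in> U" unfolding U_def by (rule cpoly.span_base[OF rangeI])
      moreover have "(\<Sum>p\<in>I. cscale (lincoef ?x p) (pvar p - L p)) \<in> U"
        unfolding U_def by (intro cpoly.span_sum cpoly.span_scale) (simp add: L_def rowcomb_span)
      ultimately have "y \<in> U" unfolding y_def by (rule cpoly.subspace_diff[OF U])
      moreover have "lincoef y j = 0" if "j \<in> I" for j
      proof -
        have "lincoef (\<Sum>p\<in>I. cscale (lincoef ?x p) (pvar p - L p)) j = (\<Sum>p\<in>I. if p = j then lincoef ?x p else 0)"
          unfolding lincoef_sum lincoef_cscale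
          using r[OF _ that] by (intro sum.cong refl) (simp add: L_def)
        then show ?thesis using that by (simp add: y_def lincoef_diff)
      qed
      ultimately have "y \<in> N" by (simp add: N_def)
      then have "y \<in> cpoly.span (ell ` {..<?q})" using B(3) cpoly.span_mono[OF Bell] by blast
      then have "y \<in> Idl\<^bsub>poly_ring UNIV\<^esub> ?G"
        using span_sub_ideal[OF Idl_ideal[OF Gsub], of "ell ` {..<?q}"] Idl_gen[OF Gsub] by blast
      moreover have "(\<Sum>p\<in>I. cscale (lincoef ?x p) (pvar p - L p)) \<in> Idl\<^bsub>poly_ring UNIV\<^esub> ?G"
        using Idl_gen[OF Gsub] by (intro ideal_sum[OF Idl_ideal[OF Gsub]] ideal_cscale[OF Idl_ideal[OF Gsub]]) auto
      ultimately have "y + (\<Sum>p\<in>I. cscale (lincoef ?x p) (pvar p - L p)) \<in> Idl\<^bsub>poly_ring UNIV\<^esub> ?G"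
        by (rule ideal_add[OF Idl_ideal[OF Gsub]])
      then show "?x \<in> Idl\<^bsub>poly_ring UNIV\<^esub> ?G" by (simp add: y_def)
    qed
  qed
  then have "row_reduction A v L ell"
    unfolding row_reduction_def I_def[symmetric] by (intro conjI ballI allI impI L_ok N_ok ellN)
  then show ?thesis by blast
qed

text \<open>A form free of the variables of \<open>nsupp v\<close> has no share in the forms
  \<open>pvar p - L p\<close>. The operator \<open>T\<close> reads this share off the coefficients
  at \<open>nsupp v\<close>: it fixes the span of these forms and kills everything free of those
  variables.\<close>

lemma row_reduction_span:
  fixes A :: "int ^ 'n::finite ^ 'd::finite"
  assumes rr: "row_reduction A v L ell" and p: "p \<in> cpoly.span (range (row_form A))" "p \<in> Polys (- nsupp v)"
  shows "p \<in> cpoly.span (ell ` {..<CARD('d) - card (nsupp v)})"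
proof -
  define I where "I = nsupp v"
  define X where "X = (\<lambda>p. pvar p - L p) ` I"
  define Y where "Y = ell ` {..<CARD('d) - card I}"
  have L: "\<And>p. p \<in> I \<Longrightarrow> L p \<in> Polys (- I) \<and> homog 1 (L p)"
    and ell: "\<And>y. y \<in> Y \<Longrightarrow> y \<in> Polys (- I) \<and> homog 1 y"
    and idl: "Idl\<^bsub>poly_ring UNIV\<^esub> (X \<union> Y) = Idl\<^bsub>poly_ring UNIV\<^esub> (range (row_form A))"
    using rr unfolding row_reduction_def graded_part_def I_def X_def Y_def by auto
  have "p \<in> Idl\<^bsub>poly_ring UNIV\<^esub> (X \<union> Y)"
    unfolding idl using span_sub_ideal[OF Idl_ideal[OF rows_sub], of "range (row_form A)" A] Idl_gen[OF rows_sub] p(1) by blast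
  moreover have "homog 1 s" if "s \<in> X \<union> Y" for s
    using that L ell by (auto simp: X_def intro!: homog_diff homog_pvar[unfolded One_nat_def])
  ultimately have "p \<in> cpoly.span (X \<union> Y)"
    using row_span_homog[OF p(1)] by (intro Idl_degree_1[of _ UNIV]) auto
  then obtain x y where xy: "x \<in> cpoly.span X" "y \<in> cpoly.span Y" "p = x + y"
    unfolding cpoly.span_Un by blast
  define T where "T x = (\<Sum>p\<in>I. cscale (lincoef x p) (pvar p - L p))" for x :: "'n cpoly"
  have "T 0 = 0" "T (x + y) = T x + T y" "T (cscale c x) = cscale c (T x)" for x y c
    by (simp_all add: T_def lincoef_add lincoef_cscale cpoly.scale_left_distrib sum.distrib cpoly.scale_sum_right)
  then have "cpoly.subspace {x. T x = x}"
    by (simp add: cpoly.subspace_def)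
  moreover have "X \<subseteq> {x. T x = x}"
  proof clarify
    fix x assume "x \<in> X"
    then obtain q where q: "q \<in> I" "x = pvar q - L q" by (auto simp: X_def)
    have "lincoef x j = (if j = q then 1 else 0)" if "j \<in> I" for j
      using that L[OF q(1)] lincoef_Polys[of "L q" "- I" j] by (auto simp: q lincoef_diff)
    then have "T x = (\<Sum>p\<in>I. if p = q then pvar p - L p else 0)"
      unfolding T_def by (intro sum.cong refl) (auto simp: cpoly.scale_one)
    then show "T x = x" using q by simp
  qed
  ultimately have "T x = x" using xy(1) cpoly.span_minimal by blast
  moreover have "y \<in> Polys (- I)"
    using xy(2) cpoly.span_minimal[OF _ Polys_subspace, of Y "- I"] ell by blast
  then have "lincoef x j = 0" if "j \<in> I" for j
  proof -
    have "x = p - y" using xy(3) by simp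
    then show ?thesis using that p(2) \<open>y \<in> Polys (- I)\<close> lincoef_Polys[of _ "- I" j] by (simp add: lincoef_diff I_def)
  qed
  then have "T x = 0" by (simp add: T_def)
  ultimately show ?thesis using xy by (simp add: Y_def I_def)
qed

section \<open>The Hilbert series of the link modulo linear forms\<close>

lemma h_poly_eq:
  assumes H: "H = hilbert_series V (sr_ideal V \<Delta>) * (1 - fps_X) ^ Max (card ` \<Delta>)"
    and fin: "\<And>q. q > N \<Longrightarrow> fps_nth H q = 0"
  shows "fps_of_poly (h_poly V \<Delta>) = H"
proof -
  define p where "p = (\<Sum>q\<le>N. Polynomial.monom (fps_nth H q) q)"
  have "coeff p q = fps_nth H q" for q
    using fin[of q] by (auto simp: p_def coeff_sum not_le)
  then have p: "fps_of_poly p = H" by (intro fps_ext) simp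
  then have "h_poly V \<Delta> = p"
    unfolding h_poly_def H[symmetric] by (intro the_equality) (auto simp: fps_of_poly_eq_iff)
  then show ?thesis using p by simp
qed

context toric_groebner
begin

text \<open>The bound \<open>CARD('n)\<close> is pigeonhole: beyond it some exponent is at least 2,
  so one factor of that variable can be exchanged for variables outside the support without losing
  any vertex. The support then grows strictly, at fixed degree.\<close>

lemma large_monomials_in_ideal:
  fixes v
  assumes rr: "row_reduction A v L ell"
  defines "V \<equiv> - nsupp v" and "J \<equiv> Idl\<^bsub>poly_ring (- nsupp v)\<^esub>
     (sr_ideal (- nsupp v) (link_complex A w v) \<union> ell ` {..<CARD('d) - card (nsupp v)})"
  assumes a: "keys a \<subseteq> V" "mdeg a > CARD('n)"
  shows "pmon a \<in> J"
proof -
  define I where "I = sr_ideal V (link_complex A w v)"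
  have I: "ideal I (poly_ring V)" unfolding I_def by (rule sr_ideal_ideal)
  have sub: "I \<union> ell ` {..<CARD('d) - card (nsupp v)} \<subseteq> Polys V"
    using ideal_sub[OF I] rr by (auto simp: V_def row_reduction_def graded_part_def)
  have J: "ideal J (poly_ring V)" unfolding J_def using Idl_ideal[OF sub] by (simp add: V_def I_def)
  have gen: "x \<in> J" if "x \<in> I \<union> ell ` {..<CARD('d) - card (nsupp v)}" for x
    using Idl_gen[OF sub that] by (simp add: J_def V_def I_def)
  show ?thesis
    using a
  proof (induction "card (V - keys a)" arbitrary: a rule: less_induct)
    case less
    show ?case
    proof (cases "keys a \<in> link_complex A w v")
      case False
      then have "pmon a \<in> I"
        using less.prems by (simp add: I_def sr_ideal_char[OF link_down])
      then show ?thesis using gen by blast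
    next
      case True
      have "\<exists>j. lookup a j \<ge> 2"
      proof (rule ccontr)
        assume "\<not> ?thesis"
        then have "lookup a j \<le> 1" for j by (metis not_less_eq_eq numeral_2_eq_2 One_nat_def)
        then have "(\<Sum>j\<in>UNIV. lookup a j) \<le> (\<Sum>j\<in>(UNIV :: 'n set). 1)" by (intro sum_mono)
        then show False using less.prems(2) mdeg_superset[of UNIV a] by simp
      qed
      then obtain j where j: "lookup a j \<ge> 2" by blast
      have jF: "j \<in> keys a" using j by (auto simp: in_keys_iff)
      \<comment> \<open>\<open>nsupp v\<close> is included so that the row combination is free of
        its variables and thus lies in the span of \<open>ell\<close>.\<close>
      obtain r where r: "\<And>i. i \<in> keys a \<union> nsupp v \<Longrightarrow> lincoef (rowcomb A r) i = (if i = j then 1 else 0)"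
        using row_combination[OF link_col_indep[OF True], of j] jF unfolding lincoef_rowcomb by (metis UnI1)
      define \<rho> where "\<rho> = rowcomb A r"
      have jI: "j \<notin> nsupp v" using jF less.prems by (auto simp: V_def)
      have "\<rho> \<in> Polys V"
        unfolding \<rho>_def
      proof (rule linear_form_Polys[OF rowcomb_homog])
        fix i assume "i \<notin> V"
        then show "lincoef (rowcomb A r) i = 0" using r[of i] jI by (auto simp: V_def)
      qed
      then have "\<rho> \<in> cpoly.span (ell ` {..<CARD('d) - card (nsupp v)})"
        using row_reduction_span[OF rr rowcomb_span] by (simp add: \<rho>_def V_def)
      then have \<rho>J: "\<rho> \<in> J"
        using span_sub_ideal[OF J, of "ell ` {..<CARD('d) - card (nsupp v)}"] gen by blast
      define b where "b = a - single j 1"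
      have ab: "a = b + single j 1"
        using j by (intro poly_mapping_eqI) (auto simp: b_def lookup_add lookup_minus lookup_single when_def)
      have kb: "keys b = keys a"
        using j by (auto simp: b_def in_keys_iff lookup_minus lookup_single when_def split: if_splits)
      have "pmon b * \<rho> \<in> J" using \<rho>J kb less.prems by (intro ideal_mult[OF J]) auto
      moreover have "\<rho> = pvar j + (\<Sum>i\<in>V - keys a. cscale (lincoef \<rho> i) (pvar i))"
      proof -
        have "\<rho> = (\<Sum>i\<in>UNIV. cscale (lincoef \<rho> i) (pvar i))"
          unfolding \<rho>_def by (rule linear_form_expand[OF rowcomb_homog])
        also have "\<dots> = (\<Sum>i\<in>insert j (V - keys a). cscale (lincoef \<rho> i) (pvar i))"
        proof (rule sum.mono_neutral_right)
          show "\<forall>i\<in>UNIV - insert j (V - keys a). cscale (lincoef \<rho> i) (pvar i) = 0"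
            using r by (auto simp: \<rho>_def V_def)
        qed auto
        also have "\<dots> = cscale (lincoef \<rho> j) (pvar j) + (\<Sum>i\<in>V - keys a. cscale (lincoef \<rho> i) (pvar i))"
          using jF by simp
        finally show ?thesis using r[of j] jF by (simp add: \<rho>_def cpoly.scale_one)
      qed
      then have "pmon b * \<rho> = pmon a + (\<Sum>i\<in>V - keys a. cscale (lincoef \<rho> i) (pmon (b + single i 1)))"
        by (metis (no_types, lifting) ab distrib_left pmon_add pvar_def cscale_mult_right sum_distrib_left sum.cong)
      moreover have "(\<Sum>i\<in>V - keys a. cscale (lincoef \<rho> i) (pmon (b + single i 1))) \<in> J"
      proof (rule ideal_sum[OF J], rule ideal_cscale[OF J])
        fix i assume i: "i \<in> V - keys a"
        have k: "keys (b + single i 1) = insert i (keys a)" by (simp add: keys_add_nat kb)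
        show "pmon (b + single i 1) \<in> J"
        proof (rule less.hyps)
          have "V - keys (b + single i 1) \<subset> V - keys a" unfolding k using i by auto
          then show "card (V - keys (b + single i 1)) < card (V - keys a)" by (rule psubset_card_mono[rotated]) simp
          show "keys (b + single i 1) \<subseteq> V" unfolding k using i less.prems by auto
          show "CARD('n) < mdeg (b + single i 1)" using less.prems(2) unfolding ab mdeg_add by simp
        qed
      qed
      ultimately have "(pmon a + (\<Sum>i\<in>V - keys a. cscale (lincoef \<rho> i) (pmon (b + single i 1)))) -
          (\<Sum>i\<in>V - keys a. cscale (lincoef \<rho> i) (pmon (b + single i 1))) \<in> J"
        using ideal_diff[OF J] by metis
      then show ?thesis by simp
    qed
  qed
qed

text \<open>The face \<open>F\<close> of the top-dimensional pair has \<open>r\<close> vertices; a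
  larger face together with \<open>nsupp v\<close> would index more than \<open>d\<close>
  independent columns. So the exponent in \<open>h_poly\<close>, the number of forms and the length
  of the regular sequence are all \<open>r\<close>.\<close>

lemma H_series_eq_h_poly:
  fixes v
  assumes rr: "row_reduction A v L ell"
    and top: "(a0, \<sigma>0) \<in> std_pairs_at A w v" "card \<sigma>0 = CARD('d)"
    and CM: "cohen_macaulay (sr_ring (- nsupp v) (link_complex A w v))"
  shows "H_series A w v ell = fps_of_poly (h_poly (- nsupp v) (link_complex A w v))"
    and "\<And>q. q > CARD('n) \<Longrightarrow> fps_nth (H_series A w v ell) q = 0"
proof -
  define V where "V = - nsupp v"
  define r where "r = CARD('d) - card (nsupp v)"
  define F where "F = \<sigma>0 - nsupp v"
  have sub: "nsupp v \<subseteq> \<sigma>0" by (rule std_pairs_at_nsupp[OF top(1)])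
  have F: "F \<in> link_complex A w v" unfolding link_alt F_def using top(1) sub by blast
  have cF: "card F = r" unfolding F_def r_def using top(2) sub by (simp add: card_Diff_subset)
  have "card \<tau> \<le> r" if "\<tau> \<in> link_complex A w v" for \<tau>
  proof -
    have "card (\<tau> \<union> nsupp v) \<le> CARD('d)" using dependent_columns[of "\<tau> \<union> nsupp v" A] link_col_indep[OF that] by linarith
    moreover have "card (\<tau> \<union> nsupp v) = card \<tau> + card (nsupp v)"
      using link_sub[OF that] by (intro card_Un_disjoint) auto
    ultimately show ?thesis by (simp add: r_def)
  qed
  then have Max: "Max (card ` link_complex A w v) = r"
    using F cF by (intro Max_eqI) auto
  have ell: "ell j \<in> Polys V \<and> homog 1 (ell j)" if "j < r" for j
    using rr that by (auto simp: row_reduction_def graded_part_def V_def r_def)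
  have H: "H_series A w v ell = hilbert_series V (sr_ideal V (link_complex A w v)) * (1 - fps_X) ^ r"
    unfolding H_series_def V_def[symmetric] r_def[symmetric]
  proof (rule hilbert_series_cohen_macaulay[OF CM[folded V_def] link_down F _ cF ell])
    show "F \<subseteq> V" using link_sub[OF F] by (simp add: V_def)
    show "pmon a \<in> Idl\<^bsub>poly_ring V\<^esub> (sr_ideal V (link_complex A w v) \<union> ell ` {..<r})"
      if "keys a \<subseteq> V" "CARD('n) < mdeg a" for a
      using large_monomials_in_ideal[OF rr, of a] that by (simp add: V_def r_def)
  qed
  show zero: "fps_nth (H_series A w v ell) q = 0" if q: "q > CARD('n)" for q
  proof -
    let ?J = "Idl\<^bsub>poly_ring V\<^esub> (sr_ideal V (link_complex A w v) \<union> ell ` {..<r})"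
    have subV: "sr_ideal V (link_complex A w v) \<union> ell ` {..<r} \<subseteq> Polys V"
      using ideal_sub[OF sr_ideal_ideal] ell by auto
    have "graded_part (Polys V) q \<subseteq> graded_part ?J q"
    proof
      fix p assume p: "p \<in> graded_part (Polys V) q"
      have "single a (lookup p a) \<in> ?J" if "a \<in> keys p" for a
        unfolding single_eq_pconst_pmon
      proof (rule ideal_mult[OF Idl_ideal[OF subV] Polys_pconst])
        show "pmon a \<in> ?J"
          using large_monomials_in_ideal[OF rr, of a] p that q
          by (auto simp: V_def r_def graded_part_def homog_def carrier_poly_ring)
      qed
      then have "(\<Sum>a\<in>keys p. single a (lookup p a)) \<in> ?J" by (intro ideal_sum[OF Idl_ideal[OF subV]])
      then show "p \<in> graded_part ?J q" using p poly_sum_single[of p] by (simp add: graded_part_def)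
    qed
    then have "graded_part (Polys V) q = graded_part ?J q"
      using graded_part_mono[of ?J "Polys V" q] ideal_sub[OF Idl_ideal[OF subV]] by blast
    then show ?thesis unfolding H_series_def hilbert_series_def by (simp add: V_def r_def)
  qed
  show "H_series A w v ell = fps_of_poly (h_poly (- nsupp v) (link_complex A w v))"
    using h_poly_eq[of "H_series A w v ell" V "link_complex A w v" "CARD('n)"] H zero by (simp add: Max V_def)
qed

section \<open>The ideal \<open>Q\<close>\<close>

lemma Q_gens_sub: "range (row_form A) \<union> {\<Prod>j\<in>G_set v (g i). pvar j | i. i < m} \<subseteq> Polys UNIV"
  by auto

lemma Q_ideal_ideal: "ideal (Q_ideal A v m g) (poly_ring UNIV)"
  unfolding Q_ideal_def by (rule Idl_ideal[OF Q_gens_sub])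

lemma Q_homog_closed: "homog_closed (Q_ideal A v m g)"
  unfolding Q_ideal_def
proof (rule homog_closed_Idl[OF Q_gens_sub])
  fix s assume "s \<in> range (row_form A) \<union> {\<Prod>j\<in>G_set v (g i). pvar j | i. i < m}"
  then show "\<exists>e. homog e s" using row_form_homog homog_prod_pvar by blast
qed

lemma Q_row: "row_form A k \<in> Q_ideal A v m g"
  unfolding Q_ideal_def by (rule Idl_gen[OF Q_gens_sub]) auto

lemma Q_G: "i < m \<Longrightarrow> (\<Prod>j\<in>G_set v (g i). pvar j) \<in> Q_ideal A v m g"
  unfolding Q_ideal_def by (rule Idl_gen[OF Q_gens_sub]) auto

lemma G_set_sub: "G_set v u \<subseteq> - nsupp v"
  by (auto simp: G_set_def)

text \<open>Substituting \<open>L p\<close> for the variables of \<open>nsupp v\<close> is a graded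
  retraction onto the polynomials in \<open>V\<close>. It maps \<open>Q\<close> onto
  \<open>J\<close> and its kernel lies in \<open>Q\<close>, so both ideals have the same codimension
  in each degree.\<close>

lemma hilbert_Q:
  fixes v
  assumes rr: "row_reduction A v L ell"
  shows "int (cpoly.dim (graded_part (Polys (UNIV :: 'n set)) q)) - int (cpoly.dim (graded_part (Q_ideal A v m g) q)) =
    fps_nth (H_series A w v ell) q"
proof -
  define V where "V = - nsupp v"
  define \<Delta> where "\<Delta> = link_complex A w v"
  define r where "r = CARD('d) - card (nsupp v)"
  define Q where "Q = Q_ideal A v m g"
  define J where "J = Idl\<^bsub>poly_ring V\<^esub> (sr_ideal V \<Delta> \<union> ell ` {..<r})"
  have ell: "ell j \<in> Polys V \<and> homog 1 (ell j)" if "j < r" for j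
    using rr that by (auto simp: row_reduction_def graded_part_def V_def r_def)
  have L: "L p \<in> Polys V \<and> homog 1 (L p)" if "p \<notin> V" for p
    using rr that by (auto simp: row_reduction_def graded_part_def V_def)
  have subV: "sr_ideal V \<Delta> \<union> ell ` {..<r} \<subseteq> Polys V"
    using ideal_sub[OF sr_ideal_ideal] ell by auto
  have J: "ideal J (poly_ring V)" unfolding J_def by (rule Idl_ideal[OF subV])
  have Qid: "ideal Q (poly_ring UNIV)" unfolding Q_def by (rule Q_ideal_ideal)
  let ?X = "(\<lambda>p. pvar p - L p) ` nsupp v \<union> ell ` {..<r}"
  let ?Gs = "{\<Prod>j\<in>G_set v (g i). pvar j | i. i < m}"
  have X_idl: "Idl\<^bsub>poly_ring UNIV\<^esub> ?X = Idl\<^bsub>poly_ring UNIV\<^esub> (range (row_form A))"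
    using rr by (simp add: row_reduction_def r_def)
  have rows_Q: "Idl\<^bsub>poly_ring UNIV\<^esub> (range (row_form A)) \<subseteq> Q"
    using Q_row by (intro Idl_least[OF Qid]) (auto simp: Q_def)
  have X_Q: "x \<in> Q" if "x \<in> ?X" for x
  proof -
    have "?X \<subseteq> Polys UNIV" by (rule subsetI) simp
    from Idl_gen[OF this that] show ?thesis using X_idl rows_Q by auto
  qed
  have Q_eq: "Q \<subseteq> Idl\<^bsub>poly_ring UNIV\<^esub> (?X \<union> ?Gs)"
    unfolding Q_def Q_ideal_def
  proof (rule Idl_least)
    show "ideal (Idl\<^bsub>poly_ring UNIV\<^esub> (?X \<union> ?Gs)) (poly_ring UNIV)" by (rule Idl_ideal) auto
    have "range (row_form A) \<subseteq> Idl\<^bsub>poly_ring UNIV\<^esub> ?X" unfolding X_idl using Idl_gen[OF rows_sub] by blast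
    also have "\<dots> \<subseteq> Idl\<^bsub>poly_ring UNIV\<^esub> (?X \<union> ?Gs)" by (rule Idl_mono) auto
    finally have "range (row_form A) \<subseteq> Idl\<^bsub>poly_ring UNIV\<^esub> (?X \<union> ?Gs)" .
    then show "range (row_form A) \<union> ?Gs \<subseteq> Idl\<^bsub>poly_ring UNIV\<^esub> (?X \<union> ?Gs)"
    proof -
      note rows = \<open>range (row_form A) \<subseteq> Idl\<^bsub>poly_ring UNIV\<^esub> (?X \<union> ?Gs)\<close>
      have s: "?X \<union> ?Gs \<subseteq> Polys UNIV" by (rule subsetI) simp
      have "?Gs \<subseteq> Idl\<^bsub>poly_ring UNIV\<^esub> (?X \<union> ?Gs)" using Idl_gen[OF s] by blast
      with rows show ?thesis by (rule Un_least)
    qed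
  qed
  define \<sigma> where "\<sigma> j = (if j \<in> V then pvar j else L j)" for j
  have \<sigma>V: "\<sigma> j \<in> Polys V" and \<sigma>h: "homog 1 (\<sigma> j)" for j
    using L[of j] homog_pvar[of j] by (auto simp: \<sigma>_def)
  have \<psi>V: "psubst \<sigma> p \<in> Polys V" for p by (rule psubst_in_Polys[OF \<sigma>V])
  have \<psi>id: "psubst \<sigma> p = p" if "p \<in> Polys V" for p
    using that by (rule psubst_id_on) (simp add: \<sigma>_def)
  have G_J: "(\<Prod>j\<in>G_set v (g i). pvar j) \<in> J" if "i < m" for i
  proof -
    have "G_set v (g i) \<notin> \<Delta>" using link_iff[of "G_set v (g i)" v] that G_set_sub[of v "g i"] by (auto simp: \<Delta>_def)
    then have "(\<Prod>j\<in>G_set v (g i). pvar j) \<in> sr_ideal V \<Delta>"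
      unfolding sr_ideal_def using G_set_sub[of v "g i"] by (intro Idl_gen[OF sr_ideal_gens]) (auto simp: V_def)
    then show ?thesis unfolding J_def by (intro Idl_gen[OF subV]) auto
  qed
  have \<psi>Q: "psubst \<sigma> p \<in> J" if p: "p \<in> Q" for p
  proof -
    have "p \<in> Idl\<^bsub>poly_ring UNIV\<^esub> (?X \<union> ?Gs)" using p Q_eq by blast
    moreover have "?X \<union> ?Gs \<subseteq> Polys UNIV" by auto
    ultimately show ?thesis
    proof (induction rule: Idl_induct)
      case (mult c s)
      have "psubst \<sigma> s \<in> J"
      proof -
        consider q where "q \<notin> V" "s = pvar q - L q" | j where "j < r" "s = ell j" | i where "i < m" "s = (\<Prod>j\<in>G_set v (g i). pvar j)"
          using mult(2) by (auto simp: V_def)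
        then show ?thesis
        proof cases
          case 1
          then have "psubst \<sigma> s = 0" using \<psi>id[of "L q"] L[of q] by (simp add: psubst_diff \<sigma>_def)
          then show ?thesis using ideal_0[OF J] by simp
        next
          case 2
          then show ?thesis using \<psi>id[of s] ell[of j] Idl_gen[OF subV, of s] by (auto simp: J_def)
        next
          case 3
          have "s \<in> J" using G_J 3 by simp
          then show ?thesis using \<psi>id[of s] ideal_sub[OF J] by simp
        qed
      qed
      then show ?case by (simp add: psubst_mult ideal_mult[OF J \<psi>V])
    qed (auto simp: psubst_add ideal_0[OF J] intro: ideal_add[OF J])
  qed
  \<comment> \<open>A nonface contains some \<open>G_set v (g i)\<close>, so its monomial is a
    multiple of a generator of \<open>Q\<close>.\<close>
  have J_Q: "p \<in> Q" if p: "p \<in> J" for p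
  proof -
    have sr: "s \<in> Q" if "s \<in> sr_ideal V \<Delta>" for s
    proof -
      have "single a (lookup s a) \<in> Q" if a: "a \<in> keys s" for a
      proof -
        have "keys a \<notin> \<Delta>" "keys a \<subseteq> V"
          using \<open>s \<in> sr_ideal V \<Delta>\<close> a by (auto simp: \<Delta>_def sr_ideal_char[OF link_down] carrier_poly_ring)
        then obtain i where i: "i < m" "G_set v (g i) \<subseteq> keys a"
          using link_iff[of "keys a" v] by (auto simp: \<Delta>_def V_def)
        have "\<forall>j. lookup (\<Sum>j\<in>G_set v (g i). single j 1) j \<le> lookup a j"
        proof
          fix j
          show "lookup (\<Sum>j\<in>G_set v (g i). single j 1) j \<le> lookup a j"
            unfolding lookup_indicator[OF finite] using i(2) by (auto simp: in_keys_iff)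
        qed
        then obtain b where "a = (\<Sum>j\<in>G_set v (g i). single j 1) + b"
          using exp_ge_iff[of a "\<Sum>j\<in>G_set v (g i). single j 1"] by blast
        then have "single a (lookup s a) = single b (lookup s a) * (\<Prod>j\<in>G_set v (g i). pvar j)"
          by (simp only: prod_pvar pmon_def mult_single add.commute mult_1_right)
        moreover have "(\<Prod>j\<in>G_set v (g i). pvar j) \<in> Q" unfolding Q_def by (rule Q_G[OF i(1)])
        ultimately show ?thesis using ideal_mult[OF Qid Polys_UNIV] by metis
      qed
      then have "(\<Sum>a\<in>keys s. single a (lookup s a)) \<in> Q" by (intro ideal_sum[OF Qid])
      then show ?thesis using poly_sum_single[of s] by simp
    qed
    show ?thesis
      using p[unfolded J_def] subV
    proof (induction rule: Idl_induct)
      case (mult c s)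
      then have "s \<in> Q" using sr X_Q by blast
      then show ?case by (intro ideal_mult[OF Qid]) auto
    qed (auto simp: ideal_0[OF Qid] intro: ideal_add[OF Qid])
  qed
  \<comment> \<open>Modulo \<open>Q\<close> the substitution is the identity: this holds on
    variables and is preserved by sums and products. In particular its kernel lies in
    \<open>Q\<close>.\<close>
  have diffQ: "p - psubst \<sigma> p \<in> Q" for p
  proof -
    have diff_mult: "x * y - psubst \<sigma> (x * y) \<in> Q" if "x - psubst \<sigma> x \<in> Q" "y - psubst \<sigma> y \<in> Q" for x y
    proof -
      have "x * y - psubst \<sigma> (x * y) = y * (x - psubst \<sigma> x) + psubst \<sigma> x * (y - psubst \<sigma> y)"
        by (simp add: psubst_mult algebra_simps)
      then show ?thesis using that by (simp only:) (intro ideal_add[OF Qid] ideal_mult[OF Qid] Polys_UNIV)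
    qed
    have var: "pvar j - psubst \<sigma> (pvar j) \<in> Q" for j
    proof (cases "j \<in> V")
      case True
      then show ?thesis using ideal_0[OF Qid] by (simp add: \<sigma>_def)
    next
      case False
      then show ?thesis using X_Q[of "pvar j - L j"] by (simp add: \<sigma>_def V_def)
    qed
    have const: "pconst c - psubst \<sigma> (pconst c) \<in> Q" for c using ideal_0[OF Qid] by simp
    have pw: "x ^ k - psubst \<sigma> (x ^ k) \<in> Q" if "x - psubst \<sigma> x \<in> Q" for x k
      by (induction k) (use ideal_0[OF Qid] that diff_mult in auto)
    have pr: "prod f X - psubst \<sigma> (prod f X) \<in> Q" if "\<And>x. f x - psubst \<sigma> (f x) \<in> Q"
      for f :: "'n \<Rightarrow> 'n cpoly" and X
      by (induction X rule: infinite_finite_induct) (use ideal_0[OF Qid] that diff_mult in auto)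
    show ?thesis
    proof (induction p rule: cpoly_induct)
      case (single a c)
      have "single a c = pconst c * (\<Prod>j\<in>keys a. pvar j ^ lookup a j)"
      proof -
        have "single a c = psubst pvar (single a c)"
          using psubst_id_on[of "single a c" UNIV pvar] by simp
        then show ?thesis by (simp only: psubst_single)
      qed
      then show ?case using diff_mult[OF const pr[OF pw[OF var]]] by simp
    next
      case (add p q)
      have "(p + q) - psubst \<sigma> (p + q) = (p - psubst \<sigma> p) + (q - psubst \<sigma> q)" by (simp add: psubst_add)
      then show ?case using add ideal_add[OF Qid] by metis
    qed (simp add: ideal_0[OF Qid])
  qed
  have lin: "Vector_Spaces.linear cscale cscale (psubst \<sigma>)"
    by (rule linear_cscaleI) (auto simp: psubst_add psubst_cscale)
  let ?T = "graded_part (Polys (UNIV :: 'n set)) q"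
  obtain E where E: "finite E" "?T \<subseteq> cpoly.span E" using graded_part_fin by blast
  have QT: "graded_part Q q \<subseteq> ?T" by (rule graded_part_mono) auto
  have d1: "cpoly.dim (psubst \<sigma> ` ?T) + cpoly.dim {u \<in> ?T. psubst \<sigma> u = 0} = cpoly.dim ?T"
    by (rule cpoly.dim_image_kernel[OF lin graded_part_subspace[OF Polys_subspace] E])
  have d2: "cpoly.dim (psubst \<sigma> ` graded_part Q q) + cpoly.dim {u \<in> graded_part Q q. psubst \<sigma> u = 0} = cpoly.dim (graded_part Q q)"
    by (rule cpoly.dim_image_kernel[OF lin graded_part_subspace[OF ideal_subspace[OF Qid]] E(1)]) (use E(2) QT in blast)
  have i1: "psubst \<sigma> ` ?T = graded_part (Polys V) q"
  proof (intro equalityI subsetI)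
    fix x assume "x \<in> psubst \<sigma> ` ?T"
    then show "x \<in> graded_part (Polys V) q" using \<psi>V homog_psubst[OF \<sigma>h] by (auto simp: graded_part_def)
  next
    fix x assume "x \<in> graded_part (Polys V) q"
    then have "x = psubst \<sigma> x" "x \<in> ?T" using \<psi>id by (auto simp: graded_part_def)
    then show "x \<in> psubst \<sigma> ` ?T" by blast
  qed
  have i2: "psubst \<sigma> ` graded_part Q q = graded_part J q"
  proof (intro equalityI subsetI)
    fix x assume "x \<in> psubst \<sigma> ` graded_part Q q"
    then show "x \<in> graded_part J q" using \<psi>Q homog_psubst[OF \<sigma>h] by (auto simp: graded_part_def)
  next
    fix x assume "x \<in> graded_part J q"
    then have "x = psubst \<sigma> x" "x \<in> graded_part Q q" using \<psi>id ideal_sub[OF J] J_Q by (auto simp: graded_part_def)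
    then show "x \<in> psubst \<sigma> ` graded_part Q q" by blast
  qed
  have "u \<in> Q" if "psubst \<sigma> u = 0" for u using diffQ[of u] that by simp
  then have "{u \<in> graded_part Q q. psubst \<sigma> u = 0} = {u \<in> ?T. psubst \<sigma> u = 0}"
    by (auto simp: graded_part_def)
  then have "int (cpoly.dim ?T) - int (cpoly.dim (graded_part Q q)) =
     int (cpoly.dim (graded_part (Polys V) q)) - int (cpoly.dim (graded_part J q))"
    using d1 d2 i1 i2 by simp
  then show ?thesis by (simp add: H_series_def hilbert_series_def J_def V_def \<Delta>_def r_def Q_def)
qed

section \<open>The solution space of \<open>Q\<close>\<close>

lemma apair_hcomp: "homog q f \<Longrightarrow> apair \<phi> f = apair (hcomp q \<phi>) f"
proof (induction \<phi> rule: cpoly_induct)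
  case (single a c)
  show ?case
  proof (cases "mdeg a = q")
    case True
    then show ?thesis using hcomp_homog[OF homog_single[of a c], of q] by simp
  next
    case False
    then have "lookup f a = 0" using single by (auto simp: homog_def in_keys_iff)
    then have "apair (single a c) f = 0" by (simp add: apair_def lookup_pdiff_single)
    moreover have "hcomp q (single a c) = 0" using hcomp_homog[OF homog_single[of a c], of q] False by simp
    ultimately show ?thesis by simp
  qed
qed (auto simp: hcomp_add apair_add_left)

lemma pdiff_hcomp:
  fixes f :: "'n cpoly"
  assumes "homog a \<phi>"
  shows "pdiff \<phi> (hcomp e f) = (if a \<le> e then hcomp (e - a) (pdiff \<phi> f) else 0)"
proof (rule poly_mapping_eqI)
  fix k
  have "lookup (pdiff \<phi> (hcomp e f)) k =
    (\<Sum>b\<in>keys \<phi>. if mdeg k + a = e then lookup \<phi> b * lookup f (k + b) * (mfact (k + b) / mfact k) else 0)"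
    unfolding lookup_pdiff using assms by (intro sum.cong refl) (auto simp: lookup_hcomp mdeg_add homog_def)
  also have "\<dots> = (if mdeg k + a = e then lookup (pdiff \<phi> f) k else 0)" by (simp add: lookup_pdiff)
  also have "\<dots> = lookup (if a \<le> e then hcomp (e - a) (pdiff \<phi> f) else 0) k"
    by (auto simp: lookup_hcomp)
  finally show "lookup (pdiff \<phi> (hcomp e f)) k = lookup (if a \<le> e then hcomp (e - a) (pdiff \<phi> f) else 0) k" .
qed

lemma Q_perp_subspace: "cpoly.subspace (Q_perp A v m g)"
  unfolding Q_perp_def cpoly.subspace_def by (auto simp: pdiff_add_right pdiff_cscale_right)

lemma Q_perp_homog_closed: "homog_closed (Q_perp A v m g)"
  unfolding homog_closed_def Q_perp_def
proof (intro ballI allI CollectI)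
  fix f e \<phi> assume f: "f \<in> {f. \<forall>\<phi>\<in>Q_ideal A v m g. pdiff \<phi> f = 0}" and \<phi>: "\<phi> \<in> Q_ideal A v m g"
  obtain N where N: "\<forall>a\<in>keys \<phi>. mdeg a \<le> N" using keys_mdeg_bound by blast
  have "pdiff (hcomp a \<phi>) (hcomp e f) = 0" for a
  proof -
    have "hcomp a \<phi> \<in> Q_ideal A v m g" using Q_homog_closed \<phi> by (auto simp: homog_closed_def)
    then have "pdiff (hcomp a \<phi>) f = 0" using f by blast
    then show ?thesis using pdiff_hcomp[OF homog_hcomp, of a \<phi> e f] by simp
  qed
  then have "pdiff (\<Sum>a\<le>N. hcomp a \<phi>) (hcomp e f) = 0" by (simp add: pdiff_sum_left)
  then show "pdiff \<phi> (hcomp e f) = 0" using sum_hcomp[of \<phi> N] N by simp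
qed

text \<open>\<open>Q\<close> is closed under monomial multiples and homogeneous components, so
  pairing with its part of degree \<open>q\<close> detects every coefficient of every
  \<open>pdiff \<phi> f\<close>.\<close>

lemma graded_Q_perp:
  "graded_part (Q_perp A v m g) q =
    {f \<in> graded_part (Polys UNIV) q. \<forall>\<phi>\<in>graded_part (Q_ideal A v m g) q. apair \<phi> f = 0}"
proof (intro equalityI subsetI)
  fix f assume "f \<in> graded_part (Q_perp A v m g) q"
  then show "f \<in> {f \<in> graded_part (Polys UNIV) q. \<forall>\<phi>\<in>graded_part (Q_ideal A v m g) q. apair \<phi> f = 0}"
    by (auto simp: graded_part_def Q_perp_def apair_def)
next
  fix f assume f: "f \<in> {f \<in> graded_part (Polys UNIV) q. \<forall>\<phi>\<in>graded_part (Q_ideal A v m g) q. apair \<phi> f = 0}"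
  then have h: "homog q f" by (simp add: graded_part_def)
  have "pdiff \<phi> f = 0" if \<phi>: "\<phi> \<in> Q_ideal A v m g" for \<phi>
  proof (rule poly_mapping_eqI)
    fix k
    have "pmon k * \<phi> \<in> Q_ideal A v m g" using \<phi> by (intro ideal_mult[OF Q_ideal_ideal]) auto
    then have "hcomp q (pmon k * \<phi>) \<in> graded_part (Q_ideal A v m g) q"
      using Q_homog_closed homog_hcomp by (auto simp: graded_part_def homog_closed_def)
    then have "apair (hcomp q (pmon k * \<phi>)) f = 0" using f by blast
    then have "lookup (pdiff \<phi> f) k * mfact k = 0" using apair_hcomp[OF h] lookup_pdiff_apair by metis
    then show "lookup (pdiff \<phi> f) k = lookup 0 k" by simp
  qed
  then show "f \<in> graded_part (Q_perp A v m g) q" using h by (simp add: graded_part_def Q_perp_def)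
qed

lemma dim_graded_Q_perp:
  assumes rr: "row_reduction A v L ell"
  shows "int (cpoly.dim (graded_part (Q_perp A v m g) q)) = fps_nth (H_series A w v ell) q"
proof -
  have "cpoly.dim (graded_part (Q_perp A v m g) q) + cpoly.dim (graded_part (Q_ideal A v m g) q) =
    cpoly.dim (graded_part (Polys (UNIV :: 'n set)) q)"
    unfolding graded_Q_perp
    by (rule dim_annihilator[OF graded_part_subspace[OF ideal_subspace[OF Q_ideal_ideal]] graded_part_mono]) auto
  then show ?thesis using hilbert_Q[OF rr, of q] by simp
qed

text \<open>All generators have positive degree; for the \<open>G_set\<close> products because the
  empty set is a face of the link.\<close>

lemma one_in_Q_perp:
  assumes "(a, \<sigma>) \<in> std_pairs_at A w v"
  shows "1 \<in> Q_perp A v m g"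
proof -
  have "{} \<in> link_complex A w v" unfolding link_alt using assms std_pairs_at_nsupp[OF assms] by blast
  then have G: "G_set v (g i) \<noteq> {}" if "i < m" for i using link_iff[of "{}" v] that by auto
  have "lookup p 0 = 0" if "p \<in> Q_ideal A v m g" for p
    using that[unfolded Q_ideal_def] Q_gens_sub
  proof (induction rule: Idl_induct)
    case (mult c s)
    have "\<exists>e>0. homog e s"
      using mult(2)
    proof
      assume "s \<in> range (row_form A)"
      then show ?thesis using row_form_homog by blast
    next
      assume "s \<in> {\<Prod>j\<in>G_set v (g i). pvar j | i. i < m}"
      then obtain i where "i < m" "s = (\<Prod>j\<in>G_set v (g i). pvar j)" by blast
      then show ?thesis using G[of i] homog_prod_pvar[of "G_set v (g i)"]
        by (intro exI[of _ "card (G_set v (g i))"]) (simp add: card_gt_0_iff)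
    qed
    then obtain e where e: "e > 0" "homog e s" by blast
    have "lookup (hcomp 0 (c * s)) 0 = 0" using hcomp_mult_homog[OF e(2), of 0 c] e(1) by simp
    then show ?case by (simp add: lookup_hcomp)
  qed (auto simp: lookup_add)
  then have "pdiff \<phi> 1 = 0" if "\<phi> \<in> Q_ideal A v m g" for \<phi>
  proof (intro poly_mapping_eqI)
    fix k
    have z: "lookup \<phi> b * lookup 1 (k + b) = 0" if "b \<in> keys \<phi>" for b
    proof (cases "b = 0")
      case True
      then show ?thesis using \<open>\<And>p. p \<in> Q_ideal A v m g \<Longrightarrow> lookup p 0 = 0\<close> \<open>\<phi> \<in> Q_ideal A v m g\<close> by simp
    next
      case False
      then have "mdeg (k + b) \<noteq> 0" using mdeg_eq_0_iff[of b] by (simp add: mdeg_add)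
      then have "k + b \<noteq> 0" by auto
      then show ?thesis by (simp add: lookup_one)
    qed
    show "lookup (pdiff \<phi> 1) k = lookup 0 k"
      unfolding lookup_pdiff lookup_zero by (intro sum.neutral ballI) (simp only: z mult_zero_left)
  qed
  then show ?thesis by (simp add: Q_perp_def)
qed

end

section \<open>The action of the Weyl algebra on series\<close>

text \<open>The operator by which the derivative of order \<open>b\<close> acts on the coefficient
  that it moves to exponent \<open>v + y\<close>; \<open>pvar j\<close> stands for the derivative in
  the logarithm of the variable \<open>j\<close>.\<close>

definition wfac :: "complex ^ 'n::finite \<Rightarrow> ('n \<Rightarrow>\<^sub>0 nat) \<Rightarrow> int ^ 'n \<Rightarrow> 'n cpoly" where
  "wfac v b y = (\<Prod>j\<in>UNIV. \<Prod>k\<in>{1..lookup b j}. pconst (v $ j + of_int (y $ j + int k)) + pvar j)"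

definition wmon :: "complex ^ 'n::finite \<Rightarrow> ('n \<Rightarrow>\<^sub>0 nat) \<times> ('n \<Rightarrow>\<^sub>0 nat) \<Rightarrow>
    (int ^ 'n \<Rightarrow> 'n cpoly) \<Rightarrow> int ^ 'n \<Rightarrow> 'n cpoly" where
  "wmon v s F u = pdiff (wfac v (snd s) (u - exp_vec (fst s))) (F (u - exp_vec (fst s) + exp_vec (snd s)))"

lemma weyl_act_eq: "weyl_act v P F u = (\<Sum>s\<in>keys P. cscale (lookup P s) (wmon v s F u))"
  unfolding weyl_act_def by (intro sum.cong refl) (auto simp: wmon_def wfac_def)

lemma weyl_act_add: "weyl_act v (P + Q) F u = weyl_act v P F u + weyl_act v Q F u"
  unfolding weyl_act_eq by (rule setsum_keys_plus_distrib) (auto simp: cpoly.scale_left_distrib)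

lemma weyl_act_single: "weyl_act v (single s c) F u = cscale c (wmon v s F u)"
  by (cases "c = 0") (auto simp: weyl_act_eq)

lemma weyl_act_0 [simp]: "weyl_act v 0 F u = 0"
  by (simp add: weyl_act_eq)

lemma weyl_act_sum: "weyl_act v (sum f X) F u = (\<Sum>x\<in>X. weyl_act v (f x) F u)"
  by (induction X rule: infinite_finite_induct) (auto simp: weyl_act_add)

lemma weyl_act_uminus: "weyl_act v (- P) F u = - weyl_act v P F u"
  by (rule sym) (simp only: neg_eq_iff_add_eq_0 weyl_act_add[symmetric] right_minus weyl_act_0)

lemma weyl_act_diff: "weyl_act v (P - Q) F u = weyl_act v P F u - weyl_act v Q F u"
  using weyl_act_add[of v P "- Q" F u] by (simp add: weyl_act_uminus)

lemma weyl_scale_single: "weyl_scale c (single s d) = single s (c * d)"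
  by (simp add: weyl_scale_def)

lemma weyl_scale_eq: "weyl_scale c P = (\<Sum>s\<in>keys P. single s (c * lookup P s))"
proof (rule poly_mapping_eqI)
  fix k
  have "lookup (weyl_scale c P) k = c * lookup P k"
    unfolding weyl_scale_def by (simp add: Poly_Mapping.map.rep_eq when_def)
  also have "\<dots> = lookup (\<Sum>s\<in>keys P. single s (c * lookup P s)) k"
    by (simp add: lookup_sum lookup_single when_def in_keys_iff sum.delta)
  finally show "lookup (weyl_scale c P) k = lookup (\<Sum>s\<in>keys P. single s (c * lookup P s)) k" .
qed

lemma weyl_act_scale: "weyl_act v (weyl_scale c P) F u = cscale c (weyl_act v P F u)"
  unfolding weyl_scale_eq weyl_act_sum weyl_act_single
  by (simp add: weyl_act_eq cpoly.scale_sum_right)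

lemma wmon_sum: "wmon v s (\<lambda>u. \<Sum>x\<in>X. f x u) u = (\<Sum>x\<in>X. wmon v s (f x) u)"
  by (simp add: wmon_def pdiff_sum_right)

lemma wmon_cscale: "wmon v s (\<lambda>u. cscale c (F u)) u = cscale c (wmon v s F u)"
  by (simp add: wmon_def pdiff_cscale_right)

lemma pochhammer_nat_binomial:
  assumes "k \<le> c"
  shows "pochhammer (c - k + 1) k = fact k * (c choose k)"
proof -
  have "fact c = pochhammer (1::nat) c" by (simp add: pochhammer_fact)
  also have "\<dots> = pochhammer 1 (c - k) * pochhammer (1 + of_nat (c - k)) k"
    using pochhammer_product[of "c - k" c "1::nat"] assms by simp
  also have "\<dots> = fact (c - k) * pochhammer (c - k + 1) k"
    by (simp only: pochhammer_fact[symmetric] of_nat_id add.commute)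
  finally have "fact (c - k) * pochhammer (c - k + 1) k = (fact c :: nat)" by simp
  moreover have "fact (c - k) * (fact k * (c choose k)) = (fact c :: nat)"
    using binomial_fact_lemma[OF assms] by (simp add: mult_ac)
  ultimately show ?thesis by (metis fact_nonzero mult_cancel_left)
qed

text \<open>Vandermonde's identity for falling factorials, the one-variable case of
  \<open>\<partial>\<^sup>b x\<^sup>c = (\<Sum>k. k! binom(b, k) binom(c, k) x\<^bsup>c-k\<^esup> \<partial>\<^bsup>b-k\<^esup>)\<close>.\<close>

lemma pochhammer_leibniz:
  fixes X :: "'a::comm_ring_1"
  shows "pochhammer (X + 1) b =
    (\<Sum>k\<in>{k. k \<le> b \<and> k \<le> c}. of_nat (fact k * (b choose k) * (c choose k)) * pochhammer (X - of_nat c + of_nat k + 1) (b - k))"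
proof -
  let ?Z = "X + of_nat b"
  have "(- 1) ^ b * pochhammer (X + 1) b = pochhammer (- ?Z) b"
    using pochhammer_minus[of ?Z b] by simp
  also have "\<dots> = pochhammer (- of_nat c + - (?Z - of_nat c)) b"
    by (rule arg_cong[where f = "\<lambda>x. pochhammer x b"]) simp
  also have "\<dots> = (\<Sum>k\<le>b. of_nat (b choose k) * pochhammer (- of_nat c) k * pochhammer (- (?Z - of_nat c)) (b - k))"
    by (rule pochhammer_binomial_sum)
  also have "\<dots> = (\<Sum>k\<in>{k. k \<le> b \<and> k \<le> c}. (- 1) ^ b * (of_nat (fact k * (b choose k) * (c choose k)) *
      pochhammer (X - of_nat c + of_nat k + 1) (b - k)))"
  proof (rule sum.mono_neutral_cong_right)
    show "\<forall>k\<in>{..b} - {k. k \<le> b \<and> k \<le> c}.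
      of_nat (b choose k) * pochhammer (- of_nat c) k * pochhammer (- (?Z - of_nat c)) (b - k) = 0"
    proof
      fix k assume "k \<in> {..b} - {k. k \<le> b \<and> k \<le> c}"
      then have "c < k" by auto
      then have "pochhammer (- of_nat c) k = (0 :: 'a)"
        unfolding pochhammer_prod by (intro prod_zero) (auto intro!: bexI[of _ c])
      then show "of_nat (b choose k) * pochhammer (- of_nat c) k * pochhammer (- (?Z - of_nat c)) (b - k) = 0"
        by (simp only: mult_zero_right mult_zero_left)
    qed
    fix k assume "k \<in> {k. k \<le> b \<and> k \<le> c}"
    then have k: "k \<le> b" "k \<le> c" by auto
    have "pochhammer (- of_nat c) k = (- 1) ^ k * (pochhammer (of_nat c - of_nat k + 1) k :: 'a)"
      by (rule pochhammer_minus)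
    also have "of_nat c - of_nat k + 1 = (of_nat (c - k + 1) :: 'a)" using k by (simp add: of_nat_diff)
    also have "pochhammer (of_nat (c - k + 1)) k = (of_nat (fact k * (c choose k)) :: 'a)"
      unfolding pochhammer_of_nat pochhammer_nat_binomial[OF k(2)] ..
    finally have p1: "pochhammer (- of_nat c) k = (- 1) ^ k * (of_nat (fact k * (c choose k)) :: 'a)" .
    have "pochhammer (- (?Z - of_nat c)) (b - k) = (- 1) ^ (b - k) * pochhammer (?Z - of_nat c - of_nat (b - k) + 1) (b - k)"
      by (rule pochhammer_minus)
    also have "?Z - of_nat c - of_nat (b - k) + 1 = X - of_nat c + of_nat k + 1" using k by (simp add: of_nat_diff)
    finally have p2: "pochhammer (- (?Z - of_nat c)) (b - k) = (- 1) ^ (b - k) * pochhammer (X - of_nat c + of_nat k + 1) (b - k)" .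
    have sgn: "(- 1) ^ b = (- 1) ^ k * ((- 1) ^ (b - k) :: 'a)" using k by (simp add: power_add[symmetric])
    show "of_nat (b choose k) * pochhammer (- of_nat c) k * pochhammer (- (?Z - of_nat c)) (b - k) =
      (- 1) ^ b * (of_nat (fact k * (b choose k) * (c choose k)) * pochhammer (X - of_nat c + of_nat k + 1) (b - k))"
      unfolding p1 p2 sgn by (simp add: mult_ac)
  qed auto
  also have "\<dots> = (- 1) ^ b * (\<Sum>k\<in>{k. k \<le> b \<and> k \<le> c}. of_nat (fact k * (b choose k) * (c choose k)) *
      pochhammer (X - of_nat c + of_nat k + 1) (b - k))"
    by (simp add: sum_distrib_left)
  finally have "(- 1) ^ b * ((- 1) ^ b * pochhammer (X + 1) b) = (- 1) ^ b * ((- 1) ^ b *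
      (\<Sum>k\<in>{k. k \<le> b \<and> k \<le> c}. of_nat (fact k * (b choose k) * (c choose k)) * pochhammer (X - of_nat c + of_nat k + 1) (b - k)))"
    by simp
  moreover have "(- 1) ^ b * ((- 1) ^ b * x) = x" for x :: 'a
    by (simp add: mult.assoc[symmetric] power_mult_distrib[symmetric])
  ultimately show ?thesis by simp
qed

lemma pconst_of_nat: "pconst (of_nat k) = of_nat k"
  by (simp add: pconst_def single_of_nat)

lemma wfac_pochhammer: "wfac v b y = (\<Prod>j\<in>UNIV. pochhammer (pconst (v $ j + of_int (y $ j)) + pvar j + 1) (lookup b j))"
  unfolding wfac_def
proof (rule prod.cong[OF refl])
  fix j
  have "(\<Prod>k\<in>{1..lookup b j}. pconst (v $ j + of_int (y $ j + int k)) + pvar j) =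
    (\<Prod>k\<in>{0..<lookup b j}. pconst (v $ j + of_int (y $ j + int (Suc k))) + pvar j)"
    by (rule prod.reindex_bij_witness[of _ Suc "\<lambda>k. k - 1"]) auto
  also have "\<dots> = (\<Prod>k\<in>{0..<lookup b j}. pconst (v $ j + of_int (y $ j)) + pvar j + 1 + of_nat k)"
    by (intro prod.cong refl) (simp add: pconst_add pconst_of_nat[symmetric] add_ac)
  finally show "(\<Prod>k\<in>{1..lookup b j}. pconst (v $ j + of_int (y $ j + int k)) + pvar j) =
    pochhammer (pconst (v $ j + of_int (y $ j)) + pvar j + 1) (lookup b j)"
    by (simp add: pochhammer_prod)
qed

text \<open>Differentiating by \<open>e\<close> leads from \<open>y + b + e\<close> to
  \<open>y + b\<close>, and then \<open>b\<close> leads to \<open>y\<close>; hence the shift in the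
  second factor.\<close>

lemma wfac_add: "wfac v (b + e) y = wfac v b y * wfac v e (y + exp_vec b)"
  unfolding wfac_pochhammer prod.distrib[symmetric]
proof (rule prod.cong[OF refl])
  fix j
  let ?X = "pconst (v $ j + of_int (y $ j)) + pvar j + 1"
  have "pochhammer ?X (lookup (b + e) j) = pochhammer ?X (lookup b j) * pochhammer (?X + of_nat (lookup b j)) (lookup e j)"
    using pochhammer_product[of "lookup b j" "lookup (b + e) j" ?X] by (simp add: lookup_add)
  also have "?X + of_nat (lookup b j) = pconst (v $ j + of_int ((y + exp_vec b) $ j)) + pvar j + 1"
    by (simp add: pconst_add pconst_of_nat add_ac)
  finally show "pochhammer ?X (lookup (b + e) j) =
    pochhammer ?X (lookup b j) * pochhammer (pconst (v $ j + of_int ((y + exp_vec b) $ j)) + pvar j + 1) (lookup e j)" .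
qed

text \<open>The one-variable identity holds in each coordinate; expanding the product over the
  coordinates turns a choice of summands into a multi-index \<open>k\<close>.\<close>

lemma wfac_leibniz:
  fixes b c :: "'n::finite \<Rightarrow>\<^sub>0 nat"
  shows "wfac v b y = (\<Sum>k\<in>{k. \<forall>j. lookup k j \<le> lookup b j \<and> lookup k j \<le> lookup c j}.
    cscale (\<Prod>j\<in>UNIV. fact (lookup k j) * of_nat (lookup b j choose lookup k j) * of_nat (lookup c j choose lookup k j))
      (wfac v (b - k) (y - exp_vec c + exp_vec k)))"
proof -
  define S where "S j = {k. k \<le> lookup b j \<and> k \<le> lookup c j}" for j
  define t where "t j k = of_nat (fact k * (lookup b j choose k) * (lookup c j choose k)) *
     pochhammer (pconst (v $ j + of_int (y $ j)) + pvar j - of_nat (lookup c j) + of_nat k + 1) (lookup b j - k)" for j k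
  have "wfac v b y = (\<Prod>j\<in>UNIV. \<Sum>k\<in>S j. t j k)"
    unfolding wfac_pochhammer S_def t_def by (intro prod.cong refl pochhammer_leibniz)
  also have "\<dots> = (\<Sum>\<kappa>\<in>PiE UNIV S. \<Prod>j\<in>UNIV. t j (\<kappa> j))"
    by (rule prod_sum_PiE) (auto simp: S_def)
  also have "\<dots> = (\<Sum>k\<in>{k. \<forall>j. lookup k j \<le> lookup b j \<and> lookup k j \<le> lookup c j}. \<Prod>j\<in>UNIV. t j (lookup k j))"
    by (rule sum.reindex_bij_witness[of _ lookup mk_exp]) (auto simp: S_def PiE_def intro: poly_mapping_eqI)
  also have "\<dots> = (\<Sum>k\<in>{k. \<forall>j. lookup k j \<le> lookup b j \<and> lookup k j \<le> lookup c j}.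
    cscale (\<Prod>j\<in>UNIV. fact (lookup k j) * of_nat (lookup b j choose lookup k j) * of_nat (lookup c j choose lookup k j))
      (wfac v (b - k) (y - exp_vec c + exp_vec k)))"
  proof (rule sum.cong[OF refl])
    fix k
    have p1: "pconst (\<Prod>j\<in>UNIV. f j) = (\<Prod>j\<in>UNIV. pconst (f j) :: 'n cpoly)" for f :: "'n \<Rightarrow> complex"
    proof -
      have pp: "pconst (prod f X) = (\<Prod>j\<in>X. pconst (f j) :: 'n cpoly)" for X
        by (induction X rule: infinite_finite_induct) (auto simp: pconst_mult)
      show ?thesis by (rule pp)
    qed
    have p2: "of_nat (fact (lookup k j) * (lookup b j choose lookup k j) * (lookup c j choose lookup k j)) =
      (pconst (fact (lookup k j) * of_nat (lookup b j choose lookup k j) * of_nat (lookup c j choose lookup k j)) :: 'n cpoly)" for j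
      unfolding pconst_of_nat[symmetric] by simp
    have p3: "pconst (v $ j + of_int (y $ j)) + pvar j - of_nat (lookup c j) + of_nat (lookup k j) + 1 =
      pconst (v $ j + of_int ((y - exp_vec c + exp_vec k) $ j)) + pvar j + 1" for j
      by (simp add: pconst_add pconst_diff pconst_of_nat)
    show "(\<Prod>j\<in>UNIV. t j (lookup k j)) =
      cscale (\<Prod>j\<in>UNIV. fact (lookup k j) * of_nat (lookup b j choose lookup k j) * of_nat (lookup c j choose lookup k j))
        (wfac v (b - k) (y - exp_vec c + exp_vec k))"
      unfolding t_def cscale_def wfac_pochhammer p1 prod.distrib[symmetric]
      by (intro prod.cong refl) (simp only: p2 p3 lookup_minus)
  qed
  finally show ?thesis .
qed

text \<open>All summands of the product shift the coefficient index equally, so what remains to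
  compare is the Leibniz identity for \<open>wfac\<close>. This is what makes the formula for
  \<open>weyl_act\<close> a module structure.\<close>

lemma weyl_act_mult_mon: "weyl_act v (weyl_mult_mon s t) F u = wmon v s (wmon v t F) u"
proof (cases s, cases t)
  fix a b c e assume s: "s = (a, b)" and t: "t = (c, e)"
  define y where "y = u - exp_vec a"
  define Z where "Z = F (y - exp_vec c + exp_vec b + exp_vec e)"
  let ?K = "{k. \<forall>j. lookup k j \<le> lookup b j \<and> lookup k j \<le> lookup c j}"
  let ?co = "\<lambda>k. \<Prod>j\<in>UNIV. fact (lookup k j) * of_nat (lookup b j choose lookup k j) * of_nat (lookup c j choose lookup k j)"
  have "weyl_act v (weyl_mult_mon s t) F u =
    (\<Sum>k\<in>?K. cscale (?co k) (wmon v (a + (c - k), (b - k) + e) F u))"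
    unfolding s t weyl_mult_mon_def prod.case weyl_act_sum weyl_act_single ..
  also have "\<dots> = (\<Sum>k\<in>?K. pdiff (cscale (?co k) (wfac v (b - k) (y - exp_vec c + exp_vec k))) (pdiff (wfac v e (y - exp_vec c + exp_vec b)) Z))"
  proof (rule sum.cong[OF refl])
    fix k assume "k \<in> ?K"
    then have k: "lookup k j \<le> lookup b j" "lookup k j \<le> lookup c j" for j by auto
    have ck: "exp_vec (c - k) = exp_vec c - exp_vec k" and bk: "exp_vec (b - k) = exp_vec b - exp_vec k"
      using k by (simp_all add: vec_eq_iff lookup_minus of_nat_diff)
    have y': "u - exp_vec (a + (c - k)) = y - exp_vec c + exp_vec k"
      by (simp add: y_def exp_vec_add ck algebra_simps)
    have z: "y - exp_vec c + exp_vec k + exp_vec ((b - k) + e) = y - exp_vec c + exp_vec b + exp_vec e"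
      by (simp add: exp_vec_add bk)
    have "wmon v (a + (c - k), (b - k) + e) F u = pdiff (wfac v ((b - k) + e) (y - exp_vec c + exp_vec k)) Z"
      by (simp only: wmon_def fst_conv snd_conv y' z Z_def)
    also have "wfac v ((b - k) + e) (y - exp_vec c + exp_vec k) =
      wfac v (b - k) (y - exp_vec c + exp_vec k) * wfac v e (y - exp_vec c + exp_vec b)"
    proof -
      have "y - exp_vec c + exp_vec k + (exp_vec b - exp_vec k) = y - exp_vec c + exp_vec b" by simp
      then show ?thesis by (simp only: wfac_add bk)
    qed
    finally show "cscale (?co k) (wmon v (a + (c - k), (b - k) + e) F u) =
      pdiff (cscale (?co k) (wfac v (b - k) (y - exp_vec c + exp_vec k))) (pdiff (wfac v e (y - exp_vec c + exp_vec b)) Z)"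
      by (simp add: pdiff_mult pdiff_cscale_left)
  qed
  also have "\<dots> = pdiff (wfac v b y) (pdiff (wfac v e (y - exp_vec c + exp_vec b)) Z)"
    by (subst wfac_leibniz[of v b y c]) (simp add: pdiff_sum_left)
  also have "\<dots> = wmon v s (wmon v t F) u"
  proof -
    have "y + exp_vec b - exp_vec c = y - exp_vec c + exp_vec b" by simp
    then show ?thesis by (simp only: wmon_def s t fst_conv snd_conv y_def[symmetric] Z_def)
  qed
  finally show ?thesis .
qed

lemma weyl_act_mult: "weyl_act v (weyl_mult P Q) F u = weyl_act v P (weyl_act v Q F) u"
proof -
  have "weyl_act v (weyl_mult P Q) F u =
    (\<Sum>s\<in>keys P. \<Sum>t\<in>keys Q. cscale (lookup P s * lookup Q t) (wmon v s (wmon v t F) u))"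
    unfolding weyl_mult_def weyl_act_sum weyl_act_scale weyl_act_mult_mon ..
  also have "\<dots> = (\<Sum>s\<in>keys P. cscale (lookup P s) (wmon v s (\<lambda>u. \<Sum>t\<in>keys Q. cscale (lookup Q t) (wmon v t F u)) u))"
    unfolding wmon_sum wmon_cscale by (simp add: cpoly.scale_sum_right)
  also have "\<dots> = weyl_act v P (weyl_act v Q F) u"
    by (simp add: weyl_act_eq[abs_def])
  finally show ?thesis .
qed

lemma weyl_act_zero_fun: "weyl_act v P (\<lambda>u. 0) u = 0"
  by (simp add: weyl_act_eq wmon_def)

lemma weyl_mult_one: "weyl_mult (weyl_const 1) Q = Q"
proof -
  have mon: "weyl_mult_mon (0, 0) t = single t 1" for t :: "('n::finite \<Rightarrow>\<^sub>0 nat) \<times> ('n \<Rightarrow>\<^sub>0 nat)"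
  proof (cases t)
    case (Pair c e)
    have K: "{k. \<forall>j. lookup k j \<le> lookup (0 :: 'n \<Rightarrow>\<^sub>0 nat) j \<and> lookup k j \<le> lookup c j} = {0}"
      by (auto intro: poly_mapping_eqI)
    show ?thesis unfolding Pair weyl_mult_mon_def prod.case K by simp
  qed
  have "weyl_mult (weyl_const 1) Q = (\<Sum>t\<in>keys Q. single t (lookup Q t))"
    by (simp add: weyl_mult_def weyl_const_def mon weyl_scale_single)
  then show ?thesis using poly_sum_single by metis
qed

lemma weyl_left_ideal_gen: "Q \<in> S \<Longrightarrow> Q \<in> weyl_left_ideal S"
  using weyl_left_ideal.mult[of Q S "weyl_const 1"] by (simp add: weyl_mult_one)

lemma weyl_left_ideal_annihilates:
  "(\<forall>P\<in>weyl_left_ideal S. weyl_act v P F = (\<lambda>u. 0)) \<longleftrightarrow> (\<forall>Q\<in>S. weyl_act v Q F = (\<lambda>u. 0))"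
proof
  assume "\<forall>P\<in>weyl_left_ideal S. weyl_act v P F = (\<lambda>u. 0)"
  then show "\<forall>Q\<in>S. weyl_act v Q F = (\<lambda>u. 0)" using weyl_left_ideal_gen by blast
next
  assume S: "\<forall>Q\<in>S. weyl_act v Q F = (\<lambda>u. 0)"
  show "\<forall>P\<in>weyl_left_ideal S. weyl_act v P F = (\<lambda>u. 0)"
  proof
    fix P assume "P \<in> weyl_left_ideal S"
    then show "weyl_act v P F = (\<lambda>u. 0)"
    proof (induction rule: weyl_left_ideal.induct)
      case (mult Q P)
      then have "weyl_act v Q F = (\<lambda>u. 0)" using S by blast
      then show ?case by (intro ext) (simp only: weyl_act_mult weyl_act_zero_fun)
    qed (simp_all add: fun_eq_iff weyl_act_add)
  qed
qed

section \<open>The hypergeometric system as equations on coefficients\<close>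

lemma weyl_act_partial: "weyl_act v (weyl_of_partial p) F u =
    (\<Sum>b\<in>keys p. cscale (lookup p b) (pdiff (wfac v b u) (F (u + exp_vec b))))"
proof -
  have "exp_vec (0 :: 'a::finite \<Rightarrow>\<^sub>0 nat) = 0" by (simp add: vec_eq_iff)
  then show ?thesis unfolding weyl_of_partial_def weyl_act_sum weyl_act_single by (simp add: wmon_def)
qed

lemma weyl_act_theta: "weyl_act v (weyl_scale c (weyl_theta j)) F u =
    cscale c (pdiff (pconst (v $ j + of_int (u $ j)) + pvar j) (F u))"
proof -
  have "wfac v (single j 1) (u - exp_vec (single j 1)) =
    (\<Prod>i\<in>UNIV. if i = j then pconst (v $ j + of_int (u $ j)) + pvar j else 1)"
    unfolding wfac_def by (intro prod.cong refl) (auto simp: lookup_single when_def)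
  also have "\<dots> = pconst (v $ j + of_int (u $ j)) + pvar j" by simp
  finally have "wmon v (single j 1, single j 1) F u = pdiff (pconst (v $ j + of_int (u $ j)) + pvar j) (F u)"
    unfolding wmon_def by simp
  then show ?thesis unfolding weyl_act_scale weyl_theta_def weyl_act_single by (simp add: cpoly.scale_one)
qed

text \<open>Along each row the constants \<open>v $ j + u $ j\<close> sum to \<beta> because
  \<open>u\<close> is in the kernel, so they cancel and the row form in the logarithmic derivatives
  remains.\<close>

lemma weyl_act_euler:
  fixes A :: "int ^ 'n::finite ^ 'd::finite"
  assumes beta: "\<And>i. (\<Sum>j\<in>UNIV. of_int (A $ i $ j) * v $ j) = \<beta> $ i" and supp: "F u \<noteq> 0 \<Longrightarrow> u \<in> int_kernel A"
  shows "weyl_act v (euler_op A \<beta> i) F u = pdiff (row_form A i) (F u)"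
proof (cases "F u = 0")
  case True
  have "exp_vec (0 :: 'n \<Rightarrow>\<^sub>0 nat) = 0" by (simp add: vec_eq_iff)
  then show ?thesis using True
    by (simp add: euler_op_def weyl_act_diff weyl_act_sum weyl_act_theta weyl_const_def weyl_act_single wmon_def)
next
  case False
  have "exp_vec (0 :: 'n \<Rightarrow>\<^sub>0 nat) = 0" by (simp add: vec_eq_iff)
  moreover have "wfac v 0 u = 1" by (simp add: wfac_def)
  ultimately have c: "weyl_act v (weyl_const (\<beta> $ i)) F u = cscale (\<beta> $ i) (F u)"
    by (simp add: weyl_const_def weyl_act_single wmon_def)
  have "(\<Sum>j\<in>UNIV. of_int (A $ i $ j) * of_int (u $ j)) = (0 :: complex)"
    using supp[OF False] unfolding int_kernel_iff by (metis (no_types, lifting) of_int_0 of_int_mult of_int_sum sum.cong)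
  then have s: "(\<Sum>j\<in>UNIV. of_int (A $ i $ j) * (v $ j + of_int (u $ j))) = \<beta> $ i"
    by (simp add: distrib_left sum.distrib beta)
  have "weyl_act v (euler_op A \<beta> i) F u =
    (\<Sum>j\<in>UNIV. cscale (of_int (A $ i $ j)) (pdiff (pconst (v $ j + of_int (u $ j)) + pvar j) (F u))) - cscale (\<beta> $ i) (F u)"
    unfolding euler_op_def weyl_act_diff weyl_act_sum weyl_act_theta c ..
  also have "(\<Sum>j\<in>UNIV. cscale (of_int (A $ i $ j)) (pdiff (pconst (v $ j + of_int (u $ j)) + pvar j) (F u))) =
    cscale (\<beta> $ i) (F u) + (\<Sum>j\<in>UNIV. cscale (of_int (A $ i $ j)) (pdiff (pvar j) (F u)))"
    unfolding s[symmetric]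
    by (simp add: pdiff_add_left pdiff_pconst cpoly.scale_right_distrib sum.distrib cpoly.scale_sum_left)
  also have "(\<Sum>j\<in>UNIV. cscale (of_int (A $ i $ j)) (pdiff (pvar j) (F u))) = pdiff (row_form A i) (F u)"
    unfolding row_form_def cscale_def[symmetric] by (simp add: pdiff_sum_left pdiff_cscale_left)
  finally show ?thesis by simp
qed

text \<open>Generators suffice by multiplicativity of the action, and binomials suffice among the
  toric operators by linearity.\<close>

lemma hypergeometric_solution_iff:
  fixes A :: "int ^ 'n::finite ^ 'd::finite"
  assumes beta: "\<And>i. (\<Sum>j\<in>UNIV. of_int (A $ i $ j) * v $ j) = \<beta> $ i" and supp: "\<forall>u. F u \<noteq> 0 \<longrightarrow> u \<in> int_kernel A"
  shows "(\<forall>P\<in>hypergeometric_ideal A \<beta>. weyl_act v P F = (\<lambda>u. 0)) \<longleftrightarrow>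
    (\<forall>i u. pdiff (row_form A i) (F u) = 0) \<and>
    (\<forall>a b y. A *v exp_vec a = A *v exp_vec b \<longrightarrow>
       pdiff (wfac v a y) (F (y + exp_vec a)) = pdiff (wfac v b y) (F (y + exp_vec b)))"
    (is "_ \<longleftrightarrow> ?E \<and> ?T")
proof -
  have E: "(\<forall>Q\<in>range (euler_op A \<beta>). weyl_act v Q F = (\<lambda>u. 0)) \<longleftrightarrow> ?E"
  proof -
    have "weyl_act v (euler_op A \<beta> i) F u = pdiff (row_form A i) (F u)" for i u
      by (rule weyl_act_euler[OF beta]) (use supp in blast)
    then show ?thesis by (simp add: fun_eq_iff)
  qed
  define W where "W p u = weyl_act v (weyl_of_partial p) F u" for p u
  have Wadd: "W (p + q) u = W p u + W q u" for p q u
    unfolding W_def weyl_act_partial by (rule setsum_keys_plus_distrib) (auto simp: cpoly.scale_left_distrib)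
  have Wmon: "W (pmon a) u = pdiff (wfac v a u) (F (u + exp_vec a))" for a u
    by (simp add: W_def weyl_act_partial pmon_def cpoly.scale_one)
  have W0: "W 0 u = 0" for u by (simp add: W_def weyl_act_partial)
  have Wsingle: "W (single a c) u = cscale c (pdiff (wfac v a u) (F (u + exp_vec a)))" for a c u
    by (cases "c = 0") (auto simp: W_def weyl_act_partial)
  have Wscale: "W (cscale c p) u = cscale c (W p u)" for c p u
    by (induction p rule: cpoly_induct)
      (auto simp: W0 Wadd cpoly.scale_right_distrib Wsingle cscale_def[of c "single _ _"] pconst_def mult_single)
  have Wdiff: "W (p - q) u = W p u - W q u" for p q u
    using Wadd[of "p - q" q u] by simp
  have T: "(\<forall>Q\<in>weyl_of_partial ` toric_ideal A. weyl_act v Q F = (\<lambda>u. 0)) \<longleftrightarrow> ?T"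
  proof
    assume L: "\<forall>Q\<in>weyl_of_partial ` toric_ideal A. weyl_act v Q F = (\<lambda>u. 0)"
    show ?T
    proof (intro allI impI)
      fix a b y assume "A *v exp_vec a = A *v exp_vec b"
      then have "pmon a - pmon b \<in> toric_ideal A" by (rule toric_ideal_binomial)
      then have "W (pmon a - pmon b) y = 0" using L by (simp add: W_def fun_eq_iff)
      then show "pdiff (wfac v a y) (F (y + exp_vec a)) = pdiff (wfac v b y) (F (y + exp_vec b))"
        by (simp add: Wdiff Wmon)
    qed
  next
    assume R: ?T
    have sp: "cpoly.subspace {p. \<forall>u. W p u = 0}"
      by (simp add: cpoly.subspace_def W0 Wadd Wscale)
    have sub: "{pmon a - pmon b | a b. A *v exp_vec a = A *v exp_vec b} \<subseteq> {p. \<forall>u. W p u = 0}"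
    proof clarify
      fix a b u assume "A *v exp_vec a = A *v exp_vec b"
      then have "pdiff (wfac v a u) (F (u + exp_vec a)) = pdiff (wfac v b u) (F (u + exp_vec b))" using R by blast
      then show "W (pmon a - pmon b) u = 0" by (simp only: Wdiff Wmon diff_self)
    qed
    have "cpoly.span {pmon a - pmon b | a b. A *v exp_vec a = A *v exp_vec b} \<subseteq> {p. \<forall>u. W p u = 0}"
      by (rule cpoly.span_minimal[OF sub sp])
    then have "\<forall>u. W p u = 0" if "p \<in> toric_ideal A" for p using toric_ideal_span[OF that] by blast
    then show "\<forall>Q\<in>weyl_of_partial ` toric_ideal A. weyl_act v Q F = (\<lambda>u. 0)"
      by (auto simp: W_def fun_eq_iff)
  qed
  show ?thesis
    unfolding hypergeometric_ideal_def weyl_left_ideal_annihilates ball_Un T E by blast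
qed

section \<open>Leading coefficients are solutions of \<open>Q\<close>\<close>

text \<open>\<open>\<theta>\<^sub>j\<close> is the only factor of \<open>wfac\<close> that acts non-invertibly on polynomials; \<open>ufac\<close> leaves it out.\<close>

definition ufac :: "complex ^ 'n::finite \<Rightarrow> 'n \<Rightarrow> int \<Rightarrow> 'n cpoly" where
  "ufac v j t = (if v $ j + of_int t = 0 then 1 else pconst (v $ j + of_int t) + pvar j)"

lemma nsupp_shift_iff: "j \<in> nsupp_shift v y \<longleftrightarrow> (\<exists>k<0. v $ j + of_int (y $ j) = of_int k)"
  by (auto simp: nsupp_shift_def nsupp_def cvec_def)

lemma nsupp_shift_0: "nsupp_shift v 0 = nsupp v"
  by (auto simp: nsupp_shift_iff nsupp_def)

lemma nsupp_shift_mono: "nsupp_shift v (y + exp_vec a) \<subseteq> nsupp_shift v y"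
proof
  fix j assume "j \<in> nsupp_shift v (y + exp_vec a)"
  then obtain k where k: "k < 0" "v $ j + of_int (y $ j + int (lookup a j)) = of_int k"
    unfolding nsupp_shift_iff by auto
  then have "v $ j + of_int (y $ j) = of_int (k - int (lookup a j))" by (simp add: algebra_simps)
  then show "j \<in> nsupp_shift v y" unfolding nsupp_shift_iff using k(1) by (intro exI[of _ "k - int (lookup a j)"]) auto
qed

text \<open>A factor vanishes exactly when differentiation takes the coordinate from the value 0 to
  \<open>- 1\<close>, that is, when it enters the negative support.\<close>

lemma zero_factor_iff:
  "(\<exists>k\<in>{1..lookup a j}. v $ j + of_int (y $ j + int k) = 0) \<longleftrightarrow>
   j \<in> nsupp_shift v y - nsupp_shift v (y + exp_vec a)"
proof
  assume "\<exists>k\<in>{1..lookup a j}. v $ j + of_int (y $ j + int k) = 0"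
  then obtain k where k: "1 \<le> k" "k \<le> lookup a j" "v $ j + of_int (y $ j + int k) = 0" by auto
  then have "v $ j = - of_int (y $ j + int k)" by (simp only: eq_neg_iff_add_eq_0)
  then have v: "v $ j = of_int (- (y $ j + int k))" by simp
  have "j \<in> nsupp_shift v y"
    unfolding nsupp_shift_iff using k(1) by (intro exI[of _ "- int k"]) (auto simp: v)
  moreover have "j \<notin> nsupp_shift v (y + exp_vec a)"
  proof
    assume "j \<in> nsupp_shift v (y + exp_vec a)"
    then obtain l where l: "l < 0" "v $ j + of_int ((y + exp_vec a) $ j) = of_int l" unfolding nsupp_shift_iff by blast
    then have "of_int (int (lookup a j) - int k) = (of_int l :: complex)" by (simp add: v)
    then have "int (lookup a j) - int k = l" by (simp only: of_int_eq_iff)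
    then show False using k l by simp
  qed
  ultimately show "j \<in> nsupp_shift v y - nsupp_shift v (y + exp_vec a)" by simp
next
  assume j: "j \<in> nsupp_shift v y - nsupp_shift v (y + exp_vec a)"
  then have "j \<in> nsupp_shift v y" and jn: "j \<notin> nsupp_shift v (y + exp_vec a)" by simp_all
  then obtain l where l: "l < 0" "v $ j + of_int (y $ j) = of_int l" unfolding nsupp_shift_iff by blast
  have "v $ j + of_int ((y + exp_vec a) $ j) = of_int (l + int (lookup a j))" using l(2) by simp
  then have "\<not> l + int (lookup a j) < 0" using jn unfolding nsupp_shift_iff by blast
  moreover have "v $ j + of_int (y $ j + int (nat (- l))) = 0" using l by (simp add: add_diff_eq)
  ultimately show "\<exists>k\<in>{1..lookup a j}. v $ j + of_int (y $ j + int k) = 0"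
    using l(1) by (intro bexI[of _ "nat (- l)"]) auto
qed

text \<open>In each coordinate at most one factor has constant term 0, since the constant term
  determines \<open>k\<close>; this factor is \<open>pvar j\<close> and is pulled out.\<close>

lemma wfac_split:
  "wfac v a y = (\<Prod>j\<in>nsupp_shift v y - nsupp_shift v (y + exp_vec a). pvar j) *
     (\<Prod>j\<in>UNIV. \<Prod>k\<in>{1..lookup a j}. ufac v j (y $ j + int k))"
proof -
  let ?D = "nsupp_shift v y - nsupp_shift v (y + exp_vec a)"
  have "wfac v a y = (\<Prod>j\<in>UNIV. (if j \<in> ?D then pvar j else 1) * (\<Prod>k\<in>{1..lookup a j}. ufac v j (y $ j + int k)))"
    unfolding wfac_def
  proof (rule prod.cong[OF refl])
    fix j
    show "(\<Prod>k\<in>{1..lookup a j}. pconst (v $ j + of_int (y $ j + int k)) + pvar j) =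
      (if j \<in> ?D then pvar j else 1) * (\<Prod>k\<in>{1..lookup a j}. ufac v j (y $ j + int k))"
    proof (cases "j \<in> ?D")
      case True
      then obtain k where k: "k \<in> {1..lookup a j}" "v $ j + of_int (y $ j + int k) = 0"
        using zero_factor_iff[of a j v y] by blast
      have uniq: "v $ j + of_int (y $ j + int l) \<noteq> 0" if "l \<noteq> k" for l
      proof
        assume "v $ j + of_int (y $ j + int l) = 0"
        then have "of_int (y $ j + int l) = (of_int (y $ j + int k) :: complex)" using k(2) by (metis add_left_cancel)
        then show False using that by (simp only: of_int_eq_iff)
      qed
      have "(\<Prod>k\<in>{1..lookup a j}. pconst (v $ j + of_int (y $ j + int k)) + pvar j) =
        (pconst (v $ j + of_int (y $ j + int k)) + pvar j) * (\<Prod>l\<in>{1..lookup a j} - {k}. pconst (v $ j + of_int (y $ j + int l)) + pvar j)"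
        by (rule prod.remove) (use k(1) in auto)
      also have "(\<Prod>l\<in>{1..lookup a j} - {k}. pconst (v $ j + of_int (y $ j + int l)) + pvar j) =
        (\<Prod>l\<in>{1..lookup a j} - {k}. ufac v j (y $ j + int l))"
        by (rule prod.cong[OF refl]) (use uniq in \<open>auto simp: ufac_def\<close>)
      also have "\<dots> = ufac v j (y $ j + int k) * (\<Prod>l\<in>{1..lookup a j} - {k}. ufac v j (y $ j + int l))"
        using k(2) by (simp add: ufac_def)
      also have "\<dots> = (\<Prod>l\<in>{1..lookup a j}. ufac v j (y $ j + int l))"
        by (rule prod.remove[symmetric]) (use k(1) in auto)
      finally show ?thesis using True k(2) by simp
    next
      case False
      have "v $ j + of_int (y $ j + int k) \<noteq> 0" if "k \<in> {1..lookup a j}" for k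
        using zero_factor_iff[of a j v y] False that by blast
      then show ?thesis using False by (auto simp: ufac_def intro!: prod.cong)
    qed
  qed
  also have "\<dots> = (\<Prod>j\<in>UNIV. if j \<in> ?D then pvar j else 1) * (\<Prod>j\<in>UNIV. \<Prod>k\<in>{1..lookup a j}. ufac v j (y $ j + int k))"
    by (rule prod.distrib)
  also have "(\<Prod>j\<in>UNIV. if j \<in> ?D then pvar j else 1) = (\<Prod>j\<in>?D. pvar j)"
    by (rule prod.mono_neutral_cong_right) auto
  finally show ?thesis .
qed

definition inj_op :: "'n::finite cpoly \<Rightarrow> bool" where
  "inj_op \<phi> \<longleftrightarrow> (\<forall>f. pdiff \<phi> f = 0 \<longrightarrow> f = 0)"

lemma inj_op_prod: "(\<And>x. x \<in> X \<Longrightarrow> inj_op (h x)) \<Longrightarrow> inj_op (prod h X)"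
proof (induction X rule: infinite_finite_induct)
  case (insert x X)
  then have "inj_op (h x)" "inj_op (prod h X)" by simp_all
  then show ?case unfolding prod.insert[OF insert.hyps] inj_op_def pdiff_mult by blast
qed (simp_all add: inj_op_def)

text \<open>A nonzero kernel element would be an eigenvector of the nilpotent derivative with
  nonzero eigenvalue.\<close>

lemma inj_op_ufac: "inj_op (ufac v j t)"
proof (cases "v $ j + of_int t = 0")
  case False
  define c where "c = v $ j + of_int t"
  have "f = 0" if f: "pdiff (pconst c + pvar j) f = 0" for f
  proof -
    have "pdiff (pvar j) f = cscale (- c) f"
      using f by (simp add: pdiff_add_left pdiff_pconst add_eq_0_iff)
    then have pw: "pdiff (pvar j ^ k) f = cscale ((- c) ^ k) f" for k
      by (induction k) (auto simp: cpoly.scale_one pdiff_mult pdiff_cscale_right mult.commute)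
    obtain N where "\<forall>m\<in>keys f. mdeg m \<le> N" using keys_mdeg_bound by blast
    then have "pdiff (pvar j ^ Suc N) f = 0" by (rule pdiff_power_eq_0)
    then have "cscale ((- c) ^ Suc N) f = 0" using pw[of "Suc N"] by metis
    moreover have "(- c) ^ Suc N \<noteq> 0" using False by (simp only: c_def power_eq_0_iff neg_equal_0_iff_equal) simp
    ultimately show "f = 0" using cpoly.scale_eq_0_iff by blast
  qed
  then show ?thesis using False by (auto simp: inj_op_def ufac_def c_def)
qed (simp add: inj_op_def ufac_def)

lemma (in toric_groebner) w_g_pos: "i < m \<Longrightarrow> w \<bullet> rvec (g i) > 0"
proof -
  assume i: "i < m"
  have "rvec (g i) = rvec (exp_vec (gp i)) - rvec (exp_vec (gm i))"
    using g_def i by (simp add: rvec_def vec_eq_iff)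
  then show ?thesis using weight_gp[OF i] by (simp add: weight_def inner_diff_right)
qed

lemma (in toric_groebner) leading_coeffs_sub:
  assumes beta: "\<And>i. (\<Sum>j\<in>UNIV. of_int (A $ i $ j) * v $ j) = \<beta> $ i"
    and F: "series_solution A \<beta> w v F"
  shows "F 0 \<in> Q_perp A v m g"
proof -
  have supp: "\<forall>u. F u \<noteq> 0 \<longrightarrow> u \<in> int_kernel A" using F by (simp add: series_solution_def)
  have sol: "\<forall>i u. pdiff (row_form A i) (F u) = 0"
    "\<forall>a b y. A *v exp_vec a = A *v exp_vec b \<longrightarrow>
       pdiff (wfac v a y) (F (y + exp_vec a)) = pdiff (wfac v b y) (F (y + exp_vec b))"
  proof -
    have ann: "\<forall>P\<in>hypergeometric_ideal A \<beta>. weyl_act v P F = (\<lambda>u. 0)"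
      using F unfolding series_solution_def by blast
    note iff = hypergeometric_solution_iff[OF beta supp]
    show "\<forall>i u. pdiff (row_form A i) (F u) = 0" by (rule iff[THEN iffD1, OF ann, THEN conjunct1])
    show "\<forall>a b y. A *v exp_vec a = A *v exp_vec b \<longrightarrow>
       pdiff (wfac v a y) (F (y + exp_vec a)) = pdiff (wfac v b y) (F (y + exp_vec b))"
      by (rule iff[THEN iffD1, OF ann, THEN conjunct2])
  qed
  obtain R where R: "\<forall>x\<in>rational_cone R. x \<noteq> 0 \<longrightarrow> w \<bullet> x > 0" "\<forall>u. F u \<noteq> 0 \<longrightarrow> rvec u \<in> rational_cone R"
    using F unfolding series_solution_def by blast
  have G0: "pdiff (\<Prod>j\<in>G_set v (g i). pvar j) (F 0) = 0" if i: "i < m" for i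
  proof -
    have Fg: "F (- g i) = 0"
    proof (rule ccontr)
      assume "F (- g i) \<noteq> 0"
      then have "rvec (- g i) \<in> rational_cone R" using R(2) by blast
      moreover have neg: "rvec (- g i) = - rvec (g i)" by (simp add: rvec_def vec_eq_iff)
      moreover have "rvec (- g i) \<noteq> 0" using w_g_pos[OF i] by (auto simp: neg)
      ultimately have "w \<bullet> rvec (- g i) > 0" using R(1) by blast
      then show False using w_g_pos[OF i] by (simp add: neg)
    qed
    \<comment> \<open>With this \<open>y\<close> the binomial of \<open>gp i\<close> and
      \<open>gm i\<close> compares the coefficients at 0 and at \<open>- g i\<close>. The latter is
      zero, so the operator of \<open>gp i\<close> kills \<open>F 0\<close>.\<close>
    define y where "y = - exp_vec (gp i)"
    have "pdiff (wfac v (gp i) y) (F (y + exp_vec (gp i))) = pdiff (wfac v (gm i) y) (F (y + exp_vec (gm i)))"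
      using sol(2) gp_gm_kernel[OF i] by blast
    moreover have "y + exp_vec (gm i) = - g i" using g_def i by (simp add: y_def)
    moreover have y0: "y + exp_vec (gp i) = 0" by (simp add: y_def)
    ultimately have "pdiff (wfac v (gp i) y) (F 0) = 0" using Fg by simp
    moreover have "nsupp_shift v y - nsupp_shift v (y + exp_vec (gp i)) = G_set v (g i)"
    proof -
      have "j \<in> nsupp_shift v y - nsupp_shift v (y + exp_vec (gp i)) \<longleftrightarrow> j \<in> G_set v (g i)" for j
        unfolding zero_factor_iff[symmetric] G_set_eq[OF i]
      proof
        assume "\<exists>k\<in>{1..lookup (gp i) j}. v $ j + of_int (y $ j + int k) = 0"
        then obtain k where k: "1 \<le> k" "k \<le> lookup (gp i) j" "v $ j + of_int (y $ j + int k) = 0" by auto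
        then have vj: "v $ j = of_nat (lookup (gp i) j - k)" by (simp add: y_def of_nat_diff add_eq_0_iff algebra_simps)
        then have "j \<in> nat_part v" unfolding nat_part_def by blast
        moreover have "nat_val v j < lookup (gp i) j" unfolding nat_val_eq[OF vj] using k(1,2) by simp
        ultimately show "j \<in> {j \<in> nat_part v. nat_val v j < lookup (gp i) j}" by simp
      next
        assume j: "j \<in> {j \<in> nat_part v. nat_val v j < lookup (gp i) j}"
        then have "v $ j + of_int (y $ j + int (lookup (gp i) j - nat_val v j)) = 0"
          using nat_val[of j v] by (simp add: y_def of_nat_diff)
        then show "\<exists>k\<in>{1..lookup (gp i) j}. v $ j + of_int (y $ j + int k) = 0"
          using j by (intro bexI[of _ "lookup (gp i) j - nat_val v j"]) auto
      qed
      then show ?thesis by blast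
    qed
    ultimately have "pdiff (\<Prod>j\<in>UNIV. \<Prod>k\<in>{1..lookup (gp i) j}. ufac v j (y $ j + int k))
        (pdiff (\<Prod>j\<in>G_set v (g i). pvar j) (F 0)) = 0"
      unfolding wfac_split by (simp add: pdiff_mult[symmetric] mult.commute)
    \<comment> \<open>The factors other than the \<open>G_set\<close> product can be
      cancelled.\<close>
    moreover have "inj_op (\<Prod>j\<in>UNIV. \<Prod>k\<in>{1..lookup (gp i) j}. ufac v j (y $ j + int k))"
      by (intro inj_op_prod inj_op_ufac)
    ultimately show ?thesis unfolding inj_op_def by blast
  qed
  have "pdiff \<phi> (F 0) = 0" if "\<phi> \<in> Q_ideal A v m g" for \<phi>
    using that[unfolded Q_ideal_def] Q_gens_sub
  proof (induction rule: Idl_induct)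
    case (mult c s)
    then have "pdiff s (F 0) = 0" using sol(1) G0 by auto
    then show ?case by (simp add: pdiff_mult)
  qed (auto simp: pdiff_add_left)
  then show ?thesis by (simp add: Q_perp_def)
qed

section \<open>The Frobenius method\<close>

lemma mfact_single: "mfact (k + single i 1) = of_nat (lookup k i + 1) * mfact k"
proof -
  have "mfact (k + single i 1) = (\<Prod>j\<in>UNIV. (if j = i then of_nat (lookup k i + 1) else 1) * fact (lookup k j))"
    unfolding mfact_def by (intro prod.cong refl) (auto simp: lookup_add lookup_single when_def)
  then show ?thesis by (simp add: prod.distrib mfact_def)
qed

lemma lookup_pdiff_pvar: "lookup (pdiff (pvar i) f) k = of_nat (lookup k i + 1) * lookup f (k + single i 1)"
  for f :: "'n::finite cpoly"
  unfolding pvar_def pmon_def lookup_pdiff_single mfact_single by simp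

lemma pdiff_pvar_mult_pvar:
  fixes f :: "'n::finite cpoly"
  shows "pdiff (pvar i) (pvar k * f) = (if i = k then f else 0) + pvar k * pdiff (pvar i) f"
proof (rule poly_mapping_eqI)
  fix n
  have mul: "lookup (pvar k * h) (a + single k 1) = lookup h a" for h :: "'n cpoly" and a
    using lookup_single_mult_add[of "single k 1" 1 h a] by (simp add: pvar_def pmon_def add.commute)
  have mul0: "lookup (pvar k * h) a = 0" if "lookup a k = 0" for h :: "'n cpoly" and a
    unfolding pvar_def pmon_def lookup_single_mult using that by (auto simp: lookup_add)
  have comm: "a + single k 1 + single i 1 = a + single i 1 + single k (1::nat)" for a by (simp add: ac_simps)
  show "lookup (pdiff (pvar i) (pvar k * f)) n = lookup ((if i = k then f else 0) + pvar k * pdiff (pvar i) f) n"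
  proof (cases "lookup n k = 0")
    case True
    then show ?thesis
      by (cases "i = k") (auto simp: lookup_pdiff_pvar lookup_add mul0 mul[unfolded One_nat_def] lookup_single when_def)
  next
    case False
    define n' where "n' = n - single k 1"
    have n: "n = n' + single k 1"
      using False by (intro poly_mapping_eqI) (auto simp: n'_def lookup_add lookup_minus lookup_single when_def)
    show ?thesis
    proof (cases "i = k")
      case True
      have "lookup (pdiff (pvar i) (pvar k * f)) n = of_nat (lookup n k + 1) * lookup f n"
        unfolding lookup_pdiff_pvar True mul ..
      moreover have "lookup (pvar k * pdiff (pvar i) f) n = of_nat (lookup n' k + 1) * lookup f n"
        unfolding n mul lookup_pdiff_pvar True ..
      moreover have "lookup n k = lookup n' k + 1" unfolding n by (simp add: lookup_add)
      ultimately show ?thesis using True by (simp add: lookup_add algebra_simps)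
    next
      case F: False
      have "lookup (pdiff (pvar i) (pvar k * f)) n = of_nat (lookup n i + 1) * lookup f (n' + single i 1)"
        unfolding lookup_pdiff_pvar by (simp only: n comm mul)
      moreover have "lookup (pvar k * pdiff (pvar i) f) n = of_nat (lookup n' i + 1) * lookup f (n' + single i 1)"
        unfolding n mul lookup_pdiff_pvar ..
      moreover have "lookup n i = lookup n' i" unfolding n using F by (simp add: lookup_add lookup_single when_def)
      ultimately show ?thesis using F by (simp add: lookup_add)
    qed
  qed
qed

definition lform :: "('n::finite \<Rightarrow> complex) \<Rightarrow> 'n cpoly" where
  "lform c = (\<Sum>i\<in>UNIV. cscale (c i) (pvar i))"

text \<open>Bilinear extension of the commutation rule: the commutator of a directional derivative
  with multiplication by a linear form is the scalar product of the coefficient vectors.\<close>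

lemma pdiff_lform_mult:
  fixes f :: "'n::finite cpoly"
  shows "pdiff (lform c) (lform d * f) = cscale (\<Sum>i\<in>UNIV. c i * d i) f + lform d * pdiff (lform c) f"
proof -
  have "pdiff (lform c) (lform d * f) = (\<Sum>i\<in>UNIV. \<Sum>k\<in>UNIV. cscale (c i * d k) (pdiff (pvar i) (pvar k * f)))"
  proof -
    have d: "lform d * f = (\<Sum>k\<in>UNIV. cscale (d k) (pvar k * f))"
      by (simp add: lform_def sum_distrib_right cscale_mult_left)
    have pc: "pdiff (lform c) h = (\<Sum>i\<in>UNIV. cscale (c i) (pdiff (pvar i) h))" for h
      by (simp add: lform_def pdiff_sum_left pdiff_cscale_left)
    show ?thesis
      unfolding pc unfolding d pdiff_sum_right pdiff_cscale_right cpoly.scale_sum_right cpoly.scale_scale ..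
  qed
  also have "\<dots> = (\<Sum>i\<in>UNIV. \<Sum>k\<in>UNIV. (if k = i then cscale (c i * d k) f else 0) + cscale (c i * d k) (pvar k * pdiff (pvar i) f))"
    by (intro sum.cong refl) (auto simp: pdiff_pvar_mult_pvar cpoly.scale_right_distrib)
  also have "\<dots> = (\<Sum>i\<in>UNIV. cscale (c i * d i) f) + (\<Sum>i\<in>UNIV. \<Sum>k\<in>UNIV. cscale (c i * d k) (pvar k * pdiff (pvar i) f))"
    by (simp add: sum.distrib)
  also have "(\<Sum>i\<in>UNIV. \<Sum>k\<in>UNIV. cscale (c i * d k) (pvar k * pdiff (pvar i) f)) = lform d * pdiff (lform c) f"
  proof -
    have "lform d * pdiff (lform c) f = (\<Sum>k\<in>UNIV. \<Sum>i\<in>UNIV. cscale (d k) (pvar k) * cscale (c i) (pdiff (pvar i) f))"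
      by (simp add: lform_def pdiff_sum_left pdiff_cscale_left sum_product)
    also have "\<dots> = (\<Sum>k\<in>UNIV. \<Sum>i\<in>UNIV. cscale (c i * d k) (pvar k * pdiff (pvar i) f))"
      by (intro sum.cong refl) (simp add: cscale_mult_left cscale_mult_right mult.commute)
    also have "\<dots> = (\<Sum>i\<in>UNIV. \<Sum>k\<in>UNIV. cscale (c i * d k) (pvar k * pdiff (pvar i) f))"
      by (rule sum.swap)
    finally show ?thesis by simp
  qed
  finally show ?thesis by (simp add: cpoly.scale_sum_left)
qed

lemma row_form_lform: "row_form A i = lform (\<lambda>j. of_int (A $ i $ j))"
  by (simp add: row_form_def lform_def cscale_def)

lemma pvar_lform: "pvar j = lform (\<lambda>i. if i = j then 1 else 0)"
  by (simp add: lform_def if_distrib[of "\<lambda>c. cscale c _"] cpoly.scale_one cong: if_cong)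

text \<open>The solutions of the Euler equations alone. All coefficients of series solutions lie
  here, and \<open>Q_perp\<close> is the part killed by the \<open>G_set\<close> products.\<close>

definition row_perp :: "int ^ 'n::finite ^ 'd::finite \<Rightarrow> 'n cpoly set" where
  "row_perp A = {q. \<forall>i. pdiff (row_form A i) q = 0}"

lemma row_perp_subspace: "cpoly.subspace (row_perp A)"
  unfolding row_perp_def cpoly.subspace_def by (auto simp: pdiff_add_right pdiff_cscale_right)

lemma row_perp_pdiff: "q \<in> row_perp A \<Longrightarrow> pdiff \<phi> q \<in> row_perp A"
  unfolding row_perp_def by (auto simp: pdiff_commute[of _ \<phi>])

lemma row_perp_span: "q \<in> row_perp A \<Longrightarrow> \<phi> \<in> cpoly.span (range (row_form A)) \<Longrightarrow> pdiff \<phi> q = 0"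
proof -
  assume q: "q \<in> row_perp A" and \<phi>: "\<phi> \<in> cpoly.span (range (row_form A))"
  have "cpoly.subspace {\<phi>. pdiff \<phi> q = 0}"
    by (auto simp: cpoly.subspace_def pdiff_add_left pdiff_cscale_left)
  moreover have "range (row_form A) \<subseteq> {\<phi>. pdiff \<phi> q = 0}" using q by (auto simp: row_perp_def)
  ultimately show ?thesis using cpoly.span_minimal \<phi> by blast
qed

text \<open>Multiplication by the linear form of \<open>u\<close> preserves \<open>row_perp A\<close> and has commutator \<open>u\<^sub>j\<close> with
  the locally nilpotent \<open>\<partial>\<^sub>j\<close>; hence \<open>\<partial>\<^sub>j\<close> is surjective on \<open>row_perp A\<close>.\<close>

lemma row_perp_antiderivative:
  fixes A :: "int ^ 'n::finite ^ 'd::finite"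
  assumes u: "u \<in> int_kernel A" "u $ j \<noteq> 0" and f: "f \<in> row_perp A"
  shows "\<exists>q\<in>row_perp A. pdiff (pvar j) q = f"
proof -
  define l where "l = lform (\<lambda>i. of_int (u $ i) :: complex)"
  have lW: "l * h \<in> row_perp A" if "h \<in> row_perp A" for h
  proof -
    have "(\<Sum>j\<in>UNIV. of_int (A $ i $ j) * of_int (u $ j)) = (0 :: complex)" for i
      using u(1) unfolding int_kernel_iff by (metis (no_types, lifting) of_int_0 of_int_mult of_int_sum sum.cong)
    then have "pdiff (row_form A i) (l * h) = l * pdiff (row_form A i) h" for i
      unfolding row_form_lform l_def pdiff_lform_mult by (simp add: cpoly.scale_zero_left)
    then show ?thesis using that by (simp add: row_perp_def)
  qed
  have lpow: "l ^ k * h \<in> row_perp A" if "h \<in> row_perp A" for h k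
    by (induction k) (use that lW in \<open>auto simp: mult.assoc\<close>)
  have comm: "pdiff (pvar j) (l * h) = cscale (of_int (u $ j)) h + l * pdiff (pvar j) h" for h
    unfolding pvar_lform[of j] l_def pdiff_lform_mult
    by (simp add: if_distrib[of "\<lambda>x. x * _"] cong: if_cong)
  have comm_pow: "pdiff (pvar j) (l ^ Suc k * h) = cscale (of_nat (Suc k) * of_int (u $ j)) (l ^ k * h) + l ^ Suc k * pdiff (pvar j) h" for k h
  proof (induction k)
    case (Suc k)
    have "pdiff (pvar j) (l ^ Suc (Suc k) * h) = pdiff (pvar j) (l * (l ^ Suc k * h))" by (simp add: mult.assoc)
    also have "\<dots> = cscale (of_int (u $ j)) (l ^ Suc k * h) + l * pdiff (pvar j) (l ^ Suc k * h)" by (rule comm)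
    also have "\<dots> = cscale (of_int (u $ j)) (l ^ Suc k * h) +
      (cscale (of_nat (Suc k) * of_int (u $ j)) (l * (l ^ k * h)) + l * (l ^ Suc k * pdiff (pvar j) h))"
      unfolding Suc.IH distrib_left cscale_mult_right ..
    also have "\<dots> = cscale (of_int (u $ j) + of_nat (Suc k) * of_int (u $ j)) (l ^ Suc k * h) + l ^ Suc (Suc k) * pdiff (pvar j) h"
      by (simp add: cpoly.scale_left_distrib mult.assoc add.assoc)
    finally show ?case by (simp add: algebra_simps)
  qed (simp add: comm)
  \<comment> \<open>Integration by parts: the derivative of \<open>l ^ Suc k * f\<close> is a
    nonzero multiple of \<open>l ^ k * f\<close> plus a term in \<open>pdiff (pvar j) f\<close>,
    which dies after one derivative less. The power \<open>k\<close> is general because it grows in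
    the recursion.\<close>
  have "\<exists>q\<in>row_perp A. pdiff (pvar j) q = l ^ k * f" if "pdiff (pvar j ^ N) f = 0" "f \<in> row_perp A" for N k f
    using that
  proof (induction N arbitrary: k f)
    case 0
    then show ?case using cpoly.subspace_0[OF row_perp_subspace] by (intro bexI[of _ 0]) auto
  next
    case (Suc N)
    have "pdiff (pvar j ^ N) (pdiff (pvar j) f) = 0"
      using Suc.prems(1) by (simp add: pdiff_mult[symmetric] mult.commute)
    then obtain q where q: "q \<in> row_perp A" "pdiff (pvar j) q = l ^ Suc k * pdiff (pvar j) f"
      using Suc.IH[of "pdiff (pvar j) f" "Suc k"] row_perp_pdiff[OF Suc.prems(2)] by blast
    define c :: complex where "c = of_nat (Suc k) * of_int (u $ j)"
    have c: "c \<noteq> 0" using u(2) unfolding c_def by (simp del: of_nat_Suc)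
    have "pdiff (pvar j) (cscale (inverse c) (l ^ Suc k * f - q)) = cscale (inverse c) (cscale c (l ^ k * f))"
      unfolding pdiff_cscale_right pdiff_diff_right comm_pow q(2) c_def[symmetric] by simp
    also have "\<dots> = l ^ k * f" using c by (simp add: cpoly.scale_one)
    finally have "pdiff (pvar j) (cscale (inverse c) (l ^ Suc k * f - q)) = l ^ k * f" .
    moreover have "cscale (inverse c) (l ^ Suc k * f - q) \<in> row_perp A"
      by (intro cpoly.subspace_scale[OF row_perp_subspace] cpoly.subspace_diff[OF row_perp_subspace]
        lpow[OF Suc.prems(2)] q(1))
    ultimately show ?case by (rule bexI)
  qed
  moreover obtain N where "\<forall>m\<in>keys f. mdeg m \<le> N" using keys_mdeg_bound by blast
  then have "pdiff (pvar j ^ Suc N) f = 0" by (rule pdiff_power_eq_0)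
  ultimately have "\<exists>q\<in>row_perp A. pdiff (pvar j) q = l ^ 0 * f" using f by blast
  then show ?thesis by simp
qed

lemma row_perp_antiderivative_set:
  fixes A :: "int ^ 'n::finite ^ 'd::finite"
  assumes X: "\<And>j. j \<in> X \<Longrightarrow> \<exists>u\<in>int_kernel A. u $ j \<noteq> 0" and f: "f \<in> row_perp A"
  shows "\<exists>q\<in>row_perp A. pdiff (\<Prod>j\<in>X. pvar j) q = f"
proof -
  have "\<exists>q\<in>row_perp A. pdiff (\<Prod>j\<in>Y. pvar j) q = f" if "finite Y" "Y \<subseteq> X" for Y
    using that
  proof (induction Y rule: finite_induct)
    case empty
    then show ?case using f by auto
  next
    case (insert j Y)
    then obtain q where q: "q \<in> row_perp A" "pdiff (\<Prod>j\<in>Y. pvar j) q = f" by auto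
    obtain u where "u \<in> int_kernel A" "u $ j \<noteq> 0" using X insert.prems by blast
    then obtain q' where q': "q' \<in> row_perp A" "pdiff (pvar j) q' = q"
      using row_perp_antiderivative[OF _ _ q(1)] by blast
    have "pdiff (\<Prod>j\<in>insert j Y. pvar j) q' = f"
      using insert.hyps q q' by (simp add: pdiff_mult pdiff_commute[of "pvar j"])
    then show ?case using q'(1) by blast
  qed
  then show ?thesis by simp
qed

text \<open>A nonzero constant plus a nilpotent operator is inverted by a finite geometric series;
  truncation at \<open>N\<close> gives one \<open>r\<close> for all polynomials of degree at most
  \<open>N\<close>.\<close>

lemma ufac_inverse:
  fixes v :: "complex ^ 'n::finite"
  shows "\<exists>r. \<forall>h. (\<forall>m\<in>keys h. mdeg m \<le> N) \<longrightarrow> pdiff (ufac v j t * r) h = h"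
proof (cases "v $ j + of_int t = 0")
  case True
  then show ?thesis by (intro exI[of _ 1]) (simp add: ufac_def)
next
  case False
  define c where "c = v $ j + of_int t"
  define x :: "'n cpoly" where "x = pconst (- inverse c) * pvar j"
  define r where "r = pconst (inverse c) * (\<Sum>i<Suc N. x ^ i)"
  have "pconst c * (1 - x) = pconst c + pconst (c * inverse c) * pvar j"
    by (simp add: x_def distrib_left pconst_mult pconst_uminus mult.assoc)
  then have "ufac v j t = pconst c * (1 - x)" using False by (simp add: ufac_def c_def)
  then have "ufac v j t * r = (pconst c * pconst (inverse c)) * ((1 - x) * (\<Sum>i<Suc N. x ^ i))"
    by (simp add: r_def mult_ac)
  also have "\<dots> = 1 - x ^ Suc N"
    unfolding one_diff_power_eq[symmetric] using False by (simp add: pconst_mult[symmetric] c_def)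
  finally have eq: "ufac v j t * r = 1 - x ^ Suc N" .
  have "pdiff (ufac v j t * r) h = h" if h: "\<forall>m\<in>keys h. mdeg m \<le> N" for h
  proof -
    have "x ^ Suc N = pconst (- inverse c) ^ Suc N * pvar j ^ Suc N" unfolding x_def by (rule power_mult_distrib)
    then have "pdiff (x ^ Suc N) h = 0" using pdiff_power_eq_0[OF h, of j] by (simp only: pdiff_mult pdiff_0_right)
    then show ?thesis unfolding eq by (simp only: pdiff_diff_left pdiff_1) simp
  qed
  then show ?thesis by blast
qed

text \<open>Truncations of \<open>\<Gamma>(v\<^sub>j + \<theta>\<^sub>j + 1) / \<Gamma>(v\<^sub>j + \<theta>\<^sub>j + t + 1)\<close> with the factors \<open>\<theta>\<^sub>j\<close> removed.\<close>

lemma gamma_ratio_exists: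
  fixes v :: "complex ^ 'n::finite"
  obtains E :: "'n \<Rightarrow> int \<Rightarrow> 'n cpoly" where "\<And>j. E j 0 = 1"
    "\<And>j t h. \<forall>m\<in>keys h. mdeg m \<le> N \<Longrightarrow> pdiff (ufac v j t * E j t) h = pdiff (E j (t - 1)) h"
proof -
  have "\<forall>j t. \<exists>r. \<forall>h. (\<forall>m\<in>keys h. mdeg m \<le> N) \<longrightarrow> pdiff (ufac v j t * r) h = h"
    using ufac_inverse by blast
  then obtain r where r: "\<And>j t h. \<forall>m\<in>keys h. mdeg m \<le> N \<Longrightarrow> pdiff (ufac v j t * r j t) h = h"
    by metis
  \<comment> \<open>The recursion from \<open>t\<close> to \<open>t - 1\<close> is solved from the
    value 1 at 0: downwards by exact products of \<open>ufac\<close>, upwards by the truncated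
    inverses \<open>r\<close>.\<close>
  define E where "E j t = (if t \<ge> 0 then (\<Prod>i<nat t. r j (int (Suc i))) else (\<Prod>i<nat (- t). ufac v j (- int i)))" for j t
  have Epos: "E j (int k) = (\<Prod>i<k. r j (int (Suc i)))" and Eneg: "E j (- int k) = (\<Prod>i<k. ufac v j (- int i))" for j k
    by (simp_all add: E_def)
  have "pdiff (ufac v j t * E j t) h = pdiff (E j (t - 1)) h" if h: "\<forall>m\<in>keys h. mdeg m \<le> N" for j t h
  proof (cases "t \<ge> 1")
    case True
    then obtain n where n: "t = int (Suc n)" by (metis Suc_pred int_one_le_iff_zero_less nonneg_int_cases of_nat_0_less_iff zero_le_one order_trans)
    then have t1: "t - 1 = int n" by simp
    have E1: "E j t = E j (t - 1) * r j t" unfolding t1 unfolding n Epos prod.lessThan_Suc ..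
    have "pdiff (ufac v j t * E j t) h = pdiff (E j (t - 1)) (pdiff (ufac v j t * r j t) h)"
      unfolding E1 pdiff_mult[symmetric] by (simp add: mult_ac)
    then show ?thesis using r[OF h] by simp
  next
    case False
    define n where "n = nat (- t)"
    have n: "t = - int n" using False by (simp add: n_def)
    then have t1: "t - 1 = - int (Suc n)" by simp
    have "E j (t - 1) = E j t * ufac v j t" unfolding t1 unfolding n Eneg prod.lessThan_Suc ..
    then have "E j (t - 1) = ufac v j t * E j t" by (simp only: mult.commute)
    then show ?thesis by simp
  qed
  moreover have "E j 0 = 1" for j by (simp add: E_def)
  ultimately show ?thesis using that by blast
qed

text \<open>Operators never raise the degree, so identities valid up to degree \<open>N\<close> can
  be applied one factor after another.\<close>

lemma pdiff_prod_cong: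
  fixes h :: "'n::finite cpoly"
  assumes "\<And>x h. x \<in> X \<Longrightarrow> \<forall>m\<in>keys h. mdeg m \<le> N \<Longrightarrow> pdiff (\<alpha> x) h = pdiff (\<beta> x) h"
    and "\<forall>m\<in>keys h. mdeg m \<le> N"
  shows "pdiff (prod \<alpha> X) h = pdiff (prod \<beta> X) h"
  using assms
proof (induction X arbitrary: h rule: infinite_finite_induct)
  case (insert x X)
  have "pdiff (prod \<alpha> (insert x X)) h = pdiff (\<alpha> x) (pdiff (prod \<alpha> X) h)" using insert by (simp add: pdiff_mult)
  also have "\<dots> = pdiff (\<beta> x) (pdiff (prod \<alpha> X) h)"
    by (rule insert.prems(1)) (auto simp: keys_pdiff_bound[OF insert.prems(2)])
  also have "pdiff (prod \<alpha> X) h = pdiff (prod \<beta> X) h" using insert by auto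
  finally show ?case using insert by (simp add: pdiff_mult)
qed simp_all

text \<open>In each coordinate the factors \<open>ufac\<close> carry \<open>E\<close> from
  \<open>y + exp_vec a\<close> down to \<open>y\<close>; only the zero factors split off in
  \<open>wfac_split\<close> remain.\<close>

lemma frobenius_step:
  fixes v :: "complex ^ 'n::finite"
  assumes E: "\<And>j t h. \<forall>m\<in>keys h. mdeg m \<le> N \<Longrightarrow> pdiff (ufac v j t * E j t) h = pdiff (E j (t - 1)) h"
    and h: "\<forall>m\<in>keys h. mdeg m \<le> N"
  shows "pdiff (wfac v a y * (\<Prod>j\<in>UNIV. E j ((y + exp_vec a) $ j))) h =
    pdiff ((\<Prod>j\<in>nsupp_shift v y - nsupp_shift v (y + exp_vec a). pvar j) * (\<Prod>j\<in>UNIV. E j (y $ j))) h"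
proof -
  have one: "pdiff ((\<Prod>k\<in>{1..n}. ufac v j (s + int k)) * E j (s + int n)) h = pdiff (E j s) h"
    if "\<forall>m\<in>keys h. mdeg m \<le> N" for n j s h
  proof (induction n)
    case (Suc n)
    have "(\<Prod>k\<in>{1..Suc n}. ufac v j (s + int k)) * E j (s + int (Suc n)) =
      (\<Prod>k\<in>{1..n}. ufac v j (s + int k)) * (ufac v j (s + int (Suc n)) * E j (s + int (Suc n)))"
      by (simp add: mult.assoc)
    then have "pdiff ((\<Prod>k\<in>{1..Suc n}. ufac v j (s + int k)) * E j (s + int (Suc n))) h =
      pdiff (\<Prod>k\<in>{1..n}. ufac v j (s + int k)) (pdiff (E j (s + int (Suc n) - 1)) h)"
      by (simp only: pdiff_mult[of "\<Prod>k\<in>{1..n}. ufac v j (s + int k)"] E[OF that])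
    also have "\<dots> = pdiff ((\<Prod>k\<in>{1..n}. ufac v j (s + int k)) * E j (s + int n)) h" by (simp add: pdiff_mult)
    finally show ?case using Suc.IH by simp
  qed simp
  let ?D = "nsupp_shift v y - nsupp_shift v (y + exp_vec a)"
  have "wfac v a y * (\<Prod>j\<in>UNIV. E j ((y + exp_vec a) $ j)) = (\<Prod>j\<in>?D. pvar j) *
    (\<Prod>j\<in>UNIV. (\<Prod>k\<in>{1..lookup a j}. ufac v j (y $ j + int k)) * E j (y $ j + int (lookup a j)))"
    unfolding wfac_split prod.distrib by (simp add: mult.assoc)
  then have "pdiff (wfac v a y * (\<Prod>j\<in>UNIV. E j ((y + exp_vec a) $ j))) h = pdiff (\<Prod>j\<in>?D. pvar j)
    (pdiff (\<Prod>j\<in>UNIV. (\<Prod>k\<in>{1..lookup a j}. ufac v j (y $ j + int k)) * E j (y $ j + int (lookup a j))) h)"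
    by (simp only: pdiff_mult)
  also have "pdiff (\<Prod>j\<in>UNIV. (\<Prod>k\<in>{1..lookup a j}. ufac v j (y $ j + int k)) * E j (y $ j + int (lookup a j))) h =
    pdiff (\<Prod>j\<in>UNIV. E j (y $ j)) h"
    by (rule pdiff_prod_cong[OF one h])
  finally show ?thesis by (simp only: pdiff_mult)
qed

section \<open>The series with a prescribed leading coefficient\<close>

context toric_groebner
begin

lemma C_monoid_cone: "u \<in> C_monoid m g \<Longrightarrow> rvec u \<in> rational_cone (g ` {..<m})"
proof -
  assume "u \<in> C_monoid m g"
  then obtain c where c: "u = (\<Sum>i<m. int (c i) *s g i)" unfolding C_monoid_def by blast
  have rs: "rvec (\<Sum>i\<in>X. int (c i) *s g i) = (\<Sum>i\<in>X. real (c i) *\<^sub>R rvec (g i))" for X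
    by (induction X rule: infinite_finite_induct) (auto simp: rvec_def vec_eq_iff)
  have "rvec u = (\<Sum>i<m. real (c i) *\<^sub>R rvec (g i))" unfolding c rs ..
  \<comment> \<open>The cone is indexed by vectors and not by \<open>i\<close>, so equal
    \<open>g i\<close> are grouped.\<close>
  also have "\<dots> = (\<Sum>r\<in>g ` {..<m}. \<Sum>i\<in>{i \<in> {..<m}. g i = r}. real (c i) *\<^sub>R rvec (g i))"
    by (rule sum.image_gen) simp
  also have "\<dots> = (\<Sum>r\<in>g ` {..<m}. (\<Sum>i\<in>{i \<in> {..<m}. g i = r}. real (c i)) *\<^sub>R rvec r)"
    by (intro sum.cong refl) (simp add: scaleR_sum_left)
  finally show ?thesis
    unfolding rational_cone_def
    by (intro CollectI exI[of _ "\<lambda>r. \<Sum>i\<in>{i \<in> {..<m}. g i = r}. real (c i)"]) (auto intro: sum_nonneg)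
qed

lemma cone_pos:
  assumes x: "x \<in> rational_cone (g ` {..<m})" "x \<noteq> 0"
  shows "w \<bullet> x > 0"
proof -
  obtain c where c: "x = (\<Sum>r\<in>g ` {..<m}. c r *\<^sub>R rvec r)" "\<forall>r\<in>g ` {..<m}. 0 \<le> c r"
    using x(1) unfolding rational_cone_def by blast
  have pos: "w \<bullet> rvec r > 0" if "r \<in> g ` {..<m}" for r using that w_g_pos by auto
  have eq: "w \<bullet> x = (\<Sum>r\<in>g ` {..<m}. c r * (w \<bullet> rvec r))" unfolding c(1) by (simp add: inner_sum_right)
  obtain r where r: "r \<in> g ` {..<m}" "c r \<noteq> 0"
  proof (rule ccontr)
    assume "\<not> thesis"
    then have "\<forall>r\<in>g ` {..<m}. c r = 0" using that by blast
    then have "x = 0" unfolding c(1) by (intro sum.neutral) auto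
    then show False using x(2) by simp
  qed
  have "c r > 0" using bspec[OF c(2) r(1)] r(2) by simp
  then have cr: "0 < c r * (w \<bullet> rvec r)" by (rule mult_pos_pos[OF _ pos[OF r(1)]])
  have nn: "0 \<le> c r * (w \<bullet> rvec r)" if "r \<in> g ` {..<m}" for r
    by (rule mult_nonneg_nonneg[OF bspec[OF c(2) that] less_imp_le[OF pos[OF that]]])
  show ?thesis unfolding eq by (rule sum_pos2[OF _ r(1)]) (simp, rule cr, rule nn)
qed

lemma nsupp_in_NS:
  assumes "(a, \<sigma>) \<in> std_pairs_at A w v"
  shows "nsupp v \<in> NS A v m g"
  unfolding NS_def
proof (intro CollectI exI conjI ballI impI)
  show "nsupp v = nsupp_shift v 0" by (simp add: nsupp_shift_0)
  show "0 \<in> int_kernel A" by (simp add: int_kernel_def)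
  fix u' assume "u' \<in> int_kernel A" "nsupp_shift v u' = nsupp_shift v 0"
  then show "u' \<in> C_monoid m g" using same_nsupp_C_monoid[OF assms] by (simp add: nsupp_shift_0)
qed

text \<open>The substitution \<open>s\<^sub>k \<mapsto> \<tau> k\<close> inverts \<open>\<theta>\<^sub>j \<mapsto> (Bs)\<^sub>j\<close> modulo the row forms of \<open>A\<close>; it is built from
  the circuits through the complement of the basis \<open>\<sigma>\<close>.\<close>

lemma inverse_substitution:
  assumes \<sigma>: "col_indep A \<sigma>" "card \<sigma> = CARD('d)"
    and B: "int_kernel A = {\<Sum>k<h. c k *s B k | c :: nat \<Rightarrow> int. True}"
  obtains \<tau> :: "nat \<Rightarrow> 'n cpoly" where
    "\<And>q F. q \<in> row_perp A \<Longrightarrow> pdiff (psubst \<tau> (Bs_prod h B F)) q = pdiff (\<Prod>j\<in>F. pvar j) q"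
proof -
  have "\<forall>j\<in>- \<sigma>. \<exists>u. u \<in> int_kernel A \<and> u $ j \<noteq> 0 \<and> (\<forall>i. i \<notin> insert j \<sigma> \<longrightarrow> u $ i = 0)"
  proof
    fix j assume "j \<in> - \<sigma>"
    then have "j \<notin> \<sigma>" by simp
    then show "\<exists>u. u \<in> int_kernel A \<and> u $ j \<noteq> 0 \<and> (\<forall>i. i \<notin> insert j \<sigma> \<longrightarrow> u $ i = 0)"
      by (rule circuit_through[OF \<sigma>]) blast
  qed
  from bchoice[OF this] obtain U where U: "\<And>j. j \<notin> \<sigma> \<Longrightarrow> U j \<in> int_kernel A" "\<And>j. j \<notin> \<sigma> \<Longrightarrow> U j $ j \<noteq> 0"
    "\<And>j i. j \<notin> \<sigma> \<Longrightarrow> i \<notin> insert j \<sigma> \<Longrightarrow> U j $ i = 0" by auto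
  have "\<forall>j\<in>- \<sigma>. \<exists>z. U j = (\<Sum>k<h. z k *s B k)" using U(1) B by auto
  from bchoice[OF this] obtain z where z: "\<And>j. j \<notin> \<sigma> \<Longrightarrow> U j = (\<Sum>k<h. z j k *s B k)" by auto
  define \<tau> :: "nat \<Rightarrow> 'n cpoly" where "\<tau> k = (\<Sum>j\<in>- \<sigma>. cscale (of_int (z j k) / of_int (U j $ j)) (pvar j))" for k
  define D where "D i = (\<Sum>k<h. cscale (of_int (B k $ i)) (\<tau> k))" for i
  have D_eq: "D i = (\<Sum>j\<in>- \<sigma>. cscale (of_int (U j $ i) / of_int (U j $ j)) (pvar j))" for i
  proof -
    have "D i = (\<Sum>j\<in>- \<sigma>. \<Sum>k<h. cscale (of_int (B k $ i) * (of_int (z j k) / of_int (U j $ j))) (pvar j))"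
      unfolding D_def \<tau>_def cpoly.scale_sum_right by (subst sum.swap) simp
    also have "\<dots> = (\<Sum>j\<in>- \<sigma>. cscale (of_int (U j $ i) / of_int (U j $ j)) (pvar j))"
    proof (rule sum.cong[OF refl])
      fix j assume "j \<in> - \<sigma>"
      then have "of_int (U j $ i) = (\<Sum>k<h. of_int (z j k) * of_int (B k $ i) :: complex)" using z[of j] by simp
      then have "(\<Sum>k<h. of_int (B k $ i) * (of_int (z j k) / of_int (U j $ j))) = of_int (U j $ i) / (of_int (U j $ j) :: complex)"
        by (simp add: sum_divide_distrib mult.commute)
      then show "(\<Sum>k<h. cscale (of_int (B k $ i) * (of_int (z j k) / of_int (U j $ j))) (pvar j)) =
        cscale (of_int (U j $ i) / of_int (U j $ j)) (pvar j)"
        by (simp only: cpoly.scale_sum_left[symmetric])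
    qed
    finally show ?thesis .
  qed
  have D_coef: "lincoef (D i) j = (if j \<in> \<sigma> then 0 else of_int (U j $ i) / of_int (U j $ j))" for i j
    unfolding D_eq by (simp add: lincoef_sum lincoef_cscale if_distrib sum.delta cong: if_cong)
  have D_homog: "homog 1 (D i)" for i unfolding D_eq by (intro homog_sum homog_cscale homog_pvar)
  have D_act: "pdiff (D i) q = pdiff (pvar i) q" if q: "q \<in> row_perp A" for i q
  proof -
    \<comment> \<open>For \<open>i\<close> in \<sigma>, the row combination isolating
      \<open>i\<close> has its remaining coefficients forced by orthogonality to the circuits; for
      \<open>i\<close> outside \<sigma> the difference is zero.\<close>
    have "pvar i - D i \<in> cpoly.span (range (row_form A))"
    proof (cases "i \<in> \<sigma>")
      case True
      obtain r where r: "\<And>j. j \<in> \<sigma> \<Longrightarrow> lincoef (rowcomb A r) j = (if j = i then 1 else 0)"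
        using row_combination[OF \<sigma>(1) True] unfolding lincoef_rowcomb by metis
      have rj: "lincoef (rowcomb A r) j = - of_int (U j $ i) / of_int (U j $ j)" if j: "j \<notin> \<sigma>" for j
      proof -
        have "(\<Sum>l\<in>UNIV. lincoef (rowcomb A r) l * of_int (U j $ l)) = (\<Sum>l\<in>UNIV. \<Sum>k\<in>UNIV. r k * (of_int (A $ k $ l) * of_int (U j $ l)))"
          unfolding lincoef_rowcomb by (simp add: sum_distrib_right mult.assoc)
        also have "\<dots> = (\<Sum>k\<in>UNIV. r k * (\<Sum>l\<in>UNIV. of_int (A $ k $ l) * of_int (U j $ l)))"
          by (subst sum.swap) (simp add: sum_distrib_left)
        also have "\<dots> = 0"
        proof -
          have "(\<Sum>l\<in>UNIV. of_int (A $ k $ l) * of_int (U j $ l)) = (0 :: complex)" for k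
            using U(1)[OF j] unfolding int_kernel_iff by (metis (no_types, lifting) of_int_0 of_int_mult of_int_sum sum.cong)
          then show ?thesis by simp
        qed
        finally have "(\<Sum>l\<in>UNIV. lincoef (rowcomb A r) l * of_int (U j $ l)) = 0" .
        moreover have "(\<Sum>l\<in>UNIV. lincoef (rowcomb A r) l * of_int (U j $ l)) =
          (\<Sum>l\<in>{i, j}. lincoef (rowcomb A r) l * of_int (U j $ l))"
        proof (rule sum.mono_neutral_right)
          show "\<forall>l\<in>UNIV - {i, j}. lincoef (rowcomb A r) l * of_int (U j $ l) = 0"
          proof
            fix l assume "l \<in> UNIV - {i, j}"
            then show "lincoef (rowcomb A r) l * of_int (U j $ l) = 0"
              using r[of l] U(3)[OF j, of l] by (cases "l \<in> \<sigma>") auto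
          qed
        qed auto
        moreover have "i \<noteq> j" using True j by auto
        ultimately have "of_int (U j $ i) + lincoef (rowcomb A r) j * of_int (U j $ j) = 0" using r[OF True] by simp
        then show ?thesis using U(2)[OF j] by (simp add: field_simps add_eq_0_iff)
      qed
      have "rowcomb A r = pvar i - D i"
      proof -
        have h: "homog 1 (pvar i - D i)" by (intro homog_diff homog_pvar D_homog)
        have "lincoef (rowcomb A r) j = lincoef (pvar i - D i) j" for j
          using r[of j] rj[of j] True by (auto simp: lincoef_diff D_coef)
        then show ?thesis
          using linear_form_expand[OF rowcomb_homog, of A r] linear_form_expand[OF h] by simp
      qed
      then show ?thesis using rowcomb_span by metis
    next
      case False
      have h: "homog 1 (pvar i - D i)" by (intro homog_diff homog_pvar D_homog)
      have "lincoef (pvar i - D i) j = 0" for j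
        using False U(2)[of j] U(3)[of j i] by (auto simp: lincoef_diff D_coef)
      then have "pvar i - D i = 0" using linear_form_expand[OF h] by simp
      then show ?thesis by (simp add: cpoly.span_zero)
    qed
    then have "pdiff (pvar i - D i) q = 0" by (rule row_perp_span[OF q])
    then show ?thesis by (simp add: pdiff_diff_left)
  qed
  have D_prod: "pdiff (\<Prod>i\<in>F. D i) q = pdiff (\<Prod>i\<in>F. pvar i) q" if q: "q \<in> row_perp A" for F q
  proof (induction F rule: infinite_finite_induct)
    case (insert i F)
    then show ?case using D_act[OF row_perp_pdiff[OF q]] by (simp add: pdiff_mult)
  qed simp_all
  have subst: "psubst \<tau> (Bs_prod h B F) = (\<Prod>i\<in>F. D i)" for F
    by (simp add: Bs_prod_def psubst_prod psubst_sum psubst_mult D_def cscale_def)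
  show ?thesis using that[of \<tau>] D_prod subst by simp
qed

text \<open>The product over \<open>nsupp_shift v u - K\<close> in the coefficients balances the
  zero factors: differentiating down to \<open>y\<close> yields the product over
  \<open>nsupp_shift v y - K\<close>, whichever exponent in \<open>NS\<close> one starts from. If
  just one exponent of a toric equation lies in \<open>NS\<close>, this product has to kill
  \<open>q\<close>, and there the identity for \<open>P\<close> enters.\<close>

lemma frobenius:
  fixes v
  assumes beta: "\<And>i. (\<Sum>j\<in>UNIV. of_int (A $ i $ j) * v $ j) = \<beta> $ i"
    and sp: "(a0, \<sigma>0) \<in> std_pairs_at A w v" "card \<sigma>0 = CARD('d)"
    and B: "int_kernel A = {\<Sum>k<h. c k *s B k | c :: nat \<Rightarrow> int. True}"
    and P: "P_ideal A v m g h B = (*) (m_elem A v m g h B) ` PB_ideal v m g h B"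
    and f: "f \<in> Q_perp A v m g" "f \<noteq> 0"
  obtains F where "series_solution A \<beta> w v F" "F 0 = f"
proof -
  define K where "K = K_set A v m g"
  define NSs where "NSs = NS A v m g"
  have fQ: "pdiff \<phi> f = 0" if "\<phi> \<in> Q_ideal A v m g" for \<phi> using f(1) that by (auto simp: Q_perp_def)
  have fW: "f \<in> row_perp A" using fQ Q_row by (simp add: row_perp_def)
  have NS0: "nsupp v \<in> NSs" unfolding NSs_def by (rule nsupp_in_NS[OF sp(1)])
  have K_sub: "K \<subseteq> I" if "I \<in> NSs" for I using that by (auto simp: K_def K_set_def NSs_def)
  \<comment> \<open>Some member of \<open>NS\<close> omits \<open>j\<close>, so the lattice vector
    behind it must move the coordinate \<open>j\<close> out of the negative support.\<close>
  have "\<exists>u\<in>int_kernel A. u $ j \<noteq> 0" if j: "j \<in> nsupp v - K" for j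
  proof -
    obtain u where u: "u \<in> int_kernel A" "j \<notin> nsupp_shift v u"
      using j unfolding K_def K_set_def NS_def by auto
    have "u $ j \<noteq> 0"
    proof
      assume "u $ j = 0"
      then show False using j u(2) unfolding nsupp_shift_iff nsupp_def by auto
    qed
    then show ?thesis using u(1) by blast
  qed
  then obtain q where q: "q \<in> row_perp A" "pdiff (\<Prod>j\<in>nsupp v - K. pvar j) q = f"
    using row_perp_antiderivative_set[OF _ fW] by blast
  obtain \<tau> :: "nat \<Rightarrow> 'n cpoly" where \<tau>:
    "\<And>q F. q \<in> row_perp A \<Longrightarrow> pdiff (psubst \<tau> (Bs_prod h B F)) q = pdiff (\<Prod>j\<in>F. pvar j) q"
    using inverse_substitution[OF std_pairs_at_col_indep[OF sp(1)] sp(2) B] by blast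
  have Bs_Polys: "Bs_prod h B F \<in> Polys {..<h}" for F
    unfolding Bs_prod_def by (intro Polys_prod Polys_sum Polys_mult Polys_pconst) simp
  \<comment> \<open>Through the substitution \<tau> the generators of \<open>PB_ideal\<close> act on
    \<open>f\<close> as the \<open>G_set\<close> generators of \<open>Q_ideal\<close>.\<close>
  have PB: "pdiff (psubst \<tau> p) f = 0" if "p \<in> PB_ideal v m g h B" for p
  proof -
    have "{Bs_prod h B (G_set v (g i)) | i. i < m} \<subseteq> Polys {..<h}" using Bs_Polys by auto
    with that[unfolded PB_ideal_def] show ?thesis
    proof (induction rule: Idl_induct)
      case (mult c s)
      then obtain i where i: "i < m" "s = Bs_prod h B (G_set v (g i))" by blast
      have "pdiff (psubst \<tau> s) f = 0" unfolding i(2) \<tau>[OF fW] by (rule fQ[OF Q_G[OF i(1)]])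
      then show ?case by (simp add: psubst_mult pdiff_mult)
    qed (auto simp: psubst_add pdiff_add_left)
  qed
  \<comment> \<open>The product is \<open>m_elem\<close> times some \<open>p\<close> in
    \<open>PB_ideal\<close>: the factor \<open>m_elem\<close> turns \<open>q\<close> into
    \<open>f\<close>, and \<open>p\<close> kills \<open>f\<close>.\<close>
  have qkill: "pdiff (\<Prod>j\<in>(I \<union> J) - K. pvar j) q = 0" if "I \<in> NSs" "J \<in> NS_compl A v m g" for I J
  proof -
    have "{Bs_prod h B ((I \<union> J) - K_set A v m g) | I J. I \<in> NS A v m g \<and> J \<in> NS_compl A v m g} \<subseteq> Polys {..<h}"
      using Bs_Polys by auto
    then have "Bs_prod h B ((I \<union> J) - K) \<in> P_ideal A v m g h B"
      unfolding P_ideal_def K_def using that by (intro Idl_gen) (auto simp: NSs_def)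
    then obtain p where p: "p \<in> PB_ideal v m g h B" "Bs_prod h B ((I \<union> J) - K) = m_elem A v m g h B * p"
      unfolding P by blast
    have "pdiff (\<Prod>j\<in>(I \<union> J) - K. pvar j) q = pdiff (psubst \<tau> (m_elem A v m g h B * p)) q"
      using \<tau>[OF q(1), of "(I \<union> J) - K"] p(2) by simp
    also have "\<dots> = pdiff (psubst \<tau> p) (pdiff (psubst \<tau> (Bs_prod h B (nsupp v - K))) q)"
      by (simp add: psubst_mult m_elem_def K_def pdiff_mult[symmetric] mult.commute)
    also have "\<dots> = pdiff (psubst \<tau> p) f" unfolding \<tau>[OF q(1)] q(2) ..
    finally show ?thesis using PB[OF p(1)] by simp
  qed
  obtain N where N: "\<forall>m\<in>keys q. mdeg m \<le> N" using keys_mdeg_bound by blast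
  obtain E :: "'n \<Rightarrow> int \<Rightarrow> 'n cpoly" where E: "\<And>j. E j 0 = 1"
    "\<And>j t h. \<forall>m\<in>keys h. mdeg m \<le> N \<Longrightarrow> pdiff (ufac v j t * E j t) h = pdiff (E j (t - 1)) h"
    using gamma_ratio_exists[where v = v and N = N] by metis
  define EE where "EE y = (\<Prod>j\<in>UNIV. E j (y $ j))" for y :: "int ^ 'n"
  define F where "F u = (if u \<in> int_kernel A \<and> nsupp_shift v u \<in> NSs
     then pdiff ((\<Prod>j\<in>nsupp_shift v u - K. pvar j) * EE u) q else 0)" for u
  have F0: "F 0 = f"
  proof -
    have "EE 0 = 1" by (simp add: EE_def E(1))
    then show ?thesis using NS0 q(2) by (simp add: F_def nsupp_shift_0 int_kernel_def)
  qed
  have supp: "\<forall>u. F u \<noteq> 0 \<longrightarrow> u \<in> int_kernel A" by (auto simp: F_def split: if_splits)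
  have suppC: "u \<in> C_monoid m g" if "F u \<noteq> 0" for u
  proof -
    have "u \<in> int_kernel A" "nsupp_shift v u \<in> NSs" using that by (auto simp: F_def split: if_splits)
    then show ?thesis unfolding NSs_def NS_def by auto
  qed
  \<comment> \<open>The right side depends on \<open>y\<close> only, which settles toric equations
    between two exponents in \<open>NS\<close>. \<open>K\<close> lies in every member of
    \<open>NS\<close>, so it never meets the zero factors.\<close>
  have shift: "pdiff (wfac v a y) (F (y + exp_vec a)) = pdiff ((\<Prod>j\<in>nsupp_shift v y - K. pvar j) * EE y) q"
    if "y + exp_vec a \<in> int_kernel A" "nsupp_shift v (y + exp_vec a) \<in> NSs" for a y
  proof -
    let ?x = "y + exp_vec a"
    have "pdiff (wfac v a y) (F ?x) = pdiff (\<Prod>j\<in>nsupp_shift v ?x - K. pvar j) (pdiff (wfac v a y * EE ?x) q)"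
      using that by (simp add: F_def pdiff_mult[symmetric] mult_ac)
    also have "pdiff (wfac v a y * EE ?x) q = pdiff ((\<Prod>j\<in>nsupp_shift v y - nsupp_shift v ?x. pvar j) * EE y) q"
      unfolding EE_def by (rule frobenius_step[OF E(2) N])
    also have "pdiff (\<Prod>j\<in>nsupp_shift v ?x - K. pvar j) \<dots> =
      pdiff (((\<Prod>j\<in>nsupp_shift v ?x - K. pvar j) * (\<Prod>j\<in>nsupp_shift v y - nsupp_shift v ?x. pvar j)) * EE y) q"
      by (simp add: pdiff_mult)
    also have "(\<Prod>j\<in>nsupp_shift v ?x - K. pvar j) * (\<Prod>j\<in>nsupp_shift v y - nsupp_shift v ?x. pvar j) =
      (\<Prod>j\<in>(nsupp_shift v ?x - K) \<union> (nsupp_shift v y - nsupp_shift v ?x). pvar j)"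
      by (rule prod.union_disjoint[symmetric]) auto
    also have "(nsupp_shift v ?x - K) \<union> (nsupp_shift v y - nsupp_shift v ?x) = nsupp_shift v y - K"
      using K_sub[OF that(2)] nsupp_shift_mono[of v y a] by auto
    finally show ?thesis .
  qed
  \<comment> \<open>Negative supports grow on the way down to \<open>y\<close>, so that of
    \<open>y\<close> contains \<open>?I \<union> ?J\<close> and its product is a multiple of the one
    killing \<open>q\<close>.\<close>
  have vanish: "pdiff ((\<Prod>j\<in>nsupp_shift v y - K. pvar j) * EE y) q = 0"
    if "nsupp_shift v (y + exp_vec a) \<in> NSs" "nsupp_shift v (y + exp_vec b) \<notin> NSs" "y + exp_vec b \<in> int_kernel A" for a b y
  proof -
    let ?I = "nsupp_shift v (y + exp_vec a)" and ?J = "nsupp_shift v (y + exp_vec b)"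
    have J: "?J \<in> NS_compl A v m g" using that(2,3) by (auto simp: NS_compl_def NSs_def)
    have "(?I \<union> ?J) - K \<subseteq> nsupp_shift v y - K"
      using nsupp_shift_mono[of v y a] nsupp_shift_mono[of v y b] by blast
    then have "(\<Prod>j\<in>nsupp_shift v y - K. pvar j) =
      (\<Prod>j\<in>(nsupp_shift v y - K) - ((?I \<union> ?J) - K). pvar j) * (\<Prod>j\<in>(?I \<union> ?J) - K. pvar j)"
      by (rule prod.subset_diff) simp
    then have "pdiff ((\<Prod>j\<in>nsupp_shift v y - K. pvar j) * EE y) q =
      pdiff ((\<Prod>j\<in>(nsupp_shift v y - K) - ((?I \<union> ?J) - K). pvar j) * EE y) (pdiff (\<Prod>j\<in>(?I \<union> ?J) - K. pvar j) q)"
      by (simp only: pdiff_mult[symmetric] mult_ac)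
    then show ?thesis using qkill[OF that(1) J] by simp
  qed
  have toric: "pdiff (wfac v a y) (F (y + exp_vec a)) = pdiff (wfac v b y) (F (y + exp_vec b))"
    if ab: "A *v exp_vec a = A *v exp_vec b" for a b y
  proof -
    have ker: "y + exp_vec a \<in> int_kernel A \<longleftrightarrow> y + exp_vec b \<in> int_kernel A"
      using ab by (simp add: int_kernel_def matrix_vector_right_distrib)
    show ?thesis
    proof (cases "y + exp_vec a \<in> int_kernel A")
      case False
      then show ?thesis using ker by (simp add: F_def)
    next
      case True
      then have kb: "y + exp_vec b \<in> int_kernel A" using ker by simp
      consider "nsupp_shift v (y + exp_vec a) \<in> NSs" "nsupp_shift v (y + exp_vec b) \<in> NSs"
        | "nsupp_shift v (y + exp_vec a) \<in> NSs" "nsupp_shift v (y + exp_vec b) \<notin> NSs"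
        | "nsupp_shift v (y + exp_vec a) \<notin> NSs" "nsupp_shift v (y + exp_vec b) \<in> NSs"
        | "nsupp_shift v (y + exp_vec a) \<notin> NSs" "nsupp_shift v (y + exp_vec b) \<notin> NSs" by blast
      then show ?thesis
      proof cases
        case 1
        then show ?thesis using shift[OF True] shift[OF kb] by simp
      next
        case 2
        then show ?thesis using shift[OF True] vanish[OF 2 kb] by (simp add: F_def)
      next
        case 3
        then show ?thesis using shift[OF kb] vanish[OF 3(2,1) True] by (simp add: F_def)
      next
        case 4
        then show ?thesis by (simp add: F_def)
      qed
    qed
  qed
  have euler: "pdiff (row_form A i) (F u) = 0" for i u
  proof (cases "F u = 0")
    case False
    then have "F u \<in> row_perp A" using row_perp_pdiff[OF q(1)] by (auto simp: F_def split: if_splits)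
    then show ?thesis by (simp add: row_perp_def)
  qed simp
  have "series_solution A \<beta> w v F"
    unfolding series_solution_def
  proof (intro conjI)
    show "\<forall>u. F u \<noteq> 0 \<longrightarrow> u \<in> int_kernel A" using supp by blast
    show "F 0 \<noteq> 0" using F0 f(2) by simp
    have "\<forall>a\<in>keys (F u). mdeg a \<le> N" for u
      using keys_pdiff_bound[OF N] by (auto simp: F_def)
    then show "\<exists>N. \<forall>u. \<forall>m\<in>keys (F u). mdeg m \<le> N" by blast
    show "\<exists>R. finite R \<and> (\<forall>x. x \<in> rational_cone R \<and> - x \<in> rational_cone R \<longrightarrow> x = 0) \<and>
        (\<forall>x\<in>rational_cone R. x \<noteq> 0 \<longrightarrow> 0 < w \<bullet> x) \<and> (\<forall>u. F u \<noteq> 0 \<longrightarrow> rvec u \<in> rational_cone R)"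
    proof (intro exI[of _ "g ` {..<m}"] conjI allI ballI impI)
      fix x assume x: "x \<in> rational_cone (g ` {..<m}) \<and> - x \<in> rational_cone (g ` {..<m})"
      show "x = 0"
      proof (rule ccontr)
        assume "x \<noteq> 0"
        then have "w \<bullet> x > 0" "w \<bullet> (- x) > 0" using cone_pos[of x] cone_pos[of "- x"] x by auto
        then show False by simp
      qed
    qed (use cone_pos C_monoid_cone suppC in auto)
    show "\<forall>P\<in>hypergeometric_ideal A \<beta>. weyl_act v P F = (\<lambda>u. 0)"
      using hypergeometric_solution_iff[OF beta supp] euler toric by blast
  qed
  then show ?thesis using that F0 by blast
qed

end

section \<open>Fake exponents\<close>

lemma peval_add: "peval z (p + q) = peval z p + peval z q"
  unfolding peval_def by (rule setsum_keys_plus_distrib) (auto simp: distrib_right)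

lemma peval_sum: "peval z (sum f X) = (\<Sum>x\<in>X. peval z (f x))"
  by (induction X rule: infinite_finite_induct) (auto simp: peval_add, simp_all add: peval_def)

lemma peval_single: "peval z (single a c) = c * (\<Prod>j\<in>keys a. z j ^ lookup a j)"
  by (cases "c = 0") (auto simp: peval_def)

lemma fake_exponent_beta:
  fixes A :: "int ^ 'n::finite ^ 'd::finite"
  assumes "fake_exponent A \<beta> w v"
  shows "(\<Sum>j\<in>UNIV. of_int (A $ i $ j) * v $ j) = \<beta> $ i"
proof -
  have "row_form A i - pconst (\<beta> $ i) \<in> fake_indicial_ideal A \<beta> w"
    unfolding fake_indicial_ideal_def by (rule Idl_gen) auto
  then have z: "peval (($) v) (row_form A i - pconst (\<beta> $ i)) = 0"
    using assms by (simp add: fake_exponent_def)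
  have "peval (($) v) (row_form A i) = (\<Sum>j\<in>UNIV. of_int (A $ i $ j) * v $ j)"
    unfolding row_form_def peval_sum
    by (simp add: pvar_def single_eq_pconst_pmon[symmetric] peval_single)
  moreover have "peval (($) v) (pconst (\<beta> $ i)) = \<beta> $ i" by (simp add: pconst_def peval_single)
  moreover have "peval (($) v) (row_form A i) = peval (($) v) (row_form A i - pconst (\<beta> $ i)) + peval (($) v) (pconst (\<beta> $ i))"
    by (simp add: peval_add[symmetric])
  ultimately show ?thesis using z by simp
qed

theorem corollary5p2:
  fixes A :: "int ^ 'n::finite ^ 'd::finite"
    and \<beta> :: "complex ^ 'd"
    and w :: "real ^ 'n"
    and v :: "complex ^ 'n"
    and m :: nat
    and gp gm :: "nat \<Rightarrow> ('n \<Rightarrow>\<^sub>0 nat)"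
    and g :: "nat \<Rightarrow> int ^ 'n"
  assumes "rank (map_matrix of_int A :: rat ^ 'n ^ 'd) = CARD('d)"
    and "columns_in_affine_hyperplane A"
    and "generic_weight A w"
    and "fake_exponent A \<beta> w v"
    and "reduced_groebner_basis w (toric_ideal A) {pmon (gp i) - pmon (gm i) | i. i < m}"
    and "\<forall>i<m. pmon (gp i) \<in> init_ideal w (toric_ideal A)"
    and "\<forall>i<m. g i = exp_vec (gp i) - exp_vec (gm i)"
    and "\<exists>(a, \<sigma>)\<in>std_pairs_at A w v. card \<sigma> = CARD('d)"
    and "cohen_macaulay (sr_ring (- nsupp v) (link_complex A w v))"
  shows
    "(\<exists>L ell. row_reduction A v L ell) \<and>
     (\<forall>L ell. row_reduction A v L ell \<longrightarrow>
        H_series A w v ell = fps_of_poly (h_poly (- nsupp v) (link_complex A w v))) \<and>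
     Abs_fps (\<lambda>q. int (cpoly.dim (graded_part (Q_perp A v m g) q))) =
       fps_of_poly (h_poly (- nsupp v) (link_complex A w v)) \<and>
     fin_dim (Q_perp A v m g) \<and>
     int (frank A v m g) = poly (h_poly (- nsupp v) (link_complex A w v)) 1 \<and>
     (\<forall>B. is_Z_basis (CARD('n) - CARD('d)) B (int_kernel A) \<and>
        P_ideal A v m g (CARD('n) - CARD('d)) B =
          (*) (m_elem A v m g (CARD('n) - CARD('d)) B) ` PB_ideal v m g (CARD('n) - CARD('d)) B \<longrightarrow>
        Abs_fps (\<lambda>q. int (cpoly.dim (graded_part (leading_coeffs A \<beta> w v) q))) =
          fps_of_poly (h_poly (- nsupp v) (link_complex A w v)) \<and>
        finite {q. graded_part (leading_coeffs A \<beta> w v) q \<noteq> {0}} \<and>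
        {q. graded_part (leading_coeffs A \<beta> w v) q \<noteq> {0}} \<noteq> {} \<and>
        Max {q. graded_part (leading_coeffs A \<beta> w v) q \<noteq> {0}} =
          degree (h_poly (- nsupp v) (link_complex A w v)) \<and>
        fin_dim (leading_coeffs A \<beta> w v) \<and>
        int (cpoly.dim (leading_coeffs A \<beta> w v)) =
          poly (h_poly (- nsupp v) (link_complex A w v)) 1)"
proof -
  interpret toric_groebner A w m gp gm g
    by (rule toric_groebner.intro[OF assms(2,3,5-7)])
  define H where "H = h_poly (- nsupp v) (link_complex A w v)"
  obtain a0 \<sigma>0 where sp: "(a0, \<sigma>0) \<in> std_pairs_at A w v" "card \<sigma>0 = CARD('d)"
    using assms(8) by blast
  have "col_indep A (nsupp v)"
    using col_indep_mono[OF std_pairs_at_col_indep[OF sp(1)] std_pairs_at_nsupp[OF sp(1)]] .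
  then have ex: "\<exists>L ell. row_reduction A v L ell" by (rule row_reduction_exists)
  have series: "H_series A w v ell = fps_of_poly H" if "row_reduction A v L ell" for L ell
    unfolding H_def by (rule H_series_eq_h_poly(1)[OF that sp assms(9)])
  obtain L ell where rr: "row_reduction A v L ell" using ex by blast
  have dims: "int (cpoly.dim (graded_part (Q_perp A v m g) q)) = coeff H q" for q
    using dim_graded_Q_perp[OF rr, of q] series[OF rr] by simp
  have high: "coeff H q = 0" if "q > CARD('n)" for q
    using H_series_eq_h_poly(2)[OF rr sp assms(9) that] series[OF rr] by simp
  have fps: "Abs_fps (\<lambda>q. int (cpoly.dim (graded_part (Q_perp A v m g) q))) = fps_of_poly H"
    by (rule fps_ext) (simp add: dims)
  \<comment> \<open>Dimension 0 means the zero space because graded parts are finite dimensional: a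
    basis is then finite, and empty if its cardinality is 0.\<close>
  have trivial_iff: "graded_part (Q_perp A v m g) q = {0} \<longleftrightarrow> coeff H q = 0" for q
  proof
    assume "graded_part (Q_perp A v m g) q = {0}"
    moreover have "cpoly.dim {0 :: 'n cpoly} = 0" using cpoly.dim_le_card[of "{0}" "{}"] by simp
    ultimately show "coeff H q = 0" using dims[of q] by simp
  next
    assume "coeff H q = 0"
    then have d: "cpoly.dim (graded_part (Q_perp A v m g) q) = 0" using dims[of q] by simp
    obtain B where B: "B \<subseteq> graded_part (Q_perp A v m g) q" "cpoly.independent B"
      "graded_part (Q_perp A v m g) q \<subseteq> cpoly.span B" "card B = cpoly.dim (graded_part (Q_perp A v m g) q)"
      using cpoly.basis_exists by blast
    obtain E where E: "finite E" "graded_part (Polys (UNIV :: 'n set)) q \<subseteq> cpoly.span E" using graded_part_fin by blast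
    have "Q_perp A v m g \<subseteq> Polys UNIV" by (rule subsetI) simp
    from graded_part_mono[OF this] E(2) have "graded_part (Q_perp A v m g) q \<subseteq> cpoly.span E" by blast
    then have "finite B" using cpoly.independent_span_bound[OF E(1) B(2)] B(1) by blast
    then have "B = {}" using B(4) d by simp
    then have "graded_part (Q_perp A v m g) q \<subseteq> {0}" using B(3) by simp
    moreover have "0 \<in> graded_part (Q_perp A v m g) q"
      by (rule cpoly.subspace_0[OF graded_part_subspace[OF Q_perp_subspace]])
    ultimately show "graded_part (Q_perp A v m g) q = {0}" by blast
  qed
  have top: "graded_part (Q_perp A v m g) q \<subseteq> {0}" if "q > CARD('n)" for q
    using trivial_iff[of q] high[OF that] by simp
  have fd: "fin_dim (Q_perp A v m g)"
    by (rule dim_eq_sum_graded(1)[OF Q_perp_subspace Q_perp_homog_closed]) (rule top)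
  have "cpoly.dim (Q_perp A v m g) = (\<Sum>q\<le>CARD('n). cpoly.dim (graded_part (Q_perp A v m g) q))"
    by (rule dim_eq_sum_graded(2)[OF Q_perp_subspace Q_perp_homog_closed]) (rule top)
  then have "int (cpoly.dim (Q_perp A v m g)) = (\<Sum>q\<le>CARD('n). coeff H q)" by (simp add: dims)
  also have "\<dots> = poly H 1"
  proof -
    have "degree H \<le> CARD('n)" by (rule degree_le) (use high in auto)
    then have "(\<Sum>q\<le>CARD('n). coeff H q) = (\<Sum>q\<le>degree H. coeff H q)"
      by (intro sum.mono_neutral_right) (auto simp: coeff_eq_0)
    then show ?thesis by (simp add: poly_altdef)
  qed
  finally have total: "int (cpoly.dim (Q_perp A v m g)) = poly H 1" .
  \<comment> \<open>The constant makes the set of occurring degrees nonempty, so its maximum is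
    meaningful and equals the degree of \<open>H\<close>.\<close>
  have "1 \<in> graded_part (Q_perp A v m g) 0"
    using one_in_Q_perp[OF sp(1)] by (simp add: graded_part_def)
  then have "graded_part (Q_perp A v m g) 0 \<noteq> {0}" by (metis singletonD zero_neq_one)
  then have H0: "coeff H 0 \<noteq> 0" unfolding trivial_iff .
  then have Hnz: "H \<noteq> 0" by (rule contrapos_nn) simp
  have supp_fin: "finite {q. coeff H q \<noteq> 0}"
    by (rule finite_subset[of _ "{..degree H}"]) (simp_all add: subset_iff le_degree)
  have supp_max: "Max {q. coeff H q \<noteq> 0} = degree H"
    by (rule Max_eqI[OF supp_fin]) (use Hnz in \<open>simp_all add: le_degree\<close>)
  \<comment> \<open>The zero polynomial is treated apart, since a series solution has a nonzero
    leading coefficient.\<close>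
  have lead: "leading_coeffs A \<beta> w v = Q_perp A v m g"
    if B: "is_Z_basis (CARD('n) - CARD('d)) B (int_kernel A)"
      and P: "P_ideal A v m g (CARD('n) - CARD('d)) B =
        (*) (m_elem A v m g (CARD('n) - CARD('d)) B) ` PB_ideal v m g (CARD('n) - CARD('d)) B" for B
  proof (rule equalityI; rule subsetI)
    note beta = fake_exponent_beta[OF assms(4)]
    fix f
    {
      assume "f \<in> leading_coeffs A \<beta> w v"
      then show "f \<in> Q_perp A v m g"
        using leading_coeffs_sub[OF beta] cpoly.subspace_0[OF Q_perp_subspace] by (auto simp: leading_coeffs_def)
    next
      assume f: "f \<in> Q_perp A v m g"
      show "f \<in> leading_coeffs A \<beta> w v"
      proof (cases "f = 0")
        case False
        have "int_kernel A = {\<Sum>k<CARD('n) - CARD('d). c k *s B k | c :: nat \<Rightarrow> int. True}"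
          using B by (simp only: is_Z_basis_def)
        then obtain F where "series_solution A \<beta> w v F" "F 0 = f"
          using frobenius[OF beta sp _ P f False] by blast
        then show ?thesis by (auto simp: leading_coeffs_def)
      qed (simp add: leading_coeffs_def)
    }
  qed
  show ?thesis
    unfolding H_def[symmetric]
  proof (intro conjI allI impI)
    show "\<exists>L ell. row_reduction A v L ell" by (rule ex)
    show "H_series A w v ell = fps_of_poly H" if "row_reduction A v L ell" for L ell by (rule series[OF that])
    show "Abs_fps (\<lambda>q. int (cpoly.dim (graded_part (Q_perp A v m g) q))) = fps_of_poly H" by (rule fps)
    show "fin_dim (Q_perp A v m g)" by (rule fd)
    show "int (frank A v m g) = poly H 1" unfolding frank_def by (rule total)
  next
    fix B
    assume *: "is_Z_basis (CARD('n) - CARD('d)) B (int_kernel A) \<and>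
        P_ideal A v m g (CARD('n) - CARD('d)) B =
          (*) (m_elem A v m g (CARD('n) - CARD('d)) B) ` PB_ideal v m g (CARD('n) - CARD('d)) B"
    then have l: "leading_coeffs A \<beta> w v = Q_perp A v m g" by (intro lead) auto
    show "Abs_fps (\<lambda>q. int (cpoly.dim (graded_part (leading_coeffs A \<beta> w v) q))) = fps_of_poly H"
      unfolding l by (rule fps)
    show "finite {q. graded_part (leading_coeffs A \<beta> w v) q \<noteq> {0}}"
      unfolding l trivial_iff by (rule supp_fin)
    show "{q. graded_part (leading_coeffs A \<beta> w v) q \<noteq> {0}} \<noteq> {}"
      unfolding l trivial_iff using H0 by blast
    show "Max {q. graded_part (leading_coeffs A \<beta> w v) q \<noteq> {0}} = degree H"
      unfolding l trivial_iff by (rule supp_max)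
    show "fin_dim (leading_coeffs A \<beta> w v)" unfolding l by (rule fd)
    show "int (cpoly.dim (leading_coeffs A \<beta> w v)) = poly H 1" unfolding l by (rule total)
  qed
qed

end
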